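(* Let $(R,\mathfrak m,K)$ be an $F$-finite regular ring of characteristic $p>0$ which is either local, or a standard graded polynomial ring over the field $K$ with homogeneous maximal ideal $\mathfrak m$. Let $I\subseteq R$ be a radical ideal (homogeneous in the graded case), and let $H$ be the big height of $I$. Let $\delta=1$ if $p\le H$ and $\delta=0$ otherwise. Then $I$ is symbolic $F$-split if and only if $$\bigcap_{n=0}^{\max\{0,\,H-1-\delta\}}\Big(\big(I^{(n+1)}\big)^{[p]}:_R I^{(np+1)}\Big)\not\subseteq\mathfrak m^{[p]}.$$
   Context: The big height of a (proper) ideal $I$ is the largest height of a minimal prime of $I$. For an ideal $J$, $J^{[p]}$ is the ideal generated by the $p$-th powers of the elements of $J$. For $n\ge0$, $I^{(n)}=I^nR_S\cap R$, where $S$ is the complement of the union of the minimal primes of $I$. A ring of characteristic $p$ is $F$-finite if it is a finitely generated module over itself via Frobenius. The ideal $I$ is called symbolic $F$-split if there is an $R$-linear map $\phi:R^{1/p}\to R$ with $\phi|_R=\mathrm{id}_R$ (a splitting of the inclusion $R\subseteq R^{1/p}$) such that $\phi\big((I^{(np+1)})^{1/p}\big)\subseteq I^{(n+1)}$ for every $n\ge0$, where $R^{1/p}$ is the ring of $p$-th roots of elements of $R$ and $J^{1/p}=\{f^{1/p}\mid f\in J\}$. In the graded case all objects considered are homogeneous. *)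

theory Defs
  imports "HOL-Algebra.Algebra" "HOL-Library.Extended_Nat" "HOL-Library.FuncSet"
begin

section \<open>Localization\<close>

text \<open>\<open>S\<close> is meant to be a multiplicative subset of the commutative ring \<open>R\<close>.  Zero divisors in
  \<open>S\<close> are allowed, hence the extra factor \<open>u\<close>.\<close>

definition loc_rel :: "('a, 'b) ring_scheme \<Rightarrow> 'a set \<Rightarrow> (('a \<times> 'a) \<times> ('a \<times> 'a)) set" where
  "loc_rel R S = {((a, s), (b, t)). a \<in> carrier R \<and> s \<in> S \<and> b \<in> carrier R \<and> t \<in> S \<and>
     (\<exists>u\<in>S. u \<otimes>\<^bsub>R\<^esub> (t \<otimes>\<^bsub>R\<^esub> a \<ominus>\<^bsub>R\<^esub> s \<otimes>\<^bsub>R\<^esub> b) = \<zero>\<^bsub>R\<^esub>)}"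

definition loc_frac :: "('a, 'b) ring_scheme \<Rightarrow> 'a set \<Rightarrow> 'a \<Rightarrow> 'a \<Rightarrow> ('a \<times> 'a) set" where
  "loc_frac R S a s = loc_rel R S `` {(a, s)}"

definition localization :: "('a, 'b) ring_scheme \<Rightarrow> 'a set \<Rightarrow> ('a \<times> 'a) set ring" where
  "localization R S =
     \<lparr> carrier = (carrier R \<times> S) // loc_rel R S,
       monoid.mult = (\<lambda>V W. \<Union>(a, s)\<in>V. \<Union>(b, t)\<in>W.
                loc_frac R S (a \<otimes>\<^bsub>R\<^esub> b) (s \<otimes>\<^bsub>R\<^esub> t)),
       one = loc_frac R S \<one>\<^bsub>R\<^esub> \<one>\<^bsub>R\<^esub>,
       ring.zero = loc_frac R S \<zero>\<^bsub>R\<^esub> \<one>\<^bsub>R\<^esub>,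
       add = (\<lambda>V W. \<Union>(a, s)\<in>V. \<Union>(b, t)\<in>W.
                loc_frac R S (t \<otimes>\<^bsub>R\<^esub> a \<oplus>\<^bsub>R\<^esub> s \<otimes>\<^bsub>R\<^esub> b)
                  (s \<otimes>\<^bsub>R\<^esub> t)) \<rparr>"

definition loc_map :: "('a, 'b) ring_scheme \<Rightarrow> 'a set \<Rightarrow> 'a \<Rightarrow> ('a \<times> 'a) set" where
  "loc_map R S r = loc_frac R S r \<one>\<^bsub>R\<^esub>"


section \<open>Dimension, height, and regularity\<close>

definition prime_chain :: "('a, 'b) ring_scheme \<Rightarrow> (nat \<Rightarrow> 'a set) \<Rightarrow> nat \<Rightarrow> bool" where
  "prime_chain R c n \<longleftrightarrow> (\<forall>i\<le>n. primeideal (c i) R) \<and> (\<forall>i<n. c i \<subset> c (Suc i))"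

definition krull_dim :: "('a, 'b) ring_scheme \<Rightarrow> enat" where
  "krull_dim R = Sup {enat n | n. \<exists>c. prime_chain R c n}"

definition prime_height :: "('a, 'b) ring_scheme \<Rightarrow> 'a set \<Rightarrow> enat" where
  "prime_height R P = Sup {enat n | n. \<exists>c. prime_chain R c n \<and> c n = P}"

definition minimal_primes :: "('a, 'b) ring_scheme \<Rightarrow> 'a set \<Rightarrow> 'a set set" where
  "minimal_primes R I = {P. primeideal P R \<and> I \<subseteq> P \<and>
     (\<forall>Q. primeideal Q R \<and> I \<subseteq> Q \<and> Q \<subseteq> P \<longrightarrow> Q = P)}"

definition big_height :: "('a, 'b) ring_scheme \<Rightarrow> 'a set \<Rightarrow> enat" where
  "big_height R I = (SUP P\<in>minimal_primes R I. prime_height R P)"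

text \<open>Noetherianity is part of \<open>regular_local_ring\<close>, not of \<open>local_ring\<close>.\<close>

definition local_ring :: "('a, 'b) ring_scheme \<Rightarrow> 'a set \<Rightarrow> bool" where
  "local_ring R M \<longleftrightarrow> cring R \<and> maximalideal M R \<and> (\<forall>N. maximalideal N R \<longrightarrow> N = M)"

definition min_num_gens :: "('a, 'b) ring_scheme \<Rightarrow> 'a set \<Rightarrow> nat" where
  "min_num_gens R J = (LEAST k. \<exists>A\<subseteq>carrier R. finite A \<and> card A = k \<and> J = Idl\<^bsub>R\<^esub> A)"

definition regular_local_ring :: "('a, 'b) ring_scheme \<Rightarrow> bool" where
  "regular_local_ring R \<longleftrightarrow>
     noetherian_ring R \<and> (\<exists>M. local_ring R M \<and> krull_dim R = enat (min_num_gens R M))"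

definition regular_ring :: "('a, 'b) ring_scheme \<Rightarrow> bool" where
  "regular_ring R \<longleftrightarrow> cring R \<and> noetherian_ring R \<and>
     (\<forall>P. primeideal P R \<longrightarrow> regular_local_ring (localization R (carrier R - P)))"


section \<open>Ideals\<close>

definition radical_ideal :: "('a, 'b) ring_scheme \<Rightarrow> 'a set \<Rightarrow> bool" where
  "radical_ideal R I \<longleftrightarrow> ideal I R \<and>
     (\<forall>a\<in>carrier R. \<forall>n::nat. a [^]\<^bsub>R\<^esub> n \<in> I \<longrightarrow> a \<in> I)"

definition symbolic_power :: "('a, 'b) ring_scheme \<Rightarrow> 'a set \<Rightarrow> nat \<Rightarrow> 'a set" where
  "symbolic_power R I n =
     (let S = carrier R - \<Union>(minimal_primes R I)
      in {r \<in> carrier R.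
            loc_map R S r \<in> Idl\<^bsub>localization R S\<^esub> (loc_map R S ` (I [^]\<^bsub>ideals_set R\<^esub> n))})"

definition frob_power :: "('a, 'b) ring_scheme \<Rightarrow> nat \<Rightarrow> 'a set \<Rightarrow> 'a set" where
  "frob_power R p J = Idl\<^bsub>R\<^esub> ((\<lambda>x. x [^]\<^bsub>R\<^esub> p) ` J)"

definition colon_ideal :: "('a, 'b) ring_scheme \<Rightarrow> 'a set \<Rightarrow> 'a set \<Rightarrow> 'a set" where
  "colon_ideal R A B = {r \<in> carrier R. \<forall>b\<in>B. r \<otimes>\<^bsub>R\<^esub> b \<in> A}"


section \<open>Prime characteristic\<close>

definition has_char :: "('a, 'b) ring_scheme \<Rightarrow> nat \<Rightarrow> bool" where
  "has_char R p \<longleftrightarrow> (\<forall>k::nat. [k] \<cdot>\<^bsub>R\<^esub> \<one>\<^bsub>R\<^esub> = \<zero>\<^bsub>R\<^esub> \<longleftrightarrow> p dvd k)"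

text \<open>\<open>R\<close> acts on itself through Frobenius, \<open>c \<cdot> b = c\<^sup>p b\<close>.\<close>

definition F_finite :: "('a, 'b) ring_scheme \<Rightarrow> nat \<Rightarrow> bool" where
  "F_finite R p \<longleftrightarrow> (\<exists>B\<subseteq>carrier R. finite B \<and>
     (\<forall>r\<in>carrier R. \<exists>c\<in>B \<rightarrow> carrier R. r = (\<Oplus>\<^bsub>R\<^esub>b\<in>B. (c b [^]\<^bsub>R\<^esub> p) \<otimes>\<^bsub>R\<^esub> b)))"

text \<open>The element \<open>Proot f\<close> stands for \<open>f\<^sup>1\<^sup>/\<^sup>p\<close>.  For a reduced ring \<open>R\<close> of characteristic \<open>p\<close>, the
  \<open>p\<close>-th roots add and multiply like their \<open>p\<close>-th powers, and \<open>r \<in> R\<close> is the \<open>p\<close>-th root of \<open>r\<^sup>p\<close>,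
  which gives the inclusion \<open>R \<subseteq> R\<^sup>1\<^sup>/\<^sup>p\<close> and the \<open>R\<close>-module structure.\<close>

datatype 'a proot = Proot 'a

primrec proot_arg :: "'a proot \<Rightarrow> 'a" where
  "proot_arg (Proot f) = f"

definition proot_incl :: "('a, 'b) ring_scheme \<Rightarrow> nat \<Rightarrow> 'a \<Rightarrow> 'a proot" where
  "proot_incl R p r = Proot (r [^]\<^bsub>R\<^esub> p)"

definition proot_ring :: "('a, 'b) ring_scheme \<Rightarrow> nat \<Rightarrow> ('a, 'a proot) module" where
  "proot_ring R p =
     \<lparr> carrier = Proot ` carrier R,
       monoid.mult = (\<lambda>s t. Proot (proot_arg s \<otimes>\<^bsub>R\<^esub> proot_arg t)),
       one = Proot \<one>\<^bsub>R\<^esub>,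
       ring.zero = Proot \<zero>\<^bsub>R\<^esub>,
       add = (\<lambda>s t. Proot (proot_arg s \<oplus>\<^bsub>R\<^esub> proot_arg t)),
       smult = (\<lambda>r t. Proot (proot_arg (proot_incl R p r) \<otimes>\<^bsub>R\<^esub> proot_arg t)) \<rparr>"

lemma proot_ring_pow:
  "Proot f [^]\<^bsub>proot_ring R p\<^esub> (n::nat) = Proot (f [^]\<^bsub>R\<^esub> n)"
  by (induction n) (simp_all add: nat_pow_def proot_ring_def)

text \<open>\<open>Proot f\<close> is indeed a \<open>p\<close>-th root of the image of \<open>f\<close>.\<close>

lemma proot_ring_pow_p: "Proot f [^]\<^bsub>proot_ring R p\<^esub> p = proot_incl R p f"
  by (simp add: proot_ring_pow proot_incl_def)

definition F_splitting :: "('a, 'b) ring_scheme \<Rightarrow> nat \<Rightarrow> ('a proot \<Rightarrow> 'a) \<Rightarrow> bool" where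
  "F_splitting R p \<phi> \<longleftrightarrow>
     \<phi> \<in> carrier (proot_ring R p) \<rightarrow> carrier R \<and>
     (\<forall>s\<in>carrier (proot_ring R p). \<forall>t\<in>carrier (proot_ring R p).
        \<phi> (s \<oplus>\<^bsub>proot_ring R p\<^esub> t) = \<phi> s \<oplus>\<^bsub>R\<^esub> \<phi> t) \<and>
     (\<forall>r\<in>carrier R. \<forall>t\<in>carrier (proot_ring R p).
        \<phi> (r \<odot>\<^bsub>proot_ring R p\<^esub> t) = r \<otimes>\<^bsub>R\<^esub> \<phi> t) \<and>
     (\<forall>r\<in>carrier R. \<phi> (proot_incl R p r) = r)"

definition symbolic_F_splitting ::
    "('a, 'b) ring_scheme \<Rightarrow> nat \<Rightarrow> 'a set \<Rightarrow> ('a proot \<Rightarrow> 'a) \<Rightarrow> bool" where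
  "symbolic_F_splitting R p I \<phi> \<longleftrightarrow> F_splitting R p \<phi> \<and>
     (\<forall>n. \<phi> ` (Proot ` symbolic_power R I (n * p + 1)) \<subseteq> symbolic_power R I (n + 1))"

definition symbolic_F_split :: "('a, 'b) ring_scheme \<Rightarrow> nat \<Rightarrow> 'a set \<Rightarrow> bool" where
  "symbolic_F_split R p I \<longleftrightarrow> (\<exists>\<phi>. symbolic_F_splitting R p I \<phi>)"


section \<open>Standard graded polynomial rings\<close>

text \<open>A polynomial ring is presented internally: \<open>K\<close> is a subfield of \<open>R\<close>, the variables are
  \<open>x 0, \<dots>, x (N - 1)\<close>, and the monomials in them form a \<open>K\<close>-basis of \<open>R\<close>.\<close>

definition exponents :: "nat \<Rightarrow> (nat \<Rightarrow> nat) set" where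
  "exponents N = {..<N} \<rightarrow>\<^sub>E UNIV"

definition var_monom :: "('a, 'b) ring_scheme \<Rightarrow> nat \<Rightarrow> (nat \<Rightarrow> 'a) \<Rightarrow> (nat \<Rightarrow> nat) \<Rightarrow> 'a" where
  "var_monom R N x \<alpha> = (\<Otimes>\<^bsub>R\<^esub>i\<in>{..<N}. x i [^]\<^bsub>R\<^esub> \<alpha> i)"

definition coeff_supp :: "('a, 'b) ring_scheme \<Rightarrow> ((nat \<Rightarrow> nat) \<Rightarrow> 'a) \<Rightarrow> (nat \<Rightarrow> nat) set" where
  "coeff_supp R c = {\<alpha>. c \<alpha> \<noteq> \<zero>\<^bsub>R\<^esub>}"

definition coeff_funs ::
    "('a, 'b) ring_scheme \<Rightarrow> 'a set \<Rightarrow> nat \<Rightarrow> ((nat \<Rightarrow> nat) \<Rightarrow> 'a) set" where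
  "coeff_funs R K N = {c. range c \<subseteq> K \<and> finite (coeff_supp R c) \<and> coeff_supp R c \<subseteq> exponents N}"

definition poly_val ::
    "('a, 'b) ring_scheme \<Rightarrow> nat \<Rightarrow> (nat \<Rightarrow> 'a) \<Rightarrow> ((nat \<Rightarrow> nat) \<Rightarrow> 'a) \<Rightarrow> 'a" where
  "poly_val R N x c = (\<Oplus>\<^bsub>R\<^esub>\<alpha>\<in>coeff_supp R c. c \<alpha> \<otimes>\<^bsub>R\<^esub> var_monom R N x \<alpha>)"

definition polynomial_ring_over ::
    "('a, 'b) ring_scheme \<Rightarrow> 'a set \<Rightarrow> nat \<Rightarrow> (nat \<Rightarrow> 'a) \<Rightarrow> bool" where
  "polynomial_ring_over R K N x \<longleftrightarrow> cring R \<and> subfield K R \<and> x \<in> {..<N} \<rightarrow> carrier R \<and>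
     bij_betw (poly_val R N x) (coeff_funs R K N) (carrier R)"

definition graded_piece ::
    "('a, 'b) ring_scheme \<Rightarrow> 'a set \<Rightarrow> nat \<Rightarrow> (nat \<Rightarrow> 'a) \<Rightarrow> nat \<Rightarrow> 'a set" where
  "graded_piece R K N x d =
     poly_val R N x ` {c \<in> coeff_funs R K N. \<forall>\<alpha>\<in>coeff_supp R c. (\<Sum>i<N. \<alpha> i) = d}"

definition homogeneous_ideal ::
    "('a, 'b) ring_scheme \<Rightarrow> 'a set \<Rightarrow> nat \<Rightarrow> (nat \<Rightarrow> 'a) \<Rightarrow> 'a set \<Rightarrow> bool" where
  "homogeneous_ideal R K N x I \<longleftrightarrow> ideal I R \<and>
     I = Idl\<^bsub>R\<^esub> (I \<inter> (\<Union>d. graded_piece R K N x d))"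

text \<open>\<open>R\<^sup>1\<^sup>/\<^sup>p\<close> is graded by the multiples of \<open>1/p\<close>: if \<open>f\<close> has degree \<open>d\<close> then \<open>f\<^sup>1\<^sup>/\<^sup>p\<close> has degree
  \<open>d/p\<close>, and \<open>R\<close> is zero in non-integral degrees.  A homogeneous map that restricts to the
  identity on \<open>R\<close> has degree \<open>0\<close>, so only degree-preserving maps are considered.\<close>

definition degree_preserving ::
    "('a, 'b) ring_scheme \<Rightarrow> 'a set \<Rightarrow> nat \<Rightarrow> (nat \<Rightarrow> 'a) \<Rightarrow> nat \<Rightarrow> ('a proot \<Rightarrow> 'a) \<Rightarrow> bool" where
  "degree_preserving R K N x p \<phi> \<longleftrightarrow> (\<forall>d. \<forall>f\<in>graded_piece R K N x d.
     \<phi> (Proot f) \<in> (if p dvd d then graded_piece R K N x (d div p) else {\<zero>\<^bsub>R\<^esub>}))"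

definition graded_symbolic_F_split ::
    "('a, 'b) ring_scheme \<Rightarrow> 'a set \<Rightarrow> nat \<Rightarrow> (nat \<Rightarrow> 'a) \<Rightarrow> nat \<Rightarrow> 'a set \<Rightarrow> bool" where
  "graded_symbolic_F_split R K N x p I \<longleftrightarrow>
     (\<exists>\<phi>. symbolic_F_splitting R p I \<phi> \<and> degree_preserving R K N x p \<phi>)"

end

theory Submission
  imports Defs
begin

text \<open>An \<open>R\<close>-linear map \<open>R\<^sup>1\<^sup>/\<^sup>p \<rightarrow> R\<close> is an additive map \<open>\<psi>\<close> on \<open>R\<close> with \<open>\<psi> (c\<^sup>p x) = c \<psi> x\<close>.  In both cases of the
  theorem there are such a map \<open>\<Phi>\<close> and finitely many elements \<open>e\<^sub>i, b\<^sub>i\<close> with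
  \<open>g = \<Sum> \<Phi> (e\<^sub>i g)\<^sup>p b\<^sub>i\<close> for all \<open>g\<close>.  It follows that every \<open>\<psi>\<close> is of the form \<open>\<Phi> (f \<cdot>)\<close>, and that
  \<open>g \<in> J\<^sup>[\<^sup>p\<^sup>]\<close> if and only if \<open>\<Phi> (R g) \<subseteq> J\<close>.  So \<open>\<Phi> (f \<cdot>)\<close> maps the symbolic power of exponent \<open>n p + 1\<close>
  into that of exponent \<open>n + 1\<close> if and only if \<open>f\<close> lies in the \<open>n\<close>-th colon ideal, and some multiple of \<open>f\<close>
  gives a splitting if and only if \<open>f \<notin> \<mm>\<^sup>[\<^sup>p\<^sup>]\<close>.  Finitely many \<open>n\<close> suffice because \<open>I\<close> is generated by at
  most \<open>H\<close> elements locally at its minimal primes, so that by the pigeonhole principle the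
  \<open>n\<close>-th colon ideal is contained in the next one for large \<open>n\<close>.

  In the local case the existence of \<open>\<Phi>\<close> is a form of Kunz's theorem.  If \<open>\<mm>\<close> is generated by \<open>d\<close>
  elements and \<open>F\<^sub>*(R/\<mm>)\<close> has rank \<open>n\<close>, then \<open>F\<^sub>*R\<close> is generated by \<open>n p\<^sup>d\<close> elements.  Comparing
  lengths along a chain of primes of length \<open>d\<close> shows that the rank of \<open>F\<^sub>*(R/P)\<close> is at least
  \<open>n p\<^sup>d\<close> for the bottom prime \<open>P\<close>, so these generators form a basis.  In the graded case \<open>\<Phi>\<close> is read
  off from the monomial basis, and the component of \<open>f\<close> of degree \<open>N (p - 1)\<close> gives a
  degree-preserving splitting.\<close>

section \<open>Chains of submodules under the Frobenius action\<close>

text \<open>Regularity is given by dimensions and numbers of generators, so the freeness of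
  \<open>F\<^sub>*R\<close> has to come from counting. Lengths are bounded from both sides by strict
  chains of subsets of \<open>R\<close>; quotients and localizations are avoided there by letting
  elements outside the prime act as denominators. The factor \<open>p\<close> gained along an
  inclusion of primes comes from measuring one length twice: multiplication by \<open>z\<close> on
  \<open>F\<^sub>*R\<close> is multiplication by \<open>z\<^sup>p\<close> on \<open>R\<close>.

  The bound \<open>H - 1 - \<delta>\<close> marks where the pigeonhole principle starts to work. The
  step from n to n + 1 needs H (p - 1) \<le> (n + 1) p; this holds for all n \<ge> H - 1, and for n
  = H - 2 \<ge> 0 precisely when p \<le> H.

  In the graded case the denominators in the definition of symbolic powers are inhomogeneous.
  Symbolic powers are shown to be homogeneous without first proving this for the minimal primes. The
  degree N (p - 1) is that of the monomial with all exponents p - 1, which the trace map sends to a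
  constant.\<close>

definition sumset :: "('a, 'b) ring_scheme \<Rightarrow> 'a set \<Rightarrow> 'a set \<Rightarrow> 'a set" where
  "sumset R V W = {z. \<exists>a\<in>V. \<exists>b\<in>W. z = a \<oplus>\<^bsub>R\<^esub> b}"

section \<open>Additivity of the p-th power map\<close>

lemma (in cring) binomial:
  assumes "a \<in> carrier R" "b \<in> carrier R"
  shows "(a \<oplus> b) [^] n = (\<Oplus>k\<in>{..n}. add_pow R (n choose k) (a [^] k \<otimes> b [^] (n - k)))"
proof (induction n)
  case 0 then show ?case by simp
next
  case (Suc n)
  let ?t = "\<lambda>n k. add_pow R (n choose k) (a [^] k \<otimes> b [^] (n - k))"
  have c: "?t n \<in> A \<rightarrow> carrier R" for A n using assms by auto
  have A: "(\<Oplus>k\<in>{..n}. ?t n k) \<otimes> a = (\<Oplus>k\<in>{..n}. add_pow R (n choose k) (a [^] Suc k \<otimes> b [^] (n - k)))"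
    (is "_ = finsum R ?f _")
    using assms c by (subst finsum_ldistr) (auto simp: add_pow_ldistr add_pow_rdistr m_ac intro!: finsum_cong')
  have B: "(\<Oplus>k\<in>{..n}. ?t n k) \<otimes> b = (\<Oplus>k\<in>{..n}. add_pow R (n choose k) (a [^] k \<otimes> b [^] (Suc n - k)))"
    (is "_ = finsum R ?g _")
    using assms c by (subst finsum_ldistr) (auto simp: add_pow_ldistr add_pow_rdistr m_ac Suc_diff_le intro!: finsum_cong')
  have g: "finsum R ?g {..n} = finsum R ?g {..Suc n}" 
  proof -
    have "finsum R ?g {..Suc n} = ?g (Suc n) \<oplus> finsum R ?g {..n}"
      using assms by (intro finsum_Suc) auto
    then show ?thesis using assms by (simp add: binomial_eq_0 finsum_closed)
  qed
  have g2: "finsum R ?g {..Suc n} = finsum R (\<lambda>k. ?g (Suc k)) {..n} \<oplus> ?g 0"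
    using assms by (subst finsum_Suc2) auto
  have "(a \<oplus> b) [^] Suc n = finsum R ?f {..n} \<oplus> (finsum R (\<lambda>k. ?g (Suc k)) {..n} \<oplus> ?g 0)"
    using Suc assms A B g g2 c by (simp add: r_distr finsum_closed)
  also have "\<dots> = finsum R (\<lambda>k. ?f k \<oplus> ?g (Suc k)) {..n} \<oplus> ?g 0"
    using assms by (subst finsum_addf) (auto simp: a_assoc finsum_closed)
  also have "finsum R (\<lambda>k. ?f k \<oplus> ?g (Suc k)) {..n} = finsum R (\<lambda>k. ?t (Suc n) (Suc k)) {..n}"
    using assms by (intro finsum_cong') (auto simp: add.nat_pow_mult)
  also have "\<dots> \<oplus> ?g 0 = (\<Oplus>k\<in>{..Suc n}. ?t (Suc n) k)"
    using assms by (subst finsum_Suc2) auto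
  finally show ?case .
qed

lemma (in cring) frobenius_add:
  assumes "Factorial_Ring.prime p" "has_char R p" "a \<in> carrier R" "b \<in> carrier R"
  shows "(a \<oplus> b) [^] p = a [^] p \<oplus> b [^] p"
proof -
  have p: "p \<noteq> 0" using assms(1) by auto
  then obtain m where m: "p = Suc m" using not0_implies_Suc by blast
  let ?t = "\<lambda>k. add_pow R (p choose k) (a [^] k \<otimes> b [^] (p - k))"
  have z: "?t k = \<zero>" if "0 < k" "k < p" for k
  proof -
    have "p dvd (p choose k)" using that assms(1) by (intro dvd_choose_prime) auto
    then have "add_pow R (p choose k) \<one> = \<zero>" using assms(2) by (simp add: has_char_def)
    then show ?thesis 
      using assms add_pow_ldistr[of \<one> "a [^] k \<otimes> b [^] (p - k)" "p choose k"] by simp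
  qed
  have "(a \<oplus> b) [^] p = (\<Oplus>k\<in>{..p}. ?t k)" using binomial assms by simp
  also have "\<dots> = (\<Oplus>k\<in>{0, p}. ?t k)"
    using assms z by (intro add.finprod_mono_neutral_cong_right) auto
  also have "\<dots> = a [^] p \<oplus> b [^] p"
    using assms p by (subst finsum_insert) (auto simp: a_comm)
  finally show ?thesis .
qed

text \<open>\<open>R\<close> acts on itself by \<open>c \<cdot> x = c\<^sup>e x\<close>: the exponent \<open>1\<close> gives the ideals of \<open>R\<close>, and the exponent \<open>p\<close>
  the submodules of \<open>F\<^sub>*R\<close>.\<close>

definition frob_submodule :: "('a, 'b) ring_scheme \<Rightarrow> nat \<Rightarrow> 'a set \<Rightarrow> bool" where
  "frob_submodule R e V \<longleftrightarrow> V \<subseteq> carrier R \<and> \<zero>\<^bsub>R\<^esub> \<in> V \<and> (\<forall>x\<in>V. \<forall>y\<in>V. x \<oplus>\<^bsub>R\<^esub> y \<in> V) \<and>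
     (\<forall>c\<in>carrier R. \<forall>x\<in>V. c [^]\<^bsub>R\<^esub> e \<otimes>\<^bsub>R\<^esub> x \<in> V)"

text \<open>Combinations are folds over lists, in which a generator may recur with several
  coefficients. Sums of combinations then require no collecting of terms, and
  \<open>frob_span_induct\<close> adds one term at a time.\<close>

definition frob_span :: "('a, 'b) ring_scheme \<Rightarrow> nat \<Rightarrow> 'a set \<Rightarrow> 'a set" where
  "frob_span R e Z = {foldr (\<lambda>(c, x) v. v \<oplus>\<^bsub>R\<^esub> c [^]\<^bsub>R\<^esub> e \<otimes>\<^bsub>R\<^esub> x) cxs \<zero>\<^bsub>R\<^esub> | cxs.
     set cxs \<subseteq> carrier R \<times> Z}"

lemma frob_span_zero: "\<zero>\<^bsub>R\<^esub> \<in> frob_span R e Z"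
  unfolding frob_span_def by (intro CollectI exI[of _ "[]"]) simp

lemma frob_span_step:
  assumes "v \<in> frob_span R e Z" "c \<in> carrier R" "x \<in> Z"
  shows "v \<oplus>\<^bsub>R\<^esub> c [^]\<^bsub>R\<^esub> e \<otimes>\<^bsub>R\<^esub> x \<in> frob_span R e Z"
proof -
  obtain cxs where "set cxs \<subseteq> carrier R \<times> Z"
    "v = foldr (\<lambda>(c, x) v. v \<oplus>\<^bsub>R\<^esub> c [^]\<^bsub>R\<^esub> e \<otimes>\<^bsub>R\<^esub> x) cxs \<zero>\<^bsub>R\<^esub>"
    using assms unfolding frob_span_def by blast
  then show ?thesis using assms unfolding frob_span_def by (intro CollectI exI[of _ "(c, x) # cxs"]) simp
qed

lemma frob_span_induct [consumes 1, case_names zero step, induct set: frob_span]: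
  assumes "v \<in> frob_span R e Z" "P \<zero>\<^bsub>R\<^esub>"
    "\<And>v c x. v \<in> frob_span R e Z \<Longrightarrow> P v \<Longrightarrow> c \<in> carrier R \<Longrightarrow> x \<in> Z \<Longrightarrow>
       P (v \<oplus>\<^bsub>R\<^esub> c [^]\<^bsub>R\<^esub> e \<otimes>\<^bsub>R\<^esub> x)"
  shows "P v"
proof -
  obtain cxs where cxs: "set cxs \<subseteq> carrier R \<times> Z"
    "v = foldr (\<lambda>(c, x) v. v \<oplus>\<^bsub>R\<^esub> c [^]\<^bsub>R\<^esub> e \<otimes>\<^bsub>R\<^esub> x) cxs \<zero>\<^bsub>R\<^esub>"
    using assms(1) unfolding frob_span_def by blast
  have "set cxs \<subseteq> carrier R \<times> Z \<Longrightarrow>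
      P (foldr (\<lambda>(c, x) v. v \<oplus>\<^bsub>R\<^esub> c [^]\<^bsub>R\<^esub> e \<otimes>\<^bsub>R\<^esub> x) cxs \<zero>\<^bsub>R\<^esub>)"
  proof (induction cxs)
    case (Cons cx cxs)
    then show ?case using assms(3) unfolding frob_span_def by (cases cx) auto
  qed (use assms in simp)
  then show ?thesis using cxs by simp
qed

text \<open>\<open>strict_at R Q e V W\<close> says that \<open>W/V\<close> does not vanish after localization at \<open>Q\<close>, so a strict chain
  shows that \<open>(W/U)\<^sub>Q\<close> has length at least \<open>k\<close>.\<close>

definition strict_at :: "('a, 'b) ring_scheme \<Rightarrow> 'a set \<Rightarrow> nat \<Rightarrow> 'a set \<Rightarrow> 'a set \<Rightarrow> bool" where
  "strict_at R Q e V W \<longleftrightarrow> (\<exists>w\<in>W. \<forall>s\<in>carrier R - Q. s [^]\<^bsub>R\<^esub> e \<otimes>\<^bsub>R\<^esub> w \<notin> V)"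

text \<open>Only strict steps are counted. The free \<open>weak\<close> steps let a chain be
  intersected, enlarged or mapped without deciding which of its inclusions become
  equalities.\<close>

inductive strict_chain :: "('a, 'b) ring_scheme \<Rightarrow> 'a set \<Rightarrow> nat \<Rightarrow> 'a set \<Rightarrow> 'a set \<Rightarrow> nat \<Rightarrow> bool"
  for R Q e U where
  refl: "frob_submodule R e U \<Longrightarrow> strict_chain R Q e U U 0"
| weak: "strict_chain R Q e U V k \<Longrightarrow> frob_submodule R e W \<Longrightarrow> V \<subseteq> W \<Longrightarrow> strict_chain R Q e U W k"
| strict_at: "strict_chain R Q e U V k \<Longrightarrow> frob_submodule R e W \<Longrightarrow> V \<subseteq> W \<Longrightarrow> strict_at R Q e V W \<Longrightarrow> strict_chain R Q e U W (Suc k)"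

text \<open>Positivity of \<open>e\<close> and additivity of x \<mapsto> x^e are all that the
  calculus of submodules rests on. It is instantiated with e = 1 for ideals, with e = p for
  \<open>F\<^sub>*R\<close>, and with powers of p where homogeneous components are
  separated.\<close>

locale frob_exponent = cring R for R (structure) +
  fixes e :: nat
  assumes e_pos: "0 < e"
    and pow_add: "a \<in> carrier R \<Longrightarrow> b \<in> carrier R \<Longrightarrow> (a \<oplus> b) [^] e = a [^] e \<oplus> b [^] e"
begin

section \<open>Submodules and spans\<close>

lemma pow_zero: "\<zero> [^] e = \<zero>"
  using e_pos nat_pow_zero by blast

lemma pow_inv: "a \<in> carrier R \<Longrightarrow> (\<ominus> a) [^] e = \<ominus> (a [^] e)"
  by (metis a_inv_closed minus_equality nat_pow_closed pow_add pow_zero r_neg a_comm)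

lemma pow_mult: "a \<in> carrier R \<Longrightarrow> b \<in> carrier R \<Longrightarrow> (a \<otimes> b) [^] e = a [^] e \<otimes> b [^] e"
  by (rule nat_pow_distrib)

lemma frob_submoduleD:
  assumes "frob_submodule R e V"
  shows "V \<subseteq> carrier R" "\<zero> \<in> V" "x \<in> V \<Longrightarrow> x \<in> carrier R"
    "x \<in> V \<Longrightarrow> y \<in> V \<Longrightarrow> x \<oplus> y \<in> V" "c \<in> carrier R \<Longrightarrow> x \<in> V \<Longrightarrow> c [^] e \<otimes> x \<in> V"
  using assms by (auto simp: frob_submodule_def)

lemma frob_submodule_inv:
  assumes "frob_submodule R e V" "x \<in> V"
  shows "\<ominus> x \<in> V"
proof -
  have "(\<ominus> \<one>) [^] e \<otimes> x \<in> V" using frob_submoduleD(5)[OF assms(1) _ assms(2)] by simp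
  then show ?thesis using frob_submoduleD(3)[OF assms] by (simp add: pow_inv l_minus)
qed

lemma frob_submodule_minus: "frob_submodule R e V \<Longrightarrow> x \<in> V \<Longrightarrow> y \<in> V \<Longrightarrow> x \<ominus> y \<in> V"
  by (simp add: a_minus_def frob_submoduleD frob_submodule_inv)

lemma frob_submodule_cancel:
  assumes "frob_submodule R e V" "x \<in> V" "y \<in> carrier R" "x \<oplus> y \<in> V"
  shows "y \<in> V"
proof -
  have "x \<oplus> y \<ominus> x \<in> V" using assms frob_submodule_minus by blast
  moreover have "x \<oplus> y \<ominus> x = y" using assms frob_submoduleD(3)[OF assms(1,2)] by algebra
  ultimately show ?thesis by simp
qed

lemma frob_submodule_carrier: "frob_submodule R e (carrier R)"
  by (simp add: frob_submodule_def)

lemma frob_submodule_Int: "frob_submodule R e V \<Longrightarrow> frob_submodule R e W \<Longrightarrow> frob_submodule R e (V \<inter> W)"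
  by (auto simp: frob_submodule_def)

lemma frob_submodule_add:
  assumes "frob_submodule R e V" "frob_submodule R e W"
  shows "frob_submodule R e (sumset R V W)"
proof -
  note D = frob_submoduleD[OF assms(1)] frob_submoduleD[OF assms(2)]
  have "\<exists>a\<in>V. \<exists>b\<in>W. \<zero> = a \<oplus> b" using D(2,7) by (intro bexI[of _ \<zero>]) auto
  moreover have "\<exists>a\<in>V. \<exists>b\<in>W. (a1 \<oplus> b1) \<oplus> (a2 \<oplus> b2) = a \<oplus> b"
    if "a1 \<in> V" "b1 \<in> W" "a2 \<in> V" "b2 \<in> W" for a1 a2 b1 b2
  proof -
    have "a1 \<in> carrier R" "b1 \<in> carrier R" "a2 \<in> carrier R" "b2 \<in> carrier R" using that D(1,6) by auto
    then have "(a1 \<oplus> b1) \<oplus> (a2 \<oplus> b2) = (a1 \<oplus> a2) \<oplus> (b1 \<oplus> b2)" by (simp add: a_ac)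
    then show ?thesis using that(1,3) that(2,4) D(4)[of a1 a2] D(9)[of b1 b2] by blast
  qed
  moreover have "\<exists>a\<in>V. \<exists>b\<in>W. c [^] e \<otimes> (a1 \<oplus> b1) = a \<oplus> b" if "a1 \<in> V" "b1 \<in> W" "c \<in> carrier R" for a1 b1 c
  proof -
    have "c [^] e \<otimes> (a1 \<oplus> b1) = c [^] e \<otimes> a1 \<oplus> c [^] e \<otimes> b1"
      using that D(3,8) by (simp add: r_distr)
    then show ?thesis using D(5)[OF that(3,1)] D(10)[OF that(3,2)] by blast
  qed
  ultimately show ?thesis
    using D(1,6) by (auto simp: frob_submodule_def sumset_def subset_iff)
qed

lemma add_le1: "frob_submodule R e V \<Longrightarrow> frob_submodule R e W \<Longrightarrow> V \<subseteq> sumset R V W"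
  using frob_submoduleD(3)[of V] frob_submoduleD(2)[of W] by (force simp: sumset_def)

lemma add_le2: "frob_submodule R e V \<Longrightarrow> frob_submodule R e W \<Longrightarrow> W \<subseteq> sumset R V W"
  using frob_submoduleD(3)[of W] frob_submoduleD(2)[of V] by (force simp: sumset_def)

lemma add_least: "frob_submodule R e Z \<Longrightarrow> V \<subseteq> Z \<Longrightarrow> W \<subseteq> Z \<Longrightarrow> sumset R V W \<subseteq> Z"
  using frob_submoduleD(4)[of Z] by (fastforce simp: sumset_def)

lemma frob_span_closed: "Z \<subseteq> carrier R \<Longrightarrow> v \<in> frob_span R e Z \<Longrightarrow> v \<in> carrier R"
  by (rotate_tac 1, induction rule: frob_span_induct) auto

lemma frob_span_plus:
  assumes Z: "Z \<subseteq> carrier R" and "w \<in> frob_span R e Z" "v \<in> frob_span R e Z"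
  shows "v \<oplus> w \<in> frob_span R e Z"
  using assms(2)
proof induction
  case zero then show ?case using assms(3) frob_span_closed[OF Z] by simp
next
  case (step w c x)
  then have "v \<oplus> (w \<oplus> c [^] e \<otimes> x) = (v \<oplus> w) \<oplus> c [^] e \<otimes> x"
    using frob_span_closed[OF Z] assms Z by (simp add: a_assoc subset_iff)
  then show ?case using step frob_span_step by metis
qed

lemma frob_span_smul:
  assumes Z: "Z \<subseteq> carrier R" and "w \<in> frob_span R e Z" "d \<in> carrier R"
  shows "d [^] e \<otimes> w \<in> frob_span R e Z"
  using assms(2)
proof induction
  case zero then show ?case using assms(3) frob_span_zero by simp
next
  case (step w c x)
  then have "d [^] e \<otimes> (w \<oplus> c [^] e \<otimes> x) = d [^] e \<otimes> w \<oplus> (d \<otimes> c) [^] e \<otimes> x"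
    using frob_span_closed[OF Z] assms Z by (simp add: r_distr pow_mult m_assoc subset_iff)
  then show ?case using step frob_span_step assms by (metis m_closed)
qed

lemma frob_span_frob_submodule: "Z \<subseteq> carrier R \<Longrightarrow> frob_submodule R e (frob_span R e Z)"
  using frob_span_closed frob_span_plus frob_span_smul frob_span_zero by (fastforce simp: frob_submodule_def)

lemma frob_span_base:
  assumes "Z \<subseteq> carrier R" "x \<in> Z"
  shows "x \<in> frob_span R e Z"
  using frob_span_step[OF frob_span_zero one_closed assms(2), of e] assms by auto

lemma frob_span_subset: "Z \<subseteq> carrier R \<Longrightarrow> Z \<subseteq> frob_span R e Z"
  using frob_span_base by blast

lemma frob_span_least:
  assumes "frob_submodule R e V" "Z \<subseteq> V"
  shows "frob_span R e Z \<subseteq> V"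
proof
  fix v assume "v \<in> frob_span R e Z"
  then show "v \<in> V" by induction (use assms frob_submoduleD[OF assms(1)] in auto)
qed

lemma frob_span_mono: "Y \<subseteq> carrier R \<Longrightarrow> Z \<subseteq> Y \<Longrightarrow> frob_span R e Z \<subseteq> frob_span R e Y"
  using frob_span_least frob_span_frob_submodule frob_span_base by (meson subset_iff)

lemma frob_span_id: "frob_submodule R e V \<Longrightarrow> frob_span R e V = V"
  using frob_span_least frob_span_subset frob_submoduleD(1) by blast

lemma frob_span_insertD:
  assumes "Z \<subseteq> carrier R" "x \<in> carrier R" "v \<in> frob_span R e (insert x Z)"
  shows "\<exists>c\<in>carrier R. \<exists>w\<in>frob_span R e Z. v = c [^] e \<otimes> x \<oplus> w"
  using assms(3)
proof induction
  case zero show ?case by (rule bexI[of _ \<zero>], rule bexI[of _ \<zero>]) (auto simp: assms pow_zero frob_span_zero)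
next
  case (step v c y)
  then obtain c' w where cw: "c' \<in> carrier R" "w \<in> frob_span R e Z" "v = c' [^] e \<otimes> x \<oplus> w" by blast
  have wc: "w \<in> carrier R" using cw frob_span_closed assms by blast
  show ?case
  proof (cases "y = x")
    case True
    have "v \<oplus> c [^] e \<otimes> y = (c' \<oplus> c) [^] e \<otimes> x \<oplus> w"
      using cw wc step True assms by (simp add: pow_add l_distr a_ac)
    then show ?thesis using cw step by blast
  next
    case False
    have "v \<oplus> c [^] e \<otimes> y = c' [^] e \<otimes> x \<oplus> (w \<oplus> c [^] e \<otimes> y)"
      using cw wc step assms False by (auto simp: a_assoc subset_iff)
    then show ?thesis using cw step frob_span_step False by (metis insertE)
  qed
qed

lemma frob_span_insertI:
  assumes "Z \<subseteq> carrier R" "x \<in> carrier R" "c \<in> carrier R" "w \<in> frob_span R e Z"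
  shows "c [^] e \<otimes> x \<oplus> w \<in> frob_span R e (insert x Z)"
  using assms frob_span_step[of w R e "insert x Z" c x] frob_span_mono[of "insert x Z" Z] frob_span_closed[of Z w]
  by (auto simp: a_comm)

lemma frob_span_insert_frob_span:
  assumes "Z \<subseteq> carrier R" "Y \<subseteq> carrier R"
  shows "frob_span R e (frob_span R e Z \<union> Y) = frob_span R e (Z \<union> Y)"
proof
  have s: "frob_span R e Z \<subseteq> carrier R" using frob_span_closed assms by blast
  show "frob_span R e (frob_span R e Z \<union> Y) \<subseteq> frob_span R e (Z \<union> Y)"
    using frob_span_mono[of "Z \<union> Y" Z] frob_span_subset[of "Z \<union> Y"] assms by (intro frob_span_least frob_span_frob_submodule) auto
  show "frob_span R e (Z \<union> Y) \<subseteq> frob_span R e (frob_span R e Z \<union> Y)"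
    using frob_span_subset[OF assms(1)] assms s by (intro frob_span_mono) auto
qed

section \<open>Strict chains as lengths at a prime\<close>

lemma strict_chain_frob_submodule: "strict_chain R Q e U W k \<Longrightarrow> frob_submodule R e U \<and> frob_submodule R e W \<and> U \<subseteq> W"
  by (induction rule: strict_chain.induct) auto

lemma strict_chain_trans:
  assumes "strict_chain R Q e U V a" "strict_chain R Q e V W b"
  shows "strict_chain R Q e U W (a + b)"
  using assms(2)
proof induction
  case refl then show ?case using assms by simp
next
  case (weak V k W) then show ?case using strict_chain.weak by blast
next
  case (strict_at V k W) then show ?case using strict_chain.strict_at by (metis add_Suc_right)
qed

lemma strict_chain_sub: "frob_submodule R e U \<Longrightarrow> frob_submodule R e W \<Longrightarrow> U \<subseteq> W \<Longrightarrow> strict_chain R Q e U W 0"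
  using strict_chain.refl strict_chain.weak by blast

lemma strict_chain_mono:
  assumes "strict_chain R Q e U W k" "frob_submodule R e U'" "U' \<subseteq> U" "frob_submodule R e W'" "W \<subseteq> W'"
  shows "strict_chain R Q e U' W' k"
  using strict_chain_trans[OF strict_chain_sub[OF assms(2) _ assms(3)] strict_chain_trans[OF assms(1) strict_chain_sub[OF _ assms(4,5)]]]
    strict_chain_frob_submodule[OF assms(1)] by simp

lemma strict_chain_less: "strict_chain R Q e U W k \<Longrightarrow> j \<le> k \<Longrightarrow> strict_chain R Q e U W j"
proof (induction arbitrary: j rule: strict_chain.induct)
  case refl then show ?case using strict_chain.refl by auto
next
  case (weak V k W) then show ?case using strict_chain.weak by blast
next
  case (strict_at V k W) then show ?case
    using strict_chain.weak[OF strict_at.IH] strict_chain.strict_at[OF strict_at.hyps] by (metis le_Suc_eq strict_at.hyps(2,3))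
qed

text \<open>Lengths are additive in short exact sequences; this is the half that gives upper bounds.
  A step that collapses both after intersecting with \<open>W\<close> and after adding
  \<open>W\<close> cannot have been strict.\<close>

lemma strict_chain_split:
  assumes Q: "primeideal Q R" and "strict_chain R Q e U Z k" and W: "frob_submodule R e W" "U \<subseteq> W"
  shows "\<exists>a b. strict_chain R Q e U (Z \<inter> W) a \<and> strict_chain R Q e W (sumset R Z W) b \<and> k \<le> a + b"
  using assms(2)
proof induction
  case refl
  have "U \<inter> W = U" using W by auto
  then show ?case using strict_chain.refl[OF refl] strict_chain_sub[OF W(1) frob_submodule_add[OF refl W(1)] add_le2[OF refl W(1)]] by fastforce
next
  case (weak V k Z)
  note sV = conjunct1[OF conjunct2[OF strict_chain_frob_submodule[OF weak.hyps(1)]]]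
  have "V \<inter> W \<subseteq> Z \<inter> W" "sumset R V W \<subseteq> sumset R Z W" using weak by (auto simp: sumset_def)
  then show ?case using weak strict_chain.weak frob_submodule_Int frob_submodule_add W by meson
next
  case (strict_at V k Z)
  note sV = conjunct1[OF conjunct2[OF strict_chain_frob_submodule[OF strict_at.hyps(1)]]]
  interpret Q: primeideal Q R by fact
  have sub: "V \<inter> W \<subseteq> Z \<inter> W" "sumset R V W \<subseteq> sumset R Z W" using strict_at by (auto simp: sumset_def)
  note sm = frob_submodule_Int[OF strict_at.hyps(2) W(1)] frob_submodule_add[OF strict_at.hyps(2) W(1)]
  obtain a b where ab: "strict_chain R Q e U (V \<inter> W) a" "strict_chain R Q e W (sumset R V W) b" "k \<le> a + b"
    using strict_at.IH by blast
  have "strict_at R Q e (V \<inter> W) (Z \<inter> W) \<or> strict_at R Q e (sumset R V W) (sumset R Z W)"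
  proof (rule ccontr)
    assume n: "\<not> ?thesis"
    \<comment> \<open>Two denominators compose: \<open>s\<close> brings \<open>w\<close> into
      \<open>sumset R V W\<close>, and \<open>t\<close> then brings the summand \<open>y\<close>,
      which lies in \<open>Z \<inter> W\<close>, into \<open>V\<close>. Their product is outside
      \<open>Q\<close> because \<open>Q\<close> is prime.\<close>
    have "\<exists>s\<in>carrier R - Q. s [^] e \<otimes> w \<in> V" if w: "w \<in> Z" for w
    proof -
      have wc: "w \<in> carrier R" using w strict_at.hyps(2) frob_submoduleD by blast
      obtain s where s: "s \<in> carrier R - Q" "s [^] e \<otimes> w \<in> sumset R V W"
        using n w add_le1[OF strict_at.hyps(2) W(1)] unfolding strict_at_def by blast
      then obtain v y where vy: "v \<in> V" "y \<in> W" "s [^] e \<otimes> w = v \<oplus> y" by (auto simp: sumset_def)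
      have vyc: "v \<in> carrier R" "y \<in> carrier R" using vy sV W frob_submoduleD by blast+
      have "s [^] e \<otimes> w \<in> Z" using frob_submoduleD(5)[OF strict_at.hyps(2) _ w] s by blast
      moreover have "v \<in> Z" using vy strict_at.hyps by blast
      ultimately have "y \<in> Z" using vy vyc frob_submodule_cancel[OF strict_at.hyps(2)] by metis
      then obtain t where t: "t \<in> carrier R - Q" "t [^] e \<otimes> y \<in> V"
        using n vy unfolding strict_at_def by blast
      have "(t \<otimes> s) [^] e \<otimes> w = t [^] e \<otimes> v \<oplus> t [^] e \<otimes> y"
        using s t wc vyc vy(3) by (simp add: pow_mult m_assoc r_distr)
      also have "\<dots> \<in> V" using frob_submoduleD[OF sV] t vy by auto
      finally show ?thesis using s t Q.I_prime by (intro bexI[of _ "t \<otimes> s"]) auto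
    qed
    then show False using strict_at.hyps(4) unfolding strict_at_def by blast
  qed
  then show ?case
  proof
    assume "strict_at R Q e (V \<inter> W) (Z \<inter> W)"
    then show ?thesis using strict_chain.strict_at[OF ab(1) sm(1) sub(1)] strict_chain.weak[OF ab(2) sm(2) sub(2)] ab(3)
      by (intro exI[of _ "Suc a"] exI[of _ b]) auto
  next
    assume "strict_at R Q e (sumset R V W) (sumset R Z W)"
    then show ?thesis using strict_chain.weak[OF ab(1) sm(1) sub(1)] strict_chain.strict_at[OF ab(2) sm(2) sub(2)] ab(3)
      by (intro exI[of _ a] exI[of _ "Suc b"]) auto
  qed
qed

text \<open>Upper bounds on lengths are statements about all strict chains. Cutting a chain at
  \<open>W\<close> makes them add up.\<close>

lemma strict_chain_bound_trans:
  assumes Q: "primeideal Q R" and W: "frob_submodule R e W" "U \<subseteq> W" "frob_submodule R e Z" "W \<subseteq> Z"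
    and a: "\<And>k. strict_chain R Q e U W k \<Longrightarrow> k \<le> a" and b: "\<And>k. strict_chain R Q e W Z k \<Longrightarrow> k \<le> b"
    and h: "strict_chain R Q e U Z k"
  shows "k \<le> a + b"
proof -
  obtain a' b' where ab: "strict_chain R Q e U (Z \<inter> W) a'" "strict_chain R Q e W (sumset R Z W) b'" "k \<le> a' + b'"
    using strict_chain_split[OF Q h W(1,2)] by blast
  have "Z \<inter> W = W" "sumset R Z W = Z"
    using W add_le1[OF W(3,1)] add_least[OF W(3) order_refl W(4)] by auto
  then have "a' \<le> a" "b' \<le> b" using ab a b by auto
  then show ?thesis using ab(3) by linarith
qed

lemma strict_chain_bound_zero:
  assumes W: "frob_submodule R e W" and t: "\<And>w. w \<in> W \<Longrightarrow> \<exists>t\<in>carrier R - Q. t [^] e \<otimes> w \<in> U"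
    and "strict_chain R Q e U W k"
  shows "k = 0"
proof -
  have "strict_chain R Q e U V k \<Longrightarrow> V \<subseteq> W \<Longrightarrow> k = 0" for V k
  proof (induction rule: strict_chain.induct)
    case (strict_at V k Z)
    obtain w where w: "w \<in> Z" "\<forall>s\<in>carrier R - Q. s [^] e \<otimes> w \<notin> V"
      using strict_at.hyps(4) unfolding strict_at_def by blast
    have "U \<subseteq> V" using strict_chain_frob_submodule strict_at.hyps(1) by blast
    then show ?case using t[of w] w strict_at.prems by blast
  qed auto
  then show ?thesis using assms by blast
qed

end

text \<open>Otherwise the exponent \<open>1\<close> would be rewritten to \<open>Suc 0\<close>.\<close>
declare One_nat_def [simp del]

section \<open>Ideals as the case of exponent 1\<close>

context cring begin

lemma frob_exponent_1: "frob_exponent R 1"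
  by unfold_locales (auto simp: nat_pow_eone)

lemma frob_submodule_1_iff: "frob_submodule R 1 J \<longleftrightarrow> ideal J R"
proof
  assume J: "frob_submodule R 1 J"
  interpret E: frob_exponent R 1 by (rule frob_exponent_1)
  have l: "x \<otimes> a \<in> J" if "a \<in> J" "x \<in> carrier R" for a x
    using E.frob_submoduleD(5)[OF J that(2,1)] that by simp
  show "ideal J R"
  proof (rule idealI)
    show "subgroup J (add_monoid R)"
      using E.frob_submoduleD(1,2,4)[OF J] E.frob_submodule_inv[OF J]
      by (intro add.subgroupI) (auto simp flip: a_inv_def)
    show "a \<otimes> x \<in> J" if "a \<in> J" "x \<in> carrier R" for a x
      using l that m_comm E.frob_submoduleD(3)[OF J that(1)] by metis
  qed (use l ring_axioms in auto)
next
  assume "ideal J R"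
  then interpret ideal J R .
  show "frob_submodule R 1 J" 
    using I_l_closed Icarr additive_subgroup.a_closed[OF is_additive_subgroup] additive_subgroup.zero_closed[OF is_additive_subgroup]
    by (auto simp: frob_submodule_def)
qed

lemma frob_span_1_eq_genideal:
  assumes "S \<subseteq> carrier R"
  shows "frob_span R 1 S = Idl S"
proof
  interpret E: frob_exponent R 1 by (rule frob_exponent_1)
  show "frob_span R 1 S \<subseteq> Idl S"
    using genideal_ideal[OF assms] genideal_self[OF assms] by (intro E.frob_span_least) (auto simp: frob_submodule_1_iff)
  have "ideal (frob_span R 1 S) R" using E.frob_span_frob_submodule[OF assms] by (simp only: frob_submodule_1_iff)
  then show "Idl S \<subseteq> frob_span R 1 S" using genideal_minimal[OF _ E.frob_span_subset[OF assms]] by blast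
qed

lemma prime_foldr_notin:
  assumes "primeideal Q R" "set ys \<subseteq> carrier R - Q"
  shows "foldr (\<otimes>) ys \<one> \<in> carrier R - Q"
  using assms(2)
proof (induction ys)
  case Nil
  interpret primeideal Q R by fact
  show ?case using one_imp_carrier I_notcarr by auto
next
  case (Cons y ys)
  interpret primeideal Q R by fact
  show ?case using Cons I_prime[of y "foldr (\<otimes>) ys \<one>"] by auto
qed

lemma foldr_mult_append:
  assumes "set ys \<subseteq> carrier R" "set zs \<subseteq> carrier R"
  shows "foldr (\<otimes>) (ys @ zs) \<one> = foldr (\<otimes>) ys \<one> \<otimes> foldr (\<otimes>) zs \<one>"
    and "foldr (\<otimes>) ys \<one> \<in> carrier R"
proof -
  have c: "set ys \<subseteq> carrier R \<Longrightarrow> foldr (\<otimes>) ys \<one> \<in> carrier R" for ys by (induction ys) auto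
  show "foldr (\<otimes>) ys \<one> \<in> carrier R" using c assms by blast
  show "foldr (\<otimes>) (ys @ zs) \<one> = foldr (\<otimes>) ys \<one> \<otimes> foldr (\<otimes>) zs \<one>"
    using assms(1) by (induction ys) (use assms(2) c in \<open>auto simp: m_assoc\<close>)
qed

end

section \<open>Lengths of finitely generated modules\<close>

context frob_exponent begin

sublocale E1: frob_exponent R 1 by (rule frob_exponent_1)

lemma ideal_frob_submodule:
  assumes "ideal J R"
  shows "frob_submodule R e J"
  using E1.frob_submoduleD(1,2,4)[OF assms[folded frob_submodule_1_iff]] ideal.I_l_closed[OF assms]
  by (auto simp: frob_submodule_def)

lemma one_notin_prime:
  assumes "primeideal Q R"
  shows "\<one> \<in> carrier R - Q"
proof -
  interpret primeideal Q R by fact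
  show ?thesis using one_imp_carrier I_notcarr by auto
qed

lemma frob_submodule_colon:
  assumes "frob_submodule R e V" "x \<in> carrier R"
  shows "frob_submodule R 1 {c \<in> carrier R. c [^] e \<otimes> x \<in> V}"
proof -
  have "(d \<otimes> c) [^] e \<otimes> x \<in> V" if "d \<in> carrier R" "c \<in> carrier R" "c [^] e \<otimes> x \<in> V" for c d
    using that frob_submoduleD(5)[OF assms(1), of d "c [^] e \<otimes> x"] assms(2) by (simp add: pow_mult m_assoc)
  then show ?thesis
    using assms(2) frob_submoduleD[OF assms(1)] by (auto simp: frob_submodule_def pow_zero pow_add l_distr)
qed

text \<open>A submodule between \<open>W\<close> and \<open>W\<close> plus one generator
  \<open>x\<close> is recovered from the ideal of scalars carrying \<open>x\<close> into it, so a
  chain of submodules becomes a chain of ideals with the same strict steps. This is how lengths of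
  modules reduce to lengths of \<open>R/J\<close>.\<close>

lemma strict_chain_cyclic:
  assumes W: "frob_submodule R e W" and x: "x \<in> carrier R" and h: "strict_chain R Q e W V k"
    and "V \<subseteq> frob_span R e (insert x W)"
  shows "strict_chain R Q 1 {c \<in> carrier R. c [^] e \<otimes> x \<in> W} {c \<in> carrier R. c [^] e \<otimes> x \<in> V} k"
  using h assms(4)
proof induction
  case refl then show ?case using frob_submodule_colon strict_chain.refl x by blast
next
  case (weak V k V')
  show ?case by (rule strict_chain.weak[OF weak.IH frob_submodule_colon[OF weak.hyps(2) x]]) (use weak in auto)
next
  case (strict_at V k V')
  have WV: "W \<subseteq> V" and sV: "frob_submodule R e V" using strict_chain_frob_submodule strict_at.hyps by blast+
  obtain v where v: "v \<in> V'" "\<forall>s\<in>carrier R - Q. s [^] e \<otimes> v \<notin> V"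
    using strict_at.hyps(4) unfolding strict_at_def by blast
  obtain c w where cw: "c \<in> carrier R" "w \<in> W" "v = c [^] e \<otimes> x \<oplus> w"
    using frob_span_insertD[OF frob_submoduleD(1)[OF W] x] frob_span_id[OF W] v(1) strict_at.prems by blast
  have wc: "w \<in> carrier R" using cw W frob_submoduleD by blast
  have "w \<oplus> c [^] e \<otimes> x \<in> V'" using v cw wc x by (simp add: a_comm)
  then have "c [^] e \<otimes> x \<in> V'" using frob_submodule_cancel[OF strict_at.hyps(2), of w] cw WV strict_at.hyps(3) x by auto
  moreover have "s [^] (1::nat) \<otimes> c \<notin> {c \<in> carrier R. c [^] e \<otimes> x \<in> V}" if s: "s \<in> carrier R - Q" for s
  proof
    assume "s [^] (1::nat) \<otimes> c \<in> {c \<in> carrier R. c [^] e \<otimes> x \<in> V}"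
    then have "s [^] e \<otimes> (c [^] e \<otimes> x) \<in> V" using s cw x by (simp add: pow_mult m_assoc)
    moreover have "s [^] e \<otimes> w \<in> V" using frob_submoduleD(5)[OF sV] s cw WV by auto
    ultimately have "s [^] e \<otimes> v \<in> V" using frob_submoduleD(4)[OF sV] cw s x wc by (simp add: r_distr)
    then show False using v s by blast
  qed
  ultimately have "strict_at R Q 1 {c \<in> carrier R. c [^] e \<otimes> x \<in> V} {c \<in> carrier R. c [^] e \<otimes> x \<in> V'}"
    using cw(1) unfolding strict_at_def by blast
  moreover have "V \<subseteq> frob_span R e (insert x W)" using strict_at by blast
  ultimately show ?case
    using strict_chain.strict_at[OF strict_at.IH frob_submodule_colon[OF strict_at.hyps(2) x]] strict_at.hyps(3) by blast
qed

text \<open>When the generators are adjoined one at a time, each new quotient is cyclic and killed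
  by \<open>J\<close>, hence a quotient of \<open>R/J\<close>, of length at most
  \<open>l\<close>.\<close>

lemma strict_chain_bound_gens:
  assumes Q: "primeideal Q R" and W: "frob_submodule R e W" and J: "ideal J R"
    and b: "\<And>k. strict_chain R Q 1 J (carrier R) k \<Longrightarrow> k \<le> l"
    and "set xs \<subseteq> carrier R" "\<And>x c. x \<in> set xs \<Longrightarrow> c \<in> J \<Longrightarrow> c [^] e \<otimes> x \<in> W"
    and "strict_chain R Q e W (frob_span R e (W \<union> set xs)) k"
  shows "k \<le> length xs * l"
  using assms(5-)
proof (induction xs arbitrary: k)
  case Nil
  then have "strict_chain R Q e W W k" using frob_span_id[OF W] by simp
  moreover have "\<exists>t\<in>carrier R - Q. t [^] e \<otimes> w \<in> W" if "w \<in> W" for w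
    using one_notin_prime[OF Q] that frob_submoduleD(3)[OF W that] by (intro bexI[of _ \<one>]) auto
  ultimately show ?case using strict_chain_bound_zero[OF W] by auto
next
  case (Cons x xs)
  let ?M = "frob_span R e (W \<union> set xs)" and ?M' = "frob_span R e (W \<union> set (x # xs))"
  note Wc = frob_submoduleD(1)[OF W]
  have sM: "frob_submodule R e ?M" "frob_submodule R e ?M'" "W \<subseteq> ?M" "?M \<subseteq> ?M'"
    using Cons.prems Wc frob_span_frob_submodule[of "W \<union> set xs"] frob_span_frob_submodule[of "W \<union> set (x # xs)"]
      frob_span_subset[of "W \<union> set xs"] frob_span_mono[of "W \<union> set (x # xs)" "W \<union> set xs"] by auto
  have "k' \<le> l" if h: "strict_chain R Q e ?M ?M' k'" for k'
  proof -
    have "?M' \<subseteq> frob_span R e (insert x ?M)"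
      using frob_span_insert_frob_span[of "W \<union> set xs" "{x}"] Cons.prems(1) Wc by auto
    then have "strict_chain R Q 1 {c \<in> carrier R. c [^] e \<otimes> x \<in> ?M} {c \<in> carrier R. c [^] e \<otimes> x \<in> ?M'} k'"
      using strict_chain_cyclic[OF sM(1) _ h] Cons.prems(1) by auto
    moreover have "J \<subseteq> {c \<in> carrier R. c [^] e \<otimes> x \<in> ?M}"
      using Cons.prems(2) sM(3) ideal.Icarr[OF J] by auto
    ultimately have "strict_chain R Q 1 J (carrier R) k'"
      using E1.strict_chain_mono J frob_submodule_1_iff E1.frob_submodule_carrier by (metis (no_types, lifting) mem_Collect_eq subsetI)
    then show ?thesis using b by blast
  qed
  then have "k \<le> length xs * l + l"
    using strict_chain_bound_trans[OF Q sM(1,3,2,4) _ _ Cons.prems(3), of "length xs * l" l] Cons by auto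
  then show ?case by simp
qed

text \<open>The localization of \<open>R/Q\<close> at \<open>Q\<close> is a field. If the step from
  \<open>V\<close> to \<open>W\<close> is strict with witness \<open>w\<close>, then w t \<in> V for
  every t \<in> V, so \<open>V\<close> has no element outside \<open>Q\<close>; but after one strict
  step it would have one. The induction carries this second claim along.\<close>

lemma strict_chain_bound_prime:
  assumes Q: "primeideal Q R" and "strict_chain R Q 1 Q (carrier R) k"
  shows "k \<le> 1"
proof -
  have "strict_chain R Q 1 Q V k \<Longrightarrow> k \<le> 1 \<and> (k = 1 \<longrightarrow> \<not> V \<subseteq> Q)" for V k
  proof (induction rule: strict_chain.induct)
    case (strict_at V k W)
    obtain w where w: "w \<in> W" "\<forall>s\<in>carrier R - Q. s [^] (1::nat) \<otimes> w \<notin> V"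
      using strict_at.hyps(4) unfolding strict_at_def by blast
    have wc: "w \<in> carrier R" using w E1.frob_submoduleD(3)[OF strict_at.hyps(2)] by blast
    have sV: "Q \<subseteq> V" "frob_submodule R 1 V" using E1.strict_chain_frob_submodule strict_at.hyps(1) by blast+
    have "V \<subseteq> Q"
    proof
      fix t assume t: "t \<in> V"
      have tc: "t \<in> carrier R" using t sV E1.frob_submoduleD by blast
      have "w [^] (1::nat) \<otimes> t \<in> V" using E1.frob_submoduleD(5)[OF sV(2) wc t] .
      then have "t [^] (1::nat) \<otimes> w \<in> V" using tc wc by (simp add: m_comm)
      then show "t \<in> Q" using w tc by blast
    qed
    moreover have "w \<notin> Q"
    proof
      assume "w \<in> Q"
      then have "\<one> [^] (1::nat) \<otimes> w \<in> V" using sV wc by auto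
      then show False using w one_notin_prime[OF Q] by blast
    qed
    ultimately show ?case using strict_at w by auto
  qed auto
  then show ?thesis using assms by blast
qed

text \<open>Choose \<open>a\<close> in \<open>J'\<close> that survives in \<open>J'/J\<close> at
  \<open>Q\<close>. Whatever multiplies \<open>a\<close> into \<open>J\<close> lies in
  \<open>Q\<close>, so V \<mapsto> J + V a turns submodules containing \<open>Q\<close> into
  submodules between \<open>J\<close> and \<open>J'\<close> without losing strictness.
  Multiplication by \<open>a\<close> is linear for every exponent \<open>e\<close>.\<close>

lemma strict_chain_refine_step:
  assumes Q: "primeideal Q R" and J: "ideal J R" "ideal J' R" "J \<subseteq> J'" "strict_at R Q 1 J J'"
    and h: "strict_chain R Q e Q (carrier R) n"
  shows "strict_chain R Q e J J' n"
proof -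
  obtain a where a: "a \<in> J'" "\<forall>s\<in>carrier R - Q. s [^] (1::nat) \<otimes> a \<notin> J"
    using J(4) unfolding strict_at_def by blast
  have ac: "a \<in> carrier R" using a ideal.Icarr[OF J(2)] by blast
  have aQ: "s \<in> Q" if "s \<in> carrier R" "s \<otimes> a \<in> J" for s
    using a(2) that by auto
  note sJ = ideal_frob_submodule[OF J(1)]
  let ?V = "\<lambda>V. {j \<oplus> v \<otimes> a | j v. j \<in> J \<and> v \<in> V}"
  have sub: "frob_submodule R e (?V V)" if V: "frob_submodule R e V" for V
  proof -
    note D = frob_submoduleD[OF V]
    note DJ = frob_submoduleD[OF sJ]
    have "\<zero> \<in> ?V V" using D(2) DJ(2) ac by force
    moreover have "(j \<oplus> v \<otimes> a) \<oplus> (j' \<oplus> v' \<otimes> a) \<in> ?V V" if "j \<in> J" "v \<in> V" "j' \<in> J" "v' \<in> V" for j v j' v'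
    proof -
      have "(j \<oplus> v \<otimes> a) \<oplus> (j' \<oplus> v' \<otimes> a) = (j \<oplus> j') \<oplus> (v \<oplus> v') \<otimes> a"
        using D(3)[OF that(2)] D(3)[OF that(4)] DJ(3)[OF that(1)] DJ(3)[OF that(3)] ac by (simp add: l_distr a_ac)
      then show ?thesis using D(4)[OF that(2,4)] DJ(4)[OF that(1,3)] by blast
    qed
    moreover have "c [^] e \<otimes> (j \<oplus> v \<otimes> a) \<in> ?V V" if "c \<in> carrier R" "j \<in> J" "v \<in> V" for c j v
    proof -
      have "c [^] e \<otimes> (j \<oplus> v \<otimes> a) = c [^] e \<otimes> j \<oplus> (c [^] e \<otimes> v) \<otimes> a"
        using D(3)[OF that(3)] DJ(3)[OF that(2)] that(1) ac by (simp add: r_distr m_assoc)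
      then show ?thesis using D(5)[OF that(1,3)] DJ(5)[OF that(1,2)] by blast
    qed
    ultimately show ?thesis using D(1) DJ(1) ac unfolding frob_submodule_def by blast
  qed
  have JV: "J \<subseteq> ?V V" if "frob_submodule R e V" for V
  proof
    fix j assume j: "j \<in> J"
    have "j = j \<oplus> \<zero> \<otimes> a" using ac ideal.Icarr[OF J(1) j] by simp
    then show "j \<in> ?V V" using frob_submoduleD(2)[OF that] j by blast
  qed
  have "strict_chain R Q e Q V k \<Longrightarrow> strict_chain R Q e J (?V V) k" for V k
  proof (induction rule: strict_chain.induct)
    case refl then show ?case using strict_chain_sub[OF sJ sub JV] by blast
  next
    case (weak V k W) show ?case by (rule strict_chain.weak[OF weak.IH sub[OF weak.hyps(2)]]) (use weak.hyps(3) in blast)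
  next
    case (strict_at V k W)
    have sV: "frob_submodule R e V" "Q \<subseteq> V" using strict_chain_frob_submodule strict_at.hyps(1) by blast+
    obtain w where w: "w \<in> W" "\<forall>s\<in>carrier R - Q. s [^] e \<otimes> w \<notin> V"
      using strict_at.hyps(4) unfolding strict_at_def by blast
    have wc: "w \<in> carrier R" using w frob_submoduleD(3)[OF strict_at.hyps(2)] by blast
    have "\<zero> \<oplus> w \<otimes> a \<in> ?V W" using w frob_submoduleD(2)[OF sJ] by blast
    then have "w \<otimes> a \<in> ?V W" using wc ac by simp
    moreover have "s [^] e \<otimes> (w \<otimes> a) \<notin> ?V V" if s: "s \<in> carrier R - Q" for s
    proof
      assume "s [^] e \<otimes> (w \<otimes> a) \<in> ?V V"
      then obtain j v where jv: "j \<in> J" "v \<in> V" "s [^] e \<otimes> (w \<otimes> a) = j \<oplus> v \<otimes> a" by blast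
      have c: "j \<in> carrier R" "v \<in> carrier R" "s [^] e \<in> carrier R"
        using jv frob_submoduleD(3)[OF sV(1)] frob_submoduleD(3)[OF sJ] s by auto
      have "(s [^] e \<otimes> w \<ominus> v) \<otimes> a = s [^] e \<otimes> (w \<otimes> a) \<ominus> v \<otimes> a"
        using c wc ac by algebra
      also have "\<dots> = j" unfolding jv(3) using c ac by algebra
      finally have "s [^] e \<otimes> w \<ominus> v \<in> Q" using aQ jv(1) c wc by simp
      then have "v \<oplus> (s [^] e \<otimes> w \<ominus> v) \<in> V" using sV jv frob_submoduleD(4) by blast
      moreover have "v \<oplus> (s [^] e \<otimes> w \<ominus> v) = s [^] e \<otimes> w" using c wc by algebra
      ultimately show False using w s by simp
    qed
    ultimately have "strict_at R Q e (?V V) (?V W)" unfolding strict_at_def by blast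
    then show ?case using strict_chain.strict_at[OF strict_at.IH sub[OF strict_at.hyps(2)]] strict_at.hyps(3) by blast
  qed
  then have "strict_chain R Q e J (?V (carrier R)) n" using h by blast
  moreover have "?V (carrier R) \<subseteq> J'"
    using a J(3) ideal.I_l_closed[OF J(2)] additive_subgroup.a_closed[OF ideal.axioms(1)[OF J(2)]] by blast
  ultimately show ?thesis using strict_chain_mono[OF _ sJ] ideal_frob_submodule[OF J(2)] by blast
qed

text \<open>Each strict step of the chain of ideals carries a copy of \<open>F\<^sub>*(R/Q)\<close>,
  which supplies \<open>n\<close> steps for the exponent \<open>e\<close>.\<close>

lemma strict_chain_refine:
  assumes Q: "primeideal Q R" and h: "strict_chain R Q e Q (carrier R) n" and "strict_chain R Q 1 J V l"
  shows "strict_chain R Q e J V (n * l)"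
  using assms(3)
proof induction
  case refl then show ?case using strict_chain.refl[OF ideal_frob_submodule] by (simp add: frob_submodule_1_iff)
next
  case (weak V k W) then show ?case using strict_chain.weak ideal_frob_submodule frob_submodule_1_iff by metis
next
  case (strict_at V k W)
  then have "ideal V R" "ideal W R" using E1.strict_chain_frob_submodule frob_submodule_1_iff by auto
  then have "strict_chain R Q e V W n" using strict_chain_refine_step[OF Q _ _ strict_at.hyps(3,4) h] by blast
  then show ?case using strict_chain_trans[OF strict_at.IH] by (simp add: add.commute)
qed

end

section \<open>Noetherian rings and minimal primes\<close>

context noetherian_ring begin

lemma noetherian_induct [consumes 1, case_names step]:
  assumes "ideal J R"
    and step: "\<And>J. ideal J R \<Longrightarrow> (\<And>J'. ideal J' R \<Longrightarrow> J \<subset> J' \<Longrightarrow> P J') \<Longrightarrow> P J"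
  shows "P J"
proof (rule ccontr)
  assume n: "\<not> P J"
  let ?A = "{J. ideal J R \<and> \<not> P J}"
  have "\<exists>M\<in>?A. \<forall>J\<in>?A. M \<subseteq> J \<longrightarrow> J = M"
  proof (rule subset_Zorn_nonempty)
    show "?A \<noteq> {}" using assms n by blast
    fix C assume C: "C \<noteq> {}" "subset.chain ?A C"
    then have "subset.chain {I. ideal I R} C" unfolding pred_on.chain_def by blast
    then have "\<Union> C \<in> C" using ideal_chain_is_trivial C by blast
    then show "\<Union> C \<in> ?A" using C(2) unfolding pred_on.chain_def by blast
  qed
  then show False using step by blast
qed

end

section \<open>Finite length and minimal primes\<close>

locale noetherian_cring = cring R + noetherian_ring R for R (structure)
begin

sublocale E1: frob_exponent R 1 by (rule frob_exponent_1)

text \<open>If \<open>J\<close> is neither prime nor everything, then a b \<in> J with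
  \<open>a\<close> and \<open>b\<close> outside \<open>J\<close>. The module (J + a R)/J is cyclic
  and killed by J + b R, so its length and that of R/(J + a R) are bounded by induction. A prime
  \<open>J\<close> inside \<open>Q\<close> equals \<open>Q\<close> by minimality; if
  \<open>J\<close> is not inside \<open>Q\<close>, the length is 0.\<close>

lemma strict_chain_finite:
  assumes Q: "primeideal Q R" and J: "ideal J R"
    and "\<And>P. primeideal P R \<Longrightarrow> J \<subseteq> P \<Longrightarrow> P \<subseteq> Q \<Longrightarrow> P = Q"
  shows "\<exists>l. \<forall>k. strict_chain R Q 1 J (carrier R) k \<longrightarrow> k \<le> l"
  using J assms(3)
proof (induction rule: noetherian_induct)
  case (step J)
  note sJ = step.hyps[folded frob_submodule_1_iff]
  show ?case
  proof (cases "primeideal J R \<or> J = carrier R")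
    case True
    then consider "primeideal J R" "J \<subseteq> Q" | "\<not> J \<subseteq> Q" 
      using E1.one_notin_prime[OF Q] by blast
    then show ?thesis
    proof cases
      case 1
      then have "J = Q" using step.prems by blast
      then show ?thesis using E1.strict_chain_bound_prime[OF Q] by blast
    next
      case 2
      then obtain t where t: "t \<in> J" "t \<notin> Q" by blast
      have tc: "t \<in> carrier R" using t ideal.Icarr[OF step.hyps] by blast
      have "k = 0" if "strict_chain R Q 1 J (carrier R) k" for k
        using that t tc ideal.I_r_closed[OF step.hyps]
        by (intro E1.strict_chain_bound_zero[OF E1.frob_submodule_carrier, of Q J k]) (auto intro!: bexI[of _ t])
      then show ?thesis by auto
    qed
  next
    case False
    then obtain a b where ab: "a \<in> carrier R" "b \<in> carrier R" "a \<otimes> b \<in> J" "a \<notin> J" "b \<notin> J"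
      using ideal.primeidealCD[OF step.hyps is_cring] by blast
    note Jc = E1.frob_submoduleD(1)[OF sJ]
    let ?A = "frob_span R 1 (insert a J)" and ?B = "frob_span R 1 (insert b J)"
    have sAB: "frob_submodule R 1 ?A" "frob_submodule R 1 ?B" "J \<subset> ?A" "J \<subset> ?B"
      using E1.frob_span_frob_submodule[of "insert a J"] E1.frob_span_frob_submodule[of "insert b J"] E1.frob_span_subset[of "insert a J"]
        E1.frob_span_subset[of "insert b J"] ab Jc by auto
    have "\<exists>l. \<forall>k. strict_chain R Q 1 ?A (carrier R) k \<longrightarrow> k \<le> l"
      by (rule step.IH[OF sAB(1)[unfolded frob_submodule_1_iff] sAB(3)]) (use step.prems sAB(3) in blast)
    then obtain la where la: "\<forall>k. strict_chain R Q 1 ?A (carrier R) k \<longrightarrow> k \<le> la" by blast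
    have "\<exists>l. \<forall>k. strict_chain R Q 1 ?B (carrier R) k \<longrightarrow> k \<le> l"
      by (rule step.IH[OF sAB(2)[unfolded frob_submodule_1_iff] sAB(4)]) (use step.prems sAB(4) in blast)
    then obtain lb where lb: "\<forall>k. strict_chain R Q 1 ?B (carrier R) k \<longrightarrow> k \<le> lb" by blast
    have B: "c [^] (1::nat) \<otimes> a \<in> J" if c: "c \<in> ?B" for c
    proof -
      obtain d w where dw: "d \<in> carrier R" "w \<in> J" "c = d [^] (1::nat) \<otimes> b \<oplus> w"
        using E1.frob_span_insertD[OF Jc ab(2) c] unfolding E1.frob_span_id[OF sJ] by blast
      have wc: "w \<in> carrier R" using dw Jc by blast
      have "c [^] (1::nat) \<otimes> a = d \<otimes> (a \<otimes> b) \<oplus> w \<otimes> a"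
        using dw ab(1,2) wc by (simp add: l_distr r_distr m_ac)
      then show ?thesis
        using ideal.I_l_closed[OF step.hyps ab(3) dw(1)] ideal.I_r_closed[OF step.hyps dw(2) ab(1)]
          E1.frob_submoduleD(4)[OF sJ] by auto
    qed
    have "k \<le> lb" if "strict_chain R Q 1 J ?A k" for k
      using E1.strict_chain_bound_gens[OF Q sJ, of ?B lb "[a]" k] sAB(2) lb B that ab by (simp add: frob_submodule_1_iff)
    then show ?thesis
      using E1.strict_chain_bound_trans[OF Q sAB(1) _ E1.frob_submodule_carrier] sAB E1.frob_submoduleD(1)[OF sAB(1)] la by blast
  qed
qed

text \<open>A finite product of primes over \<open>I\<close> lies in \<open>I\<close>, which takes
  the place of a primary decomposition. It is phrased with elements, one from each prime of the
  list. When a b \<in> J, the product of J + a R and J + b R lies in \<open>J\<close>, so the lists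
  of the two larger ideals are concatenated; the unit ideal has the empty list.\<close>

lemma prime_cover:
  assumes "ideal I R"
  shows "\<exists>Ps. (\<forall>P\<in>set Ps. primeideal P R \<and> I \<subseteq> P) \<and>
    (\<forall>ys. list_all2 (\<in>) ys Ps \<longrightarrow> foldr (\<otimes>) ys \<one> \<in> I)"
  using assms
proof (induction rule: noetherian_induct)
  case (step J)
  note sJ = step.hyps[folded frob_submodule_1_iff]
  note Jc = E1.frob_submoduleD(1)[OF sJ]
  consider "primeideal J R" | "J = carrier R" | "\<not> primeideal J R" "J \<noteq> carrier R" by blast
  then show ?case
  proof cases
    case 1
    then show ?thesis using Jc by (intro exI[of _ "[J]"]) (auto simp: list_all2_Cons2)
  next
    case 2
    then show ?thesis by (intro exI[of _ "[]"]) auto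
  next
    case 3
    then obtain a b where ab: "a \<in> carrier R" "b \<in> carrier R" "a \<otimes> b \<in> J" "a \<notin> J" "b \<notin> J"
      using ideal.primeidealCD[OF step.hyps is_cring] by blast
    let ?A = "frob_span R 1 (insert a J)" and ?B = "frob_span R 1 (insert b J)"
    have sAB: "frob_submodule R 1 ?A" "frob_submodule R 1 ?B" "J \<subset> ?A" "J \<subset> ?B"
      using E1.frob_span_frob_submodule[of "insert a J"] E1.frob_span_frob_submodule[of "insert b J"] E1.frob_span_subset[of "insert a J"]
        E1.frob_span_subset[of "insert b J"] ab Jc by auto
    obtain Ps where Ps: "\<forall>P\<in>set Ps. primeideal P R \<and> ?A \<subseteq> P"
      "\<forall>ys. list_all2 (\<in>) ys Ps \<longrightarrow> foldr (\<otimes>) ys \<one> \<in> ?A"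
      using step.IH[OF sAB(1)[unfolded frob_submodule_1_iff] sAB(3)] by blast
    obtain Ps' where Ps': "\<forall>P\<in>set Ps'. primeideal P R \<and> ?B \<subseteq> P"
      "\<forall>ys. list_all2 (\<in>) ys Ps' \<longrightarrow> foldr (\<otimes>) ys \<one> \<in> ?B"
      using step.IH[OF sAB(2)[unfolded frob_submodule_1_iff] sAB(4)] by blast
    have AB: "x \<otimes> y \<in> J" if x: "x \<in> ?A" and y: "y \<in> ?B" for x y
    proof -
      obtain d w where dw: "d \<in> carrier R" "w \<in> J" "x = d [^] (1::nat) \<otimes> a \<oplus> w"
        using E1.frob_span_insertD[OF Jc ab(1) x] unfolding E1.frob_span_id[OF sJ] by blast
      obtain d' w' where dw': "d' \<in> carrier R" "w' \<in> J" "y = d' [^] (1::nat) \<otimes> b \<oplus> w'"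
        using E1.frob_span_insertD[OF Jc ab(2) y] unfolding E1.frob_span_id[OF sJ] by blast
      have c: "w \<in> carrier R" "w' \<in> carrier R" using dw dw' Jc by auto
      have "x \<otimes> y = (d \<otimes> d') \<otimes> (a \<otimes> b) \<oplus> ((d \<otimes> a) \<otimes> w' \<oplus> (d' \<otimes> b \<oplus> w') \<otimes> w)"
        using dw dw' c ab(1,2) by (simp add: l_distr r_distr m_ac a_ac)
      also have "\<dots> \<in> J" using dw dw' ab(1-3) c ideal.I_l_closed[OF step.hyps] E1.frob_submoduleD(4)[OF sJ] by simp
      finally show ?thesis .
    qed
    have "foldr (\<otimes>) ys \<one> \<in> J" if ys: "list_all2 (\<in>) ys (Ps @ Ps')" for ys
    proof -
      obtain us vs where uv: "ys = us @ vs" "list_all2 (\<in>) us Ps" "list_all2 (\<in>) vs Ps'"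
        using ys by (auto simp: list_all2_append2)
      have "set zs \<subseteq> carrier R" if "list_all2 (\<in>) zs Qs" "\<forall>P\<in>set Qs. primeideal P R" for zs Qs
        using that by (induction rule: list_all2_induct) (auto dest: ideal.Icarr[OF primeideal.axioms(1)])
      then have "set us \<subseteq> carrier R" "set vs \<subseteq> carrier R"
        using uv(2,3) Ps(1) Ps'(1) by blast+
      then show ?thesis using AB uv Ps(2) Ps'(2) foldr_mult_append by metis
    qed
    moreover have "\<forall>P\<in>set (Ps @ Ps'). primeideal P R \<and> J \<subseteq> P"
      using Ps(1) Ps'(1) sAB(3,4) by (metis Un_iff order.trans psubset_imp_subset set_append)
    ultimately show ?thesis by blast
  qed
qed

text \<open>Otherwise every listed prime has an element outside \<open>Q\<close>, and the product of
  these elements would lie in I \<subseteq> Q.\<close>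

lemma prime_cover_mem:
  assumes Ps: "\<forall>P\<in>set Ps. primeideal P R \<and> I \<subseteq> P"
    "\<forall>ys. list_all2 (\<in>) ys Ps \<longrightarrow> foldr (\<otimes>) ys \<one> \<in> I"
    and Q: "primeideal Q R" "I \<subseteq> Q"
  shows "\<exists>P\<in>set Ps. P \<subseteq> Q"
proof (rule ccontr)
  assume "\<not> ?thesis"
  then have "\<forall>P\<in>set Ps. \<exists>y. y \<in> P - Q" by blast
  then obtain y where y: "\<forall>P\<in>set Ps. y P \<in> P - Q" by metis
  have "set (map y Ps) \<subseteq> carrier R - Q"
    using y Ps(1) ideal.Icarr[OF primeideal.axioms(1)] by fastforce
  then have "foldr (\<otimes>) (map y Ps) \<one> \<notin> Q" using prime_foldr_notin[OF Q(1)] by blast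
  moreover have "list_all2 (\<in>) (map y Ps) Ps" using y by (auto simp: list_all2_conv_all_nth)
  ultimately show False using Ps(2) Q(2) by blast
qed

lemma finite_minimal_primes:
  assumes "ideal I R"
  shows "finite (minimal_primes R I)"
proof -
  obtain Ps where Ps: "\<forall>P\<in>set Ps. primeideal P R \<and> I \<subseteq> P"
    "\<forall>ys. list_all2 (\<in>) ys Ps \<longrightarrow> foldr (\<otimes>) ys \<one> \<in> I"
    using prime_cover[OF assms] by blast
  have "minimal_primes R I \<subseteq> set Ps"
  proof
    fix P assume P: "P \<in> minimal_primes R I"
    then obtain P' where "P' \<in> set Ps" "P' \<subseteq> P"
      using prime_cover_mem[OF Ps, of P] by (auto simp: minimal_primes_def)
    then show "P \<in> set Ps" using P Ps(1) by (auto simp: minimal_primes_def)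
  qed
  then show ?thesis using finite_subset by blast
qed

lemma ex_minimal_prime:
  assumes "ideal I R" "primeideal Q R" "I \<subseteq> Q"
  shows "\<exists>P\<in>minimal_primes R I. P \<subseteq> Q"
proof -
  obtain Ps where Ps: "\<forall>P\<in>set Ps. primeideal P R \<and> I \<subseteq> P"
    "\<forall>ys. list_all2 (\<in>) ys Ps \<longrightarrow> foldr (\<otimes>) ys \<one> \<in> I"
    using prime_cover[OF assms(1)] by blast
  let ?S = "{P \<in> set Ps. P \<subseteq> Q}"
  have fin: "finite ?S" and ne: "?S \<noteq> {}" using prime_cover_mem[OF Ps assms(2,3)] by auto
  obtain P where P: "P \<in> ?S" "\<forall>P'\<in>?S. P' \<subseteq> P \<longrightarrow> P = P'"
    using finite_has_minimal[OF fin ne] by auto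
  have "P' = P" if P': "primeideal P' R" "I \<subseteq> P'" "P' \<subseteq> P" for P'
  proof -
    obtain P'' where "P'' \<in> set Ps" "P'' \<subseteq> P'" using prime_cover_mem[OF Ps P'(1,2)] by blast
    moreover from this have "P'' \<in> ?S" "P'' \<subseteq> P" using P(1) P'(3) by auto
    then have "P = P''" using P(2) by blast
    ultimately show ?thesis using P'(3) by auto
  qed
  then show ?thesis using P Ps(1) unfolding minimal_primes_def by blast
qed

end

section \<open>Ranks along chains of primes\<close>

context frob_exponent begin

lemma frob_span_UnD:
  assumes V: "frob_submodule R e V" and U: "U \<subseteq> carrier R" and "v \<in> frob_span R e (V \<union> U)"
  shows "\<exists>a\<in>V. \<exists>b\<in>frob_span R e U. v = a \<oplus> b"
  using assms(3)
proof induction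
  case zero show ?case using frob_submoduleD(2)[OF V] frob_span_zero by (intro bexI[of _ \<zero>]) auto
next
  case (step v c x)
  then obtain a b where ab: "a \<in> V" "b \<in> frob_span R e U" "v = a \<oplus> b" by blast
  have cc: "a \<in> carrier R" "b \<in> carrier R" "x \<in> carrier R"
    using ab frob_submoduleD(3)[OF V] frob_span_closed[OF U] step.hyps U by auto
  show ?case
  proof (cases "x \<in> V")
    case True
    have "v \<oplus> c [^] e \<otimes> x = (a \<oplus> c [^] e \<otimes> x) \<oplus> b" using ab cc step.hyps by (simp add: a_ac)
    moreover have "a \<oplus> c [^] e \<otimes> x \<in> V" using frob_submoduleD(4,5)[OF V] ab True step.hyps by blast
    ultimately show ?thesis using ab by blast
  next
    case False
    then have "b \<oplus> c [^] e \<otimes> x \<in> frob_span R e U" using frob_span_step[OF ab(2)] step.hyps by blast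
    moreover have "v \<oplus> c [^] e \<otimes> x = a \<oplus> (b \<oplus> c [^] e \<otimes> x)" using ab cc step.hyps by (simp add: a_ac)
    ultimately show ?thesis using ab by blast
  qed
qed

text \<open>Generators are eliminated one at a time: y = \<mu>^e y + w gives (1 - \<mu>)^e y = w,
  and 1 - \<mu> is invertible, so \<open>y\<close> lies in the span of the rest. The auxiliary fact
  \<open>dec\<close> separates the coefficient of \<open>y\<close>, which stays in the ideal
  \<open>m\<close>.\<close>

lemma nakayama:
  assumes m: "ideal m R" and u: "\<And>\<mu>. \<mu> \<in> m \<Longrightarrow> \<exists>\<nu>\<in>carrier R. \<nu> \<otimes> (\<one> \<ominus> \<mu>) = \<one>"
    and W: "frob_submodule R e W" and "set xs \<subseteq> carrier R"
    and "\<And>x. x \<in> set xs \<Longrightarrow> x \<in> frob_span R e (W \<union> {\<mu> [^] e \<otimes> x | \<mu> x. \<mu> \<in> m \<and> x \<in> set xs})"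
  shows "set xs \<subseteq> W"
  using assms(4,5)
proof (induction xs)
  case (Cons y ys)
  note mc = ideal.Icarr[OF m]
  let ?G = "\<lambda>A. W \<union> {\<mu> [^] e \<otimes> x | \<mu> x. \<mu> \<in> m \<and> x \<in> A}"
  let ?T = "frob_span R e (?G (set ys))"
  have yc: "y \<in> carrier R" "set ys \<subseteq> carrier R" using Cons.prems by auto
  have Gc: "?G (set ys) \<subseteq> carrier R" using yc mc frob_submoduleD(1)[OF W] by auto
  note sT = frob_span_frob_submodule[OF Gc]
  have dec: "\<exists>\<mu>\<in>m. \<exists>w\<in>?T. v = \<mu> [^] e \<otimes> y \<oplus> w" if "v \<in> frob_span R e (?G (set (y # ys)))" for v
    using that
  proof induction
    case zero
    show ?case using additive_subgroup.zero_closed[OF ideal.axioms(1)[OF m]] frob_span_zero yc pow_zero by force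
  next
    case (step v c x)
    then obtain \<mu> w where mw: "\<mu> \<in> m" "w \<in> ?T" "v = \<mu> [^] e \<otimes> y \<oplus> w" by blast
    have wc: "w \<in> carrier R" using mw frob_submoduleD(3)[OF sT] by blast
    show ?case
    proof (cases "x \<in> ?G (set ys)")
      case True
      then have "x \<in> carrier R" using Gc by blast
      then have "v \<oplus> c [^] e \<otimes> x = \<mu> [^] e \<otimes> y \<oplus> (w \<oplus> c [^] e \<otimes> x)"
        using mw wc yc(1) mc step.hyps(2) by (simp add: a_assoc)
      moreover have "w \<oplus> c [^] e \<otimes> x \<in> ?T" using frob_span_step[OF mw(2)] step.hyps True by blast
      ultimately show ?thesis using mw by blast
    next
      case False
      then obtain \<mu>' where m': "\<mu>' \<in> m" "x = \<mu>' [^] e \<otimes> y" using step.hyps by auto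
      have "v \<oplus> c [^] e \<otimes> x = (\<mu> \<oplus> c \<otimes> \<mu>') [^] e \<otimes> y \<oplus> w"
        using mw m' mc wc yc step.hyps by (simp add: pow_add pow_mult l_distr m_assoc a_ac)
      moreover have "\<mu> \<oplus> c \<otimes> \<mu>' \<in> m"
        using mw m' step.hyps ideal.I_l_closed[OF m] additive_subgroup.a_closed[OF ideal.axioms(1)[OF m]] by blast
      ultimately show ?thesis using mw by blast
    qed
  qed
  obtain \<mu> w where mw: "\<mu> \<in> m" "w \<in> ?T" "y = \<mu> [^] e \<otimes> y \<oplus> w"
    using dec[OF Cons.prems(2)] by (meson list.set_intros(1))
  have wc: "w \<in> carrier R" using mw frob_submoduleD(3)[OF sT] by blast
  obtain \<nu> where nu: "\<nu> \<in> carrier R" "\<nu> \<otimes> (\<one> \<ominus> \<mu>) = \<one>" using u[OF mw(1)] by blast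
  have "(\<one> \<ominus> \<mu>) [^] e \<otimes> y = y \<ominus> \<mu> [^] e \<otimes> y"
    using mc[OF mw(1)] yc by (simp add: a_minus_def pow_add pow_inv l_distr l_minus)
  also have "\<dots> = w"
  proof -
    have *: "(a \<oplus> w) \<ominus> a = w" if "a \<in> carrier R" for a using that wc by algebra
    have "y \<ominus> \<mu> [^] e \<otimes> y = (\<mu> [^] e \<otimes> y \<oplus> w) \<ominus> \<mu> [^] e \<otimes> y" using mw(3) by simp
    then show ?thesis using *[of "\<mu> [^] e \<otimes> y"] mc[OF mw(1)] yc(1) by simp
  qed
  finally have *: "(\<one> \<ominus> \<mu>) [^] e \<otimes> y = w" .
  have "\<nu> [^] e \<otimes> (d [^] e \<otimes> y) = (\<nu> \<otimes> d) [^] e \<otimes> y" if "d \<in> carrier R" for d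
    using that nu(1) yc(1) by (simp add: pow_mult m_assoc)
  from this[of "\<one> \<ominus> \<mu>"] have "\<nu> [^] e \<otimes> w = \<one> [^] e \<otimes> y"
    using * nu(2) mc[OF mw(1)] by simp
  then have "y = \<nu> [^] e \<otimes> w" using nu yc by simp
  then have yT: "y \<in> ?T" using frob_submoduleD(5)[OF sT nu(1) mw(2)] by simp
  have "x \<in> ?T" if x: "x \<in> set ys" for x
  proof -
    obtain \<mu>' w' where "\<mu>' \<in> m" "w' \<in> ?T" "x = \<mu>' [^] e \<otimes> y \<oplus> w'"
      using dec[OF Cons.prems(2)] x by (meson list.set_intros(2))
    then show ?thesis using frob_submoduleD(4,5)[OF sT] yT mc by blast
  qed
  then have ys: "set ys \<subseteq> W" using Cons.IH yc by blast
  then have "?G (set ys) \<subseteq> W" using frob_submoduleD(5)[OF W] mc by auto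
  then have "?T \<subseteq> W" using frob_span_least[OF W] by blast
  then show ?case using yT ys by auto
qed simp

text \<open>Linear independence of the images in \<open>F\<^sub>*(R/P)\<close> over the residue
  field at \<open>P\<close>, with elements of \<open>carrier R - P\<close> clearing denominators.
  Each entry is compared with later entries only.\<close>

fun indep :: "'a set \<Rightarrow> 'a list \<Rightarrow> bool" where
  "indep P [] = True"
| "indep P (b # bs) = (indep P bs \<and> (\<forall>s\<in>carrier R - P. s [^] e \<otimes> b \<notin> frob_span R e (P \<union> set bs)))"

text \<open>Each element of \<open>bs\<close> adds at most 1 to the length at \<open>P\<close>, and
  one that depends on its successors adds nothing. A span of length at least
  \<open>length bs\<close> therefore leaves no room for a dependent element.\<close>

lemma indep_of_length:
  assumes P: "primeideal P R" and bs: "set bs \<subseteq> carrier R"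
    and h: "strict_chain R P e P (frob_span R e (P \<union> set bs)) (length bs)"
  shows "indep P bs"
proof -
  interpret P: primeideal P R by fact
  note sP = ideal_frob_submodule[OF P.is_ideal]
  have one: "k \<le> 1" if "strict_chain R P 1 P (carrier R) k" for k using strict_chain_bound_prime[OF P] that .
  have act: "c [^] e \<otimes> x \<in> P" if "c \<in> P" "x \<in> carrier R" for c x
  proof -
    have "c [^] (Suc (e - 1)) \<in> P" using that P.I_l_closed by simp
    then show ?thesis using e_pos that P.I_r_closed by simp
  qed
  have "k \<le> length bs \<and> (\<not> indep P bs \<longrightarrow> k < length bs)"
    if "strict_chain R P e P (frob_span R e (P \<union> set bs)) k" for k
    using bs that
  proof (induction bs arbitrary: k)
    case Nil
    then show ?case using strict_chain_bound_gens[OF P sP P.is_ideal, of 1 "[]"] one by simp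
  next
    case (Cons b bs)
    let ?M = "frob_span R e (P \<union> set bs)" and ?M' = "frob_span R e (P \<union> set (b # bs))"
    have bc: "b \<in> carrier R" "P \<union> set bs \<subseteq> carrier R" using Cons.prems P.Icarr by auto
    have sM: "frob_submodule R e ?M" "frob_submodule R e ?M'" "P \<subseteq> ?M" "?M \<subseteq> ?M'"
      using bc frob_span_frob_submodule[of "P \<union> set bs"] frob_span_frob_submodule[of "P \<union> set (b # bs)"]
        frob_span_subset[of "P \<union> set bs"] frob_span_mono[of "P \<union> set (b # bs)" "P \<union> set bs"] by auto
    have M': "?M' = frob_span R e (?M \<union> set [b])"
      using frob_span_insert_frob_span[of "P \<union> set bs" "{b}"] bc by simp
    have "c [^] e \<otimes> x \<in> ?M" if "x \<in> set [b]" "c \<in> P" for x c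
      using act[of c b] that bc sM(3) by auto
    then have "k \<le> length [b] * 1" if "strict_chain R P e ?M ?M' k" for k
      using strict_chain_bound_gens[OF P sM(1) P.is_ideal one, of "[b]" k] that bc unfolding M' by auto
    then have le1: "k \<le> 1" if "strict_chain R P e ?M ?M' k" for k using that by (simp add: One_nat_def)
    show ?case
    proof (cases "indep P bs")
      case False
      have "k \<le> (length bs - 1) + 1"
        by (rule strict_chain_bound_trans[OF P sM(1,3,2,4) _ le1 Cons.prems(2)]) (use Cons.IH Cons.prems False in fastforce)+
      moreover have "length bs > 0" using False by (cases bs) auto
      ultimately show ?thesis by simp
    next
      case True
      have le: "k \<le> length bs + 1"
        by (rule strict_chain_bound_trans[OF P sM(1,3,2,4) _ le1 Cons.prems(2)]) (use Cons.IH Cons.prems in auto)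
      show ?thesis
      proof (cases "indep P (b # bs)")
        case False
        then obtain s where s: "s \<in> carrier R - P" "s [^] e \<otimes> b \<in> ?M" using True by auto
        have "\<exists>t\<in>carrier R - P. t [^] e \<otimes> v \<in> ?M" if v: "v \<in> ?M'" for v
        proof -
          obtain c w where cw: "c \<in> carrier R" "w \<in> ?M" "v = c [^] e \<otimes> b \<oplus> w"
            using frob_span_insertD[of "P \<union> set bs" b v] bc v by auto
          have wc: "w \<in> carrier R" using cw frob_submoduleD(3)[OF sM(1)] by blast
          have "s [^] e \<otimes> v = c [^] e \<otimes> (s [^] e \<otimes> b) \<oplus> s [^] e \<otimes> w"
            using s cw wc bc by (simp add: r_distr m_ac)
          also have "\<dots> \<in> ?M" using frob_submoduleD(4,5)[OF sM(1)] s cw by auto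
          finally show ?thesis using s by blast
        qed
        then have z: "k = 0" if "strict_chain R P e ?M ?M' k" for k using strict_chain_bound_zero[OF sM(2) _ that] by blast
        have "k \<le> length bs + 0"
          by (rule strict_chain_bound_trans[OF P sM(1,3,2,4) _ _ Cons.prems(2)]) (use Cons.IH Cons.prems z in auto)
        then show ?thesis by simp
      qed (use le in simp)
    qed
  qed
  then show ?thesis using h by blast
qed

end

context frob_exponent begin

lemma F_finite_ex_gens:
  assumes F_finite: "F_finite R e"
  shows "\<exists>gs. set gs \<subseteq> carrier R \<and> frob_span R e (set gs) = carrier R"
proof -
  obtain B where B: "B \<subseteq> carrier R" "finite B"
    "\<forall>r\<in>carrier R. \<exists>c\<in>B \<rightarrow> carrier R. r = (\<Oplus>b\<in>B. (c b [^] e) \<otimes> b)"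
    using F_finite unfolding F_finite_def by blast
  have sum: "(\<Oplus>b\<in>C. (c b [^] e) \<otimes> b) \<in> frob_span R e B" if "finite C" "C \<subseteq> B" "c \<in> B \<rightarrow> carrier R" for C c
    using that
  proof (induction C)
    case (insert x C)
    have "(\<Oplus>b\<in>insert x C. (c b [^] e) \<otimes> b) = c x [^] e \<otimes> x \<oplus> (\<Oplus>b\<in>C. (c b [^] e) \<otimes> b)"
      using insert B by (intro finsum_insert) (auto simp: Pi_iff subset_iff)
    also have "\<dots> = (\<Oplus>b\<in>C. (c b [^] e) \<otimes> b) \<oplus> c x [^] e \<otimes> x"
      using insert B frob_span_closed[OF B(1)] by (intro a_comm) (auto simp: Pi_iff subset_iff)
    also have "\<dots> \<in> frob_span R e B" using insert by (intro frob_span_step) auto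
    finally show ?case .
  qed (simp add: frob_span_zero)
  obtain gs where gs: "set gs = B" using finite_list[OF B(2)] by blast
  have "carrier R \<subseteq> frob_span R e B" using sum[OF B(2) order_refl] B(3) by fastforce
  moreover have "frob_span R e B \<subseteq> carrier R" using frob_span_closed[OF B(1)] by blast
  ultimately show ?thesis using gs B(1) by (intro exI[of _ gs]) auto
qed

end

section \<open>The rank of the Frobenius pushforward modulo a prime\<close>

locale F_finite_ring = noetherian_cring R for R (structure) +
  fixes p :: nat
  assumes p_prime: "Factorial_Ring.prime p" and char_p: "has_char R p"
    and ex_gens: "\<exists>gs. set gs \<subseteq> carrier R \<and> frob_span R p (set gs) = carrier R"
begin

lemma frob_exponent_p: "frob_exponent R p"
  using p_prime char_p frobenius_add by unfold_locales (auto simp: prime_gt_0_nat)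

sublocale Ep: frob_exponent R p by (rule frob_exponent_p)

lemma act_closed:
  assumes "ideal P R" "c \<in> P" "x \<in> carrier R"
  shows "c [^] p \<otimes> x \<in> P"
proof -
  interpret ideal P R by fact
  have "c [^] (Suc (p - 1)) \<in> P" using assms I_l_closed Icarr by simp
  then show ?thesis using Ep.e_pos assms I_r_closed by simp
qed

lemma rank_bound:
  assumes P: "primeideal P R" and gs: "set gs \<subseteq> carrier R" "frob_span R p (P \<union> set gs) = carrier R"
    and h: "strict_chain R P p P (carrier R) k"
  shows "k \<le> length gs"
proof -
  interpret P: primeideal P R by fact
  show ?thesis
    using Ep.strict_chain_bound_gens[OF P Ep.ideal_frob_submodule[OF P.is_ideal] P.is_ideal _ gs(1), of 1 k] Ep.strict_chain_bound_prime[OF P]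
      act_closed[OF P.is_ideal] gs h by auto
qed

lemma ex_rank_bound: "\<exists>G. \<forall>P k. primeideal P R \<longrightarrow> strict_chain R P p P (carrier R) k \<longrightarrow> k \<le> G"
proof -
  obtain gs where gs: "set gs \<subseteq> carrier R" "frob_span R p (set gs) = carrier R" using ex_gens by blast
  have "frob_span R p (P \<union> set gs) = carrier R" if "primeideal P R" for P
  proof -
    have "P \<union> set gs \<subseteq> carrier R" using gs(1) ideal.Icarr[OF primeideal.axioms(1)[OF that]] by auto
    then show ?thesis using Ep.frob_span_mono[of "P \<union> set gs" "set gs"] Ep.frob_span_closed[of "P \<union> set gs"] gs(2) by blast
  qed
  then show ?thesis using rank_bound[OF _ gs(1)] by blast
qed

text \<open>\<open>bs\<close> is a longest list in which every entry counts. It exists because ranks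
  are bounded, and maximality says that adjoining any \<open>g\<close> is not a strict step, which
  is the existence of the denominator \<open>s\<close>.\<close>

lemma ex_dense_list:
  assumes P: "primeideal P R"
  shows "\<exists>bs. set bs \<subseteq> carrier R \<and> strict_chain R P p P (frob_span R p (P \<union> set bs)) (length bs) \<and>
    (\<forall>g\<in>carrier R. \<exists>s\<in>carrier R - P. s [^] p \<otimes> g \<in> frob_span R p (P \<union> set bs))"
proof -
  interpret P: primeideal P R by fact
  note sP = Ep.ideal_frob_submodule[OF P.is_ideal]
  let ?ok = "\<lambda>bs. set bs \<subseteq> carrier R \<and> strict_chain R P p P (frob_span R p (P \<union> set bs)) (length bs)"
  have sub: "frob_submodule R p (frob_span R p (P \<union> set bs))" if "set bs \<subseteq> carrier R" for bs
  proof (rule Ep.frob_span_frob_submodule)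
    show "P \<union> set bs \<subseteq> carrier R" using that P.Icarr by auto
  qed
  obtain G where G: "\<forall>P k. primeideal P R \<longrightarrow> strict_chain R P p P (carrier R) k \<longrightarrow> k \<le> G" using ex_rank_bound by blast
  have "length bs \<le> G" if "?ok bs" for bs
  proof -
    have "strict_chain R P p P (carrier R) (length bs)"
      using that Ep.strict_chain_mono[OF _ sP order_refl Ep.frob_submodule_carrier Ep.frob_submoduleD(1)[OF sub]] by blast
    then show ?thesis using G P by blast
  qed
  then have "\<forall>bs. ?ok bs \<longrightarrow> length bs \<le> G" by blast
  moreover have "?ok []" using Ep.frob_span_id[OF sP] strict_chain.refl[OF sP] by simp
  ultimately have "\<exists>bs. ?ok bs \<and> (\<forall>cs. ?ok cs \<longrightarrow> length cs \<le> length bs)"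
    by (intro ex_has_greatest_nat[of ?ok "[]" length "Suc G"]) (auto simp: less_Suc_eq_le)
  then obtain bs where bs: "?ok bs" "\<forall>cs. ?ok cs \<longrightarrow> length cs \<le> length bs" by (elim exE conjE) blast
  have "\<exists>s\<in>carrier R - P. s [^] p \<otimes> g \<in> frob_span R p (P \<union> set bs)" if g: "g \<in> carrier R" for g
  proof (rule ccontr)
    assume n: "\<not> ?thesis"
    have gb: "set (g # bs) \<subseteq> carrier R" "P \<union> set (g # bs) \<subseteq> carrier R" using g bs P.Icarr by auto
    have "g \<in> frob_span R p (P \<union> set (g # bs))" using Ep.frob_span_base[OF gb(2)] by simp
    then have "strict_at R P p (frob_span R p (P \<union> set bs)) (frob_span R p (P \<union> set (g # bs)))"
      using n unfolding strict_at_def by blast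
    moreover have "frob_span R p (P \<union> set bs) \<subseteq> frob_span R p (P \<union> set (g # bs))" using Ep.frob_span_mono[OF gb(2)] by auto
    ultimately have "?ok (g # bs)" using strict_chain.strict_at[OF conjunct2[OF bs(1)] sub[OF gb(1)]] gb(1) by simp
    then show False using bs(2) by fastforce
  qed
  then show ?thesis using bs(1) by blast
qed

text \<open>Since \<open>R/P\<close> is a domain and \<open>z\<close> is nonzero in it,
  multiplication by \<open>z\<close> is injective modulo \<open>P\<close>: z (s w - v) \<in> P
  forces s w - v \<in> P, and \<open>P\<close> is contained in every member of the chain. This makes
  the quotients of successive powers of an element look alike.\<close>

lemma strict_chain_scale:
  assumes P: "primeideal P R" and Q: "primeideal Q R" "P \<subseteq> Q" and z: "z \<in> carrier R" "z \<notin> P"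
    and J: "P \<subseteq> J" and h: "strict_chain R Q 1 J V k"
  shows "strict_chain R Q 1 {z \<otimes> w \<oplus> q | w q. w \<in> J \<and> q \<in> P} {z \<otimes> w \<oplus> q | w q. w \<in> V \<and> q \<in> P} k"
proof -
  interpret P: primeideal P R by fact
  note sP = P.is_ideal[folded frob_submodule_1_iff]
  let ?S = "\<lambda>W. {z \<otimes> w \<oplus> q | w q. w \<in> W \<and> q \<in> P}"
  have sub: "frob_submodule R 1 (?S W)" if W: "frob_submodule R 1 W" for W
  proof -
    note D = E1.frob_submoduleD[OF W] and DP = E1.frob_submoduleD[OF sP]
    have "z \<otimes> \<zero> \<oplus> \<zero> \<in> ?S W" using D(2) DP(2) by blast
    then have z0: "\<zero> \<in> ?S W" using z by simp
    have add: "(z \<otimes> w \<oplus> q) \<oplus> (z \<otimes> w' \<oplus> q') \<in> ?S W" if "w \<in> W" "q \<in> P" "w' \<in> W" "q' \<in> P" for w q w' q'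
    proof -
      have "(z \<otimes> w \<oplus> q) \<oplus> (z \<otimes> w' \<oplus> q') = z \<otimes> (w \<oplus> w') \<oplus> (q \<oplus> q')"
        using D(3)[OF that(1)] D(3)[OF that(3)] DP(3)[OF that(2)] DP(3)[OF that(4)] z by (simp add: r_distr a_ac)
      then show ?thesis using D(4)[OF that(1,3)] DP(4)[OF that(2,4)] by blast
    qed
    have smul: "c [^] (1::nat) \<otimes> (z \<otimes> w \<oplus> q) \<in> ?S W" if "c \<in> carrier R" "w \<in> W" "q \<in> P" for c w q
    proof -
      have "c [^] (1::nat) \<otimes> (z \<otimes> w \<oplus> q) = z \<otimes> (c [^] (1::nat) \<otimes> w) \<oplus> c [^] (1::nat) \<otimes> q"
        using D(3)[OF that(2)] DP(3)[OF that(3)] that(1) z by (simp add: r_distr m_ac)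
      then show ?thesis using D(5)[OF that(1,2)] DP(5)[OF that(1,3)] by blast
    qed
    have "?S W \<subseteq> carrier R" using D(1) DP(1) z by auto
    moreover have "x \<oplus> y \<in> ?S W" if "x \<in> ?S W" "y \<in> ?S W" for x y
      using that add by blast
    moreover have "c [^] (1::nat) \<otimes> x \<in> ?S W" if "c \<in> carrier R" "x \<in> ?S W" for c x
      using that smul by blast
    ultimately show ?thesis using z0 unfolding frob_submodule_def by simp
  qed
  show ?thesis using h
  proof induction
    case refl then show ?case using strict_chain.refl sub by blast
  next
    case (weak V k W) show ?case by (rule strict_chain.weak[OF weak.IH sub[OF weak.hyps(2)]]) (use weak.hyps(3) in blast)
  next
    case (strict_at V k W)
    have sV: "frob_submodule R 1 V" "J \<subseteq> V" using E1.strict_chain_frob_submodule strict_at.hyps(1) by blast+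
    obtain w where w: "w \<in> W" "\<forall>s\<in>carrier R - Q. s [^] (1::nat) \<otimes> w \<notin> V"
      using strict_at.hyps(4) unfolding strict_at_def by blast
    have wc: "w \<in> carrier R" using w E1.frob_submoduleD(3)[OF strict_at.hyps(2)] by blast
    have "z \<otimes> w \<oplus> \<zero> \<in> ?S W" using w E1.frob_submoduleD(2)[OF sP] by blast
    moreover have "s [^] (1::nat) \<otimes> (z \<otimes> w \<oplus> \<zero>) \<notin> ?S V" if s: "s \<in> carrier R - Q" for s
    proof
      assume "s [^] (1::nat) \<otimes> (z \<otimes> w \<oplus> \<zero>) \<in> ?S V"
      then obtain v q where vq: "v \<in> V" "q \<in> P" "s [^] (1::nat) \<otimes> (z \<otimes> w \<oplus> \<zero>) = z \<otimes> v \<oplus> q" by blast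
      have c: "v \<in> carrier R" "q \<in> carrier R" "s \<in> carrier R"
        using vq E1.frob_submoduleD(3)[OF sV(1)] P.Icarr s by auto
      have "z \<otimes> (s \<otimes> w \<ominus> v) = s [^] (1::nat) \<otimes> (z \<otimes> w \<oplus> \<zero>) \<ominus> z \<otimes> v"
        using c wc z by simp algebra
      also have "\<dots> = q" unfolding vq(3) using c z by algebra
      finally have "s \<otimes> w \<ominus> v \<in> P" using P.I_prime[of z "s \<otimes> w \<ominus> v"] vq(2) z c wc by auto
      then have "v \<oplus> (s \<otimes> w \<ominus> v) \<in> V" using sV J vq E1.frob_submoduleD(4) by blast
      moreover have "v \<oplus> (s \<otimes> w \<ominus> v) = s [^] (1::nat) \<otimes> w" using c wc by simp algebra
      ultimately show False using w s by simp
    qed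
    ultimately have "strict_at R Q 1 (?S V) (?S W)" unfolding strict_at_def by blast
    then show ?case using strict_chain.strict_at[OF strict_at.IH sub[OF strict_at.hyps(2)]] strict_at.hyps(3) by blast
  qed
qed

end

lemma (in cring) prime_pow_notin:
  assumes P: "primeideal P R" and z: "z \<in> carrier R - P"
  shows "z [^] (k::nat) \<in> carrier R - P"
proof (induction k)
  case 0
  interpret primeideal P R by fact
  show ?case using one_imp_carrier I_notcarr by auto
next
  case (Suc k)
  interpret primeideal P R by fact
  show ?case using I_prime[of "z [^] k" z] Suc z by auto
qed

context F_finite_ring begin

text \<open>Let \<open>bs\<close> represent a basis of \<open>F\<^sub>*(R/P)\<close> at the generic point, choose \<open>z \<in> Q0 - P\<close> with
  \<open>z \<cdot> F\<^sub>*R\<close> in the span of \<open>P\<close> and \<open>bs\<close>, and let \<open>Q\<close> be minimal over \<open>P + z R\<close>.  Write \<open>l\<close> for the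
  length of \<open>R/(P + z R)\<close> at \<open>Q\<close>.  Then \<open>F\<^sub>*(R/(P + z\<^sup>m\<^sup>p R))\<close> has length at least \<open>n m p l\<close> at \<open>Q\<close>, and
  at most \<open>m \<bar>bs\<bar> l\<close> up to a constant, so \<open>p n \<le> \<bar>bs\<bar>\<close>.\<close>

lemma rank_step:
  assumes P: "primeideal P R" and Q0: "primeideal Q0 R" and PQ0: "P \<subset> Q0"
  shows "\<exists>Q. primeideal Q R \<and> P \<subset> Q \<and> Q \<subseteq> Q0 \<and>
    (\<forall>n. strict_chain R Q p Q (carrier R) n \<longrightarrow> strict_chain R P p P (carrier R) (p * n))"
proof -
  interpret P: primeideal P R by fact
  interpret Q0: primeideal Q0 R by fact
  note sP = Ep.ideal_frob_submodule[OF P.is_ideal]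
  obtain bs where bs: "set bs \<subseteq> carrier R" "strict_chain R P p P (frob_span R p (P \<union> set bs)) (length bs)"
    "\<forall>g\<in>carrier R. \<exists>s\<in>carrier R - P. s [^] p \<otimes> g \<in> frob_span R p (P \<union> set bs)"
    using ex_dense_list[OF P] by blast
  obtain gs where gs: "set gs \<subseteq> carrier R" "frob_span R p (set gs) = carrier R" using ex_gens by blast
  let ?F0 = "frob_span R p (P \<union> set bs)"
  have Pb: "P \<union> set bs \<subseteq> carrier R" using bs P.Icarr by auto
  note sF0 = Ep.frob_span_frob_submodule[OF Pb]
  \<comment> \<open>One denominator for all generators of \<open>F\<^sub>*R\<close>: the product of
    the individual denominators.\<close>
  have "\<exists>s\<in>carrier R - P. \<forall>g\<in>set hs. s [^] p \<otimes> g \<in> ?F0" if "set hs \<subseteq> carrier R" for hs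
    using that
  proof (induction hs)
    case Nil then show ?case using Ep.one_notin_prime[OF P] by auto
  next
    case (Cons h hs)
    then obtain s where s: "s \<in> carrier R - P" "\<forall>g\<in>set hs. s [^] p \<otimes> g \<in> ?F0" by auto
    obtain t where t: "t \<in> carrier R - P" "t [^] p \<otimes> h \<in> ?F0" using bs(3) Cons.prems by auto
    have "(s \<otimes> t) [^] p \<otimes> g \<in> ?F0" if g: "g \<in> set (h # hs)" for g
    proof (cases "g = h")
      case True
      have "(s \<otimes> t) [^] p \<otimes> g = s [^] p \<otimes> (t [^] p \<otimes> h)"
        using s t Cons.prems True by (simp add: Ep.pow_mult m_assoc)
      then show ?thesis using Ep.frob_submoduleD(5)[OF sF0 _ t(2), of s] s by simp
    next
      case False
      then have g': "g \<in> set hs" "g \<in> carrier R" using g Cons.prems by auto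
      have "(s \<otimes> t) [^] p \<otimes> g = t [^] p \<otimes> (s [^] p \<otimes> g)"
        using s t g' by (simp add: Ep.pow_mult m_ac)
      then show ?thesis using Ep.frob_submoduleD(5)[OF sF0, of t "s [^] p \<otimes> g"] s(2) t g' by simp
    qed
    moreover have "s \<otimes> t \<in> carrier R - P" using s t P.I_prime by auto
    ultimately show ?case by blast
  qed
  from this[OF gs(1)] obtain s where s: "s \<in> carrier R - P" "\<forall>g\<in>set gs. s [^] p \<otimes> g \<in> ?F0" by blast
  obtain y where y: "y \<in> Q0" "y \<notin> P" using PQ0 by blast
  \<comment> \<open>\<open>s\<close> clears the denominators of \<open>gs\<close>, and
    \<open>y\<close> puts \<open>z\<close> into \<open>Q0\<close>; neither factor is in
    \<open>P\<close>.\<close>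
  define z where "z = s \<otimes> y"
  have z: "z \<in> carrier R" "z \<notin> P" "z \<in> Q0"
    using s y Q0.Icarr[OF y(1)] Q0.I_l_closed P.I_prime[of s y] unfolding z_def by auto
  have zg: "z [^] p \<otimes> g \<in> ?F0" if g: "g \<in> set gs" for g
  proof -
    have "z [^] p \<otimes> g = y [^] p \<otimes> (s [^] p \<otimes> g)"
      using s y Q0.Icarr g gs(1) unfolding z_def by (simp add: Ep.pow_mult m_ac subset_iff)
    then show ?thesis using Ep.frob_submoduleD(5)[OF sF0, of y "s [^] p \<otimes> g"] s(2) g y Q0.Icarr by simp
  qed
  define J where "J k = {z [^] (k::nat) \<otimes> w \<oplus> q | w q. w \<in> carrier R \<and> q \<in> P}" for k
  have J_id: "ideal (J k) R" for k
  proof -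
    have "z [^] k \<in> carrier R - P" using prime_pow_notin[OF P] z by blast
    \<comment> \<open>Rescaling the trivial chain at \<open>carrier R\<close> is a way to read off
      that \<open>J k\<close>, which is z^k R + P, is an ideal.\<close>
    then have "strict_chain R Q0 1 {z [^] k \<otimes> w \<oplus> q | w q. w \<in> carrier R \<and> q \<in> P} {z [^] k \<otimes> w \<oplus> q | w q. w \<in> carrier R \<and> q \<in> P} 0"
      using PQ0 by (intro strict_chain_scale[OF P Q0 _ _ _ _ strict_chain.refl[OF E1.frob_submodule_carrier]]) (auto simp: P.Icarr)
    then show ?thesis using E1.strict_chain_frob_submodule frob_submodule_1_iff unfolding J_def by blast
  qed
  have PJ: "P \<subseteq> J k" for k
  proof
    fix q assume "q \<in> P"
    moreover have "q = z [^] k \<otimes> \<zero> \<oplus> q" using z P.Icarr[OF \<open>q \<in> P\<close>] by simp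
    ultimately show "q \<in> J k" unfolding J_def by blast
  qed
  have J0: "J 0 = carrier R"
  proof
    show "J 0 \<subseteq> carrier R" using ideal.Icarr[OF J_id] by blast
    show "carrier R \<subseteq> J 0"
    proof
      fix w assume "w \<in> carrier R"
      moreover have "w = z [^] (0::nat) \<otimes> w \<oplus> \<zero>" using calculation by simp
      ultimately show "w \<in> J 0" unfolding J_def using additive_subgroup.zero_closed[OF P.is_additive_subgroup] by blast
    qed
  qed
  have JQ0: "J 1 \<subseteq> Q0"
    using z PQ0 Q0.I_r_closed additive_subgroup.a_closed[OF Q0.is_additive_subgroup] unfolding J_def by auto
  obtain Q where Qm: "Q \<in> minimal_primes R (J 1)" "Q \<subseteq> Q0"
    using ex_minimal_prime[OF J_id Q0 JQ0] by blast
  have Q: "primeideal Q R" "J 1 \<subseteq> Q" using Qm unfolding minimal_primes_def by auto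
  have zQ: "z \<in> Q"
  proof -
    have "z = z [^] (1::nat) \<otimes> \<one> \<oplus> \<zero>" using z by simp
    then have "z \<in> J 1" using additive_subgroup.zero_closed[OF P.is_additive_subgroup] one_closed
      unfolding J_def by blast
    then show ?thesis using Q by blast
  qed
  then have PQ: "P \<subset> Q" using PJ Q(2) z by blast
  obtain l0 where l0: "\<forall>k. strict_chain R Q 1 (J 1) (carrier R) k \<longrightarrow> k \<le> l0"
    using strict_chain_finite[OF Q(1) J_id[of 1]] Qm unfolding minimal_primes_def by blast
  note sJ = J_id[folded frob_submodule_1_iff]
  \<comment> \<open>Since J 1 \<subseteq> Q, the length is at least 1; this makes \<open>l\<close>
    positive, so that it can be cancelled at the end.\<close>
  have "strict_at R Q 1 (J 1) (carrier R)"
    unfolding strict_at_def using Q(2) by (intro bexI[of _ \<one>]) auto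
  then have h1: "strict_chain R Q 1 (J 1) (carrier R) (Suc 0)"
    using strict_chain.strict_at[OF strict_chain.refl[OF sJ] E1.frob_submodule_carrier E1.frob_submoduleD(1)[OF sJ]] by blast
  have "\<exists>l. strict_chain R Q 1 (J 1) (carrier R) l \<and> (\<forall>k. strict_chain R Q 1 (J 1) (carrier R) k \<longrightarrow> k \<le> l)"
    using Nat.ex_has_greatest_nat[of "strict_chain R Q 1 (J 1) (carrier R)" "Suc 0" l0] h1 l0 by blast
  then obtain l where l: "strict_chain R Q 1 (J 1) (carrier R) l" "\<And>k. strict_chain R Q 1 (J 1) (carrier R) k \<Longrightarrow> k \<le> l" by blast
  have l_pos: "l > 0" using l(2)[OF h1] by simp
  have zk: "z [^] k \<in> carrier R - P" for k :: nat
    using prime_pow_notin[OF P] z by blast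
  have Jstep: "strict_chain R Q 1 (J (Suc k)) (J k) l" for k
  proof -
    have "strict_chain R Q 1 {z [^] k \<otimes> w \<oplus> q | w q. w \<in> J 1 \<and> q \<in> P} (J k) l"
      unfolding J_def[of k] using zk PJ PQ by (intro strict_chain_scale[OF P Q(1) _ _ _ _ l(1)]) auto
    moreover have "{z [^] k \<otimes> w \<oplus> q | w q. w \<in> J 1 \<and> q \<in> P} = J (Suc k)"
    proof (rule Set.set_eqI, rule iffI)
      fix v assume "v \<in> {z [^] k \<otimes> w \<oplus> q | w q. w \<in> J 1 \<and> q \<in> P}"
      then obtain w q q' where *: "w \<in> carrier R" "q \<in> P" "q' \<in> P" "v = z [^] k \<otimes> (z [^] (1::nat) \<otimes> w \<oplus> q') \<oplus> q"
        unfolding J_def by blast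
      have "v = z [^] (Suc k) \<otimes> w \<oplus> (z [^] k \<otimes> q' \<oplus> q)"
        using * z P.Icarr by (simp add: r_distr m_assoc a_assoc)
      moreover have "z [^] k \<otimes> q' \<oplus> q \<in> P" using * z P.I_l_closed additive_subgroup.a_closed[OF P.is_additive_subgroup] by simp
      ultimately show "v \<in> J (Suc k)" unfolding J_def using * by blast
    next
      fix v assume "v \<in> J (Suc k)"
      then obtain w q where *: "w \<in> carrier R" "q \<in> P" "v = z [^] (Suc k) \<otimes> w \<oplus> q" unfolding J_def by blast
      have "v = z [^] k \<otimes> (z [^] (1::nat) \<otimes> w \<oplus> \<zero>) \<oplus> q" using * z by (simp add: m_assoc)
      moreover have "z [^] (1::nat) \<otimes> w \<oplus> \<zero> \<in> J 1"
        unfolding J_def using * additive_subgroup.zero_closed[OF P.is_additive_subgroup] by blast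
      ultimately show "v \<in> {z [^] k \<otimes> w \<oplus> q | w q. w \<in> J 1 \<and> q \<in> P}" using * by blast
    qed
    ultimately show ?thesis by simp
  qed
  have Jk: "strict_chain R Q 1 (J k) (carrier R) (k * l)" for k
  proof (induction k)
    case 0 then show ?case using J0 strict_chain.refl[OF E1.frob_submodule_carrier] by simp
  next
    case (Suc k) then show ?case using E1.strict_chain_trans[OF Jstep Suc] by simp
  qed
  \<comment> \<open>Since z^(m p) is the p-th power of z^m, \<open>F m\<close> modulo
    \<open>P\<close> is z^m times \<open>F 0\<close> for the Frobenius action. It lies inside
    \<open>J (m * p)\<close>, where the lower bound is available, and the filtration from
    \<open>F m\<close> up to \<open>F 0\<close> and then to \<open>R\<close> gives the upper
    bound.\<close>
  define F where "F m = frob_span R p (P \<union> (\<lambda>b. z [^] (m * p) \<otimes> b) ` set bs)" for m :: nat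
  have Fc: "P \<union> (\<lambda>b. z [^] (m * p) \<otimes> b) ` set bs \<subseteq> carrier R" for m :: nat
    using z bs(1) P.Icarr by auto
  have sF: "frob_submodule R p (F m)" for m unfolding F_def using Ep.frob_span_frob_submodule[OF Fc] .
  have PF: "P \<subseteq> F m" for m unfolding F_def using Ep.frob_span_subset[OF Fc] by blast
  have bF: "z [^] (m * p) \<otimes> b \<in> F m" if "b \<in> set bs" for b m
    unfolding F_def using Ep.frob_span_base[OF Fc] that by blast
  have FJ: "F m \<subseteq> J (m * p)" for m
  proof -
    have "z [^] (m * p) \<otimes> b \<in> J (m * p)" if "b \<in> set bs" for b
    proof -
      have "b \<in> carrier R" using that bs by auto
      moreover from this have "z [^] (m * p) \<otimes> b = z [^] (m * p) \<otimes> b \<oplus> \<zero>" using z by simp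
      ultimately show ?thesis unfolding J_def using additive_subgroup.zero_closed[OF P.is_additive_subgroup] by blast
    qed
    then show ?thesis unfolding F_def
      using PJ by (intro Ep.frob_span_least[OF Ep.ideal_frob_submodule[OF J_id]]) blast
  qed
  have Jact: "c [^] p \<otimes> x \<in> F m" if c: "c \<in> J 1" and x: "x \<in> carrier R" "z [^] p \<otimes> x \<in> F m" for c x m
  proof -
    obtain w q where wq: "w \<in> carrier R" "q \<in> P" "c = z [^] (1::nat) \<otimes> w \<oplus> q" using c unfolding J_def by blast
    have "c [^] p \<otimes> x = w [^] p \<otimes> (z [^] p \<otimes> x) \<oplus> q [^] p \<otimes> x"
      using wq z x P.Icarr by (simp add: Ep.pow_add Ep.pow_mult l_distr r_distr m_ac)
    moreover have "q [^] p \<otimes> x \<in> F m" using act_closed[OF P.is_ideal wq(2) x(1)] PF by blast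
    ultimately show ?thesis using Ep.frob_submoduleD(4,5)[OF sF] wq(1) x(2) by simp
  qed
  have F0: "F 0 = ?F0"
  proof -
    have "(\<lambda>b. z [^] (0 * p) \<otimes> b) ` set bs = set bs" using bs(1) by (force simp: subset_iff)
    then show ?thesis unfolding F_def by simp
  qed
  \<comment> \<open>The gap between \<open>F 0\<close> and \<open>R\<close> does not depend on
    \<open>m\<close>; it is the constant error in the comparison.\<close>
  have up0: "k \<le> length gs * l" if "strict_chain R Q p (F 0) (carrier R) k" for k
  proof (rule Ep.strict_chain_bound_gens[OF Q(1) sF J_id l(2) gs(1)])
    show "c [^] p \<otimes> x \<in> F 0" if "x \<in> set gs" "c \<in> J 1" for x c
      using Jact[OF that(2), of x 0] zg[OF that(1)] gs(1) that(1) F0 by auto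
    have "F 0 \<union> set gs \<subseteq> carrier R" using gs(1) Ep.frob_submoduleD(1)[OF sF] by blast
    then have "frob_span R p (F 0 \<union> set gs) = carrier R"
      using Ep.frob_span_mono[of "F 0 \<union> set gs" "set gs"] Ep.frob_span_closed[of "F 0 \<union> set gs"] gs(2) by blast
    then show "strict_chain R Q p (F 0) (frob_span R p (F 0 \<union> set gs)) k" using that by simp
  qed
  have Fsub: "F (Suc m) \<subseteq> F m" for m
  proof -
    have "z [^] (Suc m * p) \<otimes> b \<in> F m" if b: "b \<in> set bs" for b
    proof -
      have "z [^] (Suc m * p) \<otimes> b = z [^] p \<otimes> (z [^] (m * p) \<otimes> b)"
        using z b bs(1) by (simp add: nat_pow_mult[symmetric] m_assoc subset_iff)
      then show ?thesis using Ep.frob_submoduleD(5)[OF sF z(1) bF[OF b]] by simp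
    qed
    then show ?thesis unfolding F_def[of "Suc m"] using PF by (intro Ep.frob_span_least[OF sF]) blast
  qed
  have up1: "k \<le> length bs * l" if h: "strict_chain R Q p (F (Suc m)) (F m) k" for k m
  proof -
    let ?xs = "map (\<lambda>b. z [^] (m * p) \<otimes> b) bs"
    have xs: "set ?xs \<subseteq> carrier R" using z bs(1) by auto
    then have c: "F (Suc m) \<union> set ?xs \<subseteq> carrier R" using Ep.frob_submoduleD(1)[OF sF] by blast
    have "P \<union> (\<lambda>b. z [^] (m * p) \<otimes> b) ` set bs \<subseteq> F (Suc m) \<union> set ?xs" using PF by auto
    then have "F m \<subseteq> frob_span R p (F (Suc m) \<union> set ?xs)" unfolding F_def[of m] using Ep.frob_span_mono[OF c] by blast
    then have h': "strict_chain R Q p (F (Suc m)) (frob_span R p (F (Suc m) \<union> set ?xs)) k"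
      using strict_chain.weak[OF h Ep.frob_span_frob_submodule[OF c]] by blast
    have "k \<le> length ?xs * l"
    proof (rule Ep.strict_chain_bound_gens[OF Q(1) sF J_id l(2) xs _ h'])
      show "c [^] p \<otimes> x \<in> F (Suc m)" if x: "x \<in> set ?xs" and c: "c \<in> J 1" for x c
      proof -
        obtain b where b: "b \<in> set bs" "x = z [^] (m * p) \<otimes> b" using x by auto
        have "z [^] p \<otimes> x = z [^] (Suc m * p) \<otimes> b"
          using z b bs(1) by (simp add: nat_pow_mult[symmetric] m_assoc subset_iff)
        then show ?thesis using Jact[OF c, of x "Suc m"] bF[OF b(1), of "Suc m"] xs x by auto
      qed
    qed
    then show ?thesis by simp
  qed
  have exp_frob: "k \<le> m * (length bs * l) + length gs * l" if "strict_chain R Q p (F m) (carrier R) k" for k m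
    using that
  proof (induction m arbitrary: k)
    case 0 then show ?case using up0 by simp
  next
    case (Suc m)
    have "k \<le> length bs * l + (m * (length bs * l) + length gs * l)"
      by (rule Ep.strict_chain_bound_trans[OF Q(1) sF Fsub Ep.frob_submodule_carrier Ep.frob_submoduleD(1)[OF sF] up1 Suc.IH Suc.prems])
    then show ?case by simp
  qed
  have main: "strict_chain R P p P (carrier R) (p * n)" if n: "strict_chain R Q p Q (carrier R) n" for n
  proof -
    have "n * ((m * p) * l) \<le> m * (length bs * l) + length gs * l" for m
    proof (rule exp_frob)
      have "strict_chain R Q p (J (m * p)) (carrier R) (n * ((m * p) * l))" using Ep.strict_chain_refine[OF Q(1) n Jk] .
      then show "strict_chain R Q p (F m) (carrier R) (n * ((m * p) * l))"
        using Ep.strict_chain_mono[OF _ sF FJ Ep.frob_submodule_carrier order_refl] by blast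
    qed
    \<comment> \<open>Any \<open>m\<close> above the constant error \<open>length gs * l\<close>
      turns the asymptotic inequality into \<open>p * n * l \<le> length bs * l\<close>.\<close>
    from this[of "Suc (length gs * l)"]
    have "Suc (length gs * l) * (p * n * l) \<le> Suc (length gs * l) * (length bs * l) + length gs * l"
      by (simp add: algebra_simps)
    then have "p * n * l \<le> length bs * l"
    proof (rule contrapos_pp)
      assume "\<not> p * n * l \<le> length bs * l"
      then have "Suc (length bs * l) \<le> p * n * l" by (simp only: not_le Suc_le_eq)
      then have "Suc (length gs * l) * Suc (length bs * l) \<le> Suc (length gs * l) * (p * n * l)"
        by (rule mult_le_mono2)
      then show "\<not> Suc (length gs * l) * (p * n * l) \<le> Suc (length gs * l) * (length bs * l) + length gs * l"
        by (simp add: algebra_simps)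
    qed
    then have "p * n \<le> length bs" using l_pos by simp
    moreover have "strict_chain R P p P (carrier R) (length bs)"
      using Ep.strict_chain_mono[OF bs(2) sP order_refl Ep.frob_submodule_carrier Ep.frob_submoduleD(1)[OF sF0]] .
    ultimately show ?thesis using Ep.strict_chain_less by blast
  qed
  then show ?thesis using Q PQ Qm(2) by blast
qed

text \<open>\<open>rank_step\<close> reaches only some prime between \<open>P\<close> and
  \<open>Q\<close>, so the argument climbs by Noetherian induction, discarding the factor
  \<open>p\<close> gained at each stage.\<close>

lemma rank_mono:
  assumes "primeideal P R" and Q: "primeideal Q R" and "P \<subseteq> Q" and h: "strict_chain R Q p Q (carrier R) n"
  shows "strict_chain R P p P (carrier R) n"
proof -
  have "ideal P R" using assms primeideal.axioms(1) by blast
  then have "primeideal P R \<longrightarrow> P \<subseteq> Q \<longrightarrow> strict_chain R P p P (carrier R) n"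
  proof (induction rule: noetherian_induct)
    case (step P)
    show ?case
    proof (intro impI)
      assume P: "primeideal P R" "P \<subseteq> Q"
      show "strict_chain R P p P (carrier R) n"
      proof (cases "P = Q")
        case False
        then obtain Q' where Q': "primeideal Q' R" "P \<subset> Q'" "Q' \<subseteq> Q"
          "\<forall>n. strict_chain R Q' p Q' (carrier R) n \<longrightarrow> strict_chain R P p P (carrier R) (p * n)"
          using rank_step[OF P(1) Q] P(2) by blast
        have "strict_chain R Q' p Q' (carrier R) n" using step.IH[OF _ Q'(2)] Q' primeideal.axioms(1) by blast
        then have "strict_chain R P p P (carrier R) (p * n)" using Q'(4) by blast
        moreover have "n \<le> p * n" using Ep.e_pos by simp
        ultimately show ?thesis using Ep.strict_chain_less by blast
      qed (use h in simp)
    qed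
  qed
  then show ?thesis using assms by blast
qed

text \<open>Every inclusion of the chain contributes a factor \<open>p\<close>. The prime found by
  \<open>rank_step\<close> may lie strictly below the next member of the chain;
  \<open>rank_mono\<close> covers the remaining distance.\<close>

lemma rank_chain:
  assumes "prime_chain R c d" "c d \<subseteq> Q" and Q: "primeideal Q R" and h: "strict_chain R Q p Q (carrier R) n"
  shows "strict_chain R (c 0) p (c 0) (carrier R) (p ^ d * n)"
  using assms
proof (induction d arbitrary: Q n)
  case 0
  then show ?case using rank_mono[of "c 0" Q n] by (auto simp: prime_chain_def)
next
  case (Suc d)
  have c: "primeideal (c d) R" "primeideal (c (Suc d)) R" "c d \<subset> c (Suc d)" "prime_chain R c d"
    using Suc.prems(1) by (auto simp: prime_chain_def)
  obtain Q' where Q': "primeideal Q' R" "c d \<subset> Q'" "Q' \<subseteq> c (Suc d)"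
    "\<forall>n. strict_chain R Q' p Q' (carrier R) n \<longrightarrow> strict_chain R (c d) p (c d) (carrier R) (p * n)"
    using rank_step[OF c(1-3)] by blast
  have "strict_chain R Q' p Q' (carrier R) n" using rank_mono[OF Q'(1) Suc.prems(3) _ Suc.prems(4)] Q'(3) Suc.prems(2) by blast
  then have "strict_chain R (c d) p (c d) (carrier R) (p * n)" using Q'(4) by blast
  then have "strict_chain R (c 0) p (c 0) (carrier R) (p ^ d * (p * n))" using Suc.IH[OF c(4) order_refl c(1)] by blast
  then show ?case by (simp add: mult_ac)
qed

end

section \<open>Duality over regular local rings\<close>

definition frob_linear :: "('a, 'b) ring_scheme \<Rightarrow> nat \<Rightarrow> ('a \<Rightarrow> 'a) \<Rightarrow> bool" where
  "frob_linear R p \<phi> \<longleftrightarrow> \<phi> \<in> carrier R \<rightarrow> carrier R \<and>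
     (\<forall>x\<in>carrier R. \<forall>y\<in>carrier R. \<phi> (x \<oplus>\<^bsub>R\<^esub> y) = \<phi> x \<oplus>\<^bsub>R\<^esub> \<phi> y) \<and>
     (\<forall>c\<in>carrier R. \<forall>x\<in>carrier R. \<phi> (c [^]\<^bsub>R\<^esub> p \<otimes>\<^bsub>R\<^esub> x) = c \<otimes>\<^bsub>R\<^esub> \<phi> x)"

lemma frob_linearD:
  assumes "frob_linear R p \<phi>"
  shows "x \<in> carrier R \<Longrightarrow> \<phi> x \<in> carrier R"
    "x \<in> carrier R \<Longrightarrow> y \<in> carrier R \<Longrightarrow> \<phi> (x \<oplus>\<^bsub>R\<^esub> y) = \<phi> x \<oplus>\<^bsub>R\<^esub> \<phi> y"
    "c \<in> carrier R \<Longrightarrow> x \<in> carrier R \<Longrightarrow> \<phi> (c [^]\<^bsub>R\<^esub> p \<otimes>\<^bsub>R\<^esub> x) = c \<otimes>\<^bsub>R\<^esub> \<phi> x"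
  using assms by (auto simp: frob_linear_def)

text \<open>The functionals \<open>\<Phi> (e i \<otimes> _)\<close> and the elements
  \<open>b i\<close> behave like dual bases of \<open>F\<^sub>*R\<close>, all these functionals
  being multiples of the single \<open>\<Phi>\<close>. The index type is left open: positions in a
  list over a local ring, pairs of a position and an exponent over a polynomial ring.\<close>

definition frob_dual ::
    "('a, 'b) ring_scheme \<Rightarrow> nat \<Rightarrow> ('a \<Rightarrow> 'a) \<Rightarrow> 'i set \<Rightarrow> ('i \<Rightarrow> 'a) \<Rightarrow> ('i \<Rightarrow> 'a) \<Rightarrow> bool" where
  "frob_dual R p \<Phi> I e b \<longleftrightarrow> frob_linear R p \<Phi> \<and> finite I \<and>
     e \<in> I \<rightarrow> carrier R \<and> b \<in> I \<rightarrow> carrier R \<and>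
     (\<forall>g\<in>carrier R. g = (\<Oplus>\<^bsub>R\<^esub>i\<in>I. \<Phi> (e i \<otimes>\<^bsub>R\<^esub> g) [^]\<^bsub>R\<^esub> p \<otimes>\<^bsub>R\<^esub> b i))"

section \<open>Generators and socle modulo the p-th powers of the parameters\<close>

context frob_exponent begin

lemma frob_span_scale:
  assumes "B \<subseteq> carrier R" "x \<in> carrier R" "v \<in> frob_span R e B"
  shows "v \<otimes> x \<in> frob_span R e ((\<lambda>b. b \<otimes> x) ` B)"
  using assms(3)
proof induction
  case zero then show ?case using assms frob_span_zero by simp
next
  case (step v c b)
  then have vb: "v \<in> carrier R" "b \<in> carrier R" using frob_span_closed assms by auto
  have "(v \<oplus> c [^] e \<otimes> b) \<otimes> x = v \<otimes> x \<oplus> c [^] e \<otimes> (b \<otimes> x)"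
    using vb step.hyps assms by (simp add: l_distr m_assoc)
  then show ?case using frob_span_step[OF step.IH step.hyps(2), of "b \<otimes> x"] step.hyps(3) by simp
qed

end

context F_finite_ring begin

lemma frob_linear_zero:
  assumes "frob_linear R p \<phi>"
  shows "\<phi> \<zero> = \<zero>"
proof -
  have "\<phi> (\<zero> [^] p \<otimes> \<zero>) = \<zero> \<otimes> \<phi> \<zero>" using frob_linearD[OF assms] by blast
  then show ?thesis using frob_linearD(1)[OF assms] by simp
qed

text \<open>Trading the generator \<open>x\<close> of the modulus for x^p costs a factor
  \<open>p\<close> in the number of generators. The error is pushed up one power of \<open>x\<close>
  at a time: in r x^k the coefficient \<open>r\<close> is itself expanded over \<open>bs\<close>
  modulo \<open>x\<close>. The products b x^(p - 1) are recorded because they lead to the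
  socle.\<close>

lemma gen_step:
  assumes S: "S \<subseteq> carrier R" and x: "x \<in> carrier R" and bs: "set bs \<subseteq> carrier R"
    and H: "\<forall>g\<in>carrier R. \<exists>b\<in>frob_span R p (set bs). g \<ominus> b \<in> frob_span R 1 (insert x S)"
  shows "\<exists>bs'. set bs' \<subseteq> carrier R \<and> length bs' = length bs * p \<and>
    (\<forall>b\<in>set bs. b \<otimes> x [^] (p - 1) \<in> set bs') \<and>
    (\<forall>g\<in>carrier R. \<exists>b\<in>frob_span R p (set bs'). g \<ominus> b \<in> frob_span R 1 (insert (x [^] p) S))"
proof -
  have "\<exists>bs'. set bs' \<subseteq> carrier R \<and> length bs' = length bs * k \<and>
    (\<forall>j<k. \<forall>b\<in>set bs. b \<otimes> x [^] j \<in> set bs') \<and>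
    (\<forall>g\<in>carrier R. \<exists>b\<in>frob_span R p (set bs'). g \<ominus> b \<in> frob_span R 1 (insert (x [^] k) S))" for k :: nat
  proof (induction k)
    case 0
    have "g \<ominus> \<zero> \<in> frob_span R 1 (insert (x [^] (0::nat)) S)" if g: "g \<in> carrier R" for g
    proof -
      have "g [^] (1::nat) \<otimes> x [^] (0::nat) \<oplus> \<zero> \<in> frob_span R 1 (insert (x [^] (0::nat)) S)"
        using E1.frob_span_insertI[OF S _ g frob_span_zero] by simp
      then show ?thesis using g by (simp add: a_minus_def)
    qed
    then have "\<forall>g\<in>carrier R. \<exists>b\<in>frob_span R p (set []). g \<ominus> b \<in> frob_span R 1 (insert (x [^] (0::nat)) S)"
      using frob_span_zero by blast
    then show ?case by (intro exI[of _ "[]"]) auto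
  next
    case (Suc k)
    then obtain cs where cs: "set cs \<subseteq> carrier R" "length cs = length bs * k"
      "\<forall>j<k. \<forall>b\<in>set bs. b \<otimes> x [^] j \<in> set cs"
      "\<forall>g\<in>carrier R. \<exists>b\<in>frob_span R p (set cs). g \<ominus> b \<in> frob_span R 1 (insert (x [^] k) S)" by blast
    let ?ds = "cs @ map (\<lambda>b. b \<otimes> x [^] k) bs"
    have ds: "set ?ds \<subseteq> carrier R" using cs(1) bs x by auto
    have "\<exists>b\<in>frob_span R p (set ?ds). g \<ominus> b \<in> frob_span R 1 (insert (x [^] Suc k) S)" if g: "g \<in> carrier R" for g
    proof -
      obtain b where b: "b \<in> frob_span R p (set cs)" "g \<ominus> b \<in> frob_span R 1 (insert (x [^] k) S)" using cs(4) g by blast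
      obtain r w where rw: "r \<in> carrier R" "w \<in> frob_span R 1 S" "g \<ominus> b = r [^] (1::nat) \<otimes> x [^] k \<oplus> w"
        using E1.frob_span_insertD[OF S _ b(2)] x by auto
      obtain b' where b': "b' \<in> frob_span R p (set bs)" "r \<ominus> b' \<in> frob_span R 1 (insert x S)" using H rw(1) by blast
      obtain r' w' where rw': "r' \<in> carrier R" "w' \<in> frob_span R 1 S" "r \<ominus> b' = r' [^] (1::nat) \<otimes> x \<oplus> w'"
        using E1.frob_span_insertD[OF S x b'(2)] by auto
      have c: "b \<in> carrier R" "b' \<in> carrier R" "w \<in> carrier R" "w' \<in> carrier R" "x [^] k \<in> carrier R"
        using b b' rw rw' Ep.frob_span_closed[OF cs(1)] Ep.frob_span_closed[OF bs] E1.frob_span_closed[OF S] x by auto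
      have "b' \<otimes> x [^] k \<in> frob_span R p ((\<lambda>b. b \<otimes> x [^] k) ` set bs)"
        using Ep.frob_span_scale[OF bs _ b'(1)] x by simp
      then have "b' \<otimes> x [^] k \<in> frob_span R p (set ?ds)" "b \<in> frob_span R p (set ?ds)"
        using Ep.frob_span_mono[OF ds, of "(\<lambda>b. b \<otimes> x [^] k) ` set bs"] Ep.frob_span_mono[OF ds, of "set cs"] b(1) by auto
      then have mem: "b \<oplus> b' \<otimes> x [^] k \<in> frob_span R p (set ?ds)" using Ep.frob_span_plus[OF ds] by blast
      have id1: "G \<ominus> (B \<oplus> B' \<otimes> y) = (G \<ominus> B) \<ominus> B' \<otimes> y"
        if "G \<in> carrier R" "B \<in> carrier R" "B' \<in> carrier R" "y \<in> carrier R" for G B B' y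
        using that by algebra
      have id2: "(r \<otimes> y \<oplus> w) \<ominus> B' \<otimes> y = (r \<ominus> B') \<otimes> y \<oplus> w"
        if "B' \<in> carrier R" "y \<in> carrier R" for B' y
        using that rw(1) c(3) by algebra
      have "g \<ominus> (b \<oplus> b' \<otimes> x [^] k) = (r \<ominus> b') \<otimes> x [^] k \<oplus> w"
        using id1[OF g c(1,2,5)] id2[OF c(2,5)] rw(1,3) by simp
      also have "\<dots> = r' [^] (1::nat) \<otimes> x [^] Suc k \<oplus> ((x [^] k) [^] (1::nat) \<otimes> w' \<oplus> w)"
        using rw'(1,3) c x by (simp add: l_distr r_distr m_ac a_assoc)
      also have "\<dots> \<in> frob_span R 1 (insert (x [^] Suc k) S)"
        using E1.frob_span_insertI[OF S _ rw'(1)] E1.frob_span_plus[OF S rw(2) E1.frob_span_smul[OF S rw'(2) c(5)]] x by simp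
      finally show ?thesis using mem by blast
    qed
    moreover have "\<forall>j<Suc k. \<forall>b\<in>set bs. b \<otimes> x [^] j \<in> set ?ds" using cs(3) by (auto simp: less_Suc_eq)
    moreover have "length ?ds = length bs * Suc k" using cs(2) by simp
    ultimately show ?case using ds by blast
  qed
  from this[of p] obtain bs' where "set bs' \<subseteq> carrier R" "length bs' = length bs * p"
    "\<forall>j<p. \<forall>b\<in>set bs. b \<otimes> x [^] j \<in> set bs'"
    "\<forall>g\<in>carrier R. \<exists>b\<in>frob_span R p (set bs'). g \<ominus> b \<in> frob_span R 1 (insert (x [^] p) S)" by blast
  then show ?thesis using Ep.e_pos by (intro exI[of _ bs']) auto
qed

lemma gen_all:
  assumes "S \<subseteq> carrier R" and "set xs \<subseteq> carrier R" and "set bs \<subseteq> carrier R"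
    and "\<forall>g\<in>carrier R. \<exists>b\<in>frob_span R p (set bs). g \<ominus> b \<in> frob_span R 1 (S \<union> set xs)"
  shows "\<exists>bs'. set bs' \<subseteq> carrier R \<and> length bs' = length bs * p ^ length xs \<and>
    (\<forall>b\<in>set bs. b \<otimes> foldr (\<lambda>x s. x [^] (p - 1) \<otimes> s) xs \<one> \<in> set bs') \<and>
    (\<forall>g\<in>carrier R. \<exists>b\<in>frob_span R p (set bs'). g \<ominus> b \<in> frob_span R 1 (S \<union> (\<lambda>x. x [^] p) ` set xs))"
  using assms
proof (induction xs arbitrary: S bs)
  case Nil then show ?case by (intro exI[of _ bs]) auto
next
  case (Cons y ys)
  have y: "y \<in> carrier R" "S \<union> set ys \<subseteq> carrier R" "set ys \<subseteq> carrier R" using Cons.prems by auto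
  obtain cs where cs: "set cs \<subseteq> carrier R" "length cs = length bs * p"
    "\<forall>b\<in>set bs. b \<otimes> y [^] (p - 1) \<in> set cs"
    "\<forall>g\<in>carrier R. \<exists>b\<in>frob_span R p (set cs). g \<ominus> b \<in> frob_span R 1 (insert (y [^] p) (S \<union> set ys))"
    using gen_step[OF y(2,1) Cons.prems(3)] Cons.prems(4) by auto
  have "insert (y [^] p) S \<subseteq> carrier R" using y Cons.prems by auto
  then obtain bs' where bs': "set bs' \<subseteq> carrier R" "length bs' = length cs * p ^ length ys"
    "\<forall>b\<in>set cs. b \<otimes> foldr (\<lambda>x s. x [^] (p - 1) \<otimes> s) ys \<one> \<in> set bs'"
    "\<forall>g\<in>carrier R. \<exists>b\<in>frob_span R p (set bs'). g \<ominus> b \<in> frob_span R 1 (insert (y [^] p) S \<union> (\<lambda>x. x [^] p) ` set ys)"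
    using Cons.IH[of "insert (y [^] p) S" cs] y(3) cs(1,4) by auto
  have fc: "foldr (\<lambda>x s. x [^] (p - 1) \<otimes> s) ys \<one> \<in> carrier R" using y(3) by (induction ys) auto
  have "b \<otimes> foldr (\<lambda>x s. x [^] (p - 1) \<otimes> s) (y # ys) \<one> \<in> set bs'" if b: "b \<in> set bs" for b
  proof -
    have "(b \<otimes> y [^] (p - 1)) \<otimes> foldr (\<lambda>x s. x [^] (p - 1) \<otimes> s) ys \<one> \<in> set bs'"
      using bs'(3) cs(3) b by blast
    moreover have "b \<in> carrier R" using b Cons.prems by auto
    ultimately show ?thesis using fc y by (simp add: m_assoc)
  qed
  then show ?case using bs' cs(2) by (intro exI[of _ bs']) auto
qed

text \<open>Write g = a + x^k g' with \<open>k\<close> as large as possible up to p. If k < p, then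
  \<open>g'\<close> is outside the modulus generated by \<open>x\<close> and \<open>S\<close>, some
  multiple r g' is congruent to \<open>\<kappa>\<close>, and multiplying by r x^(p - 1 - k) carries
  \<open>g\<close> to \<kappa> x^(p - 1). If k = p, then \<open>g\<close> is in the new
  modulus.\<close>

lemma socle_step:
  assumes S: "S \<subseteq> carrier R" and x: "x \<in> carrier R" and s: "\<kappa> \<in> carrier R"
    and H: "\<forall>g\<in>carrier R. g \<in> frob_span R 1 (insert x S) \<or> (\<exists>r\<in>carrier R. r \<otimes> g \<ominus> \<kappa> \<in> frob_span R 1 (insert x S))"
    and g: "g \<in> carrier R"
  shows "g \<in> frob_span R 1 (insert (x [^] p) S) \<or>
    (\<exists>r\<in>carrier R. r \<otimes> g \<ominus> \<kappa> \<otimes> x [^] (p - 1) \<in> frob_span R 1 (insert (x [^] p) S))"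
proof (rule disjCI)
  assume n: "\<not> (\<exists>r\<in>carrier R. r \<otimes> g \<ominus> \<kappa> \<otimes> x [^] (p - 1) \<in> frob_span R 1 (insert (x [^] p) S))"
  have "k \<le> p \<Longrightarrow> \<exists>a\<in>frob_span R 1 S. \<exists>g'\<in>carrier R. g = a \<oplus> x [^] k \<otimes> g'" for k
  proof (induction k)
    case 0 then show ?case using g frob_span_zero by (intro bexI[of _ \<zero>] bexI[of _ g]) auto
  next
    case (Suc k)
    then obtain a g' where ag: "a \<in> frob_span R 1 S" "g' \<in> carrier R" "g = a \<oplus> x [^] k \<otimes> g'" by auto
    have ac: "a \<in> carrier R" using ag E1.frob_span_closed[OF S] by blast
    consider "g' \<in> frob_span R 1 (insert x S)" | r where "r \<in> carrier R" "r \<otimes> g' \<ominus> \<kappa> \<in> frob_span R 1 (insert x S)"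
      using H ag(2) by blast
    then show ?case
    proof cases
      case 1
      obtain c w where cw: "c \<in> carrier R" "w \<in> frob_span R 1 S" "g' = c [^] (1::nat) \<otimes> x \<oplus> w"
        using E1.frob_span_insertD[OF S x 1] by auto
      have wc: "w \<in> carrier R" using cw E1.frob_span_closed[OF S] by blast
      have "g = ((x [^] k) [^] (1::nat) \<otimes> w \<oplus> a) \<oplus> x [^] Suc k \<otimes> c"
        using ag cw wc ac x by (simp add: r_distr m_ac a_ac)
      moreover have "(x [^] k) [^] (1::nat) \<otimes> w \<oplus> a \<in> frob_span R 1 S"
        using E1.frob_span_plus[OF S ag(1) E1.frob_span_smul[OF S cw(2)]] x by blast
      ultimately show ?thesis using cw(1) by blast
    next
      case (2 r)
      obtain c w where cw: "c \<in> carrier R" "w \<in> frob_span R 1 S" "r \<otimes> g' \<ominus> \<kappa> = c [^] (1::nat) \<otimes> x \<oplus> w"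
        using E1.frob_span_insertD[OF S x 2(2)] by auto
      have wc: "w \<in> carrier R" using cw E1.frob_span_closed[OF S] by blast
      let ?y = "x [^] (p - 1 - k)" and ?z = "x [^] k"
      have yz: "?y \<in> carrier R" "?z \<in> carrier R" using x by auto
      have yz1: "x [^] (p - 1) = ?y \<otimes> ?z" using Suc.prems x by (simp add: nat_pow_mult)
      have yz2: "?y \<otimes> ?z \<otimes> x = x [^] p"
        using Suc.prems x yz1[symmetric] nat_pow_Suc[of x "p - 1"] by simp
      have id: "(r \<otimes> y) \<otimes> (a \<oplus> z \<otimes> g') \<ominus> \<kappa> \<otimes> (y \<otimes> z) = r \<otimes> y \<otimes> a \<oplus> y \<otimes> z \<otimes> (r \<otimes> g' \<ominus> \<kappa>)"
        if "y \<in> carrier R" "z \<in> carrier R" for y z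
        using that 2(1) ac ag(2) s by algebra
      have "(r \<otimes> ?y) \<otimes> g \<ominus> \<kappa> \<otimes> x [^] (p - 1) = r \<otimes> ?y \<otimes> a \<oplus> ?y \<otimes> ?z \<otimes> (r \<otimes> g' \<ominus> \<kappa>)"
        unfolding yz1 using id[OF yz] ag(3) by simp
      also have "\<dots> = c [^] (1::nat) \<otimes> (?y \<otimes> ?z \<otimes> x) \<oplus> ((?y \<otimes> ?z) [^] (1::nat) \<otimes> w \<oplus> (r \<otimes> ?y) [^] (1::nat) \<otimes> a)"
        unfolding cw(3) using 2(1) cw(1) wc ac yz x by (simp add: l_distr r_distr m_ac a_ac)
      also have "\<dots> \<in> frob_span R 1 (insert (x [^] p) S)"
        unfolding yz2 using 2(1) yz x
        by (intro E1.frob_span_insertI[OF S _ cw(1)] E1.frob_span_plus[OF S] E1.frob_span_smul[OF S] ag(1) cw(2)) auto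
      finally show ?thesis using n 2(1) yz by blast
    qed
  qed
  from this[OF order_refl] obtain a g' where ag: "a \<in> frob_span R 1 S" "g' \<in> carrier R" "g = a \<oplus> x [^] p \<otimes> g'" by blast
  have "g = g' [^] (1::nat) \<otimes> x [^] p \<oplus> a" using ag x E1.frob_span_closed[OF S] by (simp add: m_comm a_comm)
  then show "g \<in> frob_span R 1 (insert (x [^] p) S)" using E1.frob_span_insertI[OF S _ ag(2,1)] x by simp
qed

text \<open>Started at \<kappa> = 1 modulo a maximal ideal, this yields that every element that is
  nonzero modulo the p-th powers of \<open>xs\<close> divides the product of all x^(p - 1)
  there.\<close>

lemma socle_all:
  assumes "S \<subseteq> carrier R" "set xs \<subseteq> carrier R" "\<kappa> \<in> carrier R"
    and "\<forall>g\<in>carrier R. g \<in> frob_span R 1 (S \<union> set xs) \<or> (\<exists>r\<in>carrier R. r \<otimes> g \<ominus> \<kappa> \<in> frob_span R 1 (S \<union> set xs))"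
    and "g \<in> carrier R"
  shows "g \<in> frob_span R 1 (S \<union> (\<lambda>x. x [^] p) ` set xs) \<or>
    (\<exists>r\<in>carrier R. r \<otimes> g \<ominus> \<kappa> \<otimes> foldr (\<lambda>x s. x [^] (p - 1) \<otimes> s) xs \<one> \<in> frob_span R 1 (S \<union> (\<lambda>x. x [^] p) ` set xs))"
  using assms
proof (induction xs arbitrary: S \<kappa> g)
  case Nil then show ?case by simp
next
  case (Cons y ys)
  have y: "y \<in> carrier R" "S \<union> set ys \<subseteq> carrier R" "set ys \<subseteq> carrier R" using Cons.prems by auto
  have fc: "foldr (\<lambda>x s. x [^] (p - 1) \<otimes> s) ys \<one> \<in> carrier R" using y(3) by (induction ys) auto
  have H: "g \<in> frob_span R 1 (insert (y [^] p) (S \<union> set ys)) \<or>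
      (\<exists>r\<in>carrier R. r \<otimes> g \<ominus> \<kappa> \<otimes> y [^] (p - 1) \<in> frob_span R 1 (insert (y [^] p) (S \<union> set ys)))"
    if "g \<in> carrier R" for g
    using socle_step[OF y(2,1) Cons.prems(3) _ that] Cons.prems(4) by simp
  have "g \<in> frob_span R 1 (insert (y [^] p) S \<union> (\<lambda>x. x [^] p) ` set ys) \<or>
    (\<exists>r\<in>carrier R. r \<otimes> g \<ominus> \<kappa> \<otimes> y [^] (p - 1) \<otimes> foldr (\<lambda>x s. x [^] (p - 1) \<otimes> s) ys \<one>
       \<in> frob_span R 1 (insert (y [^] p) S \<union> (\<lambda>x. x [^] p) ` set ys))"
    by (rule Cons.IH) (use Cons.prems y H in auto)
  moreover have "\<kappa> \<otimes> y [^] (p - 1) \<otimes> foldr (\<lambda>x s. x [^] (p - 1) \<otimes> s) ys \<one> =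
      \<kappa> \<otimes> foldr (\<lambda>x s. x [^] (p - 1) \<otimes> s) (y # ys) \<one>"
    using fc y Cons.prems(3) by (simp add: m_assoc)
  ultimately show ?case by simp
qed

end

section \<open>Coordinates over a generating list\<close>

context frob_exponent begin

fun lincomb :: "'a list \<Rightarrow> 'a list \<Rightarrow> 'a" where
  "lincomb (c # cs) (b # bs) = c [^] e \<otimes> b \<oplus> lincomb cs bs"
| "lincomb _ _ = \<zero>"

lemma lincomb_frob_span: "set bs \<subseteq> carrier R \<Longrightarrow> set cs \<subseteq> carrier R \<Longrightarrow> lincomb cs bs \<in> frob_span R e (set bs)"
proof (induction cs bs rule: lincomb.induct)
  case (1 c cs b bs)
  then show ?case using frob_span_insertI[of "set bs" b c "lincomb cs bs"] by simp
qed (simp_all add: frob_span_zero)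

lemma lincomb_closed: "set bs \<subseteq> carrier R \<Longrightarrow> set cs \<subseteq> carrier R \<Longrightarrow> lincomb cs bs \<in> carrier R"
  using lincomb_frob_span frob_span_closed by blast

lemma ex_lincomb:
  assumes "set bs \<subseteq> carrier R" "v \<in> frob_span R e (set bs)"
  shows "\<exists>cs. length cs = length bs \<and> set cs \<subseteq> carrier R \<and> v = lincomb cs bs"
  using assms
proof (induction bs arbitrary: v)
  case Nil
  have "frob_span R e {} \<subseteq> {\<zero>}" by (rule frob_span_least) (auto simp: frob_submodule_def)
  then show ?case using Nil by auto
next
  case (Cons b bs)
  then obtain c w where cw: "c \<in> carrier R" "w \<in> frob_span R e (set bs)" "v = c [^] e \<otimes> b \<oplus> w"
    using frob_span_insertD[of "set bs" b v] by auto
  then obtain cs where "length cs = length bs" "set cs \<subseteq> carrier R" "w = lincomb cs bs"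
    using Cons by auto
  then show ?case using cw by (intro exI[of _ "c # cs"]) auto
qed

lemma lincomb_add:
  assumes "length cs = length bs" "length ds = length bs" "set bs \<subseteq> carrier R" "set cs \<subseteq> carrier R" "set ds \<subseteq> carrier R"
  shows "lincomb cs bs \<oplus> lincomb ds bs = lincomb (map2 (\<oplus>) cs ds) bs"
  using assms
proof (induction bs arbitrary: cs ds)
  case (Cons b bs)
  then obtain c cs' d ds' where cd: "cs = c # cs'" "ds = d # ds'" by (auto simp: length_Suc_conv)
  have l: "lincomb cs' bs \<in> carrier R" "lincomb ds' bs \<in> carrier R" using Cons.prems cd by (auto intro!: lincomb_closed)
  have "lincomb cs' bs \<oplus> lincomb ds' bs = lincomb (map2 (\<oplus>) cs' ds') bs" using Cons cd by auto
  then show ?case using Cons.prems l unfolding cd by (simp add: pow_add l_distr a_ac flip: Cons.IH)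
qed simp

lemma lincomb_smul:
  assumes "d \<in> carrier R" "set bs \<subseteq> carrier R" "set cs \<subseteq> carrier R"
  shows "d [^] e \<otimes> lincomb cs bs = lincomb (map ((\<otimes>) d) cs) bs"
  using assms
proof (induction cs bs rule: lincomb.induct)
  case (1 c cs b bs)
  then show ?case using lincomb_closed[of bs cs] by (simp add: r_distr pow_mult m_assoc)
qed auto

text \<open>The leading coefficient is in \<open>P\<close> by independence; its term then lies in
  \<open>P\<close> as well and is subtracted.\<close>

lemma lincomb_mem:
  assumes P: "primeideal P R" and "indep P bs" "length cs = length bs" "set bs \<subseteq> carrier R"
    "set cs \<subseteq> carrier R" "lincomb cs bs \<in> P"
  shows "set cs \<subseteq> P"
  using assms(2-)
proof (induction bs arbitrary: cs)
  case (Cons b bs)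
  interpret P: primeideal P R by fact
  note sP = ideal_frob_submodule[OF P.is_ideal]
  obtain c ds where cd: "cs = c # ds" using Cons.prems by (auto simp: length_Suc_conv)
  have l: "lincomb ds bs \<in> frob_span R e (set bs)" "lincomb ds bs \<in> carrier R"
    using Cons.prems cd by (auto intro!: lincomb_closed lincomb_frob_span)
  have cb: "c [^] e \<otimes> b \<in> carrier R" using Cons.prems cd by auto
  have Pb: "P \<union> set bs \<subseteq> carrier R" using P.Icarr Cons.prems by auto
  note sM = frob_span_frob_submodule[OF Pb]
  have "lincomb ds bs \<in> frob_span R e (P \<union> set bs)" using l(1) frob_span_mono[OF Pb, of "set bs"] by auto
  moreover have "lincomb ds bs \<oplus> c [^] e \<otimes> b \<in> frob_span R e (P \<union> set bs)"
    using Cons.prems(5) cd l cb frob_span_base[OF Pb, of "lincomb cs (b # bs)"] by (simp add: a_comm)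
  ultimately have "c [^] e \<otimes> b \<in> frob_span R e (P \<union> set bs)" using frob_submodule_cancel[OF sM _ cb] by blast
  then have c: "c \<in> P" using Cons.prems(1,4) cd by auto
  have cc: "c \<in> carrier R" "b \<in> carrier R" using Cons.prems(3,4) cd by auto
  have "c [^] Suc (e - 1) \<in> P" using P.I_l_closed[OF c] cc by simp
  then have "c [^] e \<otimes> b \<in> P" using e_pos P.I_r_closed cc by simp
  then have "lincomb ds bs \<in> P" using frob_submodule_cancel[OF sP _ l(2)] Cons.prems(5) cd by simp
  then have "set ds \<subseteq> P" using Cons.prems cd by (intro Cons.IH) auto
  then show ?case using cd c by simp
qed simp

lemma lincomb_finsum:
  assumes "length cs = length bs" "set bs \<subseteq> carrier R" "set cs \<subseteq> carrier R"
  shows "lincomb cs bs = (\<Oplus>i\<in>{..<length bs}. (cs ! i) [^] e \<otimes> bs ! i)"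
  using assms
proof (induction bs arbitrary: cs)
  case (Cons b bs)
  obtain c ds where cd: "cs = c # ds" using Cons.prems by (auto simp: length_Suc_conv)
  let ?f = "\<lambda>i. (cs ! i) [^] e \<otimes> (b # bs) ! i"
  have nth: "i < Suc (length bs) \<Longrightarrow> ?f i \<in> carrier R" for i
  proof -
    assume i: "i < Suc (length bs)"
    then have "cs ! i \<in> set cs" "(b # bs) ! i \<in> set (b # bs)"
      using Cons.prems(1) by (auto intro!: nth_mem simp del: set_simps)
    then show "?f i \<in> carrier R" using Cons.prems by blast
  qed
  have "finsum R ?f {..<length (b # bs)} = finsum R ?f (insert 0 (Suc ` {..<length bs}))"
    by (simp add: lessThan_Suc_eq_insert_0)
  also have "\<dots> = ?f 0 \<oplus> finsum R ?f (Suc ` {..<length bs})"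
    using nth[of 0] nth by (intro finsum_insert) auto
  also have "finsum R ?f (Suc ` {..<length bs}) = finsum R (\<lambda>i. ?f (Suc i)) {..<length bs}"
    using nth by (intro finsum_reindex) auto
  also have "\<dots> = lincomb ds bs" using Cons cd by auto
  finally show ?case using cd by simp
qed simp

end

text \<open>Regularity enters as a chain of primes exactly as long as the list generating
  \<open>m\<close>; that its top lies in \<open>m\<close> follows from \<open>units\<close>. With
  empty \<open>xs\<close> the locale also covers fields.\<close>

locale local_frob = F_finite_ring R p for R (structure) and p :: nat +
  fixes m :: "'a set" and xs :: "'a list" and c :: "nat \<Rightarrow> 'a set"
  assumes m: "primeideal m R"
    and units: "x \<in> carrier R - m \<Longrightarrow> \<exists>y\<in>carrier R. y \<otimes> x = \<one>"
    and xs: "set xs \<subseteq> carrier R" "m = frob_span R 1 (set xs)"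
    and chain: "prime_chain R c (length xs)"
begin

sublocale M: primeideal m R by (rule m)

text \<open>This is \<open>m^[p]\<close>. The p-th powers of the chosen generators suffice by
  additivity, and this form matches \<open>gen_all\<close> and \<open>socle_all\<close>.\<close>

definition max_frob :: "'a set" where
  "max_frob = frob_span R 1 ((\<lambda>x. x [^] p) ` set xs)"

lemma xsp: "(\<lambda>x. x [^] p) ` set xs \<subseteq> carrier R"
  using xs by auto

lemma max_frob_ideal: "ideal max_frob R"
  unfolding max_frob_def using E1.frob_span_frob_submodule[OF xsp] frob_submodule_1_iff by blast

lemma max_frob_pow:
  assumes "\<mu> \<in> m"
  shows "\<mu> [^] p \<in> max_frob"
proof -
  have "\<mu> \<in> frob_span R 1 (set xs)" using assms xs by simp
  then show ?thesis
  proof induction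
    case zero then show ?case using Ep.pow_zero additive_subgroup.zero_closed[OF ideal.axioms(1)[OF max_frob_ideal]] by simp
  next
    case (step v c x)
    have vx: "v \<in> carrier R" "x \<in> carrier R" using step.hyps xs E1.frob_span_closed[OF xs(1)] by auto
    have "x [^] p \<in> max_frob" unfolding max_frob_def using E1.frob_span_base[OF xsp] step.hyps by blast
    then have "c [^] p \<otimes> x [^] p \<in> max_frob" using ideal.I_l_closed[OF max_frob_ideal] step.hyps by simp
    moreover have "(v \<oplus> c [^] (1::nat) \<otimes> x) [^] p = v [^] p \<oplus> c [^] p \<otimes> x [^] p"
      using vx step.hyps by (simp add: Ep.pow_add Ep.pow_mult)
    ultimately show ?case using step.IH additive_subgroup.a_closed[OF ideal.axioms(1)[OF max_frob_ideal]] by simp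
  qed
qed

lemma unit_minus:
  assumes "\<mu> \<in> m"
  shows "\<exists>\<nu>\<in>carrier R. \<nu> \<otimes> (\<one> \<ominus> \<mu>) = \<one>"
proof (rule units)
  have mc: "\<mu> \<in> carrier R" using assms M.Icarr by blast
  have "\<one> \<ominus> \<mu> \<notin> m"
  proof
    assume "\<one> \<ominus> \<mu> \<in> m"
    then have "(\<one> \<ominus> \<mu>) \<oplus> \<mu> \<in> m" using assms additive_subgroup.a_closed[OF M.is_additive_subgroup] by blast
    moreover have "(\<one> \<ominus> \<mu>) \<oplus> \<mu> = \<one>" using mc by algebra
    ultimately show False using Ep.one_notin_prime[OF m] by simp
  qed
  then show "\<one> \<ominus> \<mu> \<in> carrier R - m" using mc by simp
qed

text \<open>As a submodule of \<open>F\<^sub>*R\<close>, \<open>m^[p]\<close> is \<open>m\<close>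
  times \<open>F\<^sub>*R\<close>: the product of \<open>r\<close> with \<mu>^p is \<mu> acting on
  \<open>r\<close>. So Nakayama's lemma applies modulo \<open>m^[p]\<close>.\<close>

lemma nakayama_R:
  assumes W: "frob_submodule R p W" and H: "carrier R \<subseteq> frob_span R p (W \<union> max_frob)"
  shows "W = carrier R"
proof -
  obtain gs where gs: "set gs \<subseteq> carrier R" "frob_span R p (set gs) = carrier R" using ex_gens by blast
  let ?G = "W \<union> {\<mu> [^] p \<otimes> x | \<mu> x. \<mu> \<in> m \<and> x \<in> set gs}"
  have Gc: "?G \<subseteq> carrier R" using Ep.frob_submoduleD(1)[OF W] M.Icarr gs(1) by auto
  have 1: "r \<otimes> \<mu> [^] p \<in> frob_span R p ?G" if r: "r \<in> carrier R" and mu: "\<mu> \<in> m" for r \<mu>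
  proof -
    have "r \<in> frob_span R p (set gs)" using r gs by simp
    then show ?thesis
    proof induction
      case zero then show ?case using frob_span_zero M.Icarr[OF mu] by simp
    next
      case (step v c g)
      have c: "v \<in> carrier R" "g \<in> carrier R" "\<mu> \<in> carrier R" using step.hyps gs Ep.frob_span_closed[OF gs(1)] M.Icarr mu by auto
      have "(v \<oplus> c [^] p \<otimes> g) \<otimes> \<mu> [^] p = v \<otimes> \<mu> [^] p \<oplus> c [^] p \<otimes> (\<mu> [^] p \<otimes> g)"
        using c step.hyps by (simp add: l_distr r_distr m_ac)
      then show ?case using frob_span_step[OF step.IH step.hyps(2), of "\<mu> [^] p \<otimes> g"] mu step.hyps(3) by auto
    qed
  qed
  have "max_frob \<subseteq> frob_span R p ?G"
  proof
    fix v assume "v \<in> max_frob"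
    then show "v \<in> frob_span R p ?G" unfolding max_frob_def
    proof induction
      case zero then show ?case using frob_span_zero by blast
    next
      case (step v c y)
      then obtain x where x: "x \<in> set xs" "y = x [^] p" by blast
      have "x \<in> m" using x xs E1.frob_span_base[OF xs(1)] by simp
      then have "c \<otimes> x [^] p \<in> frob_span R p ?G" using 1 step.hyps by blast
      then show ?case using Ep.frob_span_plus[OF Gc _ step.IH] x step.hyps by simp
    qed
  qed
  then have "frob_span R p (W \<union> max_frob) \<subseteq> frob_span R p ?G"
    using Ep.frob_span_subset[OF Gc] by (intro Ep.frob_span_least Ep.frob_span_frob_submodule Gc) auto
  then have "set gs \<subseteq> W"
    using H gs(1) by (intro Ep.nakayama[OF M.is_ideal unit_minus W gs(1)]) auto
  then show ?thesis using Ep.frob_span_least[OF W] gs(2) Ep.frob_submoduleD(1)[OF W] by blast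
qed

text \<open>The generator of the socle of \<open>R/m^[p]\<close>; that it is nonzero there is proved
  only once a basis of \<open>F\<^sub>*R\<close> is available.\<close>

definition socle_gen :: 'a where
  "socle_gen = foldr (\<lambda>x s. x [^] (p - 1) \<otimes> s) xs \<one>"

lemma socle_gen_closed: "socle_gen \<in> carrier R"
proof -
  have "set ys \<subseteq> carrier R \<Longrightarrow> foldr (\<lambda>x s. x [^] (p - 1) \<otimes> s) ys \<one> \<in> carrier R" for ys
    by (induction ys) auto
  then show ?thesis using xs unfolding socle_gen_def by blast
qed

lemma socle:
  assumes "g \<in> carrier R" "g \<notin> max_frob"
  shows "\<exists>r\<in>carrier R. r \<otimes> g \<ominus> socle_gen \<in> max_frob"
proof -
  have "\<forall>g\<in>carrier R. g \<in> frob_span R 1 ({} \<union> set xs) \<or> (\<exists>r\<in>carrier R. r \<otimes> g \<ominus> \<one> \<in> frob_span R 1 ({} \<union> set xs))"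
  proof
    fix g assume g: "g \<in> carrier R"
    show "g \<in> frob_span R 1 ({} \<union> set xs) \<or> (\<exists>r\<in>carrier R. r \<otimes> g \<ominus> \<one> \<in> frob_span R 1 ({} \<union> set xs))"
    proof (cases "g \<in> m")
      case False
      then obtain r where "r \<in> carrier R" "r \<otimes> g = \<one>" using units g by blast
      then show ?thesis using frob_span_zero by (intro disjI2 bexI[of _ r]) (auto simp: a_minus_def r_neg)
    qed (use xs in simp)
  qed
  then show ?thesis
    using socle_all[of "{}" xs \<one> g] xs(1) assms socle_gen_closed unfolding max_frob_def socle_gen_def by auto
qed

lemma chain_top: "c (length xs) \<subseteq> m"
proof
  fix x assume x: "x \<in> c (length xs)"
  have pr: "primeideal (c (length xs)) R" using chain by (auto simp: prime_chain_def)
  have i: "ideal (c (length xs)) R" using pr primeideal.axioms(1) by blast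
  show "x \<in> m"
  proof (rule ccontr)
    assume "x \<notin> m"
    then obtain y where "y \<in> carrier R" "y \<otimes> x = \<one>" using units x ideal.Icarr[OF i] by blast
    then show False using ideal.I_l_closed[OF i x] Ep.one_notin_prime[OF pr] by force
  qed
qed

text \<open>The generators \<open>u\<^sub>i x\<^sup>a\<close> of \<open>F\<^sub>*R\<close> are independent modulo the bottom \<open>P\<close> of the chain, because
  there are only as many of them as the rank of \<open>F\<^sub>*(R/P)\<close>.  Hence every coordinate of an element of
  \<open>P\<close> lies in \<open>P\<close>, so \<open>P\<close> is generated by \<open>p\<close>-th powers and \<open>P = mP\<close>, that is \<open>P = 0\<close>.\<close>

lemma ex_basis:
  "primeideal {\<zero>} R \<and> (\<exists>bs. set bs \<subseteq> carrier R \<and> frob_span R p (set bs) = carrier R \<and> Ep.indep {\<zero>} bs \<and>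
     (\<exists>u\<in>carrier R. u \<otimes> socle_gen \<in> set bs))"
proof -
  obtain us where us: "set us \<subseteq> carrier R" "strict_chain R m p m (frob_span R p (m \<union> set us)) (length us)"
    "\<forall>g\<in>carrier R. \<exists>s\<in>carrier R - m. s [^] p \<otimes> g \<in> frob_span R p (m \<union> set us)"
    using ex_dense_list[OF m] by blast
  note sm = Ep.ideal_frob_submodule[OF M.is_ideal]
  have mu: "m \<union> set us \<subseteq> carrier R" using us M.Icarr by auto
  note sM = Ep.frob_span_frob_submodule[OF mu]
  have rk: "strict_chain R m p m (carrier R) (length us)"
    using Ep.strict_chain_mono[OF us(2) sm order_refl Ep.frob_submodule_carrier Ep.frob_submoduleD(1)[OF sM]] .
  have gen: "g \<in> frob_span R p (m \<union> set us)" if g: "g \<in> carrier R" for g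
  proof -
    obtain s where s: "s \<in> carrier R - m" "s [^] p \<otimes> g \<in> frob_span R p (m \<union> set us)" using us(3) g by blast
    obtain t where t: "t \<in> carrier R" "t \<otimes> s = \<one>" using units s by blast
    have "t [^] p \<otimes> (s [^] p \<otimes> g) = (t \<otimes> s) [^] p \<otimes> g" using s t(1) g by (simp add: Ep.pow_mult m_assoc)
    then show ?thesis using Ep.frob_submoduleD(5)[OF sM t(1) s(2)] t(2) g by simp
  qed
  \<comment> \<open>Some \<open>u\<close> is required so that a multiple of \<open>socle_gen\<close>
    is one of the basis elements; this is what later keeps \<open>socle_gen\<close> out of
    \<open>m^[p]\<close>.\<close>
  have "us \<noteq> []"
  proof
    assume "us = []"
    then have "\<one> \<in> m" using gen[OF one_closed] Ep.frob_span_id[OF sm] by simp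
    then show False using Ep.one_notin_prime[OF m] by blast
  qed
  then obtain u where u: "u \<in> set us" by (cases us) auto
  have "\<exists>b\<in>frob_span R p (set us). g \<ominus> b \<in> frob_span R 1 ({} \<union> set xs)" if g: "g \<in> carrier R" for g
  proof -
    obtain a b where ab: "a \<in> m" "b \<in> frob_span R p (set us)" "g = a \<oplus> b"
      using Ep.frob_span_UnD[OF sm us(1) gen[OF g]] by blast
    have abc: "a \<in> carrier R" "b \<in> carrier R" using ab M.Icarr Ep.frob_span_closed[OF us(1)] by auto
    have "g \<ominus> b = a" unfolding ab(3) using abc by algebra
    then show ?thesis using ab xs by auto
  qed
  then obtain bs where bs: "set bs \<subseteq> carrier R" "length bs = length us * p ^ length xs"
    "\<forall>b\<in>set us. b \<otimes> socle_gen \<in> set bs"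
    "\<forall>g\<in>carrier R. \<exists>b\<in>frob_span R p (set bs). g \<ominus> b \<in> max_frob"
    using gen_all[of "{}" xs us] xs(1) us(1) unfolding max_frob_def socle_gen_def by auto
  note sW = Ep.frob_span_frob_submodule[OF bs(1)]
  have Wm: "frob_span R p (set bs) \<union> max_frob \<subseteq> carrier R" using Ep.frob_submoduleD(1)[OF sW] ideal.Icarr[OF max_frob_ideal] by blast
  have "carrier R \<subseteq> frob_span R p (frob_span R p (set bs) \<union> max_frob)"
  proof
    fix g assume g: "g \<in> carrier R"
    obtain b where b: "b \<in> frob_span R p (set bs)" "g \<ominus> b \<in> max_frob" using bs(4) g by blast
    have bc: "b \<in> carrier R" using b Ep.frob_span_closed[OF bs(1)] by blast
    have "b \<oplus> (g \<ominus> b) \<in> frob_span R p (frob_span R p (set bs) \<union> max_frob)"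
      using b Ep.frob_span_base[OF Wm] by (intro Ep.frob_span_plus[OF Wm]) auto
    moreover have "b \<oplus> (g \<ominus> b) = g" using g bc by algebra
    ultimately show "g \<in> frob_span R p (frob_span R p (set bs) \<union> max_frob)" by simp
  qed
  then have W: "frob_span R p (set bs) = carrier R" using nakayama_R[OF sW] by blast
  define P where "P = c 0"
  have P: "primeideal P R" using chain by (auto simp: prime_chain_def P_def)
  interpret P: primeideal P R by (rule P)
  \<comment> \<open>With a factor \<open>p\<close> for each inclusion of the chain, the rank at the
    bottom is at least the number of generators, \<open>length bs\<close>.\<close>
  have "strict_chain R P p P (carrier R) (p ^ length xs * length us)"
    unfolding P_def using rank_chain[OF chain chain_top m rk] .
  then have h: "strict_chain R P p P (carrier R) (length bs)" using bs(2) by (simp add: mult.commute)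
  have Pb: "P \<union> set bs \<subseteq> carrier R" using bs P.Icarr by auto
  have "frob_span R p (P \<union> set bs) = carrier R"
    using Ep.frob_span_mono[OF Pb, of "set bs"] Ep.frob_span_closed[OF Pb] W by blast
  then have ind: "Ep.indep P bs" using Ep.indep_of_length[OF P bs(1)] h by simp
  have "P = c 0" by (rule P_def)
  have Pm: "P \<subseteq> m"
  proof -
    have "c 0 \<subseteq> c i" if "i \<le> length xs" for i
      using that
    proof (induction i)
      case (Suc i)
      then have "c i \<subset> c (Suc i)" using chain by (auto simp: prime_chain_def)
      then show ?case using Suc by auto
    qed simp
    then show ?thesis using chain_top unfolding P_def by blast
  qed
  obtain hs where hs: "set hs \<subseteq> carrier R" "P = frob_span R 1 (set hs)"
    using finetely_gen[OF P.is_ideal] frob_span_1_eq_genideal finite_list by metis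
  let ?G = "{\<zero>} \<union> {\<mu> [^] (1::nat) \<otimes> x | \<mu> x. \<mu> \<in> m \<and> x \<in> set hs}"
  have Gc: "?G \<subseteq> carrier R" using M.Icarr hs(1) by auto
  note sG = E1.frob_span_frob_submodule[OF Gc]
  have mP: "\<mu> \<otimes> v \<in> frob_span R 1 ?G" if "\<mu> \<in> m" "v \<in> P" for \<mu> v
  proof -
    have "v \<in> frob_span R 1 (set hs)" using that hs by simp
    then show ?thesis
    proof induction
      case zero then show ?case using frob_span_zero M.Icarr[OF that(1)] by simp
    next
      case (step v c x)
      have cc: "v \<in> carrier R" "x \<in> carrier R" "\<mu> \<in> carrier R"
        using step.hyps hs E1.frob_span_closed[OF hs(1)] M.Icarr that by auto
      have "\<mu> \<otimes> (v \<oplus> c [^] (1::nat) \<otimes> x) = \<mu> \<otimes> v \<oplus> c [^] (1::nat) \<otimes> (\<mu> [^] (1::nat) \<otimes> x)"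
        using cc step.hyps by (simp add: r_distr m_ac)
      moreover have "\<mu> [^] (1::nat) \<otimes> x \<in> ?G" using that(1) step.hyps(3) by blast
      ultimately show ?case using frob_span_step[OF step.IH step.hyps(2)] by (simp only:)
    qed
  qed
  have lcG: "Ep.lincomb cs ds \<in> frob_span R 1 ?G" if "set cs \<subseteq> P" "set ds \<subseteq> carrier R" for cs ds
    using that
  proof (induction cs ds rule: Ep.lincomb.induct)
    case (1 c cs d ds)
    have c: "c \<in> P" "c \<in> carrier R" "d \<in> carrier R" using 1 P.Icarr by auto
    \<comment> \<open>Here p \<ge> 2 matters: one factor \<open>c\<close> serves as an element of
      \<open>m\<close>, and another keeps the rest in \<open>P\<close>.\<close>
    obtain q where q: "p = Suc (Suc q)"
      using prime_ge_2_nat[OF p_prime] by (metis add_2_eq_Suc le_Suc_ex)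
    have "c [^] p \<otimes> d = c \<otimes> ((c [^] q \<otimes> d) \<otimes> c)" unfolding q using c by (simp add: m_ac)
    moreover have "(c [^] q \<otimes> d) \<otimes> c \<in> P" using P.I_l_closed[OF c(1)] c by simp
    ultimately have "c [^] p \<otimes> d \<in> frob_span R 1 ?G" using mP c(1) Pm by auto
    then show ?case using 1 E1.frob_submoduleD(4)[OF sG] by simp
  qed (simp_all add: frob_span_zero)
  have "set hs \<subseteq> {\<zero>}"
  proof (rule E1.nakayama[OF M.is_ideal unit_minus _ hs(1)])
    show "frob_submodule R 1 {\<zero>}" by (auto simp: frob_submodule_def)
    show "h \<in> frob_span R 1 ?G" if h: "h \<in> set hs" for h
    proof -
      have hP: "h \<in> P" using h hs E1.frob_span_base[OF hs(1)] by simp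
      then have "h \<in> frob_span R p (set bs)" using W P.Icarr by simp
      then obtain cs where cs: "length cs = length bs" "set cs \<subseteq> carrier R" "h = Ep.lincomb cs bs"
        using Ep.ex_lincomb[OF bs(1)] by blast
      have "set cs \<subseteq> P" using Ep.lincomb_mem[OF P ind cs(1) bs(1) cs(2)] cs(3) hP by simp
      then show ?thesis using lcG bs(1) cs(3) by simp
    qed
  qed
  then have "P \<subseteq> {\<zero>}" unfolding hs(2) by (intro E1.frob_span_least) (auto simp: frob_submodule_def)
  then have "P = {\<zero>}" using additive_subgroup.zero_closed[OF P.is_additive_subgroup] by blast
  then show ?thesis using P ind bs(1,3) W u us(1) by blast
qed

end

section \<open>The dual basis over a regular local ring\<close>

lemma (in F_finite_ring) frob_linear_mult:
  assumes "frob_linear R p \<Phi>" and f: "f \<in> carrier R"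
  shows "frob_linear R p (\<lambda>g. \<Phi> (f \<otimes> g))"
proof -
  note L = frob_linearD[OF assms(1)]
  have "f \<otimes> (c [^] p \<otimes> x) = c [^] p \<otimes> (f \<otimes> x)" if "c \<in> carrier R" "x \<in> carrier R" for c x
    using that f by (simp add: m_lcomm)
  then show ?thesis using L f by (simp add: frob_linear_def r_distr)
qed

lemma (in F_finite_ring) frob_linear_agree:
  assumes "frob_linear R p \<phi>" "frob_linear R p \<psi>" and bs: "set bs \<subseteq> carrier R" "frob_span R p (set bs) = carrier R"
    and eq: "\<And>b. b \<in> set bs \<Longrightarrow> \<phi> b = \<psi> b" and g: "g \<in> carrier R"
  shows "\<phi> g = \<psi> g"
proof -
  have "g \<in> frob_span R p (set bs)" using g bs by simp
  then show ?thesis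
  proof induction
    case zero show ?case by (simp add: frob_linear_zero[OF assms(1)] frob_linear_zero[OF assms(2)])
  next
    case (step v c b)
    then have "v \<in> carrier R" "b \<in> carrier R" using bs Ep.frob_span_closed by auto
    then show ?case using step eq frob_linearD[OF assms(1)] frob_linearD[OF assms(2)] by simp
  qed
qed

locale local_dual = local_frob R p m xs c for R (structure) and p m xs c +
  fixes bs :: "'a list" and u :: 'a
  assumes zero_prime: "primeideal {\<zero>} R" and bs: "set bs \<subseteq> carrier R" "frob_span R p (set bs) = carrier R"
    "Ep.indep {\<zero>} bs" and socle_gen_bs: "u \<in> carrier R" "u \<otimes> socle_gen \<in> set bs"
begin

definition coords :: "'a \<Rightarrow> 'a list" where
  "coords g = (SOME cs. length cs = length bs \<and> set cs \<subseteq> carrier R \<and> g = Ep.lincomb cs bs)"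

lemma coords:
  assumes "g \<in> carrier R"
  shows "length (coords g) = length bs" "set (coords g) \<subseteq> carrier R" "Ep.lincomb (coords g) bs = g"
  using someI_ex[OF Ep.ex_lincomb[OF bs(1), of g]] assms bs(2) unfolding coords_def by auto

lemma map2_carrier:
  assumes "set cs \<subseteq> carrier R" "set ds \<subseteq> carrier R"
  shows "set (map2 (\<oplus>) cs ds) \<subseteq> carrier R"
proof -
  have "x \<oplus> y \<in> carrier R" if "(x, y) \<in> set (zip cs ds)" for x y
    using set_zip_leftD[OF that] set_zip_rightD[OF that] assms by auto
  then show ?thesis by auto
qed

lemma coords_unique:
  assumes cs: "length cs = length bs" "set cs \<subseteq> carrier R" and g: "g = Ep.lincomb cs bs"
  shows "coords g = cs"
proof -
  have gc: "g \<in> carrier R" using g Ep.lincomb_closed[OF bs(1) cs(2)] by simp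
  \<comment> \<open>Subtraction is written as the action of -1, whose p-th power is again -1 by
    additivity.\<close>
  let ?ds = "map ((\<otimes>) (\<ominus> \<one>)) (coords g)"
  have ds: "length ?ds = length bs" "set ?ds \<subseteq> carrier R" using coords[OF gc] by auto
  have "Ep.lincomb (map2 (\<oplus>) cs ?ds) bs = g \<oplus> (\<ominus> \<one>) [^] p \<otimes> g"
    using Ep.lincomb_add[OF cs(1) ds(1) bs(1) cs(2) ds(2)] Ep.lincomb_smul[OF _ bs(1) coords(2)[OF gc], of "\<ominus> \<one>"] coords(3)[OF gc] g by simp
  also have "\<dots> = \<zero>" using gc by (simp add: Ep.pow_inv l_minus r_neg)
  finally have z: "Ep.lincomb (map2 (\<oplus>) cs ?ds) bs \<in> {\<zero>}" by simp
  have nthc: "cs ! i \<in> carrier R" "coords g ! i \<in> carrier R" if "i < length bs" for i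
    using cs coords[OF gc] that nth_mem by (metis subsetD)+
  have "set (map2 (\<oplus>) cs ?ds) \<subseteq> carrier R"
    using map2_carrier[OF cs(2) ds(2)] .
  then have "set (map2 (\<oplus>) cs ?ds) \<subseteq> {\<zero>}"
    using Ep.lincomb_mem[OF zero_prime bs(3) _ bs(1) _ z] cs ds by simp
  then have "map2 (\<oplus>) cs ?ds ! i = \<zero>" if "i < length bs" for i
    using that cs ds nth_mem[of i "map2 (\<oplus>) cs ?ds"] by auto
  then have "cs ! i \<oplus> \<ominus> \<one> \<otimes> coords g ! i = \<zero>" if "i < length bs" for i
    using that cs ds coords[OF gc] by auto
  then have "cs ! i = coords g ! i" if "i < length bs" for i
    using nthc[OF that] that by (metis a_minus_def l_minus l_one one_closed r_right_minus_eq)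
  then show ?thesis using cs coords[OF gc] by (intro nth_equalityI) auto
qed

lemma coords_frob_linear:
  assumes "i < length bs"
  shows "frob_linear R p (\<lambda>g. coords g ! i)"
  unfolding frob_linear_def
proof (intro conjI ballI)
  have nthc: "coords g ! i \<in> carrier R" if "g \<in> carrier R" for g
    using coords[OF that] assms nth_mem by (metis subsetD)
  show "(\<lambda>g. coords g ! i) \<in> carrier R \<rightarrow> carrier R" using nthc by auto
  fix x y assume x: "x \<in> carrier R" and y: "y \<in> carrier R"
  have "coords (x \<oplus> y) = map2 (\<oplus>) (coords x) (coords y)"
    using coords[OF x] coords[OF y] Ep.lincomb_add[OF coords(1)[OF x] coords(1)[OF y] bs(1) coords(2)[OF x] coords(2)[OF y]]
    by (intro coords_unique map2_carrier) auto
  then show "coords (x \<oplus> y) ! i = coords x ! i \<oplus> coords y ! i" using assms coords[OF x] coords[OF y] by simp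
  have "coords (x [^] p \<otimes> y) = map ((\<otimes>) x) (coords y)"
    using coords[OF y] x Ep.lincomb_smul[OF x bs(1) coords(2)[OF y]] by (intro coords_unique) auto
  then show "coords (x [^] p \<otimes> y) ! i = x \<otimes> coords y ! i" using assms coords[OF y] by simp
qed

text \<open>The coordinates of c x^p are those of \<open>c\<close> multiplied by x \<in> m. With the
  converse \<open>max_frob_of_coords\<close> this describes \<open>m^[p]\<close> as the set of
  elements all of whose coordinates are in \<open>m\<close>.\<close>

lemma max_frob_coords:
  assumes "g \<in> max_frob" "i < length bs"
  shows "coords g ! i \<in> m"
proof -
  note L = frob_linearD[OF coords_frob_linear[OF assms(2)]]
  show ?thesis using assms(1) unfolding max_frob_def
  proof induction
    case zero then show ?case using frob_linear_zero[OF coords_frob_linear[OF assms(2)]] 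
        additive_subgroup.zero_closed[OF M.is_additive_subgroup] by simp
  next
    case (step v c y)
    obtain x where x: "x \<in> set xs" "y = x [^] p" using step.hyps by blast
    have xm: "x \<in> m" "x \<in> carrier R" using x xs E1.frob_span_base[OF xs(1)] by auto
    have vc: "v \<in> carrier R" using step.hyps E1.frob_span_closed[OF xsp] by blast
    have "coords (v \<oplus> c [^] (1::nat) \<otimes> y) ! i = coords v ! i \<oplus> x \<otimes> coords c ! i"
      using L(2)[OF vc, of "x [^] p \<otimes> c"] L(3)[OF xm(2), of c] xm x step.hyps by (simp add: m_comm)
    then show ?case using step.IH M.I_r_closed[OF xm(1) L(1)] step.hyps(2)
        additive_subgroup.a_closed[OF M.is_additive_subgroup] by simp
  qed
qed

lemma max_frob_of_coords:
  assumes g: "g \<in> carrier R" and "\<And>i. i < length bs \<Longrightarrow> coords g ! i \<in> m"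
  shows "g \<in> max_frob"
proof -
  have "set cs \<subseteq> m \<Longrightarrow> set ds \<subseteq> carrier R \<Longrightarrow> Ep.lincomb cs ds \<in> max_frob" for cs ds
  proof (induction cs ds rule: Ep.lincomb.induct)
    case (1 c cs d ds)
    then have "c [^] p \<otimes> d \<in> max_frob" using max_frob_pow ideal.I_r_closed[OF max_frob_ideal] by simp
    then show ?case using 1 additive_subgroup.a_closed[OF ideal.axioms(1)[OF max_frob_ideal]] by simp
  qed (simp_all add: additive_subgroup.zero_closed[OF ideal.axioms(1)[OF max_frob_ideal]])
  moreover have "set (coords g) \<subseteq> m" using assms(2) coords(1)[OF g] by (metis in_set_conv_nth subsetI)
  ultimately show ?thesis using bs(1) coords(3)[OF g] by metis
qed

text \<open>\<open>u \<otimes> socle_gen\<close> is a basis element, so one of its coordinates is 1;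
  membership in \<open>m^[p]\<close> would put 1 into \<open>m\<close>.\<close>

lemma socle_gen_notin_max_frob: "socle_gen \<notin> max_frob"
proof
  assume "socle_gen \<in> max_frob"
  then have us: "u \<otimes> socle_gen \<in> max_frob" using ideal.I_l_closed[OF max_frob_ideal] socle_gen_bs by blast
  obtain k where k: "k < length bs" "bs ! k = u \<otimes> socle_gen" using socle_gen_bs(2) by (metis in_set_conv_nth)
  have unit_lc: "set ds \<subseteq> carrier R \<Longrightarrow> k < length ds \<Longrightarrow>
      Ep.lincomb ((map (\<lambda>_. \<zero>) ds)[k := \<one>]) ds = ds ! k" for ds k
  proof (induction ds arbitrary: k)
    case (Cons d ds)
    have z: "set es \<subseteq> carrier R \<Longrightarrow> Ep.lincomb (map (\<lambda>_. \<zero>) es) es = \<zero>" for es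
      by (induction es) (auto simp: Ep.pow_zero)
    show ?case
    proof (cases k)
      case 0 then show ?thesis using Cons.prems z[of ds] by simp
    next
      case (Suc j)
      then have "ds ! j \<in> carrier R" using Cons.prems nth_mem by (metis Suc_less_eq length_Cons set_subset_Cons subsetD)
      then show ?thesis using Suc Cons by (simp add: Ep.pow_zero)
    qed
  qed simp
  have "set ((map (\<lambda>_. \<zero>) bs)[k := \<one>]) \<subseteq> carrier R"
    using set_update_subset_insert[of "map (\<lambda>_. \<zero>) bs" k \<one>] by auto
  then have "coords (u \<otimes> socle_gen) = (map (\<lambda>_. \<zero>) bs)[k := \<one>]"
    using unit_lc[OF bs(1) k(1)] k(2) by (intro coords_unique) auto
  then have "\<one> \<in> m" using max_frob_coords[OF us k(1)] k(1) by simp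
  then show False using Ep.one_notin_prime[OF m] by blast
qed

text \<open>A coordinate that does not send \<open>socle_gen\<close> into \<open>m\<close> will do:
  every \<open>g\<close> outside \<open>m^[p]\<close> has a multiple congruent to
  \<open>socle_gen\<close>, and coordinates send \<open>m^[p]\<close> into \<open>m\<close>.\<close>

lemma ex_trace:
  "\<exists>\<Phi>. frob_linear R p \<Phi> \<and> (\<forall>g\<in>carrier R. (\<forall>r\<in>carrier R. \<Phi> (r \<otimes> g) \<in> m) \<longrightarrow> g \<in> max_frob)"
proof -
  obtain k where k: "k < length bs" "coords socle_gen ! k \<notin> m"
    using max_frob_of_coords[OF socle_gen_closed] socle_gen_notin_max_frob by blast
  note L = frob_linearD[OF coords_frob_linear[OF k(1)]]
  have "g \<in> max_frob" if g: "g \<in> carrier R" and H: "\<forall>r\<in>carrier R. coords (r \<otimes> g) ! k \<in> m" for g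
  proof (rule ccontr)
    assume "g \<notin> max_frob"
    then obtain r where r: "r \<in> carrier R" "r \<otimes> g \<ominus> socle_gen \<in> max_frob" using socle g by blast
    have eq: "socle_gen \<oplus> (r \<otimes> g \<ominus> socle_gen) = r \<otimes> g" using r g socle_gen_closed by algebra
    have "coords (socle_gen \<oplus> (r \<otimes> g \<ominus> socle_gen)) ! k = coords socle_gen ! k \<oplus> coords (r \<otimes> g \<ominus> socle_gen) ! k"
      using L(2) socle_gen_closed r g by simp
    then have "coords (r \<otimes> g \<ominus> socle_gen) ! k \<oplus> coords socle_gen ! k \<in> m"
      using H r(1) eq L(1) socle_gen_closed r g by (metis a_comm m_closed minus_closed)
    then have "coords socle_gen ! k \<in> m"
      using E1.frob_submodule_cancel[OF M.is_ideal[folded frob_submodule_1_iff] max_frob_coords[OF r(2) k(1)] L(1)[OF socle_gen_closed]] by blast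
    then show False using k by blast
  qed
  then show ?thesis using coords_frob_linear[OF k(1)] by blast
qed

text \<open>\<open>F\<^sub>*R\<close> and \<open>Hom(F\<^sub>*R, R)\<close> are free of the same rank; in coordinates the map sending \<open>f\<close> to
  \<open>\<Phi> (f \<cdot>)\<close> becomes an endomorphism of \<open>F\<^sub>*R\<close>.  It is injective modulo \<open>m\<close> by the choice of \<open>\<Phi>\<close>, hence
  surjective modulo \<open>m\<close> because lengths are finite, hence surjective by Nakayama.\<close>

lemma ex_dual: "\<exists>\<Phi> e. frob_dual R p \<Phi> {..<length bs} e (\<lambda>i. bs ! i)"
proof -
  obtain \<Phi> where Phi: "frob_linear R p \<Phi>" 
    "\<And>g. g \<in> carrier R \<Longrightarrow> \<forall>r\<in>carrier R. \<Phi> (r \<otimes> g) \<in> m \<Longrightarrow> g \<in> max_frob"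
    using ex_trace by blast
  note L = frob_linearD[OF Phi(1)]
  define \<tau> where "\<tau> f = Ep.lincomb (map (\<lambda>b. \<Phi> (f \<otimes> b)) bs) bs" for f
  have sc: "set (map (\<lambda>b. \<Phi> (f \<otimes> b)) bs) \<subseteq> carrier R" if "f \<in> carrier R" for f
    using that bs(1) L(1) by auto
  have tc: "\<tau> f \<in> carrier R" if "f \<in> carrier R" for f
    unfolding \<tau>_def using Ep.lincomb_closed[OF bs(1) sc[OF that]] .
  have tco: "coords (\<tau> f) = map (\<lambda>b. \<Phi> (f \<otimes> b)) bs" if "f \<in> carrier R" for f
    using sc[OF that] unfolding \<tau>_def by (intro coords_unique) auto
  have tadd: "\<tau> (f \<oplus> g) = \<tau> f \<oplus> \<tau> g" if "f \<in> carrier R" "g \<in> carrier R" for f g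
  proof -
    have "map (\<lambda>b. \<Phi> ((f \<oplus> g) \<otimes> b)) bs = map2 (\<oplus>) (map (\<lambda>b. \<Phi> (f \<otimes> b)) bs) (map (\<lambda>b. \<Phi> (g \<otimes> b)) bs)"
      using that bs(1) L(2) by (intro nth_equalityI) (auto simp: l_distr subset_iff)
    then show ?thesis unfolding \<tau>_def
      using Ep.lincomb_add[OF _ _ bs(1) sc[OF that(1)] sc[OF that(2)]] by simp
  qed
  have tsmul: "\<tau> (d [^] p \<otimes> f) = d [^] p \<otimes> \<tau> f" if "d \<in> carrier R" "f \<in> carrier R" for d f
  proof -
    have eq: "map (\<lambda>b. \<Phi> ((d [^] p \<otimes> f) \<otimes> b)) bs = map ((\<otimes>) d) (map (\<lambda>b. \<Phi> (f \<otimes> b)) bs)"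
      using that bs(1) L(3) by (auto simp: m_assoc subset_iff)
    show ?thesis unfolding \<tau>_def eq using Ep.lincomb_smul[OF that(1) bs(1) sc[OF that(2)]] by (simp only:)
  qed
  have tinj: "f \<in> max_frob" if f: "f \<in> carrier R" and t: "\<tau> f \<in> max_frob" for f
  proof (rule Phi(2)[OF f], rule ballI)
    have b: "\<Phi> (f \<otimes> b) \<in> m" if bb: "b \<in> set bs" for b
    proof -
      obtain i where "i < length bs" "bs ! i = b" using bb by (metis in_set_conv_nth)
      then show ?thesis using max_frob_coords[OF t, of i] tco[OF f] by simp
    qed
    fix r assume "r \<in> carrier R"
    then have "r \<in> frob_span R p (set bs)" using bs by simp
    then show "\<Phi> (r \<otimes> f) \<in> m"
    proof induction
      case zero then show ?case using f frob_linear_zero[OF Phi(1)] additive_subgroup.zero_closed[OF M.is_additive_subgroup] by simp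
    next
      case (step v c y)
      have vy: "v \<in> carrier R" "y \<in> carrier R" using step.hyps bs Ep.frob_span_closed[OF bs(1)] by auto
      have "(v \<oplus> c [^] p \<otimes> y) \<otimes> f = v \<otimes> f \<oplus> c [^] p \<otimes> (f \<otimes> y)"
        using vy f step.hyps by (simp add: l_distr r_distr m_ac)
      then have "\<Phi> ((v \<oplus> c [^] p \<otimes> y) \<otimes> f) = \<Phi> (v \<otimes> f) \<oplus> c \<otimes> \<Phi> (f \<otimes> y)"
        using L vy f step.hyps by simp
      then show ?case using step.IH b[OF step.hyps(3)] M.I_l_closed step.hyps(2)
          additive_subgroup.a_closed[OF M.is_additive_subgroup] by simp
    qed
  qed
  note smp = Ep.ideal_frob_submodule[OF max_frob_ideal]
  have st: "frob_submodule R p (\<tau> ` V)" if V: "frob_submodule R p V" for V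
  proof -
    note D = Ep.frob_submoduleD[OF V]
    have "\<tau> \<zero> = \<zero>" using tsmul[of \<zero> \<zero>] tc[of \<zero>] by (simp add: Ep.pow_zero)
    then have "\<zero> \<in> \<tau> ` V" using D(2) by force
    moreover have "\<tau> x \<oplus> \<tau> y \<in> \<tau> ` V" if "x \<in> V" "y \<in> V" for x y
      using tadd[OF D(3)[OF that(1)] D(3)[OF that(2)]] D(4)[OF that] by (metis imageI)
    moreover have "d [^] p \<otimes> \<tau> x \<in> \<tau> ` V" if "d \<in> carrier R" "x \<in> V" for d x
      using tsmul[OF that(1) D(3)[OF that(2)]] D(5)[OF that] by (metis imageI)
    ultimately show ?thesis using tc D(1) by (auto simp: frob_submodule_def)
  qed
  \<comment> \<open>Injectivity of \<open>\<tau>\<close> modulo \<open>m^[p]\<close> keeps every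
    strict step strict, so a chain from \<open>m^[p]\<close> to \<open>R\<close> is carried to one
    of the same length ending at the image of \<open>\<tau>\<close> plus
    \<open>m^[p]\<close>.\<close>
  have push: "strict_chain R m p max_frob V k \<Longrightarrow> strict_chain R m p max_frob (sumset R max_frob (\<tau> ` V)) k" for V k
  proof (induction rule: strict_chain.induct)
    case refl
    show ?case using Ep.strict_chain_sub[OF smp Ep.frob_submodule_add[OF smp st[OF refl]] Ep.add_le1[OF smp st[OF refl]]] .
  next
    case (weak V k W)
    show ?case by (rule strict_chain.weak[OF weak.IH Ep.frob_submodule_add[OF smp st[OF weak.hyps(2)]]])
        (use weak.hyps(3) in \<open>auto simp: sumset_def\<close>)
  next
    case (strict_at V k W)
    have sV: "frob_submodule R p V" "max_frob \<subseteq> V" using Ep.strict_chain_frob_submodule strict_at.hyps(1) by blast+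
    obtain w where w: "w \<in> W" "\<forall>s\<in>carrier R - m. s [^] p \<otimes> w \<notin> V"
      using strict_at.hyps(4) unfolding strict_at_def by blast
    have wc: "w \<in> carrier R" using w Ep.frob_submoduleD(3)[OF strict_at.hyps(2)] by blast
    have "\<tau> w \<in> sumset R max_frob (\<tau> ` W)" using Ep.add_le2[OF smp st[OF strict_at.hyps(2)]] w by blast
    moreover have "s [^] p \<otimes> \<tau> w \<notin> sumset R max_frob (\<tau> ` V)" if s: "s \<in> carrier R - m" for s
    proof
      assume "s [^] p \<otimes> \<tau> w \<in> sumset R max_frob (\<tau> ` V)"
      then obtain a v where av: "a \<in> max_frob" "v \<in> V" "s [^] p \<otimes> \<tau> w = a \<oplus> \<tau> v" unfolding sumset_def by blast
      have vc: "v \<in> carrier R" "a \<in> carrier R" using av Ep.frob_submoduleD(3)[OF sV(1)] ideal.Icarr[OF max_frob_ideal] by auto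
      let ?n = "(\<ominus> \<one>) [^] p \<otimes> v"
      have n: "?n = \<ominus> v" using vc by (simp add: Ep.pow_inv l_minus)
      have "\<tau> (s [^] p \<otimes> w \<oplus> ?n) = (a \<oplus> \<tau> v) \<oplus> (\<ominus> \<one>) [^] p \<otimes> \<tau> v"
        using tadd tsmul s wc vc av(3) by simp
      also have "\<dots> = a" using vc tc[OF vc(1)] by (simp add: Ep.pow_inv l_minus a_assoc r_neg)
      finally have "\<tau> (s [^] p \<otimes> w \<oplus> ?n) \<in> max_frob" using av(1) by simp
      then have "s [^] p \<otimes> w \<oplus> ?n \<in> max_frob" using tinj s wc vc by simp
      then have "v \<oplus> (s [^] p \<otimes> w \<oplus> ?n) \<in> V" using sV av(2) Ep.frob_submoduleD(4)[OF sV(1)] by blast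
      moreover have "v \<oplus> (s [^] p \<otimes> w \<oplus> ?n) = s [^] p \<otimes> w" 
        unfolding n using vc s wc by (simp add: a_ac r_neg2 r_neg r_neg1)
      ultimately show False using w s by simp
    qed
    ultimately have "strict_at R m p (sumset R max_frob (\<tau> ` V)) (sumset R max_frob (\<tau> ` W))" unfolding strict_at_def by blast
    then show ?case using strict_chain.strict_at[OF strict_at.IH Ep.frob_submodule_add[OF smp st[OF strict_at.hyps(2)]]] strict_at.hyps(3)
      by (auto simp: sumset_def)
  qed
  have cmp: "max_frob \<union> set bs \<subseteq> carrier R" using bs(1) ideal.Icarr[OF max_frob_ideal] by auto
  have sp: "frob_span R p (max_frob \<union> set bs) = carrier R"
    using Ep.frob_span_mono[OF cmp, of "set bs"] Ep.frob_span_closed[OF cmp] bs(2) by blast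
  have bound: "k \<le> length bs * 1" if "strict_chain R m p max_frob (carrier R) k" for k
  proof (rule Ep.strict_chain_bound_gens[OF m smp M.is_ideal Ep.strict_chain_bound_prime[OF m] bs(1)])
    show "c [^] p \<otimes> x \<in> max_frob" if "x \<in> set bs" "c \<in> m" for x c
      using max_frob_pow[OF that(2)] ideal.I_r_closed[OF max_frob_ideal] bs(1) that(1) by blast
    show "strict_chain R m p max_frob (frob_span R p (max_frob \<union> set bs)) k" using that sp by simp
  qed
  have "strict_chain R m p max_frob (carrier R) 0" using Ep.strict_chain_sub[OF smp Ep.frob_submodule_carrier Ep.frob_submoduleD(1)[OF smp]] .
  then obtain k where k: "strict_chain R m p max_frob (carrier R) k" "\<forall>j. strict_chain R m p max_frob (carrier R) j \<longrightarrow> j \<le> k"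
    using Nat.ex_has_greatest_nat[of "strict_chain R m p max_frob (carrier R)" 0 "length bs * 1"] bound by blast
  let ?T = "sumset R max_frob (\<tau> ` carrier R)"
  note sT = Ep.frob_submodule_add[OF smp st[OF Ep.frob_submodule_carrier]]
  \<comment> \<open>The length \<open>k\<close> is maximal, so \<open>?T\<close> admits no further
    strict step up to \<open>R\<close>; invertibility of the elements outside \<open>m\<close> turns
    this into equality.\<close>
  have "carrier R \<subseteq> ?T"
  proof
    fix g assume g: "g \<in> carrier R"
    show "g \<in> ?T"
    proof (rule ccontr)
      assume n: "g \<notin> ?T"
      have "s [^] p \<otimes> g \<notin> ?T" if s: "s \<in> carrier R - m" for s
      proof
        assume a: "s [^] p \<otimes> g \<in> ?T"
        obtain t where t: "t \<in> carrier R" "t \<otimes> s = \<one>" using units s by blast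
        have "t [^] p \<otimes> (s [^] p \<otimes> g) = (t \<otimes> s) [^] p \<otimes> g" using s t(1) g by (simp add: Ep.pow_mult m_assoc)
        then show False using Ep.frob_submoduleD(5)[OF sT t(1) a] t(2) g n by simp
      qed
      then have "strict_at R m p ?T (carrier R)" using g unfolding strict_at_def by blast
      then have "strict_chain R m p max_frob (carrier R) (Suc k)"
        using strict_chain.strict_at[OF push[OF k(1)] Ep.frob_submodule_carrier Ep.frob_submoduleD(1)[OF sT]] by blast
      then show False using k(2) by fastforce
    qed
  qed
  moreover have "?T \<subseteq> frob_span R p (\<tau> ` carrier R \<union> max_frob)"
  proof -
    have "\<tau> ` carrier R \<union> max_frob \<subseteq> carrier R" using tc ideal.Icarr[OF max_frob_ideal] by auto
    then show ?thesis using Ep.frob_span_subset by (intro Ep.add_least Ep.frob_span_frob_submodule) blast+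
  qed
  ultimately have surj: "\<tau> ` carrier R = carrier R"
    by (intro nakayama_R st Ep.frob_submodule_carrier) blast
  \<comment> \<open>Surjectivity realizes each coordinate functional as a multiple of
    \<open>\<Phi>\<close>; the multipliers are the elements \<open>e i\<close> of the dual
    family.\<close>
  have "\<exists>f\<in>carrier R. \<forall>g\<in>carrier R. \<Phi> (f \<otimes> g) = coords g ! i" if i: "i < length bs" for i
  proof -
    let ?v = "Ep.lincomb (map (\<lambda>b. coords b ! i) bs) bs"
    have vs: "set (map (\<lambda>b. coords b ! i) bs) \<subseteq> carrier R"
      using frob_linearD(1)[OF coords_frob_linear[OF i]] bs(1) by auto
    then obtain f where f: "f \<in> carrier R" "\<tau> f = ?v" using surj Ep.lincomb_closed[OF bs(1)] by (metis imageE)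
    have "map (\<lambda>b. \<Phi> (f \<otimes> b)) bs = map (\<lambda>b. coords b ! i) bs"
      using tco[OF f(1)] coords_unique[OF _ vs HOL.refl] f(2) by simp
    then have eq: "\<Phi> (f \<otimes> b) = coords b ! i" if "b \<in> set bs" for b using that by simp
    have "frob_linear R p (\<lambda>g. \<Phi> (f \<otimes> g))"
      using frob_linear_mult[OF Phi(1) f(1)] .
    then have "\<forall>g\<in>carrier R. \<Phi> (f \<otimes> g) = coords g ! i"
      using frob_linear_agree[OF _ coords_frob_linear[OF i] bs(1,2)] eq by blast
    then show ?thesis using f(1) by blast
  qed
  then obtain e where e: "\<And>i. i < length bs \<Longrightarrow> e i \<in> carrier R"
    "\<And>i g. i < length bs \<Longrightarrow> g \<in> carrier R \<Longrightarrow> \<Phi> (e i \<otimes> g) = coords g ! i" by metis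
  have "g = (\<Oplus>i\<in>{..<length bs}. \<Phi> (e i \<otimes> g) [^] p \<otimes> bs ! i)" if g: "g \<in> carrier R" for g
  proof -
    have "g = (\<Oplus>i\<in>{..<length bs}. (coords g ! i) [^] p \<otimes> bs ! i)"
      using Ep.lincomb_finsum[OF coords(1)[OF g] bs(1) coords(2)[OF g]] coords(3)[OF g] by simp
    also have "\<dots> = (\<Oplus>i\<in>{..<length bs}. \<Phi> (e i \<otimes> g) [^] p \<otimes> bs ! i)"
    proof (rule finsum_cong')
      fix i assume i: "i \<in> {..<length bs}"
      then show "coords g ! i [^] p \<otimes> bs ! i = \<Phi> (e i \<otimes> g) [^] p \<otimes> bs ! i" using e(2) g by simp
    next
      have "bs ! i \<in> carrier R" if "i < length bs" for i using bs(1) that nth_mem by blast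
      then show "(\<lambda>i. \<Phi> (e i \<otimes> g) [^] p \<otimes> bs ! i) \<in> {..<length bs} \<rightarrow> carrier R"
        using e(1) g L(1) by auto
    qed simp
    finally show ?thesis .
  qed
  then have "frob_dual R p \<Phi> {..<length bs} e (\<lambda>i. bs ! i)"
    unfolding frob_dual_def using Phi(1) e(1) bs(1) by auto
  then show ?thesis by blast
qed

end

lemma (in local_frob) ex_frob_dual: "\<exists>\<Phi> (n::nat) e b. frob_dual R p \<Phi> {..<n} e b"
proof -
  note ex_basis[THEN conjunct1]
  from ex_basis[THEN conjunct2] obtain bs where bs: "set bs \<subseteq> carrier R" "frob_span R p (set bs) = carrier R"
    "Ep.indep {\<zero>} bs" "\<exists>u\<in>carrier R. u \<otimes> socle_gen \<in> set bs" by (elim exE conjE)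
  from bs(4) obtain u where u: "u \<in> carrier R" "u \<otimes> socle_gen \<in> set bs" by (elim bexE)
  interpret local_dual R p m xs c bs u
    using ex_basis[THEN conjunct1] bs(1-3) u by (intro local_dual.intro local_dual_axioms.intro local_frob_axioms)
  from ex_dual obtain \<Phi> e where "frob_dual R p \<Phi> {..<length bs} e (\<lambda>i. bs ! i)" by (elim exE)
  then show ?thesis by (intro exI)
qed

section \<open>Localization\<close>

locale mult_sys = cring R for R (structure) +
  fixes S :: "'a set"
  assumes S_sub: "S \<subseteq> carrier R" and S_one: "\<one> \<in> S"
    and S_mult: "s \<in> S \<Longrightarrow> t \<in> S \<Longrightarrow> s \<otimes> t \<in> S"
begin

abbreviation "fr \<equiv> loc_frac R S"
abbreviation "L \<equiv> localization R S"

lemma S_carr: "s \<in> S \<Longrightarrow> s \<in> carrier R"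
  using S_sub by blast

lemma loc_rel_iff: "((a, s), (b, t)) \<in> loc_rel R S \<longleftrightarrow> a \<in> carrier R \<and> s \<in> S \<and> b \<in> carrier R \<and> t \<in> S \<and>
     (\<exists>u\<in>S. u \<otimes> (t \<otimes> a \<ominus> s \<otimes> b) = \<zero>)"
  by (simp add: loc_rel_def)

lemma equiv_loc: "equiv (carrier R \<times> S) (loc_rel R S)"
proof (rule equivI)
  show "loc_rel R S \<subseteq> (carrier R \<times> S) \<times> (carrier R \<times> S)" by (auto simp: loc_rel_def)
  show "refl_on (carrier R \<times> S) (loc_rel R S)"
  proof (rule refl_onI)
    fix x assume "x \<in> carrier R \<times> S"
    then obtain a s where x: "x = (a, s)" "a \<in> carrier R" "s \<in> S" by blast
    have "\<one> \<otimes> (s \<otimes> a \<ominus> s \<otimes> a) = \<zero>" using x S_carr by (simp add: a_minus_def r_neg)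
    then show "(x, x) \<in> loc_rel R S" using x S_one by (auto simp: loc_rel_iff)
  qed
  show "sym (loc_rel R S)"
  proof (rule symI)
    fix x y assume "(x, y) \<in> loc_rel R S"
    moreover obtain a s b t where xy: "x = (a, s)" "y = (b, t)" by (cases x, cases y) auto
    ultimately obtain u where u: "a \<in> carrier R" "s \<in> S" "b \<in> carrier R" "t \<in> S" "u \<in> S" "u \<otimes> (t \<otimes> a \<ominus> s \<otimes> b) = \<zero>"
      by (auto simp: loc_rel_iff)
    have c: "s \<in> carrier R" "t \<in> carrier R" "u \<in> carrier R" using u S_carr by auto
    have "u \<otimes> (s \<otimes> b \<ominus> t \<otimes> a) = \<ominus> (u \<otimes> (t \<otimes> a \<ominus> s \<otimes> b))" using u(1,3) c by algebra
    then have "u \<otimes> (s \<otimes> b \<ominus> t \<otimes> a) = \<zero>" using u(6) by simp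
    then show "(y, x) \<in> loc_rel R S" using u xy by (auto simp: loc_rel_iff)
  qed
  show "trans (loc_rel R S)"
  proof (rule transI)
    fix x y z assume "(x, y) \<in> loc_rel R S" "(y, z) \<in> loc_rel R S"
    moreover obtain a s b t d r where xyz: "x = (a, s)" "y = (b, t)" "z = (d, r)" by (cases x, cases y, cases z) auto
    ultimately obtain u v where u: "a \<in> carrier R" "s \<in> S" "b \<in> carrier R" "t \<in> S" "u \<in> S" "u \<otimes> (t \<otimes> a \<ominus> s \<otimes> b) = \<zero>"
      and v: "d \<in> carrier R" "r \<in> S" "v \<in> S" "v \<otimes> (r \<otimes> b \<ominus> t \<otimes> d) = \<zero>"
      by (auto simp: loc_rel_iff)
    have c: "s \<in> carrier R" "t \<in> carrier R" "u \<in> carrier R" "r \<in> carrier R" "v \<in> carrier R" using u v S_carr by auto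
    have "(u \<otimes> v \<otimes> t) \<otimes> (r \<otimes> a \<ominus> s \<otimes> d) = (v \<otimes> r) \<otimes> (u \<otimes> (t \<otimes> a \<ominus> s \<otimes> b)) \<oplus> (u \<otimes> s) \<otimes> (v \<otimes> (r \<otimes> b \<ominus> t \<otimes> d))"
      using u(1,3) v(1) c by algebra
    also have "\<dots> = \<zero>" using u(6) v(4) c by simp
    finally show "(x, z) \<in> loc_rel R S" using u v xyz S_mult unfolding xyz loc_rel_iff by blast
  qed
qed

lemma fr_eq_iff:
  assumes "a \<in> carrier R" "s \<in> S" "b \<in> carrier R" "t \<in> S"
  shows "fr a s = fr b t \<longleftrightarrow> (\<exists>u\<in>S. u \<otimes> (t \<otimes> a \<ominus> s \<otimes> b) = \<zero>)"
  using eq_equiv_class_iff[OF equiv_loc, of "(a, s)" "(b, t)"] assms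
  by (simp add: loc_frac_def loc_rel_iff)

lemma fr_eqI:
  assumes "a \<in> carrier R" "s \<in> S" "b \<in> carrier R" "t \<in> S" "t \<otimes> a = s \<otimes> b"
  shows "fr a s = fr b t"
  using fr_eq_iff[OF assms(1-4)] S_one assms S_carr by (auto simp: a_minus_def r_neg intro!: bexI[of _ \<one>])

lemma carrier_L: "carrier L = {fr a s | a s. a \<in> carrier R \<and> s \<in> S}"
  by (auto simp: localization_def loc_frac_def quotient_def)

lemma fr_carrier: "a \<in> carrier R \<Longrightarrow> s \<in> S \<Longrightarrow> fr a s \<in> carrier L"
  using carrier_L by blast

lemma fr_cases:
  assumes "x \<in> carrier L"
  obtains a s where "a \<in> carrier R" "s \<in> S" "x = fr a s"
  using assms carrier_L by blast

lemma fr_self: "a \<in> carrier R \<Longrightarrow> s \<in> S \<Longrightarrow> (a, s) \<in> fr a s"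
  using equiv_class_self[OF equiv_loc, of "(a, s)"] by (simp add: loc_frac_def)

lemma fr_memD:
  assumes "(b, t) \<in> fr a s" 
  shows "b \<in> carrier R" "t \<in> S" "fr b t = fr a s"
proof -
  have r: "((a, s), (b, t)) \<in> loc_rel R S" using assms by (simp add: loc_frac_def)
  then show "b \<in> carrier R" "t \<in> S" by (auto simp: loc_rel_iff)
  show "fr b t = fr a s" unfolding loc_frac_def using equiv_class_eq[OF equiv_loc r] by simp
qed

text \<open>The operations of \<open>localization\<close> are unions over all representatives.
  Independence of the representatives collapses such a union to a single class.\<close>

lemma UN_frac:
  assumes as: "a \<in> carrier R" "s \<in> S" and bt: "b \<in> carrier R" "t \<in> S"
    and cong: "\<And>a' s' b' t'. (a', s') \<in> fr a s \<Longrightarrow> (b', t') \<in> fr b t \<Longrightarrow> f a' s' b' t' = f a s b t"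
  shows "(\<Union>(a', s')\<in>fr a s. \<Union>(b', t')\<in>fr b t. f a' s' b' t') = f a s b t"
proof -
  have "(\<Union>(b', t')\<in>fr b t. f a' s' b' t') = f a s b t" if "(a', s') \<in> fr a s" for a' s'
    using cong[OF that] fr_self[OF bt] by auto
  then show ?thesis using fr_self[OF as] by auto
qed

lemma mult_L:
  assumes "a \<in> carrier R" "s \<in> S" "b \<in> carrier R" "t \<in> S"
  shows "fr a s \<otimes>\<^bsub>L\<^esub> fr b t = fr (a \<otimes> b) (s \<otimes> t)"
proof -
  have "fr (a' \<otimes> b') (s' \<otimes> t') = fr (a \<otimes> b) (s \<otimes> t)" if m: "(a', s') \<in> fr a s" "(b', t') \<in> fr b t" for a' s' b' t'
  proof -
    note c = fr_memD[OF m(1)] fr_memD[OF m(2)]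
    obtain u where u: "u \<in> S" "u \<otimes> (s \<otimes> a' \<ominus> s' \<otimes> a) = \<zero>" using fr_eq_iff[of a' s' a s] assms c by auto
    obtain v where v: "v \<in> S" "v \<otimes> (t \<otimes> b' \<ominus> t' \<otimes> b) = \<zero>" using fr_eq_iff[of b' t' b t] assms c by auto
    have cc: "u \<in> carrier R" "v \<in> carrier R" "s \<in> carrier R" "t \<in> carrier R" "s' \<in> carrier R" "t' \<in> carrier R"
      "a \<in> carrier R" "b \<in> carrier R" "a' \<in> carrier R" "b' \<in> carrier R"
      using u v assms c S_carr by auto
    have "(u \<otimes> v) \<otimes> ((s \<otimes> t) \<otimes> (a' \<otimes> b') \<ominus> (s' \<otimes> t') \<otimes> (a \<otimes> b)) =
       (v \<otimes> t \<otimes> b') \<otimes> (u \<otimes> (s \<otimes> a' \<ominus> s' \<otimes> a)) \<oplus> (u \<otimes> s' \<otimes> a) \<otimes> (v \<otimes> (t \<otimes> b' \<ominus> t' \<otimes> b))"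
      using cc by algebra
    also have "\<dots> = \<zero>" using u(2) v(2) cc by simp
    finally show ?thesis using fr_eq_iff[of "a' \<otimes> b'" "s' \<otimes> t'" "a \<otimes> b" "s \<otimes> t"] u(1) v(1) c assms S_mult cc by auto
  qed
  then show ?thesis using UN_frac[OF assms, of "\<lambda>a s b t. fr (a \<otimes> b) (s \<otimes> t)"] by (simp add: localization_def)
qed

lemma add_L:
  assumes "a \<in> carrier R" "s \<in> S" "b \<in> carrier R" "t \<in> S"
  shows "fr a s \<oplus>\<^bsub>L\<^esub> fr b t = fr (t \<otimes> a \<oplus> s \<otimes> b) (s \<otimes> t)"
proof -
  have "fr (t' \<otimes> a' \<oplus> s' \<otimes> b') (s' \<otimes> t') = fr (t \<otimes> a \<oplus> s \<otimes> b) (s \<otimes> t)"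
    if m: "(a', s') \<in> fr a s" "(b', t') \<in> fr b t" for a' s' b' t'
  proof -
    note c = fr_memD[OF m(1)] fr_memD[OF m(2)]
    obtain u where u: "u \<in> S" "u \<otimes> (s \<otimes> a' \<ominus> s' \<otimes> a) = \<zero>" using fr_eq_iff[of a' s' a s] assms c by auto
    obtain v where v: "v \<in> S" "v \<otimes> (t \<otimes> b' \<ominus> t' \<otimes> b) = \<zero>" using fr_eq_iff[of b' t' b t] assms c by auto
    have cc: "u \<in> carrier R" "v \<in> carrier R" "s \<in> carrier R" "t \<in> carrier R" "s' \<in> carrier R" "t' \<in> carrier R"
      "a \<in> carrier R" "b \<in> carrier R" "a' \<in> carrier R" "b' \<in> carrier R"
      using u v assms c S_carr by auto
    have "(u \<otimes> v) \<otimes> ((s \<otimes> t) \<otimes> (t' \<otimes> a' \<oplus> s' \<otimes> b') \<ominus> (s' \<otimes> t') \<otimes> (t \<otimes> a \<oplus> s \<otimes> b)) =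
       (v \<otimes> t \<otimes> t') \<otimes> (u \<otimes> (s \<otimes> a' \<ominus> s' \<otimes> a)) \<oplus> (u \<otimes> s \<otimes> s') \<otimes> (v \<otimes> (t \<otimes> b' \<ominus> t' \<otimes> b))"
      using cc by algebra
    also have "\<dots> = \<zero>" using u(2) v(2) cc by simp
    finally show ?thesis
      using fr_eq_iff[of "t' \<otimes> a' \<oplus> s' \<otimes> b'" "s' \<otimes> t'" "t \<otimes> a \<oplus> s \<otimes> b" "s \<otimes> t"] u(1) v(1) c assms S_mult cc by auto
  qed
  then show ?thesis
    using UN_frac[OF assms, of "\<lambda>a s b t. fr (t \<otimes> a \<oplus> s \<otimes> b) (s \<otimes> t)"] by (simp add: localization_def)
qed

lemma one_L: "\<one>\<^bsub>L\<^esub> = fr \<one> \<one>" and zero_L: "\<zero>\<^bsub>L\<^esub> = fr \<zero> \<one>"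
  by (simp_all add: localization_def)

lemma cring_L: "cring L"
proof (rule cringI)
  show "abelian_group L"
  proof (rule abelian_groupI)
    show "x \<oplus>\<^bsub>L\<^esub> y \<in> carrier L" if "x \<in> carrier L" "y \<in> carrier L" for x y
      using that by (elim fr_cases) (auto simp: add_L S_carr S_mult intro!: fr_carrier)
    show "\<zero>\<^bsub>L\<^esub> \<in> carrier L" using S_one by (simp add: zero_L fr_carrier)
    show "x \<oplus>\<^bsub>L\<^esub> y \<oplus>\<^bsub>L\<^esub> z = x \<oplus>\<^bsub>L\<^esub> (y \<oplus>\<^bsub>L\<^esub> z)"
      if xyz: "x \<in> carrier L" "y \<in> carrier L" "z \<in> carrier L" for x y z
    proof -
      obtain a s b t d r where *: "a \<in> carrier R" "s \<in> S" "x = fr a s" "b \<in> carrier R" "t \<in> S" "y = fr b t"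
        "d \<in> carrier R" "r \<in> S" "z = fr d r" using xyz by (metis fr_cases)
      then have c: "s \<in> carrier R" "t \<in> carrier R" "r \<in> carrier R" using S_carr by auto
      have "r \<otimes> (t \<otimes> a \<oplus> s \<otimes> b) \<oplus> (s \<otimes> t) \<otimes> d = (t \<otimes> r) \<otimes> a \<oplus> s \<otimes> (r \<otimes> b \<oplus> t \<otimes> d)"
        using *(1,4,7) c by algebra
      then show ?thesis using * c S_mult by (simp add: add_L m_assoc)
    qed
    show "x \<oplus>\<^bsub>L\<^esub> y = y \<oplus>\<^bsub>L\<^esub> x" if xy: "x \<in> carrier L" "y \<in> carrier L" for x y
    proof -
      obtain a s b t where *: "a \<in> carrier R" "s \<in> S" "x = fr a s" "b \<in> carrier R" "t \<in> S" "y = fr b t"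
        using xy by (metis fr_cases)
      then show ?thesis using S_carr by (simp add: add_L m_comm a_comm)
    qed
    show "\<zero>\<^bsub>L\<^esub> \<oplus>\<^bsub>L\<^esub> x = x" if "x \<in> carrier L" for x
      using that S_one by (elim fr_cases) (simp add: zero_L add_L S_carr)
    show "\<exists>y\<in>carrier L. y \<oplus>\<^bsub>L\<^esub> x = \<zero>\<^bsub>L\<^esub>" if x: "x \<in> carrier L" for x
    proof -
      obtain a s where *: "a \<in> carrier R" "s \<in> S" "x = fr a s" using x by (rule fr_cases)
      then have c: "s \<in> carrier R" using S_carr by auto
      have "fr (\<ominus> a) s \<oplus>\<^bsub>L\<^esub> x = fr (s \<otimes> \<ominus> a \<oplus> s \<otimes> a) (s \<otimes> s)" using * by (simp add: add_L)
      also have "s \<otimes> \<ominus> a \<oplus> s \<otimes> a = \<zero>" using *(1) c by algebra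
      also have "fr \<zero> (s \<otimes> s) = \<zero>\<^bsub>L\<^esub>" unfolding zero_L using * c S_one S_mult by (intro fr_eqI) auto
      finally show ?thesis using * fr_carrier by (intro bexI[of _ "fr (\<ominus> a) s"]) auto
    qed
  qed
  show "comm_monoid L"
  proof (rule comm_monoidI)
    show "x \<otimes>\<^bsub>L\<^esub> y \<in> carrier L" if "x \<in> carrier L" "y \<in> carrier L" for x y
      using that by (elim fr_cases) (auto simp: mult_L S_mult intro!: fr_carrier)
    show "\<one>\<^bsub>L\<^esub> \<in> carrier L" using S_one by (simp add: one_L fr_carrier)
    show "x \<otimes>\<^bsub>L\<^esub> y \<otimes>\<^bsub>L\<^esub> z = x \<otimes>\<^bsub>L\<^esub> (y \<otimes>\<^bsub>L\<^esub> z)"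
      if xyz: "x \<in> carrier L" "y \<in> carrier L" "z \<in> carrier L" for x y z
    proof -
      obtain a s b t d r where *: "a \<in> carrier R" "s \<in> S" "x = fr a s" "b \<in> carrier R" "t \<in> S" "y = fr b t"
        "d \<in> carrier R" "r \<in> S" "z = fr d r" using xyz by (metis fr_cases)
      then show ?thesis using S_mult S_carr by (simp add: mult_L m_assoc)
    qed
    show "\<one>\<^bsub>L\<^esub> \<otimes>\<^bsub>L\<^esub> x = x" if "x \<in> carrier L" for x
      using that S_one by (elim fr_cases) (simp add: one_L mult_L S_carr)
    show "x \<otimes>\<^bsub>L\<^esub> y = y \<otimes>\<^bsub>L\<^esub> x" if xy: "x \<in> carrier L" "y \<in> carrier L" for x y
    proof -
      obtain a s b t where *: "a \<in> carrier R" "s \<in> S" "x = fr a s" "b \<in> carrier R" "t \<in> S" "y = fr b t"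
        using xy by (metis fr_cases)
      then show ?thesis using S_carr by (simp add: mult_L m_comm)
    qed
  qed
  show "(x \<oplus>\<^bsub>L\<^esub> y) \<otimes>\<^bsub>L\<^esub> z = x \<otimes>\<^bsub>L\<^esub> z \<oplus>\<^bsub>L\<^esub> y \<otimes>\<^bsub>L\<^esub> z"
    if xyz: "x \<in> carrier L" "y \<in> carrier L" "z \<in> carrier L" for x y z
  proof -
    obtain a s b t d r where *: "a \<in> carrier R" "s \<in> S" "x = fr a s" "b \<in> carrier R" "t \<in> S" "y = fr b t"
      "d \<in> carrier R" "r \<in> S" "z = fr d r" using xyz by (metis fr_cases)
    then have c: "s \<in> carrier R" "t \<in> carrier R" "r \<in> carrier R" using S_carr by auto
    have "((s \<otimes> r) \<otimes> (t \<otimes> r)) \<otimes> ((t \<otimes> a \<oplus> s \<otimes> b) \<otimes> d) =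
        ((s \<otimes> t) \<otimes> r) \<otimes> ((t \<otimes> r) \<otimes> (a \<otimes> d) \<oplus> (s \<otimes> r) \<otimes> (b \<otimes> d))"
      using *(1,4,7) c by algebra
    then have "fr ((t \<otimes> a \<oplus> s \<otimes> b) \<otimes> d) ((s \<otimes> t) \<otimes> r) =
        fr ((t \<otimes> r) \<otimes> (a \<otimes> d) \<oplus> (s \<otimes> r) \<otimes> (b \<otimes> d)) ((s \<otimes> r) \<otimes> (t \<otimes> r))"
      using * c S_mult by (intro fr_eqI) auto
    then show ?thesis using * c S_mult by (simp add: add_L mult_L)
  qed
qed

sublocale LR: cring L by (rule cring_L)

lemma ideal_LI:
  assumes J: "J \<subseteq> carrier L" "\<zero>\<^bsub>L\<^esub> \<in> J" "\<And>x y. x \<in> J \<Longrightarrow> y \<in> J \<Longrightarrow> x \<oplus>\<^bsub>L\<^esub> y \<in> J"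
    "\<And>r x. r \<in> carrier L \<Longrightarrow> x \<in> J \<Longrightarrow> r \<otimes>\<^bsub>L\<^esub> x \<in> J"
  shows "ideal J L"
  using J LR.frob_submodule_1_iff[of J] by (auto simp: frob_submodule_def LR.nat_pow_eone)

lemma ideal_ext:
  assumes A: "ideal A R"
  shows "ideal {fr a s | a s. a \<in> A \<and> s \<in> S} L"
proof (rule ideal_LI)
  interpret A: ideal A R by fact
  note zA = additive_subgroup.zero_closed[OF A.is_additive_subgroup] and aA = additive_subgroup.a_closed[OF A.is_additive_subgroup]
  show "{fr a s | a s. a \<in> A \<and> s \<in> S} \<subseteq> carrier L" using fr_carrier A.Icarr by blast
  show "\<zero>\<^bsub>L\<^esub> \<in> {fr a s | a s. a \<in> A \<and> s \<in> S}" using zA S_one zero_L by blast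
  show "x \<oplus>\<^bsub>L\<^esub> y \<in> {fr a s | a s. a \<in> A \<and> s \<in> S}"
    if xy: "x \<in> {fr a s | a s. a \<in> A \<and> s \<in> S}" "y \<in> {fr a s | a s. a \<in> A \<and> s \<in> S}" for x y
  proof -
    obtain a s b t where *: "a \<in> A" "s \<in> S" "x = fr a s" "b \<in> A" "t \<in> S" "y = fr b t" using xy by blast
    then have "x \<oplus>\<^bsub>L\<^esub> y = fr (t \<otimes> a \<oplus> s \<otimes> b) (s \<otimes> t)" using A.Icarr by (simp add: add_L)
    moreover have "t \<otimes> a \<oplus> s \<otimes> b \<in> A" using * A.I_l_closed aA S_carr by simp
    ultimately show ?thesis using S_mult * by blast
  qed
  show "r \<otimes>\<^bsub>L\<^esub> x \<in> {fr a s | a s. a \<in> A \<and> s \<in> S}"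
    if rx: "r \<in> carrier L" "x \<in> {fr a s | a s. a \<in> A \<and> s \<in> S}" for r x
  proof -
    obtain b t where bt: "b \<in> carrier R" "t \<in> S" "r = fr b t" using rx(1) by (rule fr_cases)
    obtain a s where *: "a \<in> A" "s \<in> S" "x = fr a s" using rx by blast
    then have "r \<otimes>\<^bsub>L\<^esub> x = fr (b \<otimes> a) (t \<otimes> s)" using A.Icarr bt by (simp add: mult_L)
    then show ?thesis using S_mult * bt A.I_l_closed by blast
  qed
qed

text \<open>The contraction of an extended ideal. It turns membership in a symbolic power into the
  existence of a denominator, which is the form used afterwards.\<close>

lemma loc_map_ext_iff:
  assumes A: "ideal A R" and r: "r \<in> carrier R"
  shows "loc_map R S r \<in> Idl\<^bsub>L\<^esub> (loc_map R S ` A) \<longleftrightarrow> (\<exists>s\<in>S. s \<otimes> r \<in> A)"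
proof
  interpret A: ideal A R by fact
  have sub: "loc_map R S ` A \<subseteq> carrier L" using A.Icarr fr_carrier S_one by (auto simp: loc_map_def)
  {
    assume "loc_map R S r \<in> Idl\<^bsub>L\<^esub> (loc_map R S ` A)"
    moreover have "Idl\<^bsub>L\<^esub> (loc_map R S ` A) \<subseteq> {fr a s | a s. a \<in> A \<and> s \<in> S}"
      using S_one by (intro LR.genideal_minimal[OF ideal_ext[OF A]]) (auto simp: loc_map_def)
    ultimately obtain a s where as: "a \<in> A" "s \<in> S" "fr r \<one> = fr a s" by (auto simp: loc_map_def)
    then obtain u where u: "u \<in> S" "u \<otimes> (s \<otimes> r \<ominus> \<one> \<otimes> a) = \<zero>"
      using fr_eq_iff[of r \<one> a s] r S_one A.Icarr by auto
    have c: "u \<in> carrier R" "s \<in> carrier R" "a \<in> carrier R" using u as S_carr A.Icarr by auto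
    have "(u \<otimes> s) \<otimes> r = u \<otimes> (s \<otimes> r \<ominus> \<one> \<otimes> a) \<oplus> u \<otimes> a" using c r by algebra
    then have "(u \<otimes> s) \<otimes> r \<in> A" using u A.I_l_closed[OF as(1)] c by simp
    then show "\<exists>s\<in>S. s \<otimes> r \<in> A" using u as S_mult by blast
  next
    assume "\<exists>s\<in>S. s \<otimes> r \<in> A"
    then obtain s where s: "s \<in> S" "s \<otimes> r \<in> A" by blast
    have "fr \<one> s \<otimes>\<^bsub>L\<^esub> fr (s \<otimes> r) \<one> = fr r \<one>"
      using s r S_carr S_one mult_L[of \<one> s "s \<otimes> r" \<one>] fr_eqI[of "s \<otimes> r" s r \<one>] by simp
    moreover have "fr (s \<otimes> r) \<one> \<in> Idl\<^bsub>L\<^esub> (loc_map R S ` A)"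
      using LR.genideal_self[OF sub] s(2) by (auto simp: loc_map_def)
    ultimately show "loc_map R S r \<in> Idl\<^bsub>L\<^esub> (loc_map R S ` A)"
      using ideal.I_l_closed[OF LR.genideal_ideal[OF sub], of "fr (s \<otimes> r) \<one>" "fr \<one> s"] fr_carrier s
      by (simp add: loc_map_def)
  }
qed

end

section \<open>Regularity at a prime, expressed in the ring itself\<close>

lemma (in cring) mult_sys_prime:
  assumes "primeideal P R"
  shows "mult_sys R (carrier R - P)"
proof -
  interpret primeideal P R by fact
  show ?thesis
    using one_imp_carrier I_notcarr I_prime by unfold_locales auto
qed

text \<open>The chain is truncated at \<open>k\<close> and its last member replaced by
  \<open>P\<close>, which contains \<open>c h\<close> and hence \<open>c k\<close>.\<close>

lemma prime_chain_cut:
  assumes "prime_chain R c h" "c h \<subseteq> P" "primeideal P R" "k \<le> h"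
  shows "\<exists>c'. prime_chain R c' k \<and> c' k = P"
proof (intro exI[of _ "c(k := P)"] conjI)
  have mono: "c i \<subseteq> c j" if "i \<le> j" "j \<le> h" for i j
    using that
  proof (induction j)
    case (Suc j)
    show ?case
    proof (cases "i = Suc j")
      case False
      then have "c i \<subseteq> c j" "c j \<subset> c (Suc j)" using Suc assms(1) by (auto simp: prime_chain_def)
      then show ?thesis by blast
    qed simp
  qed simp
  show "prime_chain R (c(k := P)) k"
    unfolding prime_chain_def
  proof (intro conjI allI impI)
    show "primeideal ((c(k := P)) i) R" if "i \<le> k" for i using that assms by (auto simp: prime_chain_def)
    show "(c(k := P)) i \<subset> (c(k := P)) (Suc i)" if i: "i < k" for i
    proof -
      have "c i \<subset> c (Suc i)" using i assms by (auto simp: prime_chain_def)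
      moreover have "c (Suc i) \<subseteq> c h" using mono i assms(4) by auto
      ultimately show ?thesis using i assms(2) by auto
    qed
  qed
qed simp

text \<open>A finite supremum of a nonempty set of natural numbers is attained; \<open>P\<close>
  provides a chain of length 0.\<close>

lemma krull_dim_chain:
  assumes "krull_dim R = enat h" "primeideal P R"
  shows "\<exists>c. prime_chain R c h"
proof -
  let ?A = "{enat n | n. \<exists>c. prime_chain R c n}"
  have ne: "?A \<noteq> {}"
  proof -
    have "prime_chain R (\<lambda>_. P) 0" using assms(2) by (auto simp: prime_chain_def)
    then show ?thesis by blast
  qed
  have le: "x \<le> enat h" if "x \<in> ?A" for x
    using that assms(1) Sup_upper[of x ?A] by (simp add: krull_dim_def)
  then have "?A \<subseteq> enat ` {..h}" by fastforce
  then have fin: "finite ?A" using finite_surj by blast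
  have "Sup ?A = Max ?A" using fin ne by (simp add: cSup_eq_Max)
  then have "enat h \<in> ?A" using Max_in[OF fin ne] assms(1) by (simp add: krull_dim_def)
  then show ?thesis by blast
qed

text \<open>Regularity of the localization at \<open>P\<close> is pulled back to \<open>R\<close>:
  numerators of a minimal generating set generate \<open>P\<close> up to denominators, and a chain
  of primes of the localization is contracted. The match between the chain and
  \<open>length ys\<close> later yields both the freeness of \<open>F\<^sub>*R\<close> and the bound
  \<open>H\<close> on the number of local generators.\<close>

lemma (in noetherian_cring) regular_prime:
  assumes reg: "regular_ring R" and P: "primeideal P R"
  shows "\<exists>ys c. set ys \<subseteq> P \<and> (\<forall>y\<in>P. \<exists>s\<in>carrier R - P. s \<otimes> y \<in> frob_span R 1 (set ys)) \<and>
    prime_chain R c (length ys) \<and> c (length ys) = P"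
proof -
  interpret P: primeideal P R by fact
  interpret mult_sys R "carrier R - P" by (rule mult_sys_prime[OF P])
  have "regular_local_ring L" using reg P by (simp add: regular_ring_def)
  then obtain N where N: "noetherian_ring L" "local_ring L N" "krull_dim L = enat (min_num_gens L N)"
    by (auto simp: regular_local_ring_def)
  interpret LN: noetherian_ring L by (rule N(1))
  have Nmax: "maximalideal N L" "\<And>N'. maximalideal N' L \<Longrightarrow> N' = N" using N(2) by (auto simp: local_ring_def)
  have Nid: "ideal N L" using Nmax(1) maximalideal.axioms(1) by blast
  let ?S = "carrier R - P"
  define PL where "PL = {fr a s | a s. a \<in> P \<and> s \<in> ?S}"
  have frP: "a \<in> P" if aP: "a \<in> carrier R" "s \<in> ?S" "fr a s \<in> PL" for a s
  proof -
    obtain b t where bt: "b \<in> P" "t \<in> ?S" "fr a s = fr b t" using aP(3) unfolding PL_def by blast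
    then obtain u where u: "u \<in> ?S" "u \<otimes> (t \<otimes> a \<ominus> s \<otimes> b) = \<zero>"
      using fr_eq_iff[of a s b t] aP P.Icarr by auto
    have c: "b \<in> carrier R" "t \<in> carrier R" "u \<in> carrier R" "s \<in> carrier R" using bt u that P.Icarr by auto
    have "(u \<otimes> t) \<otimes> a = u \<otimes> (t \<otimes> a \<ominus> s \<otimes> b) \<oplus> (u \<otimes> s) \<otimes> b" using c that(1) by algebra
    then have "(u \<otimes> t) \<otimes> a \<in> P" using u(2) P.I_l_closed[OF bt(1)] c by simp
    then show ?thesis using P.I_prime[of "u \<otimes> t" a] P.I_prime[of u t] u bt c that(1) by auto
  qed
  have unitL: "\<exists>y\<in>carrier L. y \<otimes>\<^bsub>L\<^esub> x = \<one>\<^bsub>L\<^esub>" if x: "x \<in> carrier L" "x \<notin> PL" for x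
  proof -
    obtain a s where as: "a \<in> carrier R" "s \<in> ?S" "x = fr a s" using x(1) by (rule fr_cases)
    then have "a \<in> ?S" using x(2) unfolding PL_def by blast
    then have "fr s a \<otimes>\<^bsub>L\<^esub> x = \<one>\<^bsub>L\<^esub>" unfolding as(3) one_L
      using as S_one S_mult \<open>a \<in> ?S\<close> mult_L[of s a a s] fr_eqI[of "s \<otimes> a" "a \<otimes> s" \<one> \<one>]
      by (simp add: m_comm)
    then show ?thesis using fr_carrier \<open>a \<in> ?S\<close> as(2) by (intro bexI[of _ "fr s a"]) auto
  qed
  have properL: "J \<subseteq> PL" if J: "ideal J L" "J \<noteq> carrier L" for J
  proof
    fix x assume x: "x \<in> J"
    show "x \<in> PL"
    proof (rule ccontr)
      assume "x \<notin> PL"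
      then obtain y where "y \<in> carrier L" "y \<otimes>\<^bsub>L\<^esub> x = \<one>\<^bsub>L\<^esub>" using unitL x ideal.Icarr[OF J(1)] by blast
      then have "\<one>\<^bsub>L\<^esub> \<in> J" using ideal.I_l_closed[OF J(1) x] by metis
      then show False using ideal.one_imp_carrier[OF J(1)] J(2) by blast
    qed
  qed
  have PLid: "ideal PL L" unfolding PL_def using ideal_ext[OF P.is_ideal] .
  have PLne: "PL \<noteq> carrier L"
    using frP[of \<one> \<one>] S_one fr_carrier[of \<one> \<one>] by auto
  have "maximalideal PL L"
    using PLid PLne properL by (intro maximalidealI) blast+
  then have NPL: "N = PL" using Nmax(2) by simp
  have "\<exists>k. \<exists>A\<subseteq>carrier L. finite A \<and> card A = k \<and> N = Idl\<^bsub>L\<^esub> A"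
    using LN.finetely_gen[OF Nid] by blast
  then have "\<exists>A\<subseteq>carrier L. finite A \<and> card A = min_num_gens L N \<and> N = Idl\<^bsub>L\<^esub> A"
    unfolding min_num_gens_def by (rule LeastI_ex)
  then obtain A where A: "A \<subseteq> carrier L" "finite A" "card A = min_num_gens L N" "N = Idl\<^bsub>L\<^esub> A" by blast
  define num where "num x = (SOME a. a \<in> carrier R \<and> (\<exists>s\<in>?S. x = fr a s))" for x
  have num: "num x \<in> carrier R \<and> (\<exists>s\<in>?S. x = fr (num x) s)" if "x \<in> carrier L" for x
  proof -
    obtain a s where "a \<in> carrier R" "s \<in> ?S" "x = fr a s" using \<open>x \<in> carrier L\<close> by (rule fr_cases)
    then have "\<exists>a. a \<in> carrier R \<and> (\<exists>s\<in>?S. x = fr a s)" by blast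
    then show ?thesis unfolding num_def by (rule someI_ex)
  qed
  \<comment> \<open>Different generators may share a numerator, so \<open>ys\<close> can be shorter
    than the dimension; the chain is cut down to its length at the end.\<close>
  obtain ys where ys: "set ys = num ` A" "distinct ys"
    using finite_distinct_list[OF finite_imageI[OF A(2), of num]] by auto
  have len: "length ys \<le> min_num_gens L N"
    using distinct_card[OF ys(2)] card_image_le[OF A(2), of num] ys(1) A(3) by simp
  have AP: "A \<subseteq> PL" using LR.genideal_self[OF A(1)] A(4) NPL by blast
  have ysP: "set ys \<subseteq> P"
  proof
    fix y assume "y \<in> set ys"
    then obtain x where x: "x \<in> A" "y = num x" using ys by blast
    have "x \<in> carrier L" using x A(1) by blast
    from num[OF this] obtain s where s: "y \<in> carrier R" "s \<in> ?S" "x = fr y s" unfolding x(2) by blast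
    have "fr y s \<in> PL" using AP x(1) unfolding s(3)[symmetric] by blast
    then show "y \<in> P" by (rule frP[OF s(1,2)])
  qed
  then have ysc: "set ys \<subseteq> carrier R" using P.Icarr by blast
  have B: "ideal (frob_span R 1 (set ys)) R" using E1.frob_span_frob_submodule[OF ysc] frob_submodule_1_iff by blast
  have subB: "loc_map R ?S ` frob_span R 1 (set ys) \<subseteq> carrier L"
    using ideal.Icarr[OF B] fr_carrier S_one by (auto simp: loc_map_def)
  note IB = LR.genideal_ideal[OF subB]
  have "A \<subseteq> Idl\<^bsub>L\<^esub> (loc_map R ?S ` frob_span R 1 (set ys))"
  proof
    fix x assume x: "x \<in> A"
    have "x \<in> carrier L" using x A(1) by blast
    from num[OF this] obtain s where s: "num x \<in> carrier R" "s \<in> ?S" "x = fr (num x) s" by blast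
    have "num x \<in> frob_span R 1 (set ys)" using E1.frob_span_base[OF ysc] x ys(1) by blast
    then have "fr (num x) \<one> \<in> Idl\<^bsub>L\<^esub> (loc_map R ?S ` frob_span R 1 (set ys))"
      using LR.genideal_self[OF subB] by (auto simp: loc_map_def)
    then have "fr \<one> s \<otimes>\<^bsub>L\<^esub> fr (num x) \<one> \<in> Idl\<^bsub>L\<^esub> (loc_map R ?S ` frob_span R 1 (set ys))"
      using ideal.I_l_closed[OF IB] fr_carrier[of \<one> s] s(2) by simp
    moreover have "fr \<one> s \<otimes>\<^bsub>L\<^esub> fr (num x) \<one> = fr (num x) s"
      using s(1,2) S_one mult_L[of \<one> s "num x" \<one>] by simp
    ultimately show "x \<in> Idl\<^bsub>L\<^esub> (loc_map R ?S ` frob_span R 1 (set ys))"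
      using s(3) by (simp only:)
  qed
  then have "N \<subseteq> Idl\<^bsub>L\<^esub> (loc_map R ?S ` frob_span R 1 (set ys))"
    unfolding A(4) by (rule LR.genideal_minimal[OF IB])
  moreover have "loc_map R ?S y \<in> N" if "y \<in> P" for y
    using that S_one unfolding NPL PL_def loc_map_def by blast
  ultimately have gen: "\<exists>s\<in>?S. s \<otimes> y \<in> frob_span R 1 (set ys)" if "y \<in> P" for y
    using loc_map_ext_iff[OF B P.Icarr[OF that]] that by blast
  have "primeideal N L" using LR.maximalideal_prime[OF Nmax(1)] .
  then obtain c where c: "prime_chain L c (min_num_gens L N)" using krull_dim_chain[OF N(3)] by blast
  define c' where "c' i = {r \<in> carrier R. fr r \<one> \<in> c i}" for i
  let ?h = "min_num_gens L N"
  have cp: "primeideal (c i) L" if "i \<le> ?h" for i using c that by (auto simp: prime_chain_def)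
  have mapm: "fr (a \<otimes> b) \<one> = fr a \<one> \<otimes>\<^bsub>L\<^esub> fr b \<one>" if "a \<in> carrier R" "b \<in> carrier R" for a b
    using that S_one by (subst mult_L) auto
  have mapa: "fr (a \<oplus> b) \<one> = fr a \<one> \<oplus>\<^bsub>L\<^esub> fr b \<one>" if "a \<in> carrier R" "b \<in> carrier R" for a b
    using that S_one by (subst add_L) auto
  have c'p: "primeideal (c' i) R" if "i \<le> ?h" for i
  proof -
    interpret C: primeideal "c i" L using cp that .
    have "frob_submodule R 1 (c' i)"
      unfolding frob_submodule_def c'_def
      using C.I_l_closed additive_subgroup.a_closed[OF C.is_additive_subgroup]
        additive_subgroup.zero_closed[OF C.is_additive_subgroup] fr_carrier S_one
      by (auto simp: mapm mapa zero_L[symmetric])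
    then have id: "ideal (c' i) R" using frob_submodule_1_iff by blast
    show ?thesis
    proof (rule primeidealI[OF id is_cring])
      show "carrier R \<noteq> c' i"
      proof
        assume "carrier R = c' i"
        then have "\<one>\<^bsub>L\<^esub> \<in> c i" unfolding one_L c'_def by auto
        then show False using C.one_imp_carrier C.I_notcarr by blast
      qed
      show "a \<in> c' i \<or> b \<in> c' i" if "a \<in> carrier R" "b \<in> carrier R" "a \<otimes> b \<in> c' i" for a b
        using that C.I_prime[of "fr a \<one>" "fr b \<one>"] mapm fr_carrier S_one unfolding c'_def by auto
    qed
  qed
  have "prime_chain R c' ?h"
    unfolding prime_chain_def
  proof (intro conjI allI impI)
    show "c' i \<subset> c' (Suc i)" if i: "i < ?h" for i
    proof -
      have cc: "c i \<subset> c (Suc i)" using c i by (auto simp: prime_chain_def)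
      then obtain x where x: "x \<in> c (Suc i)" "x \<notin> c i" by blast
      have id: "ideal (c i) L" "ideal (c (Suc i)) L" using primeideal.axioms(1)[OF cp[of i]] primeideal.axioms(1)[OF cp[of "Suc i"]] i by auto
      obtain a s where as: "a \<in> carrier R" "s \<in> ?S" "x = fr a s"
        using ideal.Icarr[OF id(2) x(1)] by (rule fr_cases)
      have "fr s \<one> \<otimes>\<^bsub>L\<^esub> x = fr a \<one>" unfolding as(3)
        using as S_one mult_L[of s \<one> a s] fr_eqI[of "s \<otimes> a" s a \<one>] by simp
      then have "fr a \<one> \<in> c (Suc i)" using ideal.I_l_closed[OF id(2) x(1), of "fr s \<one>"] fr_carrier[of s \<one>] as S_one by auto
      moreover have "fr a \<one> \<notin> c i"
      proof
        assume "fr a \<one> \<in> c i"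
        moreover have "fr \<one> s \<otimes>\<^bsub>L\<^esub> fr a \<one> = x" unfolding as(3) using as S_one by (subst mult_L) auto
        ultimately show False using ideal.I_l_closed[OF id(1), of "fr a \<one>" "fr \<one> s"] fr_carrier[of \<one> s] as x(2) by auto
      qed
      ultimately have "a \<in> c' (Suc i)" "a \<notin> c' i" using as unfolding c'_def by auto
      moreover have "c' i \<subseteq> c' (Suc i)" using cc unfolding c'_def by auto
      ultimately show ?thesis by blast
    qed
  qed (use c'p in blast)
  moreover have "c' ?h \<subseteq> P"
  proof
    fix r assume r: "r \<in> c' ?h"
    have pr: "primeideal (c ?h) L" using cp by simp
    then have "c ?h \<noteq> carrier L" using primeideal.I_notcarr by blast
    then have "c ?h \<subseteq> PL" using properL primeideal.axioms(1)[OF pr] by blast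
    then show "r \<in> P" using r frP[of r \<one>] S_one unfolding c'_def by blast
  qed
  ultimately obtain d where "prime_chain R d (length ys)" "d (length ys) = P"
    using prime_chain_cut[OF _ _ P len] by blast
  then show ?thesis using ysP gen by blast
qed

section \<open>Powers of ideals and prime avoidance\<close>

lemma (in ring) ideal_finsum:
  assumes A: "ideal A R" and "finite F" "\<And>i. i \<in> F \<Longrightarrow> f i \<in> A"
  shows "finsum R f F \<in> A"
proof -
  interpret ideal A R by fact
  show ?thesis using assms(2,3)
  proof (induction F)
    case empty then show ?case using additive_subgroup.zero_closed[OF is_additive_subgroup] by simp
  next
    case (insert x F)
    then have "finsum R f (insert x F) = f x \<oplus> finsum R f F"
      using Icarr by (intro finsum_insert) auto
    then show ?case using insert additive_subgroup.a_closed[OF is_additive_subgroup] by simp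
  qed
qed

context frob_exponent begin

lemma frob_span_prod:
  assumes A: "A \<subseteq> carrier R" and B: "B \<subseteq> carrier R" and x: "x \<in> frob_span R 1 A" and y: "y \<in> frob_span R 1 B"
  shows "x \<otimes> y \<in> frob_span R 1 {a \<otimes> b | a b. a \<in> A \<and> b \<in> B}"
proof -
  let ?C = "{a \<otimes> b | a b. a \<in> A \<and> b \<in> B}"
  have C: "?C \<subseteq> carrier R" using A B by auto
  have yc: "y \<in> carrier R" using E1.frob_span_closed[OF B y] .
  have a: "a \<otimes> y \<in> frob_span R 1 ?C" if a: "a \<in> A" for a
    using y
  proof induction
    case zero then show ?case using frob_span_zero a A by (simp add: subset_iff)
  next
    case (step w d b)
    have c: "w \<in> carrier R" "b \<in> carrier R" "a \<in> carrier R" using step.hyps E1.frob_span_closed[OF B] A B a by auto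
    have eq: "a \<otimes> (w \<oplus> d [^] (1::nat) \<otimes> b) = a \<otimes> w \<oplus> d [^] (1::nat) \<otimes> (a \<otimes> b)"
      using c step.hyps by (simp add: r_distr m_lcomm)
    have "a \<otimes> b \<in> ?C" using a step.hyps(3) by blast
    then show ?case unfolding eq by (intro frob_span_step step.IH step.hyps(2))
  qed
  show ?thesis using x
  proof induction
    case zero then show ?case using frob_span_zero yc by simp
  next
    case (step v c a')
    have cc: "v \<in> carrier R" "a' \<in> carrier R" using step.hyps E1.frob_span_closed[OF A] A by auto
    have eq: "(v \<oplus> c [^] (1::nat) \<otimes> a') \<otimes> y = v \<otimes> y \<oplus> c [^] (1::nat) \<otimes> (a' \<otimes> y)"
      using cc yc step.hyps by (simp add: l_distr m_assoc)
    show ?case unfolding eq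
      using E1.frob_span_plus[OF C E1.frob_span_smul[OF C a[OF step.hyps(3)] step.hyps(2)] step.IH] .
  qed
qed

end

context cring begin

definition ideal_power :: "'a set \<Rightarrow> nat \<Rightarrow> 'a set" where
  "ideal_power I k = I [^]\<^bsub>ideals_set R\<^esub> k"

lemma ideal_power_simps: "ideal_power I 0 = carrier R" "ideal_power I (Suc k) = ideal_prod R (ideal_power I k) I"
  by (simp_all add: ideal_power_def ideals_set_def)

lemma ideal_power_ideal:
  assumes "ideal I R"
  shows "ideal (ideal_power I k) R"
  using oneideal ideal_prod_is_ideal assms by (induction k) (auto simp: ideal_power_simps)

lemma ideal_power_foldr:
  assumes I: "ideal I R" and "set zs \<subseteq> I"
  shows "foldr (\<otimes>) zs \<one> \<in> ideal_power I (length zs)"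
  using assms(2)
proof (induction zs)
  case Nil then show ?case by (simp add: ideal_power_simps(1))
next
  case (Cons z zs)
  have c: "z \<in> carrier R" "foldr (\<otimes>) zs \<one> \<in> carrier R"
    using Cons ideal.Icarr[OF I] ideal.Icarr[OF ideal_power_ideal[OF I]] by auto
  have "foldr (\<otimes>) zs \<one> \<otimes> z \<in> ideal_prod R (ideal_power I (length zs)) I"
    using Cons by (intro ideal_prod.prod) auto
  moreover have "foldr (\<otimes>) (z # zs) \<one> = foldr (\<otimes>) zs \<one> \<otimes> z" using c by (simp add: m_comm)
  moreover have "length (z # zs) = Suc (length zs)" by simp
  ultimately show ?case by (simp only: ideal_power_simps(2))
qed

lemma ideal_power_mult:
  assumes I: "ideal I R" and "x \<in> ideal_power I k" "y \<in> I"
  shows "y \<otimes> x \<in> ideal_power I (Suc k)"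
proof -
  have "x \<otimes> y \<in> ideal_power I (Suc k)" unfolding ideal_power_simps(2) using assms(2,3) by (rule ideal_prod.prod)
  moreover have "x \<in> carrier R" "y \<in> carrier R"
    using assms ideal.Icarr[OF I] ideal.Icarr[OF ideal_power_ideal[OF I]] by auto
  ultimately show ?thesis using m_comm by simp
qed

text \<open>Local generation of \<open>I\<close> passes to its powers by multiplying denominators.
  The spanning products are indexed by lists, so that repetitions of a factor can be
  counted.\<close>

lemma ideal_power_span:
  assumes I: "ideal I R" and T: "mult_sys R T" and ys: "set ys \<subseteq> carrier R"
    and gen: "\<And>y. y \<in> I \<Longrightarrow> \<exists>s\<in>T. s \<otimes> y \<in> frob_span R 1 (set ys)" and "a \<in> ideal_power I k"
  shows "\<exists>s\<in>T. s \<otimes> a \<in> frob_span R 1 {foldr (\<otimes>) zs \<one> | zs. set zs \<subseteq> set ys \<and> length zs = k}"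
  using assms(5)
proof (induction k arbitrary: a)
  interpret T: mult_sys R T by (rule T)
  interpret E1: frob_exponent R 1 by (rule frob_exponent_1)
  let ?M = "\<lambda>k. {foldr (\<otimes>) zs \<one> | zs. set zs \<subseteq> set ys \<and> length zs = k}"
  have Mc: "?M k \<subseteq> carrier R" for k
  proof -
    have "foldr (\<otimes>) zs \<one> \<in> carrier R" if "set zs \<subseteq> set ys" for zs
      using that ys by (induction zs) auto
    then show ?thesis by blast
  qed
  {
    case 0
    have ac: "a \<in> carrier R" using 0 by (simp add: ideal_power_simps(1))
    have "\<one> \<in> ?M 0" by auto
    then have "\<zero> \<oplus> a [^] (1::nat) \<otimes> \<one> \<in> frob_span R 1 (?M 0)" using ac by (intro frob_span_step frob_span_zero)
    then have "\<one> \<otimes> a \<in> frob_span R 1 (?M 0)" using ac by simp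
    then show ?case using T.S_one by blast
  next
    case (Suc k)
    have "a \<in> ideal_prod R (ideal_power I k) I" using Suc.prems by (simp only: ideal_power_simps(2))
    then have "a \<in> carrier R \<and> (\<exists>s\<in>T. s \<otimes> a \<in> frob_span R 1 (?M (Suc k)))"
    proof induction
      case (prod i j)
      have c: "i \<in> carrier R" "j \<in> carrier R" using prod ideal.Icarr[OF I] ideal.Icarr[OF ideal_power_ideal[OF I]] by auto
      obtain s where s: "s \<in> T" "s \<otimes> i \<in> frob_span R 1 (?M k)" using Suc.IH[OF prod(1)] by blast
      obtain t where t: "t \<in> T" "t \<otimes> j \<in> frob_span R 1 (set ys)" using gen[OF prod(2)] by blast
      have st: "s \<in> carrier R" "t \<in> carrier R" using s t T.S_carr by auto
      have "(s \<otimes> i) \<otimes> (t \<otimes> j) \<in> frob_span R 1 {a \<otimes> b | a b. a \<in> ?M k \<and> b \<in> set ys}"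
        using E1.frob_span_prod[OF Mc ys s(2) t(2)] .
      moreover have "{a \<otimes> b | a b. a \<in> ?M k \<and> b \<in> set ys} \<subseteq> ?M (Suc k)"
      proof
        fix v assume "v \<in> {a \<otimes> b | a b. a \<in> ?M k \<and> b \<in> set ys}"
        then obtain zs b where zs: "set zs \<subseteq> set ys" "length zs = k" "b \<in> set ys" "v = foldr (\<otimes>) zs \<one> \<otimes> b" by blast
        have "foldr (\<otimes>) zs \<one> \<in> carrier R" "b \<in> carrier R" using zs ys Mc[of k] by blast+
        then have "v = foldr (\<otimes>) (b # zs) \<one>" using zs(4) by (simp add: m_comm)
        then show "v \<in> ?M (Suc k)" using zs by (intro CollectI exI[of _ "b # zs"]) auto
      qed
      moreover have "(s \<otimes> i) \<otimes> (t \<otimes> j) = (s \<otimes> t) \<otimes> (i \<otimes> j)" using c st by (simp add: m_ac)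
      ultimately have "(s \<otimes> t) \<otimes> (i \<otimes> j) \<in> frob_span R 1 (?M (Suc k))"
        using E1.frob_span_mono[OF Mc[of "Suc k"]] by auto
      then show ?case using T.S_mult[OF s(1) t(1)] c by blast
    next
      case (sum s1 s2)
      obtain s where s: "s \<in> T" "s \<otimes> s1 \<in> frob_span R 1 (?M (Suc k))" using sum by blast
      obtain t where t: "t \<in> T" "t \<otimes> s2 \<in> frob_span R 1 (?M (Suc k))" using sum by blast
      have st: "s \<in> carrier R" "t \<in> carrier R" "s1 \<in> carrier R" "s2 \<in> carrier R" using s t T.S_carr sum by auto
      have "(s \<otimes> t) \<otimes> (s1 \<oplus> s2) = t [^] (1::nat) \<otimes> (s \<otimes> s1) \<oplus> s [^] (1::nat) \<otimes> (t \<otimes> s2)"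
        using st by (simp add: r_distr m_ac)
      moreover have "t [^] (1::nat) \<otimes> (s \<otimes> s1) \<oplus> s [^] (1::nat) \<otimes> (t \<otimes> s2) \<in> frob_span R 1 (?M (Suc k))"
        using s t st by (intro E1.frob_span_plus[OF Mc] E1.frob_span_smul[OF Mc])
      ultimately have "(s \<otimes> t) \<otimes> (s1 \<oplus> s2) \<in> frob_span R 1 (?M (Suc k))" by (simp only:)
      then show ?case using T.S_mult[OF s(1) t(1)] st by blast
    qed
    then show ?case by blast
  }
qed

lemma foldr_extract:
  assumes "set zs \<subseteq> carrier R" "c \<le> count_list zs y" 
  shows "\<exists>zs'. set zs' \<subseteq> set zs \<and> length zs = length zs' + c \<and> foldr (\<otimes>) zs \<one> = y [^] c \<otimes> foldr (\<otimes>) zs' \<one>"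
  using assms
proof (induction c arbitrary: zs)
  case 0
  then show ?case using foldr_mult_append(2)[of zs] by (intro exI[of _ zs]) auto
next
  case (Suc c)
  then have "y \<in> set zs" using count_notin[of y zs] by fastforce
  then obtain us vs where zs: "zs = us @ y # vs" by (meson split_list)
  have c: "set us \<subseteq> carrier R" "set vs \<subseteq> carrier R" "set (us @ vs) \<subseteq> carrier R" "y \<in> carrier R" using Suc zs by auto
  have "c \<le> count_list (us @ vs) y" using Suc zs by simp
  then obtain zs' where zs': "set zs' \<subseteq> set (us @ vs)" "length (us @ vs) = length zs' + c"
    "foldr (\<otimes>) (us @ vs) \<one> = y [^] c \<otimes> foldr (\<otimes>) zs' \<one>" using Suc.IH[OF c(3)] by blast
  have d: "foldr (\<otimes>) us \<one> \<in> carrier R" "foldr (\<otimes>) vs \<one> \<in> carrier R" using foldr_mult_append(2) c by auto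
  have e: "foldr (\<otimes>) zs' \<one> \<in> carrier R" using foldr_mult_append(2)[of zs'] c zs'(1) by blast
  have "foldr (\<otimes>) zs \<one> = foldr (\<otimes>) us \<one> \<otimes> (y \<otimes> foldr (\<otimes>) vs \<one>)"
    unfolding zs using foldr_mult_append(1)[of us "y # vs"] c by simp
  also have "\<dots> = y \<otimes> foldr (\<otimes>) (us @ vs) \<one>"
    using foldr_mult_append(1)[OF c(1,2)] c d by (simp add: m_lcomm)
  also have "\<dots> = y [^] Suc c \<otimes> foldr (\<otimes>) zs' \<one>" unfolding zs'(3) using c e by (simp add: m_ac)
  finally show ?case using zs' zs by (intro exI[of _ zs']) auto
qed

lemma ex_outside:
  assumes "finite F" and P: "primeideal P R" and "\<And>P'. P' \<in> F \<Longrightarrow> ideal P' R \<and> \<not> P' \<subseteq> P"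
  shows "\<exists>z\<in>carrier R - P. \<forall>P'\<in>F. z \<in> P'"
  using assms(1,3)
proof (induction F)
  case empty
  interpret frob_exponent R 1 by (rule frob_exponent_1)
  show ?case using one_notin_prime[OF P] by blast
next
  case (insert Q F)
  interpret P: primeideal P R by (rule P)
  obtain z where z: "z \<in> carrier R - P" "\<forall>P'\<in>F. z \<in> P'" using insert by auto
  have Q: "ideal Q R" "\<not> Q \<subseteq> P" using insert.prems by auto
  then obtain q where q: "q \<in> Q" "q \<notin> P" by blast
  have qc: "q \<in> carrier R" using ideal.Icarr[OF Q(1) q(1)] .
  have "z \<otimes> q \<in> carrier R - P" using z q qc P.I_prime[of z q] by auto
  moreover have "z \<otimes> q \<in> P'" if P': "P' \<in> insert Q F" for P'
  proof (cases "P' = Q")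
    case True then show ?thesis using ideal.I_l_closed[OF Q(1) q(1)] z(1) by blast
  next
    case False
    then have "z \<in> P'" "ideal P' R" using P' z(2) insert.prems by auto
    then show ?thesis using ideal.I_r_closed qc by metis
  qed
  ultimately show ?case by blast
qed

text \<open>Induction on the set of primes. If the element \<open>s\<close> found for
  \<open>F\<close> lies in the new prime \<open>P\<close>, it is corrected by y z with
  \<open>y\<close> in \<open>A\<close> outside \<open>P\<close> and \<open>z\<close> in all members
  of \<open>F\<close> but not in \<open>P\<close>; such a \<open>z\<close> exists because the primes
  are incomparable.\<close>

lemma prime_avoidance:
  assumes "finite F" and "\<And>P. P \<in> F \<Longrightarrow> primeideal P R"
    and "\<And>P P'. P \<in> F \<Longrightarrow> P' \<in> F \<Longrightarrow> P \<subseteq> P' \<Longrightarrow> P = P'"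
    and A: "ideal A R" and "\<And>P. P \<in> F \<Longrightarrow> \<not> A \<subseteq> P"
  shows "\<exists>s\<in>A. \<forall>P\<in>F. s \<notin> P"
  using assms(1-3,5)
proof (induction F)
  case empty
  show ?case using additive_subgroup.zero_closed[OF ideal.axioms(1)[OF A]] by blast
next
  case (insert P F)
  have "\<exists>s\<in>A. \<forall>P\<in>F. s \<notin> P" by (rule insert.IH) (use insert.prems in auto)
  then obtain s where s: "s \<in> A" "\<forall>P\<in>F. s \<notin> P" by blast
  interpret P: primeideal P R using insert.prems by simp
  show ?case
  proof (cases "s \<in> P")
    case True
    obtain y where y: "y \<in> A" "y \<notin> P" using insert.prems(3)[of P] by blast
    have "ideal P' R \<and> \<not> P' \<subseteq> P" if P': "P' \<in> F" for P'
    proof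
      show "ideal P' R" using insert.prems(1)[of P'] P' primeideal.axioms(1) by blast
      show "\<not> P' \<subseteq> P" using insert.prems(2)[of P' P] P' insert.hyps(2) by blast
    qed
    then obtain z where z: "z \<in> carrier R - P" "\<forall>P'\<in>F. z \<in> P'"
      using ex_outside[OF insert.hyps(1) insert.prems(1)[of P]] by blast
    have c: "s \<in> carrier R" "y \<in> carrier R" "z \<in> carrier R" using s y z ideal.Icarr[OF A] by auto
    have yz: "y \<otimes> z \<notin> P" using P.I_prime[of y z] y z c by auto
    have "s \<oplus> y \<otimes> z \<in> A" using s(1) ideal.I_r_closed[OF A y(1)] z additive_subgroup.a_closed[OF ideal.axioms(1)[OF A]] by auto
    moreover have "s \<oplus> y \<otimes> z \<notin> P'" if P': "P' \<in> insert P F" for P'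
    proof
      assume a: "s \<oplus> y \<otimes> z \<in> P'"
      have P'id: "ideal P' R" using insert.prems(1)[OF P'] primeideal.axioms(1) by blast
      interpret frob_exponent R 1 by (rule frob_exponent_1)
      note sP' = P'id[folded frob_submodule_1_iff]
      show False
      proof (cases "P' = P")
        case True
        then show False using frob_submodule_cancel[OF sP' _ _ a] \<open>s \<in> P\<close> yz c by simp
      next
        case False
        then have F: "P' \<in> F" using P' by simp
        then have "y \<otimes> z \<in> P'" using z(2) ideal.I_l_closed[OF P'id _ c(2)] by blast
        then have "s \<in> P'" using frob_submodule_cancel[OF sP' _ c(1), of "y \<otimes> z"] a c by (simp add: a_comm)
        then show False using s(2) F by blast
      qed
    qed
    ultimately show ?thesis by blast
  qed (use s in blast)
qed

end

text \<open>Pigeonhole: if each of at most \<open>h\<close> elements occurred at most p - 1 times,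
  the list would have length at most h (p - 1).\<close>

lemma ex_count_list_ge:
  assumes "set zs \<subseteq> set ys" "length ys \<le> h" "h * (p - 1) < length zs" "0 < p"
  shows "\<exists>y\<in>set ys. p \<le> count_list zs y"
proof (rule ccontr)
  assume "\<not> ?thesis"
  then have "count_list zs y \<le> p - 1" if "y \<in> set ys" for y using that assms(4) by fastforce
  then have "sum (count_list zs) (set ys) \<le> (\<Sum>y\<in>set ys. p - 1)" by (rule sum_mono)
  also have "\<dots> = card (set ys) * (p - 1)" by simp
  also have "\<dots> \<le> h * (p - 1)" using card_length[of ys] assms(2) by (intro mult_le_mono1) linarith
  finally show False using sum_count_set[OF assms(1)] assms(3) by simp
qed

section \<open>Frobenius powers and functionals\<close>

context F_finite_ring begin

lemma frob_linear_finsum: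
  assumes "frob_linear R p \<phi>" "finite A" "f \<in> A \<rightarrow> carrier R"
  shows "\<phi> (finsum R f A) = finsum R (\<lambda>i. \<phi> (f i)) A"
  using assms(2,3)
proof (induction A)
  case empty then show ?case using frob_linear_zero[OF assms(1)] by simp
next
  case (insert x A)
  note L = frob_linearD[OF assms(1)]
  have "\<phi> (finsum R f (insert x A)) = \<phi> (f x \<oplus> finsum R f A)" using insert by (subst finsum_insert) auto
  also have "\<dots> = \<phi> (f x) \<oplus> finsum R (\<lambda>i. \<phi> (f i)) A" using insert L by auto
  also have "\<dots> = finsum R (\<lambda>i. \<phi> (f i)) (insert x A)" using insert L(1) by (subst finsum_insert) (auto simp: Pi_iff)
  finally show ?case .
qed

lemma pow_subset: "J \<subseteq> carrier R \<Longrightarrow> (\<lambda>x. x [^] p) ` J \<subseteq> carrier R"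
  by auto

lemma frob_power_frob_span:
  assumes "J \<subseteq> carrier R"
  shows "frob_power R p J = frob_span R 1 ((\<lambda>x. x [^] p) ` J)"
  unfolding frob_power_def using frob_span_1_eq_genideal[OF pow_subset[OF assms]] by simp

lemma frob_power_ideal:
  assumes "J \<subseteq> carrier R"
  shows "ideal (frob_power R p J) R"
  unfolding frob_power_def using genideal_ideal[OF pow_subset[OF assms]] .

lemma frob_power_pow:
  assumes "J \<subseteq> carrier R" "x \<in> J"
  shows "x [^] p \<in> frob_power R p J"
  unfolding frob_power_def using genideal_self[OF pow_subset[OF assms(1)]] assms(2) by blast

text \<open>In one direction, multiples of x^p with x \<in> J are sent into x R. In the other,
  \<open>g\<close> is a combination of the \<open>b i\<close> whose coefficients are the p-th powers
  of \<open>\<Phi> (e i \<otimes> g)\<close>, and these values lie in \<open>J\<close>.\<close>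

lemma mem_frob_power_iff:
  assumes D: "frob_dual R p \<Phi> I e b" and J: "ideal J R" and g: "g \<in> carrier R"
  shows "g \<in> frob_power R p J \<longleftrightarrow> (\<forall>r\<in>carrier R. \<Phi> (r \<otimes> g) \<in> J)"
proof
  have Jc: "J \<subseteq> carrier R" using ideal.Icarr[OF J] by blast
  have L: "frob_linear R p \<Phi>" using D by (simp add: frob_dual_def)
  note LD = frob_linearD[OF L]
  {
    assume "g \<in> frob_power R p J"
    then have "g \<in> frob_span R 1 ((\<lambda>x. x [^] p) ` J)" using frob_power_frob_span[OF Jc] by simp
    then show "\<forall>r\<in>carrier R. \<Phi> (r \<otimes> g) \<in> J"
    proof induction
      case zero
      show ?case using frob_linear_zero[OF L] additive_subgroup.zero_closed[OF ideal.axioms(1)[OF J]] by simp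
    next
      case (step v c y)
      show ?case
      proof
        fix r assume r: "r \<in> carrier R"
        obtain x where x: "x \<in> J" "y = x [^] p" using step.hyps by blast
        have cc: "v \<in> carrier R" "x \<in> carrier R" using step.hyps x Jc E1.frob_span_closed[OF pow_subset[OF Jc]] by auto
        have "r \<otimes> (v \<oplus> c [^] (1::nat) \<otimes> y) = r \<otimes> v \<oplus> x [^] p \<otimes> (r \<otimes> c)"
          unfolding x(2) using cc r step.hyps(2) by (simp add: r_distr m_ac)
        then have "\<Phi> (r \<otimes> (v \<oplus> c [^] (1::nat) \<otimes> y)) = \<Phi> (r \<otimes> v) \<oplus> x \<otimes> \<Phi> (r \<otimes> c)"
          using LD cc r step.hyps(2) by simp
        then show "\<Phi> (r \<otimes> (v \<oplus> c [^] (1::nat) \<otimes> y)) \<in> J"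
          using step.IH r ideal.I_r_closed[OF J x(1)] LD(1) step.hyps(2)
            additive_subgroup.a_closed[OF ideal.axioms(1)[OF J]] by simp
      qed
    qed
  next
    assume H: "\<forall>r\<in>carrier R. \<Phi> (r \<otimes> g) \<in> J"
    have eb: "finite I" "e \<in> I \<rightarrow> carrier R" "b \<in> I \<rightarrow> carrier R" "g = (\<Oplus>i\<in>I. \<Phi> (e i \<otimes> g) [^] p \<otimes> b i)"
      using D g unfolding frob_dual_def by blast+
    have "(\<Oplus>i\<in>I. \<Phi> (e i \<otimes> g) [^] p \<otimes> b i) \<in> frob_power R p J"
    proof (rule ideal_finsum[OF frob_power_ideal[OF Jc] eb(1)])
      fix i assume i: "i \<in> I"
      have "\<Phi> (e i \<otimes> g) \<in> J" using H eb(2) i by auto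
      then show "\<Phi> (e i \<otimes> g) [^] p \<otimes> b i \<in> frob_power R p J"
        using ideal.I_r_closed[OF frob_power_ideal[OF Jc] frob_power_pow[OF Jc]] eb(3) i by blast
    qed
    then show "g \<in> frob_power R p J" using eb(4) by simp
  }
qed

text \<open>The multiplier is \<open>\<Sum> \<phi>(b\<^sub>i)\<^sup>p e\<^sub>i\<close>. After
  expanding \<open>g\<close> in the \<open>b i\<close>, the value of \<open>\<phi>\<close> is
  \<open>\<Sum> \<Phi>(e\<^sub>i g) \<phi>(b\<^sub>i)\<close>, and the factor
  \<open>\<phi>(b\<^sub>i)\<close> moves under \<open>\<Phi>\<close> as its p-th power.\<close>

lemma frob_dual_rep:
  assumes D: "frob_dual R p \<Phi> I e b" and phi: "frob_linear R p \<phi>"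
  shows "\<exists>f\<in>carrier R. \<forall>g\<in>carrier R. \<phi> g = \<Phi> (f \<otimes> g)"
proof
  have L: "frob_linear R p \<Phi>" and eb: "finite I" "e \<in> I \<rightarrow> carrier R" "b \<in> I \<rightarrow> carrier R"
    using D by (auto simp: frob_dual_def)
  note LD = frob_linearD[OF L] and PD = frob_linearD[OF phi]
  let ?f = "\<Oplus>i\<in>I. \<phi> (b i) [^] p \<otimes> e i"
  have t: "(\<lambda>i. \<phi> (b i) [^] p \<otimes> e i) \<in> I \<rightarrow> carrier R" using eb PD(1) by (auto simp: Pi_iff)
  show "?f \<in> carrier R" using t by (rule finsum_closed)
  show "\<forall>g\<in>carrier R. \<phi> g = \<Phi> (?f \<otimes> g)"
  proof
    fix g assume g: "g \<in> carrier R"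
    have "?f \<otimes> g = (\<Oplus>i\<in>I. \<phi> (b i) [^] p \<otimes> (e i \<otimes> g))"
      unfolding finsum_ldistr[OF eb(1) g t] using eb PD(1) g
      by (intro finsum_cong') (auto simp: m_assoc Pi_iff)
    then have "\<Phi> (?f \<otimes> g) = (\<Oplus>i\<in>I. \<Phi> (\<phi> (b i) [^] p \<otimes> (e i \<otimes> g)))"
      using frob_linear_finsum[OF L eb(1), of "\<lambda>i. \<phi> (b i) [^] p \<otimes> (e i \<otimes> g)"] eb PD(1) g by (simp add: Pi_iff)
    also have "\<dots> = (\<Oplus>i\<in>I. \<Phi> (e i \<otimes> g) \<otimes> \<phi> (b i))"
      using eb PD(1) LD g by (intro finsum_cong') (auto simp: Pi_iff m_comm)
    also have "\<dots> = (\<Oplus>i\<in>I. \<phi> (\<Phi> (e i \<otimes> g) [^] p \<otimes> b i))"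
      using eb PD LD g by (intro finsum_cong') (auto simp: Pi_iff)
    also have "\<dots> = \<phi> (\<Oplus>i\<in>I. \<Phi> (e i \<otimes> g) [^] p \<otimes> b i)"
      using frob_linear_finsum[OF phi eb(1), of "\<lambda>i. \<Phi> (e i \<otimes> g) [^] p \<otimes> b i"] eb LD g by (simp add: Pi_iff)
    also have "(\<Oplus>i\<in>I. \<Phi> (e i \<otimes> g) [^] p \<otimes> b i) = g" using D g by (simp add: frob_dual_def)
    finally show "\<phi> g = \<Phi> (?f \<otimes> g)" by simp
  qed
qed

end

section \<open>Symbolic powers and colon ideals\<close>

locale symbolic = F_finite_ring R p for R (structure) and p :: nat +
  fixes I :: "'a set" and H :: nat
  assumes reg: "regular_ring R" and rad: "radical_ideal R I" and H: "big_height R I = enat H"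
begin

definition S :: "'a set" where
  "S = carrier R - \<Union>(minimal_primes R I)"

lemma I_ideal: "ideal I R"
  using rad by (simp add: radical_ideal_def)

lemma I_sub: "I \<subseteq> carrier R"
  using ideal.Icarr[OF I_ideal] by blast

lemma minp: "P \<in> minimal_primes R I \<Longrightarrow> primeideal P R" "P \<in> minimal_primes R I \<Longrightarrow> I \<subseteq> P"
  by (auto simp: minimal_primes_def)

sublocale MS: mult_sys R S
proof
  show "S \<subseteq> carrier R" by (auto simp: S_def)
  show "\<one> \<in> S" using Ep.one_notin_prime minp(1) by (auto simp: S_def)
  show "s \<otimes> t \<in> S" if "s \<in> S" "t \<in> S" for s t
    using that primeideal.I_prime[OF minp(1), of _ s t] by (auto simp: S_def)
qed

lemma S_notin: "s \<in> S \<Longrightarrow> P \<in> minimal_primes R I \<Longrightarrow> s \<in> carrier R - P"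
  by (auto simp: S_def)

lemma mem_symb: "r \<in> symbolic_power R I n \<longleftrightarrow> r \<in> carrier R \<and> (\<exists>s\<in>S. s \<otimes> r \<in> ideal_power I n)"
  unfolding symbolic_power_def Let_def S_def[symmetric]
  using MS.loc_map_ext_iff[OF ideal_power_ideal[OF I_ideal, of n]] by (auto simp: ideal_power_def)

lemma ideal_power_symb: "ideal_power I n \<subseteq> symbolic_power R I n"
  using mem_symb MS.S_one ideal.Icarr[OF ideal_power_ideal[OF I_ideal]] by (auto intro!: bexI[of _ \<one>])

lemma symb_ideal: "ideal (symbolic_power R I n) R"
proof -
  note id = ideal_power_ideal[OF I_ideal, of n]
  have "frob_submodule R 1 (symbolic_power R I n)"
    unfolding frob_submodule_def
  proof (intro conjI ballI)
    show "symbolic_power R I n \<subseteq> carrier R" using mem_symb by blast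
    show "\<zero> \<in> symbolic_power R I n"
      using ideal_power_symb additive_subgroup.zero_closed[OF ideal.axioms(1)[OF id]] by blast
  next
    fix x y assume "x \<in> symbolic_power R I n" "y \<in> symbolic_power R I n"
    then obtain s t where st: "x \<in> carrier R" "s \<in> S" "s \<otimes> x \<in> ideal_power I n" "y \<in> carrier R" "t \<in> S" "t \<otimes> y \<in> ideal_power I n"
      using mem_symb by blast
    have c: "s \<in> carrier R" "t \<in> carrier R" using st MS.S_carr by auto
    have "(s \<otimes> t) \<otimes> (x \<oplus> y) = t \<otimes> (s \<otimes> x) \<oplus> s \<otimes> (t \<otimes> y)" using st c by (simp add: r_distr m_ac)
    also have "\<dots> \<in> ideal_power I n"
      using ideal.I_l_closed[OF id] st c additive_subgroup.a_closed[OF ideal.axioms(1)[OF id]] by simp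
    finally show "x \<oplus> y \<in> symbolic_power R I n" using mem_symb st MS.S_mult by blast
  next
    fix c x assume "c \<in> carrier R" "x \<in> symbolic_power R I n"
    then obtain s where s: "c \<in> carrier R" "x \<in> carrier R" "s \<in> S" "s \<otimes> x \<in> ideal_power I n"
      using mem_symb by blast
    have "s \<otimes> (c [^] (1::nat) \<otimes> x) = c \<otimes> (s \<otimes> x)" using s MS.S_carr by (simp add: m_lcomm)
    then have "s \<otimes> (c [^] (1::nat) \<otimes> x) \<in> ideal_power I n" using ideal.I_l_closed[OF id s(4) s(1)] by (simp only:)
    then show "c [^] (1::nat) \<otimes> x \<in> symbolic_power R I n"
      unfolding mem_symb using s(1-3) by (intro conjI bexI[of _ s]) auto
  qed
  then show ?thesis using frob_submodule_1_iff by blast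
qed

lemma symb_sub: "symbolic_power R I n \<subseteq> carrier R"
  using mem_symb by blast

lemma symb_saturated:
  assumes "s \<in> S" "r \<in> carrier R" "s \<otimes> r \<in> symbolic_power R I n"
  shows "r \<in> symbolic_power R I n"
proof -
  obtain t where t: "t \<in> S" "t \<otimes> (s \<otimes> r) \<in> ideal_power I n" using assms(3) mem_symb by blast
  have "(t \<otimes> s) \<otimes> r = t \<otimes> (s \<otimes> r)" using assms t MS.S_carr by (simp add: m_assoc)
  then show ?thesis using t assms mem_symb MS.S_mult by metis
qed

text \<open>\<open>S\<close> is the complement of the union of finitely many incomparable primes, so
  prime avoidance lets a denominator be sought one minimal prime at a time.\<close>

lemma meets_S:
  assumes A: "ideal A R" and "\<And>P. P \<in> minimal_primes R I \<Longrightarrow> \<exists>s\<in>A. s \<notin> P"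
  shows "\<exists>s\<in>A. s \<in> S"
proof -
  have "\<exists>s\<in>A. \<forall>P\<in>minimal_primes R I. s \<notin> P"
  proof (rule prime_avoidance[OF finite_minimal_primes[OF I_ideal] minp(1) _ A])
    show "P = P'" if "P \<in> minimal_primes R I" "P' \<in> minimal_primes R I" "P \<subseteq> P'" for P P'
      using that by (auto simp: minimal_primes_def)
    show "\<not> A \<subseteq> P" if "P \<in> minimal_primes R I" for P using assms(2)[OF that] by blast
  qed
  then show ?thesis using ideal.Icarr[OF A] by (auto simp: S_def)
qed

text \<open>\<open>I\<close> and \<open>P\<close> agree after localization at \<open>P\<close>,
  since \<open>I\<close> is radical. In the list of primes whose product lies in \<open>I\<close>,
  \<open>x\<close> is used wherever \<open>P\<close> occurs and an element outside \<open>P\<close>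
  elsewhere, which gives s x^k \<in> I.\<close>

lemma minimal_prime_local:
  assumes P: "P \<in> minimal_primes R I" and x: "x \<in> P"
  shows "\<exists>s\<in>carrier R - P. s \<otimes> x \<in> I"
proof -
  interpret P: primeideal P R by (rule minp(1)[OF P])
  have xc: "x \<in> carrier R" using x P.Icarr by blast
  obtain Ps where Ps: "\<forall>P\<in>set Ps. primeideal P R \<and> I \<subseteq> P"
    "\<forall>ys. list_all2 (\<in>) ys Ps \<longrightarrow> foldr (\<otimes>) ys \<one> \<in> I"
    using prime_cover[OF I_ideal] by blast
  have "\<exists>y. y \<in> Q \<and> (if Q = P then y = x else y \<in> carrier R - P)" if Q: "Q \<in> set Ps" for Q
  proof (cases "Q = P")
    case False
    have "primeideal Q R" "I \<subseteq> Q" using Ps Q by auto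
    then have "\<not> Q \<subseteq> P" using P False unfolding minimal_primes_def by blast
    then obtain y where "y \<in> Q" "y \<notin> P" by blast
    moreover have "y \<in> carrier R" using ideal.Icarr[OF primeideal.axioms(1)[OF \<open>primeideal Q R\<close>] \<open>y \<in> Q\<close>] .
    ultimately show ?thesis using False by auto
  qed (use x in auto)
  then obtain y where y: "\<And>Q. Q \<in> set Ps \<Longrightarrow> y Q \<in> Q \<and> (if Q = P then y Q = x else y Q \<in> carrier R - P)" by metis
  have "\<exists>s\<in>carrier R - P. \<exists>k::nat. foldr (\<otimes>) (map y Qs) \<one> = s \<otimes> x [^] k" if "set Qs \<subseteq> set Ps" for Qs
    using that
  proof (induction Qs)
    case Nil
    show ?case using Ep.one_notin_prime[OF minp(1)[OF P]] by (intro bexI[of _ \<one>] exI[of _ 0]) auto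
  next
    case (Cons Q Qs)
    then obtain s and k :: nat where s: "s \<in> carrier R - P" "foldr (\<otimes>) (map y Qs) \<one> = s \<otimes> x [^] k" by auto
    show ?case
    proof (cases "Q = P")
      case True
      then have "y Q = x" using y[of Q] Cons.prems by auto
      then have "foldr (\<otimes>) (map y (Q # Qs)) \<one> = s \<otimes> x [^] Suc k" using s xc by (simp add: m_ac)
      then show ?thesis using s by blast
    next
      case False
      then have yQ: "y Q \<in> carrier R - P" using y[of Q] Cons.prems by auto
      then have "foldr (\<otimes>) (map y (Q # Qs)) \<one> = (y Q \<otimes> s) \<otimes> x [^] k" using s xc by (simp add: m_assoc)
      moreover have "y Q \<otimes> s \<in> carrier R - P" using yQ s P.I_prime by auto
      ultimately show ?thesis by blast
    qed
  qed
  from this[OF order_refl] obtain s and k :: nat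
    where s: "s \<in> carrier R - P" "foldr (\<otimes>) (map y Ps) \<one> = s \<otimes> x [^] k" by blast
  have "list_all2 (\<in>) (map y Ps) Ps" using y by (auto simp: list_all2_conv_all_nth)
  then have "s \<otimes> x [^] k \<in> I" using Ps(2) s(2) by metis
  \<comment> \<open>The factor s^k x completes s x^k to the power (s x)^(k + 1), also for k =
    0.\<close>
  then have "(s [^] k \<otimes> x) \<otimes> (s \<otimes> x [^] k) \<in> I" using ideal.I_l_closed[OF I_ideal] s xc by simp
  moreover have "(s \<otimes> x) [^] Suc k = (s [^] k \<otimes> x) \<otimes> (s \<otimes> x [^] k)"
    using s xc by (simp add: nat_pow_distrib m_ac)
  ultimately have "(s \<otimes> x) [^] Suc k \<in> I" by simp
  moreover have "s \<otimes> x \<in> carrier R" using s xc by simp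
  ultimately have "s \<otimes> x \<in> I" using rad unfolding radical_ideal_def by blast
  then show ?thesis using s by blast
qed

text \<open>Regularity gives at most as many local generators of \<open>P\<close> as its height,
  hence at most \<open>H\<close>. A common denominator moves them from \<open>P\<close> into
  \<open>I\<close>.\<close>

lemma local_gens:
  assumes P: "P \<in> minimal_primes R I"
  shows "\<exists>ys. set ys \<subseteq> I \<and> length ys \<le> H \<and> (\<forall>y\<in>I. \<exists>s\<in>carrier R - P. s \<otimes> y \<in> frob_span R 1 (set ys))"
proof -
  interpret P: primeideal P R by (rule minp(1)[OF P])
  interpret MP: mult_sys R "carrier R - P" by (rule mult_sys_prime[OF minp(1)[OF P]])
  obtain xs c where xs: "set xs \<subseteq> P" "\<forall>y\<in>P. \<exists>s\<in>carrier R - P. s \<otimes> y \<in> frob_span R 1 (set xs)"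
    "prime_chain R c (length xs)" "c (length xs) = P"
    using regular_prime[OF reg minp(1)[OF P]] by blast
  have xsc: "set xs \<subseteq> carrier R" using xs(1) P.Icarr by blast
  have "enat (length xs) \<le> prime_height R P"
    unfolding prime_height_def using xs(3,4) by (intro Sup_upper) blast
  also have "\<dots> \<le> enat H" unfolding H[symmetric] big_height_def using P by (intro SUP_upper)
  finally have len: "length xs \<le> H" by simp
  have "\<exists>s\<in>carrier R - P. \<forall>x\<in>set zs. s \<otimes> x \<in> I" if "set zs \<subseteq> P" for zs
    using that
  proof (induction zs)
    case Nil show ?case using MP.S_one by (intro bexI[of _ \<one>]) auto
  next
    case (Cons z zs)
    then obtain s where s: "s \<in> carrier R - P" "\<forall>x\<in>set zs. s \<otimes> x \<in> I" by auto
    obtain t where t: "t \<in> carrier R - P" "t \<otimes> z \<in> I" using minimal_prime_local[OF P] Cons.prems by auto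
    have "(s \<otimes> t) \<otimes> x \<in> I" if x: "x \<in> set (z # zs)" for x
    proof -
      have xc: "x \<in> carrier R" using x Cons.prems P.Icarr by blast
      have "(s \<otimes> t) \<otimes> x = s \<otimes> (t \<otimes> x)" "(s \<otimes> t) \<otimes> x = t \<otimes> (s \<otimes> x)"
        using s t xc by (simp_all add: m_ac)
      moreover have "t \<otimes> x \<in> I \<or> s \<otimes> x \<in> I" using x s(2) t(2) by auto
      ultimately show ?thesis using s(1) t(1) ideal.I_l_closed[OF I_ideal] by (metis DiffD1)
    qed
    then show ?case using MP.S_mult[OF s(1) t(1)] by blast
  qed
  from this[OF xs(1)] obtain s where s: "s \<in> carrier R - P" "\<forall>x\<in>set xs. s \<otimes> x \<in> I" by blast
  let ?ys = "map (\<lambda>x. x \<otimes> s) xs"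
  have ysI: "set ?ys \<subseteq> I"
  proof
    fix v assume "v \<in> set ?ys"
    then obtain x where x: "x \<in> set xs" "v = x \<otimes> s" by auto
    then show "v \<in> I" using s xsc m_comm[of x s] by auto
  qed
  have "\<exists>t\<in>carrier R - P. t \<otimes> y \<in> frob_span R 1 (set ?ys)" if y: "y \<in> I" for y
  proof -
    obtain t where t: "t \<in> carrier R - P" "t \<otimes> y \<in> frob_span R 1 (set xs)" using xs(2) y minp(2)[OF P] by blast
    have "(t \<otimes> y) \<otimes> s \<in> frob_span R 1 ((\<lambda>x. x \<otimes> s) ` set xs)" using E1.frob_span_scale[OF xsc _ t(2)] s by blast
    moreover have "(t \<otimes> y) \<otimes> s = (s \<otimes> t) \<otimes> y" using s t y I_sub by (auto simp: m_ac)
    ultimately show ?thesis using MP.S_mult[OF s(1) t(1)] by auto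
  qed
  then show ?thesis using ysI len by (intro exI[of _ ?ys]) auto
qed

abbreviation colon_n :: "nat \<Rightarrow> 'a set" where
  "colon_n n \<equiv> colon_ideal R (frob_power R p (symbolic_power R I (n + 1))) (symbolic_power R I (n * p + 1))"

text \<open>Absorbs the p-th power extracted by the pigeonhole principle into the Frobenius power of
  the next symbolic power.\<close>

lemma frob_power_mult:
  assumes y: "y \<in> I" and w: "w \<in> frob_power R p (symbolic_power R I n)"
  shows "y [^] p \<otimes> w \<in> frob_power R p (symbolic_power R I (Suc n))"
proof -
  let ?J = "symbolic_power R I n" and ?J' = "symbolic_power R I (Suc n)"
  have yc: "y \<in> carrier R" using y I_sub by blast
  have "w \<in> frob_span R 1 ((\<lambda>x. x [^] p) ` ?J)" using w frob_power_frob_span[OF symb_sub] by simp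
  then show ?thesis
  proof induction
    case zero
    show ?case using additive_subgroup.zero_closed[OF ideal.axioms(1)[OF frob_power_ideal[OF symb_sub]]] yc by simp
  next
    case (step v c x)
    obtain j where j: "j \<in> ?J" "x = j [^] p" using step.hyps by blast
    have jc: "j \<in> carrier R" "v \<in> carrier R" using j symb_sub step.hyps E1.frob_span_closed[OF pow_subset[OF symb_sub]] by auto
    obtain t where t: "t \<in> S" "t \<otimes> j \<in> ideal_power I n" using j mem_symb by blast
    have "y \<otimes> (t \<otimes> j) \<in> ideal_power I (Suc n)" using ideal_power_mult[OF I_ideal t(2) y] .
    moreover have "y \<otimes> (t \<otimes> j) = t \<otimes> (y \<otimes> j)" using yc jc t MS.S_carr by (simp add: m_lcomm)
    ultimately have "y \<otimes> j \<in> ?J'" using mem_symb t(1) yc jc by auto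
    then have "c \<otimes> (y \<otimes> j) [^] p \<in> frob_power R p ?J'"
      using ideal.I_l_closed[OF frob_power_ideal[OF symb_sub] frob_power_pow[OF symb_sub]] step.hyps(2) by blast
    moreover have "y [^] p \<otimes> (v \<oplus> c [^] (1::nat) \<otimes> x) = y [^] p \<otimes> v \<oplus> c \<otimes> (y \<otimes> j) [^] p"
      using yc jc j step.hyps(2) by (simp add: r_distr Ep.pow_mult m_ac)
    ultimately show ?case
      using step.IH additive_subgroup.a_closed[OF ideal.axioms(1)[OF frob_power_ideal[OF symb_sub]]] by simp
  qed
qed

text \<open>At a minimal prime \<open>I\<close> is generated by at most \<open>H\<close> elements, so a product of \<open>(n + 1) p + 1\<close> of
  them contains a \<open>p\<close>-th power as soon as \<open>(n + 1) p \<ge> H (p - 1)\<close>.\<close>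

lemma colon_step:
  assumes D: "frob_dual R p \<Phi> B e b" and n: "H * (p - 1) \<le> Suc n * p" and f: "f \<in> colon_n n"
  shows "f \<in> colon_n (Suc n)"
proof -
  have fc: "f \<in> carrier R" using f by (simp add: colon_ideal_def)
  let ?J = "symbolic_power R I (n + 1)" and ?J' = "symbolic_power R I (Suc n + 1)"
  note idJ' = frob_power_ideal[OF symb_sub, of "Suc n + 1"]
  have "f \<otimes> a \<in> frob_power R p ?J'" if a: "a \<in> symbolic_power R I (Suc n * p + 1)" for a
  proof -
    have ac: "a \<in> carrier R" using a symb_sub by blast
    \<comment> \<open>The multipliers of f a into the Frobenius power form an ideal, so it suffices
      to find one outside each minimal prime; the result is a single multiplier in
      \<open>S\<close>.\<close>
    let ?A = "{s \<in> carrier R. s [^] (1::nat) \<otimes> (f \<otimes> a) \<in> frob_power R p ?J'}"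
    have A: "ideal ?A R"
      using E1.frob_submodule_colon[OF idJ'[folded frob_submodule_1_iff], of "f \<otimes> a"] fc ac frob_submodule_1_iff by blast
    have "\<exists>s\<in>?A. s \<notin> P" if P: "P \<in> minimal_primes R I" for P
    proof -
      interpret P: primeideal P R by (rule minp(1)[OF P])
      interpret MP: mult_sys R "carrier R - P" by (rule mult_sys_prime[OF minp(1)[OF P]])
      obtain ys where ys: "set ys \<subseteq> I" "length ys \<le> H" "\<And>y. y \<in> I \<Longrightarrow> \<exists>s\<in>carrier R - P. s \<otimes> y \<in> frob_span R 1 (set ys)"
        using local_gens[OF P] by blast
      have ysc: "set ys \<subseteq> carrier R" using ys(1) I_sub by blast
      obtain t where t: "t \<in> S" "t \<otimes> a \<in> ideal_power I (Suc n * p + 1)" using a mem_symb by blast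
      let ?M = "{foldr (\<otimes>) zs \<one> | zs. set zs \<subseteq> set ys \<and> length zs = Suc n * p + 1}"
      obtain s where s: "s \<in> carrier R - P" "s \<otimes> (t \<otimes> a) \<in> frob_span R 1 ?M"
        using ideal_power_span[OF I_ideal MP.mult_sys_axioms ysc ys(3) t(2)] by blast
      have tc: "t \<in> carrier R - P" using S_notin[OF t(1) P] .
      have z: "foldr (\<otimes>) zs \<one> \<otimes> f \<in> frob_power R p ?J' \<and> foldr (\<otimes>) zs \<one> \<in> carrier R"
        if zs: "set zs \<subseteq> set ys" "length zs = Suc n * p + 1" for zs
      proof -
        have zc: "set zs \<subseteq> carrier R" using zs(1) ysc by blast
        have "H * (p - 1) < length zs" using n zs(2) by simp
        then obtain y where y: "y \<in> set ys" "p \<le> count_list zs y"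
          using ex_count_list_ge[OF zs(1) ys(2) _ Ep.e_pos] by blast
        obtain zs' where zs': "set zs' \<subseteq> set zs" "length zs = length zs' + p"
          "foldr (\<otimes>) zs \<one> = y [^] p \<otimes> foldr (\<otimes>) zs' \<one>" using foldr_extract[OF zc y(2)] by blast
        \<comment> \<open>Removing \<open>p\<close> of the (n + 1) p + 1 factors leaves exactly the
          exponent n p + 1 of \<open>colon_n n\<close>.\<close>
        have l: "length zs' = n * p + 1" using zs'(2) zs(2) by simp
        have "foldr (\<otimes>) zs' \<one> \<in> ideal_power I (n * p + 1)"
          using ideal_power_foldr[OF I_ideal, of zs'] zs'(1) zs(1) ys(1) l by auto
        then have m: "foldr (\<otimes>) zs' \<one> \<in> symbolic_power R I (n * p + 1)" using ideal_power_symb by blast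
        then have "f \<otimes> foldr (\<otimes>) zs' \<one> \<in> frob_power R p ?J" using f by (auto simp: colon_ideal_def)
        then have "y [^] p \<otimes> (f \<otimes> foldr (\<otimes>) zs' \<one>) \<in> frob_power R p ?J'"
          using frob_power_mult[of y _ "n + 1"] y(1) ys(1) by auto
        moreover have "foldr (\<otimes>) zs' \<one> \<in> carrier R" "y \<in> carrier R" using m symb_sub y ysc by auto
        ultimately show ?thesis using zs'(3) fc by (auto simp: m_ac)
      qed
      have Mc: "?M \<subseteq> carrier R" using z by blast
      have "v \<otimes> f \<in> frob_power R p ?J'" if "v \<in> frob_span R 1 ?M" for v
        using that
      proof induction
        case zero show ?case using additive_subgroup.zero_closed[OF ideal.axioms(1)[OF idJ']] fc by simp
      next
        case (step v c w)
        have c: "v \<in> carrier R" "w \<in> carrier R" using step.hyps E1.frob_span_closed[OF Mc] Mc by auto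
        have "w \<otimes> f \<in> frob_power R p ?J'" using z step.hyps(3) by blast
        then have "c \<otimes> (w \<otimes> f) \<in> frob_power R p ?J'" using ideal.I_l_closed[OF idJ'] step.hyps(2) by blast
        moreover have "(v \<oplus> c [^] (1::nat) \<otimes> w) \<otimes> f = v \<otimes> f \<oplus> c \<otimes> (w \<otimes> f)"
          using c fc step.hyps(2) by (simp add: l_distr m_assoc)
        ultimately show ?case using step.IH additive_subgroup.a_closed[OF ideal.axioms(1)[OF idJ']] by simp
      qed
      then have "(s \<otimes> (t \<otimes> a)) \<otimes> f \<in> frob_power R p ?J'" using s(2) by blast
      moreover have "(s \<otimes> (t \<otimes> a)) \<otimes> f = (s \<otimes> t) [^] (1::nat) \<otimes> (f \<otimes> a)" using s tc ac fc by (simp add: m_ac)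
      ultimately have "s \<otimes> t \<in> ?A" using s tc by simp
      then show ?thesis using MP.S_mult[OF s(1) tc] by blast
    qed
    then obtain s where s: "s \<in> ?A" "s \<in> S" using meets_S[OF A] by blast
    then have sm: "s \<in> carrier R" "s \<otimes> (f \<otimes> a) \<in> frob_power R p ?J'" by auto
    have L: "frob_linear R p \<Phi>" using D by (simp add: frob_dual_def)
    show ?thesis
    proof (subst mem_frob_power_iff[OF D symb_ideal], simp add: fc ac, intro ballI)
      fix r assume r: "r \<in> carrier R"
      \<comment> \<open>The Frobenius power is saturated with respect to \<open>S\<close>:
        multiplying by s^(p - 1) completes \<open>s\<close> to s^p, which \<open>\<Phi>\<close>
        turns into the factor \<open>s\<close>, and symbolic powers are saturated.\<close>
      obtain q where q: "p = Suc q" using Ep.e_pos by (cases p) auto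
      have "(r \<otimes> s [^] q) \<otimes> (s \<otimes> (f \<otimes> a)) = s [^] p \<otimes> (r \<otimes> (f \<otimes> a))"
        unfolding q using r sm fc ac by (simp add: m_ac)
      moreover have "\<Phi> ((r \<otimes> s [^] q) \<otimes> (s \<otimes> (f \<otimes> a))) \<in> ?J'"
        using mem_frob_power_iff[OF D symb_ideal] sm r fc ac by (meson m_closed nat_pow_closed)
      ultimately have "s \<otimes> \<Phi> (r \<otimes> (f \<otimes> a)) \<in> ?J'" using frob_linearD(3)[OF L] sm r fc ac by simp
      then show "\<Phi> (r \<otimes> (f \<otimes> a)) \<in> ?J'" using symb_saturated[OF s(2)] frob_linearD(1)[OF L] r fc ac by simp
    qed
  qed
  then show ?thesis using fc by (auto simp: colon_ideal_def)
qed

lemma colon_all: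
  assumes D: "frob_dual R p \<Phi> B e b" and \<delta>: "\<delta> = (if p \<le> H then 1 else (0::nat))"
    and f: "f \<in> (\<Inter>n\<in>{0..nat (max 0 (int H - 1 - int \<delta>))}. colon_n n)"
  shows "f \<in> colon_n n"
proof -
  let ?n0 = "nat (max 0 (int H - 1 - int \<delta>))"
  \<comment> \<open>The last index of the intersection is already in the range where
    \<open>colon_step\<close> applies, also when it is truncated to 0, so the induction can start
    there.\<close>
  have bound: "H * (p - 1) \<le> Suc n * p" if "?n0 \<le> n" for n
  proof (cases "p \<le> H")
    case True
    have "int H - 2 \<le> int n" using that True \<delta> by auto
    then have "H - 1 \<le> Suc n" by linarith
    then have "(H - 1) * p \<le> Suc n * p" by (rule mult_le_mono1)
    moreover have "H * (p - 1) \<le> (H - 1) * p" using True by (simp add: diff_mult_distrib diff_mult_distrib2)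
    ultimately show ?thesis by linarith
  next
    case False
    then have "H \<le> Suc n" using that \<delta> by auto
    then show ?thesis by (intro mult_le_mono) auto
  qed
  show ?thesis
  proof (cases "n \<le> ?n0")
    case True then show ?thesis using f by auto
  next
    case False
    then have "?n0 \<le> n" by simp
    then show ?thesis
    proof (induction rule: dec_induct)
      case base then show ?case using f by auto
    next
      case (step k) then show ?case using colon_step[OF D bound] by blast
    qed
  qed
qed

text \<open>\<open>f\<close> represents \<open>\<psi>\<close>. Symbolic powers being ideals,
  \<open>\<psi>\<close> can be tested on all multiples r a, as the criterion for Frobenius powers
  demands; and \<Phi>(f) = \<psi>(1) = 1 keeps \<open>f\<close> out of
  \<open>frob_power R p m\<close>.\<close>

lemma split_imp_colon:
  assumes D: "frob_dual R p \<Phi> B e b" and psi: "frob_linear R p \<psi>" "\<psi> \<one> = \<one>"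
    and split: "\<And>n. \<psi> ` symbolic_power R I (n * p + 1) \<subseteq> symbolic_power R I (n + 1)"
    and m: "ideal m R" "\<one> \<notin> m"
  shows "\<not> (\<Inter>n\<in>N. colon_n n) \<subseteq> frob_power R p m"
proof -
  obtain f where f: "f \<in> carrier R" "\<forall>g\<in>carrier R. \<psi> g = \<Phi> (f \<otimes> g)"
    using frob_dual_rep[OF D psi(1)] by blast
  have "f \<in> colon_n n" for n
  proof -
    have "f \<otimes> a \<in> frob_power R p (symbolic_power R I (n + 1))" if a: "a \<in> symbolic_power R I (n * p + 1)" for a
    proof -
      have ac: "a \<in> carrier R" using a symb_sub by blast
      have "\<Phi> (r \<otimes> (f \<otimes> a)) \<in> symbolic_power R I (n + 1)" if r: "r \<in> carrier R" for r
      proof -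
        have "r \<otimes> a \<in> symbolic_power R I (n * p + 1)" using ideal.I_l_closed[OF symb_ideal a r] .
        then have "\<psi> (r \<otimes> a) \<in> symbolic_power R I (n + 1)" using split by blast
        moreover have "r \<otimes> (f \<otimes> a) = f \<otimes> (r \<otimes> a)" using r f(1) ac by (simp add: m_lcomm)
        ultimately show ?thesis using f(2) r ac by simp
      qed
      then show ?thesis using mem_frob_power_iff[OF D symb_ideal] f(1) ac by simp
    qed
    then show ?thesis using f(1) by (simp add: colon_ideal_def)
  qed
  moreover have "f \<notin> frob_power R p m"
  proof
    assume "f \<in> frob_power R p m"
    then have "\<Phi> (\<one> \<otimes> f) \<in> m" using mem_frob_power_iff[OF D m(1) f(1)] by blast
    moreover have "\<Phi> (f \<otimes> \<one>) = \<one>" using f(2) psi(2) by (metis one_closed)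
    ultimately show False using f(1) m(2) by simp
  qed
  ultimately show ?thesis by blast
qed

lemma colon_maps:
  assumes D: "frob_dual R p \<Phi> B e b" and f: "f \<in> colon_n n" and a: "a \<in> symbolic_power R I (n * p + 1)"
    and r: "r \<in> carrier R"
  shows "\<Phi> (r \<otimes> (f \<otimes> a)) \<in> symbolic_power R I (n + 1)"
proof -
  have "f \<in> carrier R" "a \<in> carrier R" using f a symb_sub by (auto simp: colon_ideal_def)
  moreover have "f \<otimes> a \<in> frob_power R p (symbolic_power R I (n + 1))" using f a by (auto simp: colon_ideal_def)
  ultimately show ?thesis using mem_frob_power_iff[OF D symb_ideal, of "f \<otimes> a" "n + 1"] r by simp
qed

section \<open>Functionals and splittings\<close>

lemma F_splitting_linear:
  assumes "F_splitting R p \<phi>"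
  shows "frob_linear R p (\<lambda>g. \<phi> (Proot g))" "\<phi> (Proot \<one>) = \<one>"
proof -
  have F: "\<phi> \<in> Proot ` carrier R \<rightarrow> carrier R"
    "\<And>x y. x \<in> carrier R \<Longrightarrow> y \<in> carrier R \<Longrightarrow> \<phi> (Proot (x \<oplus> y)) = \<phi> (Proot x) \<oplus> \<phi> (Proot y)"
    "\<And>c x. c \<in> carrier R \<Longrightarrow> x \<in> carrier R \<Longrightarrow> \<phi> (Proot (c [^] p \<otimes> x)) = c \<otimes> \<phi> (Proot x)"
    "\<And>r. r \<in> carrier R \<Longrightarrow> \<phi> (Proot (r [^] p)) = r"
    using assms unfolding F_splitting_def proot_ring_def proot_incl_def by auto
  show "frob_linear R p (\<lambda>g. \<phi> (Proot g))" unfolding frob_linear_def using F by auto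
  show "\<phi> (Proot \<one>) = \<one>" using F(4)[of \<one>] by simp
qed

lemma linear_F_splitting:
  assumes psi: "frob_linear R p \<psi>" "\<psi> \<one> = \<one>"
  shows "F_splitting R p (\<lambda>t. \<psi> (proot_arg t))"
proof -
  note L = frob_linearD[OF psi(1)]
  have "\<psi> (r [^] p) = r" if "r \<in> carrier R" for r
    using L(3)[OF that one_closed] psi(2) that by simp
  then show ?thesis
    unfolding F_splitting_def proot_ring_def proot_incl_def using L by auto
qed

lemma symbolic_splitting_iff:
  "symbolic_F_splitting R p I \<phi> \<longleftrightarrow> F_splitting R p \<phi> \<and>
     (\<forall>n. (\<lambda>g. \<phi> (Proot g)) ` symbolic_power R I (n * p + 1) \<subseteq> symbolic_power R I (n + 1))"
  unfolding symbolic_F_splitting_def by (simp add: image_image)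

lemma local_equivalence:
  assumes D: "frob_dual R p \<Phi> B e b" and \<delta>: "\<delta> = (if p \<le> H then 1 else (0::nat))"
    and m: "ideal m R" "\<one> \<notin> m" and units: "\<And>x. x \<in> carrier R - m \<Longrightarrow> \<exists>y\<in>carrier R. y \<otimes> x = \<one>"
  shows "symbolic_F_split R p I \<longleftrightarrow>
    \<not> (\<Inter>n\<in>{0..nat (max 0 (int H - 1 - int \<delta>))}. colon_n n) \<subseteq> frob_power R p m"
proof
  assume "symbolic_F_split R p I"
  then obtain \<phi> where phi: "symbolic_F_splitting R p I \<phi>" unfolding symbolic_F_split_def by blast
  then have s: "F_splitting R p \<phi>" "\<And>n. (\<lambda>g. \<phi> (Proot g)) ` symbolic_power R I (n * p + 1) \<subseteq> symbolic_power R I (n + 1)"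
    using symbolic_splitting_iff by auto
  show "\<not> (\<Inter>n\<in>{0..nat (max 0 (int H - 1 - int \<delta>))}. colon_n n) \<subseteq> frob_power R p m"
    by (rule split_imp_colon[OF D F_splitting_linear[OF s(1)] s(2) m])
next
  assume "\<not> (\<Inter>n\<in>{0..nat (max 0 (int H - 1 - int \<delta>))}. colon_n n) \<subseteq> frob_power R p m"
  then obtain f where f: "f \<in> (\<Inter>n\<in>{0..nat (max 0 (int H - 1 - int \<delta>))}. colon_n n)" "f \<notin> frob_power R p m" by blast
  have fn: "f \<in> colon_n n" for n by (rule colon_all[OF D \<delta> f(1)])
  then have fc: "f \<in> carrier R" by (auto simp: colon_ideal_def)
  have L: "frob_linear R p \<Phi>" using D by (simp add: frob_dual_def)
  obtain r where r: "r \<in> carrier R" "\<Phi> (r \<otimes> f) \<notin> m"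
    using mem_frob_power_iff[OF D m(1) fc] f(2) by blast
  obtain v where v: "v \<in> carrier R" "v \<otimes> \<Phi> (r \<otimes> f) = \<one>"
    using units[of "\<Phi> (r \<otimes> f)"] r fc frob_linearD(1)[OF L] by auto
  \<comment> \<open>Rescaling by v^p makes the value at 1 equal to v \<Phi>(r f) = 1, without
    leaving the colon ideals.\<close>
  define h where "h = v [^] p \<otimes> (r \<otimes> f)"
  have hc: "h \<in> carrier R" using v r fc by (simp add: h_def)
  let ?psi = "\<lambda>g. \<Phi> (h \<otimes> g)"
  have psi: "frob_linear R p ?psi" using frob_linear_mult[OF L hc] .
  have "?psi \<one> = \<one>" using frob_linearD(3)[OF L v(1), of "r \<otimes> f"] v r fc by (simp add: h_def)
  then have sp: "F_splitting R p (\<lambda>t. ?psi (proot_arg t))" using linear_F_splitting[OF psi] by blast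
  have "?psi a \<in> symbolic_power R I (n + 1)" if a: "a \<in> symbolic_power R I (n * p + 1)" for a n
  proof -
    have "a \<in> carrier R" using a symb_sub by blast
    then have "h \<otimes> a = (v [^] p \<otimes> r) \<otimes> (f \<otimes> a)" using v r fc by (simp add: h_def m_assoc)
    then show ?thesis using colon_maps[OF D fn a, of "v [^] p \<otimes> r"] v r by simp
  qed
  then have "symbolic_F_splitting R p I (\<lambda>t. ?psi (proot_arg t))"
    using sp symbolic_splitting_iff by auto
  then show "symbolic_F_split R p I" unfolding symbolic_F_split_def by blast
qed

end

section \<open>Duality over polynomial rings\<close>

text \<open>The duality for the coefficient field is obtained in the ring with restricted carrier,
  while its sums are needed in \<open>R\<close>.\<close>

lemma finsum_subring:
  assumes "abelian_monoid R" "abelian_monoid (R \<lparr> carrier := K \<rparr>)" "K \<subseteq> carrier R" "finite A" "f \<in> A \<rightarrow> K"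
  shows "finsum (R \<lparr> carrier := K \<rparr>) f A = finsum R f A"
  using assms(4,5)
proof (induction A)
  case empty
  show ?case by (simp add: abelian_monoid.finsum_empty[OF assms(1)] abelian_monoid.finsum_empty[OF assms(2)])
next
  case (insert x A)
  have "finsum (R \<lparr> carrier := K \<rparr>) f (insert x A) = f x \<oplus>\<^bsub>R\<lparr>carrier := K\<rparr>\<^esub> finsum (R \<lparr> carrier := K \<rparr>) f A"
    using insert by (intro abelian_monoid.finsum_insert[OF assms(2)]) auto
  moreover have "finsum R f (insert x A) = f x \<oplus>\<^bsub>R\<^esub> finsum R f A"
    using insert assms(3) by (intro abelian_monoid.finsum_insert[OF assms(1)]) auto
  ultimately show ?case using insert by simp
qed

lemma (in field) field_ideal:
  assumes "ideal J R"
  shows "J = {\<zero>} \<or> J = carrier R"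
  using assms all_ideals by blast

lemma pow_subring: "x [^]\<^bsub>R \<lparr>carrier := K\<rparr>\<^esub> (n::nat) = x [^]\<^bsub>R\<^esub> n"
  by (induction n) auto

lemma add_pow_subring: "add_pow (R \<lparr>carrier := K\<rparr>) (n::nat) x = add_pow R n x"
  by (induction n) (auto simp: add_pow_def nat_pow_def)

text \<open>A field is a local ring with maximal ideal 0 and a chain consisting of one prime, so the
  local construction applies with no parameters. The conclusion is rewritten in the operations of
  \<open>R\<close>.\<close>

lemma (in cring) field_frob_dual:
  assumes K: "subfield K R" and p: "Factorial_Ring.prime p" "has_char R p"
    and gs: "set gs \<subseteq> K" "frob_span (R \<lparr> carrier := K \<rparr>) p (set gs) = K"
  shows "\<exists>\<Lambda> (n::nat) e b. \<Lambda> \<in> K \<rightarrow> K \<and> (\<forall>x\<in>K. \<forall>y\<in>K. \<Lambda> (x \<oplus> y) = \<Lambda> x \<oplus> \<Lambda> y) \<and>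
    (\<forall>c\<in>K. \<forall>x\<in>K. \<Lambda> (c [^] p \<otimes> x) = c \<otimes> \<Lambda> x) \<and> e \<in> {..<n} \<rightarrow> K \<and> b \<in> {..<n} \<rightarrow> K \<and>
    (\<forall>g\<in>K. g = (\<Oplus>i\<in>{..<n}. \<Lambda> (e i \<otimes> g) [^] p \<otimes> b i))"
proof -
  let ?F = "R \<lparr> carrier := K \<rparr>"
  interpret F: field ?F using subfield_iff(2)[OF K] .
  have noeth: "noetherian_ring ?F"
  proof (rule F.noetherian_ringI)
    fix J assume J: "ideal J ?F"
    have "J = Idl\<^bsub>?F\<^esub> {} \<or> J = Idl\<^bsub>?F\<^esub> {\<one>\<^bsub>?F\<^esub>}"
      using F.field_ideal[OF J] F.genideal_zero F.genideal_one
        F.genideal_minimal[OF F.zeroideal, of "{}"] additive_subgroup.zero_closed[OF ideal.axioms(1)[OF F.genideal_ideal[of "{}"]]]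
      by auto
    then show "\<exists>A\<subseteq>carrier ?F. finite A \<and> J = Idl\<^bsub>?F\<^esub> A" using F.one_closed by blast
  qed
  interpret FF: noetherian_ring ?F by (rule noeth)
  interpret F2: F_finite_ring ?F p
  proof unfold_locales
    show "Factorial_Ring.prime p" by (rule p(1))
    show "has_char ?F p" using p(2) by (simp add: has_char_def add_pow_subring)
    show "\<exists>gs. set gs \<subseteq> carrier ?F \<and> frob_span ?F p (set gs) = carrier ?F" using gs by auto
  qed
  interpret F3: local_frob ?F p "{\<zero>}" "[]" "\<lambda>_. {\<zero>}"
  proof (intro local_frob.intro local_frob_axioms.intro)
    show "F_finite_ring ?F p" by (rule F2.F_finite_ring_axioms)
    show zp: "primeideal {\<zero>} ?F" using F.zeroprimeideal by simp
    show "\<exists>y\<in>carrier ?F. y \<otimes>\<^bsub>?F\<^esub> x = \<one>\<^bsub>?F\<^esub>" if x: "x \<in> carrier ?F - {\<zero>}" for x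
    proof -
      have "x \<in> Units ?F" using x F.field_Units by simp
      then show ?thesis by (rule F.Units_l_inv_ex)
    qed
    have "frob_span ?F 1 {} \<subseteq> {\<zero>}" using F2.E1.frob_span_least[of "{\<zero>}" "{}"] F.zeroideal F.frob_submodule_1_iff[of "{\<zero>}"] by simp
    then show "{\<zero>} = frob_span ?F 1 (set [])" using frob_span_zero[of ?F 1 "{}"] by auto
    show "prime_chain ?F (\<lambda>_. {\<zero>}) (length [])" using zp by (simp add: prime_chain_def)
  qed simp
  obtain \<Lambda> n e b where D: "frob_dual ?F p \<Lambda> {..<n::nat} e b" using F3.ex_frob_dual by blast
  have am: "abelian_monoid R" "abelian_monoid ?F" using abelian_monoid_axioms F.abelian_monoid_axioms by auto
  have KR: "K \<subseteq> carrier R" using subringE(1)[OF subfieldE(1)[OF K]] .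
  have L: "frob_linear ?F p \<Lambda>" and eb: "e \<in> {..<n} \<rightarrow> K" "b \<in> {..<n} \<rightarrow> K"
    using D by (auto simp: frob_dual_def)
  note LD = frob_linearD[OF L]
  have "g = (\<Oplus>i\<in>{..<n}. \<Lambda> (e i \<otimes> g) [^] p \<otimes> b i)" if g: "g \<in> K" for g
  proof -
    let ?t = "\<lambda>i. \<Lambda> (e i \<otimes> g) [^] p \<otimes> b i"
    have t: "?t \<in> {..<n} \<rightarrow> K"
    proof
      fix i assume i: "i \<in> {..<n}"
      have c: "e i \<in> carrier ?F" "b i \<in> carrier ?F" "g \<in> carrier ?F" using eb i g by auto
      then have "\<Lambda> (e i \<otimes>\<^bsub>?F\<^esub> g) \<in> carrier ?F" by (intro LD(1) F.m_closed)
      then have "\<Lambda> (e i \<otimes>\<^bsub>?F\<^esub> g) [^]\<^bsub>?F\<^esub> p \<otimes>\<^bsub>?F\<^esub> b i \<in> carrier ?F"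
        by (intro F.m_closed F.nat_pow_closed c)
      then show "?t i \<in> K" by (simp add: pow_subring)
    qed
    have D4: "\<forall>g\<in>carrier ?F. g = (\<Oplus>\<^bsub>?F\<^esub>i\<in>{..<n}. \<Lambda> (e i \<otimes>\<^bsub>?F\<^esub> g) [^]\<^bsub>?F\<^esub> p \<otimes>\<^bsub>?F\<^esub> b i)"
      using D unfolding frob_dual_def by (elim conjE)
    have gF: "g \<in> carrier ?F" using g by simp
    have "g = (\<Oplus>\<^bsub>?F\<^esub>i\<in>{..<n}. \<Lambda> (e i \<otimes>\<^bsub>?F\<^esub> g) [^]\<^bsub>?F\<^esub> p \<otimes>\<^bsub>?F\<^esub> b i)"
      by (rule bspec[OF D4 gF])
    also have "\<dots> = (\<Oplus>i\<in>{..<n}. ?t i)"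
      using finsum_subring[OF am KR, of "{..<n}" ?t] t by (simp add: pow_subring)
    finally show ?thesis .
  qed
  then have "\<forall>g\<in>K. g = (\<Oplus>i\<in>{..<n}. \<Lambda> (e i \<otimes> g) [^] p \<otimes> b i)" by (rule ballI)
  moreover have "\<Lambda> \<in> K \<rightarrow> K" "\<forall>x\<in>K. \<forall>y\<in>K. \<Lambda> (x \<oplus> y) = \<Lambda> x \<oplus> \<Lambda> y"
    "\<forall>c\<in>K. \<forall>x\<in>K. \<Lambda> (c [^] p \<otimes> x) = c \<otimes> \<Lambda> x"
    using LD by (auto simp: pow_subring)
  ultimately show ?thesis using eb by (intro exI conjI)
qed

section \<open>Monomials and coefficients\<close>

locale poly_ring = F_finite_ring R p for R (structure) and p :: nat +
  fixes K :: "'a set" and N :: nat and x :: "nat \<Rightarrow> 'a"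
  assumes poly: "polynomial_ring_over R K N x"
begin

abbreviation "xpow \<equiv> var_monom R N x"
abbreviation "V \<equiv> exponents N"

definition coeffs :: "'a \<Rightarrow> (nat \<Rightarrow> nat) \<Rightarrow> 'a" where
  "coeffs g = the_inv_into (coeff_funs R K N) (poly_val R N x) g"

lemma K_subfield: "subfield K R" and x_closed: "i < N \<Longrightarrow> x i \<in> carrier R"
  and bij: "bij_betw (poly_val R N x) (coeff_funs R K N) (carrier R)"
  using poly by (auto simp: polynomial_ring_over_def)

lemma K_props: "K \<subseteq> carrier R" "\<zero> \<in> K" "\<one> \<in> K" "k \<in> K \<Longrightarrow> l \<in> K \<Longrightarrow> k \<oplus> l \<in> K"
    "k \<in> K \<Longrightarrow> l \<in> K \<Longrightarrow> k \<otimes> l \<in> K" "k \<in> K \<Longrightarrow> k \<in> carrier R"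
  using subringE[OF subfieldE(1)[OF K_subfield]] by auto

lemma K_pow: "k \<in> K \<Longrightarrow> k [^] (n::nat) \<in> K"
  by (induction n) (auto simp: K_props)

lemma mon_closed: "xpow \<alpha> \<in> carrier R"
  unfolding var_monom_def using x_closed by (intro finprod_closed) auto

definition exp_add :: "(nat \<Rightarrow> nat) \<Rightarrow> (nat \<Rightarrow> nat) \<Rightarrow> nat \<Rightarrow> nat" where
  "exp_add \<alpha> \<beta> = (\<lambda>i\<in>{..<N}. \<alpha> i + \<beta> i)"

definition exp_scale :: "nat \<Rightarrow> (nat \<Rightarrow> nat) \<Rightarrow> nat \<Rightarrow> nat" where
  "exp_scale k \<alpha> = (\<lambda>i\<in>{..<N}. k * \<alpha> i)"

lemma V_I: "(\<lambda>i\<in>{..<N}. f i) \<in> V" and exp_add_V: "exp_add \<alpha> \<beta> \<in> V" and exp_scale_V: "exp_scale k \<alpha> \<in> V"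
  by (auto simp: exponents_def exp_add_def exp_scale_def)

lemma V_eqI: "\<alpha> \<in> V \<Longrightarrow> \<beta> \<in> V \<Longrightarrow> (\<And>i. i < N \<Longrightarrow> \<alpha> i = \<beta> i) \<Longrightarrow> \<alpha> = \<beta>"
  unfolding exponents_def by (rule PiE_ext) auto

lemma mon_cong: "(\<And>i. i < N \<Longrightarrow> \<alpha> i = \<beta> i) \<Longrightarrow> xpow \<alpha> = xpow \<beta>"
  unfolding var_monom_def using x_closed by (intro finprod_cong') auto

lemma mon_exp_add: "xpow (exp_add \<alpha> \<beta>) = xpow \<alpha> \<otimes> xpow \<beta>"
proof -
  have "xpow (exp_add \<alpha> \<beta>) = (\<Otimes>i\<in>{..<N}. x i [^] \<alpha> i \<otimes> x i [^] \<beta> i)"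
    unfolding var_monom_def exp_add_def using x_closed by (intro finprod_cong') (auto simp: nat_pow_mult)
  also have "\<dots> = xpow \<alpha> \<otimes> xpow \<beta>"
    unfolding var_monom_def using x_closed by (intro finprod_multf) auto
  finally show ?thesis .
qed

lemma mon_zero: "xpow (\<lambda>i\<in>{..<N}. 0) = \<one>"
  unfolding var_monom_def by (intro finprod_one_eqI) auto

lemma mon_pow: "xpow \<alpha> [^] (k::nat) = xpow (exp_scale k \<alpha>)"
proof (induction k)
  case 0
  have "xpow (exp_scale 0 \<alpha>) = xpow (\<lambda>i\<in>{..<N}. 0)" by (rule mon_cong) (simp add: exp_scale_def)
  then show ?case using mon_zero by simp
next
  case (Suc k)
  have "xpow (exp_scale (Suc k) \<alpha>) = xpow (exp_add (exp_scale k \<alpha>) \<alpha>)"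
    by (rule mon_cong) (simp add: exp_scale_def exp_add_def)
  then show ?case using Suc mon_exp_add by simp
qed

lemma poly_val_superset:
  assumes c: "c \<in> coeff_funs R K N" and A: "finite A" "coeff_supp R c \<subseteq> A"
  shows "poly_val R N x c = (\<Oplus>\<alpha>\<in>A. c \<alpha> \<otimes> xpow \<alpha>)"
proof -
  have cK: "c \<alpha> \<in> carrier R" for \<alpha> using c K_props(1) by (auto simp: coeff_funs_def)
  show ?thesis unfolding poly_val_def
    by (rule add.finprod_mono_neutral_cong_left[OF A]) (auto simp: coeff_supp_def mon_closed cK)
qed

lemma coeffs_closed: "g \<in> carrier R \<Longrightarrow> coeffs g \<in> coeff_funs R K N"
  unfolding coeffs_def by (rule bij_betw_apply[OF bij_betw_the_inv_into[OF bij]])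

lemma poly_val_coeffs: "g \<in> carrier R \<Longrightarrow> poly_val R N x (coeffs g) = g"
  unfolding coeffs_def using bij by (metis bij_betw_def f_the_inv_into_f)

lemma coeffs_poly_val: "c \<in> coeff_funs R K N \<Longrightarrow> coeffs (poly_val R N x c) = c"
  unfolding coeffs_def using bij by (metis bij_betw_def the_inv_into_f_f)

lemma poly_val_closed: "c \<in> coeff_funs R K N \<Longrightarrow> poly_val R N x c \<in> carrier R"
  using bij by (auto simp: bij_betw_def)

lemma coeffs_inj: "g \<in> carrier R \<Longrightarrow> h \<in> carrier R \<Longrightarrow> coeffs g = coeffs h \<Longrightarrow> g = h"
  using poly_val_coeffs by metis

lemma coeffs_props:
  assumes "g \<in> carrier R"
  shows "coeffs g \<alpha> \<in> K" "finite (coeff_supp R (coeffs g))" "coeff_supp R (coeffs g) \<subseteq> V" "\<alpha> \<notin> V \<Longrightarrow> coeffs g \<alpha> = \<zero>"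
  using coeffs_closed[OF assms] by (auto simp: coeff_funs_def coeff_supp_def)

lemma coeffs_add:
  assumes g: "g \<in> carrier R" and h: "h \<in> carrier R"
  shows "coeffs (g \<oplus> h) = (\<lambda>\<alpha>. coeffs g \<alpha> \<oplus> coeffs h \<alpha>)"
proof -
  let ?c = "\<lambda>\<alpha>. coeffs g \<alpha> \<oplus> coeffs h \<alpha>"
  let ?A = "coeff_supp R (coeffs g) \<union> coeff_supp R (coeffs h)"
  have sup: "coeff_supp R ?c \<subseteq> ?A" by (auto simp: coeff_supp_def)
  have fin: "finite ?A" "?A \<subseteq> V" using coeffs_props g h by auto
  have c: "?c \<in> coeff_funs R K N"
    using coeffs_props(1) g h K_props(4) finite_subset[OF sup fin(1)] sup fin(2)
    unfolding coeff_funs_def by blast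
  have k: "coeffs g \<alpha> \<in> carrier R" "coeffs h \<alpha> \<in> carrier R" for \<alpha> using coeffs_props(1) g h K_props(1) by auto
  have "poly_val R N x ?c = (\<Oplus>\<alpha>\<in>?A. coeffs g \<alpha> \<otimes> xpow \<alpha> \<oplus> coeffs h \<alpha> \<otimes> xpow \<alpha>)"
    unfolding poly_val_superset[OF c fin(1) sup] using k mon_closed by (intro finsum_cong') (auto simp: l_distr)
  also have "\<dots> = (\<Oplus>\<alpha>\<in>?A. coeffs g \<alpha> \<otimes> xpow \<alpha>) \<oplus> (\<Oplus>\<alpha>\<in>?A. coeffs h \<alpha> \<otimes> xpow \<alpha>)"
    using k mon_closed by (intro finsum_addf) auto
  also have "\<dots> = g \<oplus> h"
    using poly_val_superset[OF coeffs_closed[OF g] fin(1)] poly_val_superset[OF coeffs_closed[OF h] fin(1)]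
      poly_val_coeffs g h by auto
  finally show ?thesis using coeffs_poly_val[OF c] by simp
qed

lemma single:
  assumes k: "k \<in> K" and a: "\<alpha> \<in> V"
  shows "(\<lambda>\<beta>. if \<beta> = \<alpha> then k else \<zero>) \<in> coeff_funs R K N"
    "poly_val R N x (\<lambda>\<beta>. if \<beta> = \<alpha> then k else \<zero>) = k \<otimes> xpow \<alpha>"
proof -
  let ?c = "\<lambda>\<beta>. if \<beta> = \<alpha> then k else \<zero>"
  have sup: "coeff_supp R ?c \<subseteq> {\<alpha>}" by (auto simp: coeff_supp_def)
  then have "finite (coeff_supp R ?c)" using finite_subset by blast
  then show c: "?c \<in> coeff_funs R K N" using sup k a K_props(2) by (auto simp: coeff_funs_def)
  show "poly_val R N x ?c = k \<otimes> xpow \<alpha>"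
    using poly_val_superset[OF c _ sup] k K_props(1) mon_closed by (simp add: finsum_insert subset_iff)
qed

lemma coeffs_mon: "k \<in> K \<Longrightarrow> \<alpha> \<in> V \<Longrightarrow> coeffs (k \<otimes> xpow \<alpha>) = (\<lambda>\<beta>. if \<beta> = \<alpha> then k else \<zero>)"
  using single coeffs_poly_val by metis

lemma coeffs_zero: "coeffs \<zero> = (\<lambda>\<beta>. \<zero>)"
  using coeffs_mon[OF K_props(2) V_I[of "\<lambda>_. 0"]] mon_closed by simp

lemma poly_induct [consumes 1, case_names zero mon add]:
  assumes g: "g \<in> carrier R" and z: "P \<zero>" and m: "\<And>k \<alpha>. k \<in> K \<Longrightarrow> \<alpha> \<in> V \<Longrightarrow> P (k \<otimes> xpow \<alpha>)"
    and a: "\<And>g h. g \<in> carrier R \<Longrightarrow> h \<in> carrier R \<Longrightarrow> P g \<Longrightarrow> P h \<Longrightarrow> P (g \<oplus> h)"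
  shows "P g"
proof -
  have "finite A \<Longrightarrow> A \<subseteq> V \<Longrightarrow> P (\<Oplus>\<alpha>\<in>A. coeffs g \<alpha> \<otimes> xpow \<alpha>)" for A
  proof (induction A rule: finite_induct)
    case empty then show ?case using z by simp
  next
    case (insert \<alpha> A)
    have k: "coeffs g \<beta> \<in> carrier R" for \<beta> using coeffs_props(1)[OF g] K_props(1) by auto
    have "(\<Oplus>\<alpha>\<in>insert \<alpha> A. coeffs g \<alpha> \<otimes> xpow \<alpha>) = coeffs g \<alpha> \<otimes> xpow \<alpha> \<oplus> (\<Oplus>\<alpha>\<in>A. coeffs g \<alpha> \<otimes> xpow \<alpha>)"
      using insert k mon_closed by (intro finsum_insert) auto
    moreover have "(\<Oplus>\<alpha>\<in>A. coeffs g \<alpha> \<otimes> xpow \<alpha>) \<in> carrier R" using k mon_closed by (intro finsum_closed) auto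
    ultimately show ?case using a m insert coeffs_props(1)[OF g] k mon_closed by auto
  qed
  from this[OF coeffs_props(2)[OF g] coeffs_props(3)[OF g]] show ?thesis using poly_val_coeffs[OF g] unfolding poly_val_def by simp
qed

lemma mon_mult:
  assumes "k \<in> carrier R" "l \<in> carrier R"
  shows "(k \<otimes> xpow \<alpha>) \<otimes> (l \<otimes> xpow \<beta>) = (k \<otimes> l) \<otimes> xpow (exp_add \<alpha> \<beta>)"
  using assms mon_closed by (simp add: mon_exp_add m_ac)

definition const_coeff :: "'a \<Rightarrow> 'a" where
  "const_coeff g = coeffs g (\<lambda>i\<in>{..<N}. 0)"

lemma const_coeff_closed: "g \<in> carrier R \<Longrightarrow> const_coeff g \<in> K" and const_coeff_zero: "const_coeff \<zero> = \<zero>"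
  and const_coeff_add: "g \<in> carrier R \<Longrightarrow> h \<in> carrier R \<Longrightarrow> const_coeff (g \<oplus> h) = const_coeff g \<oplus> const_coeff h"
  by (auto simp: const_coeff_def coeffs_props coeffs_zero coeffs_add)

lemma const_coeff_mon: "k \<in> K \<Longrightarrow> \<alpha> \<in> V \<Longrightarrow> const_coeff (k \<otimes> xpow \<alpha>) = (if \<alpha> = (\<lambda>i\<in>{..<N}. 0) then k else \<zero>)"
  by (auto simp: const_coeff_def coeffs_mon)

lemma const_coeff_K: "k \<in> K \<Longrightarrow> const_coeff k = k"
  using const_coeff_mon[of k "\<lambda>i\<in>{..<N}. 0"] V_I[of "\<lambda>_. 0"] mon_zero K_props(6) by simp

lemma exp_add_eq_zero: "\<alpha> \<in> V \<Longrightarrow> \<beta> \<in> V \<Longrightarrow> exp_add \<alpha> \<beta> = (\<lambda>i\<in>{..<N}. 0) \<longleftrightarrow> \<alpha> = (\<lambda>i\<in>{..<N}. 0) \<and> \<beta> = (\<lambda>i\<in>{..<N}. 0)"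
proof
  assume V: "\<alpha> \<in> V" "\<beta> \<in> V" and e: "exp_add \<alpha> \<beta> = (\<lambda>i\<in>{..<N}. 0)"
  have "\<alpha> i = 0 \<and> \<beta> i = 0" if "i < N" for i using fun_cong[OF e, of i] that by (simp add: exp_add_def)
  then show "\<alpha> = (\<lambda>i\<in>{..<N}. 0) \<and> \<beta> = (\<lambda>i\<in>{..<N}. 0)"
    using V_eqI[OF V(1) V_I[of "\<lambda>_. 0"]] V_eqI[OF V(2) V_I[of "\<lambda>_. 0"]] by simp
qed (auto simp: exp_add_def)

lemma const_coeff_mult:
  assumes g: "g \<in> carrier R" and h: "h \<in> carrier R"
  shows "const_coeff (g \<otimes> h) = const_coeff g \<otimes> const_coeff h"
  using g
proof (induction rule: poly_induct)
  case zero then show ?case using h K_props const_coeff_closed by (simp add: const_coeff_zero)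
next
  case (mon k \<alpha>)
  note kV = mon
  have kc: "k \<in> carrier R" using mon K_props by blast
  show ?case using h
  proof (induction rule: poly_induct)
    case zero then show ?case using kc mon_closed K_props const_coeff_closed by (simp add: const_coeff_zero)
  next
    case (mon l \<beta>)
    have "const_coeff ((k \<otimes> xpow \<alpha>) \<otimes> (l \<otimes> xpow \<beta>)) = const_coeff ((k \<otimes> l) \<otimes> xpow (exp_add \<alpha> \<beta>))"
      using mon_mult kc mon K_props by simp
    also have "\<dots> = (if exp_add \<alpha> \<beta> = (\<lambda>i\<in>{..<N}. 0) then k \<otimes> l else \<zero>)"
      by (rule const_coeff_mon[OF K_props(5)[OF kV(1) mon(1)] exp_add_V])
    also have "\<dots> = const_coeff (k \<otimes> xpow \<alpha>) \<otimes> const_coeff (l \<otimes> xpow \<beta>)"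
      unfolding const_coeff_mon[OF kV] const_coeff_mon[OF mon] exp_add_eq_zero[OF kV(2) mon(2)]
      using kc K_props(6)[OF mon(1)] by simp
    finally show ?case .
  next
    case (add g h) then show ?case using kc mon_closed const_coeff_closed K_props(6) by (simp add: r_distr const_coeff_add)
  qed
next
  case (add g g') then show ?case using h const_coeff_closed K_props(6) by (simp add: l_distr const_coeff_add)
qed

lemma const_coeff_pow: "g \<in> carrier R \<Longrightarrow> const_coeff (g [^] (n::nat)) = const_coeff g [^] n"
  by (induction n) (auto simp: const_coeff_mult const_coeff_K K_props)

text \<open>\<open>const_coeff\<close> is a ring homomorphism onto \<open>K\<close> fixing
  \<open>K\<close>, so it carries generators of \<open>F\<^sub>*R\<close> to generators of
  \<open>K\<close> over its p-th powers: F-finiteness descends to the coefficient field.\<close>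

lemma K_frob_span: "\<exists>ks. set ks \<subseteq> K \<and> frob_span (R \<lparr> carrier := K \<rparr>) p (set ks) = K"
proof -
  let ?F = "R \<lparr> carrier := K \<rparr>"
  obtain gs where gs: "set gs \<subseteq> carrier R" "frob_span R p (set gs) = carrier R" using ex_gens by blast
  have "const_coeff v \<in> frob_span ?F p (const_coeff ` set gs)" if "v \<in> frob_span R p (set gs)" for v
    using that
  proof induction
    case zero then show ?case using frob_span_zero[of ?F p "const_coeff ` set gs"] by (simp add: const_coeff_zero)
  next
    case (step v c g)
    have c: "v \<in> carrier R" "g \<in> carrier R" using step.hyps gs Ep.frob_span_closed[OF gs(1)] by auto
    have "const_coeff (v \<oplus> c [^] p \<otimes> g) = const_coeff v \<oplus> const_coeff c [^] p \<otimes> const_coeff g"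
      using c step.hyps by (simp add: const_coeff_add const_coeff_mult const_coeff_pow)
    then show ?case
      using frob_span_step[OF step.IH, of "const_coeff c" "const_coeff g"] const_coeff_closed step.hyps by (simp add: pow_subring)
  qed
  then have "const_coeff k \<in> frob_span ?F p (const_coeff ` set gs)" if "k \<in> K" for k using gs(2) K_props(6)[OF that] by simp
  then have "K \<subseteq> frob_span ?F p (const_coeff ` set gs)" using const_coeff_K by auto
  moreover have "frob_span ?F p (const_coeff ` set gs) \<subseteq> K"
  proof
    fix v assume "v \<in> frob_span ?F p (const_coeff ` set gs)"
    then show "v \<in> K"
    proof induction
      case (step v c g)
      then have "g \<in> K" "c \<in> K" using gs(1) const_coeff_closed by auto
      then show ?case using step.IH K_props(4,5) K_pow by (simp add: pow_subring)
    qed (simp add: K_props)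
  qed
  ultimately show ?thesis using gs(1) const_coeff_closed by (intro exI[of _ "map const_coeff gs"]) auto
qed

definition exp_top :: "nat \<Rightarrow> nat" where
  "exp_top = (\<lambda>i\<in>{..<N}. p - 1)"

end

section \<open>The trace map of a polynomial ring\<close>

locale poly_dual = poly_ring R p K N x for R (structure) and p K N x +
  fixes \<Lambda> :: "'a \<Rightarrow> 'a" and n :: nat and e b :: "nat \<Rightarrow> 'a"
  assumes Lam: "\<Lambda> \<in> K \<rightarrow> K" "y \<in> K \<Longrightarrow> z \<in> K \<Longrightarrow> \<Lambda> (y \<oplus> z) = \<Lambda> y \<oplus> \<Lambda> z"
      "c \<in> K \<Longrightarrow> y \<in> K \<Longrightarrow> \<Lambda> (c [^] p \<otimes> y) = c \<otimes> \<Lambda> y"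
    and eb: "e \<in> {..<n} \<rightarrow> K" "b \<in> {..<n} \<rightarrow> K"
      "\<forall>g\<in>K. g = (\<Oplus>i\<in>{..<n}. \<Lambda> (e i \<otimes> g) [^] p \<otimes> b i)"
begin

lemma Lam_closed: "y \<in> K \<Longrightarrow> \<Lambda> y \<in> K"
  using Lam(1) by blast

lemma Lam_zero: "\<Lambda> \<zero> = \<zero>"
  using Lam(3)[OF K_props(2,2)] Lam_closed[OF K_props(2)] K_props(6) by (simp add: Ep.pow_zero)

definition exp_frob :: "(nat \<Rightarrow> nat) \<Rightarrow> nat \<Rightarrow> nat" where
  "exp_frob \<gamma> = exp_add (exp_scale p \<gamma>) exp_top"

lemma exp_frob_V: "exp_frob \<gamma> \<in> V" unfolding exp_frob_def by (rule exp_add_V)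

lemma exp_frob_apply: "i < N \<Longrightarrow> exp_frob \<gamma> i = p * \<gamma> i + (p - 1)"
  by (simp add: exp_frob_def exp_add_def exp_scale_def exp_top_def)

lemma exp_frob_inj: "\<gamma> \<in> V \<Longrightarrow> \<gamma>' \<in> V \<Longrightarrow> exp_frob \<gamma> = exp_frob \<gamma>' \<Longrightarrow> \<gamma> = \<gamma>'"
proof (rule V_eqI)
  fix i assume "exp_frob \<gamma> = exp_frob \<gamma>'" "i < N"
  then have "p * \<gamma> i + (p - 1) = p * \<gamma>' i + (p - 1)" using exp_frob_apply by metis
  then have "p * \<gamma> i = p * \<gamma>' i" by (simp only: add_right_cancel)
  then show "\<gamma> i = \<gamma>' i" using Ep.e_pos by simp
qed

text \<open>The standard generator of the functionals on \<open>F\<^sub>*R\<close>: up to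
  \<open>\<Lambda>\<close> on coefficients it sends the monomial whose exponents are p \<gamma> + (p
  - 1) in every variable to that of exponent \<gamma>, and it kills all monomials not of this
  form.\<close>

definition trace :: "'a \<Rightarrow> 'a" where
  "trace g = poly_val R N x (\<lambda>\<gamma>. if \<gamma> \<in> V then \<Lambda> (coeffs g (exp_frob \<gamma>)) else \<zero>)"

lemma trace_coeff_funs:
  assumes g: "g \<in> carrier R"
  shows "(\<lambda>\<gamma>. if \<gamma> \<in> V then \<Lambda> (coeffs g (exp_frob \<gamma>)) else \<zero>) \<in> coeff_funs R K N"
proof -
  let ?c = "\<lambda>\<gamma>. if \<gamma> \<in> V then \<Lambda> (coeffs g (exp_frob \<gamma>)) else \<zero>"
  have "exp_frob ` coeff_supp R ?c \<subseteq> coeff_supp R (coeffs g)" using Lam_zero by (auto simp: coeff_supp_def split: if_splits)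
  then have "finite (exp_frob ` coeff_supp R ?c)" using coeffs_props(2)[OF g] finite_subset by blast
  moreover have sub: "coeff_supp R ?c \<subseteq> V" by (auto simp: coeff_supp_def)
  moreover have "inj_on exp_frob (coeff_supp R ?c)" using exp_frob_inj sub by (auto intro!: inj_onI)
  ultimately have "finite (coeff_supp R ?c)" using finite_imageD by blast
  then show ?thesis using sub Lam_closed coeffs_props(1)[OF g] K_props(2) by (auto simp: coeff_funs_def)
qed

lemma trace_closed: "g \<in> carrier R \<Longrightarrow> trace g \<in> carrier R"
  unfolding trace_def by (rule poly_val_closed[OF trace_coeff_funs])

lemma coeffs_trace: "g \<in> carrier R \<Longrightarrow> coeffs (trace g) = (\<lambda>\<gamma>. if \<gamma> \<in> V then \<Lambda> (coeffs g (exp_frob \<gamma>)) else \<zero>)"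
  unfolding trace_def by (rule coeffs_poly_val[OF trace_coeff_funs])

lemma trace_add:
  assumes g: "g \<in> carrier R" and h: "h \<in> carrier R"
  shows "trace (g \<oplus> h) = trace g \<oplus> trace h"
proof (rule coeffs_inj)
  show "coeffs (trace (g \<oplus> h)) = coeffs (trace g \<oplus> trace h)"
    using g h coeffs_props(1) Lam(2) K_props(2) by (auto simp: coeffs_trace coeffs_add trace_closed fun_eq_iff)
qed (use g h trace_closed in auto)

lemma trace_zero: "trace \<zero> = \<zero>"
  by (rule coeffs_inj) (auto simp: coeffs_trace coeffs_zero Lam_zero trace_closed)

lemma trace_mon_exp_frob:
  assumes k: "k \<in> K" and V: "\<gamma> \<in> V"
  shows "trace (k \<otimes> xpow (exp_frob \<gamma>)) = \<Lambda> k \<otimes> xpow \<gamma>"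
proof (rule coeffs_inj)
  have c: "k \<otimes> xpow (exp_frob \<gamma>) \<in> carrier R" using k K_props(6) mon_closed by simp
  show "coeffs (trace (k \<otimes> xpow (exp_frob \<gamma>))) = coeffs (\<Lambda> k \<otimes> xpow \<gamma>)"
    unfolding coeffs_trace[OF c] coeffs_mon[OF k exp_frob_V] coeffs_mon[OF Lam_closed[OF k] V]
  proof
    fix \<beta>
    have "\<beta> \<in> V \<Longrightarrow> exp_frob \<beta> = exp_frob \<gamma> \<longleftrightarrow> \<beta> = \<gamma>" using exp_frob_inj[OF _ V] by blast
    then show "(if \<beta> \<in> V then \<Lambda> (if exp_frob \<beta> = exp_frob \<gamma> then k else \<zero>) else \<zero>) = (if \<beta> = \<gamma> then \<Lambda> k else \<zero>)"
      using V Lam_zero by simp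
  qed
qed (use k K_props(6) Lam_closed mon_closed trace_closed in auto)

lemma trace_mon_not_exp_frob:
  assumes k: "k \<in> K" and a: "\<alpha> \<in> V" and n: "\<And>\<gamma>. \<gamma> \<in> V \<Longrightarrow> \<alpha> \<noteq> exp_frob \<gamma>"
  shows "trace (k \<otimes> xpow \<alpha>) = \<zero>"
proof (rule coeffs_inj)
  have c: "k \<otimes> xpow \<alpha> \<in> carrier R" using k K_props(6) mon_closed by simp
  show "coeffs (trace (k \<otimes> xpow \<alpha>)) = coeffs \<zero>"
    unfolding coeffs_trace[OF c] coeffs_mon[OF k a] coeffs_zero
  proof
    fix \<beta>
    show "(if \<beta> \<in> V then \<Lambda> (if exp_frob \<beta> = \<alpha> then k else \<zero>) else \<zero>) = \<zero>"
      using n[of \<beta>] Lam_zero by auto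
  qed
qed (use k K_props(6) mon_closed trace_closed in auto)

lemma exp_frob_exp_add: "exp_frob (exp_add \<delta> \<gamma>) = exp_add (exp_scale p \<delta>) (exp_frob \<gamma>)"
proof (rule V_eqI[OF exp_frob_V exp_add_V])
  fix i assume i: "i < N"
  show "exp_frob (exp_add \<delta> \<gamma>) i = exp_add (exp_scale p \<delta>) (exp_frob \<gamma>) i"
    using i exp_frob_apply[OF i] by (simp add: exp_add_def exp_scale_def algebra_simps)
qed

text \<open>Multiplication by a p-th power must not revive a monomial killed by the trace. The
  subtraction of exponents is safe: \<open>\<delta> i > \<gamma> i\<close> would make p times
  \<open>\<delta> i\<close> larger than the total exponent in that variable.\<close>

lemma exp_frob_shift:
  assumes "\<alpha> \<in> V" "\<gamma> \<in> V" "exp_add (exp_scale p \<delta>) \<alpha> = exp_frob \<gamma>"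
  shows "\<exists>\<gamma>'\<in>V. \<alpha> = exp_frob \<gamma>'"
proof -
  let ?g = "\<lambda>i\<in>{..<N}. \<gamma> i - \<delta> i"
  have "\<alpha> = exp_frob ?g"
  proof (rule V_eqI[OF assms(1) exp_frob_V])
    fix i assume i: "i < N"
    have eq: "p * \<delta> i + \<alpha> i = p * \<gamma> i + (p - 1)"
      using fun_cong[OF assms(3), of i] i by (simp add: exp_frob_apply exp_add_def exp_scale_def)
    have "\<delta> i \<le> \<gamma> i"
    proof (rule ccontr)
      assume "\<not> \<delta> i \<le> \<gamma> i"
      then have "p * Suc (\<gamma> i) \<le> p * \<delta> i" by (intro mult_le_mono2) simp
      then show False using eq Ep.e_pos by simp
    qed
    then have "p * \<gamma> i = p * \<delta> i + p * (\<gamma> i - \<delta> i)" by (simp add: diff_mult_distrib2)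
    then show "\<alpha> i = exp_frob ?g i" using eq i by (simp add: exp_frob_apply)
  qed
  then show ?thesis using V_I by blast
qed

lemma trace_frob_linear: "frob_linear R p trace"
  unfolding frob_linear_def
proof (intro conjI ballI)
  show "trace \<in> carrier R \<rightarrow> carrier R" using trace_closed by blast
  show "trace (g \<oplus> h) = trace g \<oplus> trace h" if "g \<in> carrier R" "h \<in> carrier R" for g h using trace_add that .
  show "trace (c [^] p \<otimes> g) = c \<otimes> trace g" if c: "c \<in> carrier R" and g: "g \<in> carrier R" for c g
    using c
  proof (induction rule: poly_induct)
    case zero then show ?case using g trace_zero trace_closed by (simp add: Ep.pow_zero)
  next
    case (mon k \<delta>)
    have kc: "k \<in> carrier R" "xpow \<delta> \<in> carrier R" using mon K_props(6) mon_closed by auto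
    have eq: "(k \<otimes> xpow \<delta>) [^] p = k [^] p \<otimes> xpow (exp_scale p \<delta>)" using kc by (simp add: Ep.pow_mult mon_pow)
    show ?case using g
    proof (induction rule: poly_induct)
      case zero then show ?case using kc trace_zero by simp
    next
      case (mon l \<alpha>)
      have lincomb: "l \<in> carrier R" using mon K_props(6) by blast
      have pr: "(k \<otimes> xpow \<delta>) [^] p \<otimes> (l \<otimes> xpow \<alpha>) = (k [^] p \<otimes> l) \<otimes> xpow (exp_add (exp_scale p \<delta>) \<alpha>)"
        unfolding eq using kc lincomb by (intro mon_mult) auto
      have klK: "k [^] p \<otimes> l \<in> K" using mon \<open>k \<in> K\<close> K_pow K_props(5) by blast
      show ?case
      proof (cases "\<exists>\<gamma>\<in>V. \<alpha> = exp_frob \<gamma>")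
        case True
        then obtain \<gamma> where ga: "\<gamma> \<in> V" "\<alpha> = exp_frob \<gamma>" by blast
        have "trace ((k \<otimes> xpow \<delta>) [^] p \<otimes> (l \<otimes> xpow \<alpha>)) = trace ((k [^] p \<otimes> l) \<otimes> xpow (exp_frob (exp_add \<delta> \<gamma>)))"
          unfolding pr exp_frob_exp_add by (simp only: ga(2))
        also have "\<dots> = \<Lambda> (k [^] p \<otimes> l) \<otimes> xpow (exp_add \<delta> \<gamma>)" by (rule trace_mon_exp_frob[OF klK exp_add_V])
        also have "\<dots> = (k \<otimes> xpow \<delta>) \<otimes> (\<Lambda> l \<otimes> xpow \<gamma>)"
          using Lam(3)[OF \<open>k \<in> K\<close> mon(1)] mon_mult[OF kc(1) K_props(6)[OF Lam_closed[OF mon(1)]]] by simp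
        also have "\<Lambda> l \<otimes> xpow \<gamma> = trace (l \<otimes> xpow \<alpha>)" unfolding ga(2) by (rule trace_mon_exp_frob[OF mon(1) ga(1), symmetric])
        finally show ?thesis .
      next
        case False
        then have "trace (l \<otimes> xpow \<alpha>) = \<zero>" using trace_mon_not_exp_frob[OF mon] by blast
        moreover have "trace ((k \<otimes> xpow \<delta>) [^] p \<otimes> (l \<otimes> xpow \<alpha>)) = \<zero>"
          unfolding pr using exp_frob_shift[OF mon(2)] False by (intro trace_mon_not_exp_frob[OF klK exp_add_V]) blast
        ultimately show ?thesis using kc by simp
      qed
    next
      case (add g h) then show ?case using kc trace_closed by (simp add: r_distr trace_add)
    qed
  next
    case (add c d)
    then show ?case using g trace_closed by (simp add: Ep.pow_add l_distr trace_add)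
  qed
qed

definition exp_box :: "(nat \<Rightarrow> nat) set" where
  "exp_box = {..<N} \<rightarrow>\<^sub>E {..<p}"

lemma exp_box_V: "\<alpha> \<in> exp_box \<Longrightarrow> \<alpha> \<in> V"
  by (auto simp: exp_box_def exponents_def PiE_def)

text \<open>The complement in the box: together with the exponent \<alpha> it adds up to p - 1 in
  every variable, which makes the two monomials dual under the trace.\<close>

definition exp_codeg :: "(nat \<Rightarrow> nat) \<Rightarrow> nat \<Rightarrow> nat" where
  "exp_codeg \<alpha> = (\<lambda>i\<in>{..<N}. p - 1 - \<alpha> i)"

text \<open>For \<alpha> \<noteq> \<beta> some exponent is not congruent to p - 1 modulo p, because
  the entries in the box are below p.\<close>

lemma trace_exp_box:
  assumes k: "k \<in> K" and a: "\<alpha> \<in> exp_box" and be: "\<beta> \<in> exp_box" and g: "\<gamma> \<in> V"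
  shows "trace (k \<otimes> xpow (exp_add (exp_codeg \<alpha>) (exp_add (exp_scale p \<gamma>) \<beta>))) = (if \<alpha> = \<beta> then \<Lambda> k \<otimes> xpow \<gamma> else \<zero>)"
proof -
  have lt: "\<alpha> i < p" "\<beta> i < p" if "i < N" for i using a be that by (auto simp: exp_box_def)
  have ap: "exp_add (exp_codeg \<alpha>) (exp_add (exp_scale p \<gamma>) \<beta>) i = p - 1 - \<alpha> i + (p * \<gamma> i + \<beta> i)" if "i < N" for i
    using that by (simp add: exp_add_def exp_codeg_def exp_scale_def)
  show ?thesis
  proof (cases "\<alpha> = \<beta>")
    case True
    have "exp_add (exp_codeg \<alpha>) (exp_add (exp_scale p \<gamma>) \<beta>) = exp_frob \<gamma>"
    proof (rule V_eqI[OF exp_add_V exp_frob_V])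
      fix i assume i: "i < N"
      show "exp_add (exp_codeg \<alpha>) (exp_add (exp_scale p \<gamma>) \<beta>) i = exp_frob \<gamma> i"
        using ap[OF i] exp_frob_apply[OF i, of \<gamma>] lt[OF i] True by simp
    qed
    then show ?thesis using trace_mon_exp_frob[OF k g] True by simp
  next
    case False
    have "exp_add (exp_codeg \<alpha>) (exp_add (exp_scale p \<gamma>) \<beta>) \<noteq> exp_frob \<gamma>'" for \<gamma>'
    proof
      assume eq: "exp_add (exp_codeg \<alpha>) (exp_add (exp_scale p \<gamma>) \<beta>) = exp_frob \<gamma>'"
      have "\<alpha> i = \<beta> i" if i: "i < N" for i
      proof -
        have "p - 1 - \<alpha> i + (p * \<gamma> i + \<beta> i) = p * \<gamma>' i + (p - 1)"
          using fun_cong[OF eq, of i] ap[OF i] exp_frob_apply[OF i] by metis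
        then have e: "p * \<gamma> i + \<beta> i = p * \<gamma>' i + \<alpha> i" using lt[OF i] by linarith
        have "\<beta> i = (p * \<gamma> i + \<beta> i) mod p" "\<alpha> i = (p * \<gamma>' i + \<alpha> i) mod p" using lt[OF i] by auto
        then show ?thesis using e by simp
      qed
      then show False using V_eqI[OF exp_box_V[OF a] exp_box_V[OF be]] False by blast
    qed
    then show ?thesis using trace_mon_not_exp_frob[OF k exp_add_V] False by simp
  qed
qed

text \<open>Additivity reduces the expansion to a single term. Division of its exponent by p with
  remainder leaves one index of the box at which the trace can be nonzero, and the remaining sum
  over \<open>i\<close> restores the coefficient by the duality for \<open>K\<close>.\<close>

lemma trace_dual: "frob_dual R p trace ({..<n} \<times> exp_box) (\<lambda>(i, \<alpha>). e i \<otimes> xpow (exp_codeg \<alpha>)) (\<lambda>(i, \<alpha>). b i \<otimes> xpow \<alpha>)"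
proof -
  have finI: "finite ({..<n} \<times> exp_box)" by (simp add: exp_box_def finite_PiE)
  have ec: "e i \<in> carrier R" "b i \<in> carrier R" "e i \<in> K" "b i \<in> K" if "i < n" for i
    using eb(1,2) K_props(6) that by auto
  let ?T = "\<lambda>g. (\<lambda>(i, \<alpha>). trace (e i \<otimes> xpow (exp_codeg \<alpha>) \<otimes> g) [^] p \<otimes> (b i \<otimes> xpow \<alpha>))"
  have Tc: "?T g \<in> {..<n} \<times> exp_box \<rightarrow> carrier R" if "g \<in> carrier R" for g
    using that ec mon_closed trace_closed by auto
  have "g = finsum R (?T g) ({..<n} \<times> exp_box)" if "g \<in> carrier R" for g
    using that
  proof (induction rule: poly_induct)
    case zero
    have "finsum R (?T \<zero>) ({..<n} \<times> exp_box) = \<zero>"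
      using ec mon_closed by (intro add.finprod_one_eqI) (auto simp: trace_zero Ep.pow_zero)
    then show ?case by simp
  next
    case (mon k \<alpha>0)
    let ?a = "\<lambda>i\<in>{..<N}. \<alpha>0 i mod p" and ?g = "\<lambda>i\<in>{..<N}. \<alpha>0 i div p"
    have a: "?a \<in> exp_box" using Ep.e_pos by (auto simp: exp_box_def)
    have dec: "\<alpha>0 = exp_add (exp_scale p ?g) ?a"
      by (rule V_eqI[OF mon(2) exp_add_V]) (simp add: exp_add_def exp_scale_def)
    have kc: "k \<in> carrier R" using mon K_props(6) by blast
    have T: "?T (k \<otimes> xpow \<alpha>0) (i, \<alpha>) = (if \<alpha> = ?a then (\<Lambda> (e i \<otimes> k) [^] p \<otimes> b i) \<otimes> xpow \<alpha>0 else \<zero>)"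
      if i: "i < n" and al: "\<alpha> \<in> exp_box" for i \<alpha>
    proof -
      have eK: "e i \<otimes> k \<in> K" using ec[OF i] mon K_props(5) by blast
      have LK: "\<Lambda> (e i \<otimes> k) \<in> carrier R" using Lam_closed[OF eK] K_props(6) by blast
      have "e i \<otimes> xpow (exp_codeg \<alpha>) \<otimes> (k \<otimes> xpow \<alpha>0) = (e i \<otimes> k) \<otimes> xpow (exp_add (exp_codeg \<alpha>) \<alpha>0)"
        using ec[OF i] kc by (intro mon_mult) auto
      then have "e i \<otimes> xpow (exp_codeg \<alpha>) \<otimes> (k \<otimes> xpow \<alpha>0) = (e i \<otimes> k) \<otimes> xpow (exp_add (exp_codeg \<alpha>) (exp_add (exp_scale p ?g) ?a))"
        using dec by simp
      then have t: "trace (e i \<otimes> xpow (exp_codeg \<alpha>) \<otimes> (k \<otimes> xpow \<alpha>0)) = (if \<alpha> = ?a then \<Lambda> (e i \<otimes> k) \<otimes> xpow ?g else \<zero>)"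
        using trace_exp_box[OF eK al a V_I] by simp
      show ?thesis
      proof (cases "\<alpha> = ?a")
        case True
        have "?T (k \<otimes> xpow \<alpha>0) (i, \<alpha>) = (\<Lambda> (e i \<otimes> k) \<otimes> xpow ?g) [^] p \<otimes> (b i \<otimes> xpow ?a)" using t True by simp
        also have "\<dots> = (\<Lambda> (e i \<otimes> k) [^] p \<otimes> xpow (exp_scale p ?g)) \<otimes> (b i \<otimes> xpow ?a)"
          using LK mon_closed by (simp add: Ep.pow_mult mon_pow)
        also have "\<dots> = (\<Lambda> (e i \<otimes> k) [^] p \<otimes> b i) \<otimes> xpow (exp_add (exp_scale p ?g) ?a)"
          using LK ec[OF i] by (intro mon_mult) auto
        finally show ?thesis using True dec by simp
      next
        case False
        then show ?thesis using t ec[OF i] mon_closed by (simp add: Ep.pow_zero)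
      qed
    qed
    have eKi: "e i \<otimes> k \<in> K" if "i < n" for i using ec[OF that] mon K_props(5) by blast
    have sc: "\<Lambda> (e i \<otimes> k) [^] p \<otimes> b i \<in> carrier R" if "i < n" for i
      using Lam_closed[OF eKi[OF that]] K_props(6) ec[OF that] by auto
    have "finsum R (?T (k \<otimes> xpow \<alpha>0)) ({..<n} \<times> exp_box) =
        finsum R (\<lambda>(i, \<alpha>). (\<Lambda> (e i \<otimes> k) [^] p \<otimes> b i) \<otimes> xpow \<alpha>0) ({..<n} \<times> {?a})"
    proof (rule add.finprod_mono_neutral_cong_right[OF finI])
      show "{..<n} \<times> {?a} \<subseteq> {..<n} \<times> exp_box" using a by auto
      show "?T (k \<otimes> xpow \<alpha>0) y = \<zero>" if y0: "y \<in> {..<n} \<times> exp_box - {..<n} \<times> {?a}" for y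
      proof -
        obtain i \<alpha> where y: "y = (i, \<alpha>)" "i < n" "\<alpha> \<in> exp_box" "\<alpha> \<noteq> ?a" using y0 by (cases y) auto
        show ?thesis unfolding y(1) using T[OF y(2,3)] y(4) by (simp only: if_False)
      qed
      show "?T (k \<otimes> xpow \<alpha>0) y = (case y of (i, \<alpha>) \<Rightarrow> (\<Lambda> (e i \<otimes> k) [^] p \<otimes> b i) \<otimes> xpow \<alpha>0)"
        if y0: "y \<in> {..<n} \<times> {?a}" for y
      proof -
        obtain i where y: "y = (i, ?a)" "i < n" using y0 by (cases y) auto
        show ?thesis unfolding y(1) using T[OF y(2) a] by simp
      qed
      show "?T (k \<otimes> xpow \<alpha>0) \<in> {..<n} \<times> exp_box \<rightarrow> carrier R" using Tc[of "k \<otimes> xpow \<alpha>0"] kc mon_closed by simp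
    qed
    also have "{..<n} \<times> {?a} = (\<lambda>i. (i, ?a)) ` {..<n}" by auto
    also have "finsum R (\<lambda>(i, \<alpha>). (\<Lambda> (e i \<otimes> k) [^] p \<otimes> b i) \<otimes> xpow \<alpha>0) ((\<lambda>i. (i, ?a)) ` {..<n}) =
        finsum R (\<lambda>i. (\<Lambda> (e i \<otimes> k) [^] p \<otimes> b i) \<otimes> xpow \<alpha>0) {..<n}"
      using sc mon_closed by (subst finsum_reindex) (auto intro!: inj_onI)
    also have "\<dots> = (\<Oplus>i\<in>{..<n}. \<Lambda> (e i \<otimes> k) [^] p \<otimes> b i) \<otimes> xpow \<alpha>0"
      using sc mon_closed by (intro finsum_ldistr[symmetric]) auto
    also have "(\<Oplus>i\<in>{..<n}. \<Lambda> (e i \<otimes> k) [^] p \<otimes> b i) = k" by (rule bspec[OF eb(3) mon(1), symmetric])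
    finally show ?case by (rule sym)
  next
    case (add g h)
    have "finsum R (?T (g \<oplus> h)) ({..<n} \<times> exp_box) = finsum R (\<lambda>y. ?T g y \<oplus> ?T h y) ({..<n} \<times> exp_box)"
    proof (rule finsum_cong')
      show "?T (g \<oplus> h) y = ?T g y \<oplus> ?T h y" if "y \<in> {..<n} \<times> exp_box" for y
        using that add.hyps ec mon_closed trace_closed
        by (cases y) (simp add: r_distr trace_add Ep.pow_add l_distr)
      show "(\<lambda>y. ?T g y \<oplus> ?T h y) \<in> {..<n} \<times> exp_box \<rightarrow> carrier R"
        using Tc[OF add.hyps(1)] Tc[OF add.hyps(2)] by (intro Pi_I a_closed) (auto dest: Pi_mem)
    qed simp
    also have "\<dots> = finsum R (?T g) ({..<n} \<times> exp_box) \<oplus> finsum R (?T h) ({..<n} \<times> exp_box)"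
      using Tc add.hyps by (intro finsum_addf) auto
    also have "\<dots> = g \<oplus> h" using add.IH by simp
    finally show ?case by (rule sym)
  qed
  then have "\<forall>g\<in>carrier R. g = (\<Oplus>y\<in>{..<n} \<times> exp_box. trace ((case y of (i, \<alpha>) \<Rightarrow> e i \<otimes> xpow (exp_codeg \<alpha>)) \<otimes> g) [^] p \<otimes>
      (case y of (i, \<alpha>) \<Rightarrow> b i \<otimes> xpow \<alpha>))"
    by (simp add: case_prod_beta')
  then show ?thesis
    unfolding frob_dual_def using trace_frob_linear finI ec mon_closed by auto
qed

end

section \<open>Homogeneous components\<close>

lemma (in F_finite_ring) frob_exponent_pk: "frob_exponent R (p ^ k)"
proof (induction k)
  case 0 then show ?case using frob_exponent_1 by simp
next
  case (Suc k)
  then interpret Q: frob_exponent R "p ^ k" .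
  have "x [^] (p ^ Suc k) = (x [^] p) [^] (p ^ k)" if "x \<in> carrier R" for x
    using that by (simp add: nat_pow_pow)
  then show ?case using Ep.pow_add Q.pow_add Ep.e_pos by unfold_locales auto
qed

context poly_ring begin

definition tdeg :: "(nat \<Rightarrow> nat) \<Rightarrow> nat" where
  "tdeg \<alpha> = (\<Sum>i<N. \<alpha> i)"

lemma tdeg_exp_add: "tdeg (exp_add \<alpha> \<beta>) = tdeg \<alpha> + tdeg \<beta>"
  by (simp add: tdeg_def exp_add_def sum.distrib)

lemma tdeg_exp_scale: "tdeg (exp_scale k \<alpha>) = k * tdeg \<alpha>"
  by (simp add: tdeg_def exp_scale_def sum_distrib_left)

definition hcomp :: "nat \<Rightarrow> 'a \<Rightarrow> 'a" where
  "hcomp d g = poly_val R N x (\<lambda>\<alpha>. if tdeg \<alpha> = d then coeffs g \<alpha> else \<zero>)"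

lemma hcomp_coeff_funs:
  assumes g: "g \<in> carrier R"
  shows "(\<lambda>\<alpha>. if tdeg \<alpha> = d then coeffs g \<alpha> else \<zero>) \<in> coeff_funs R K N"
proof -
  let ?c = "\<lambda>\<alpha>. if tdeg \<alpha> = d then coeffs g \<alpha> else \<zero>"
  have sub: "coeff_supp R ?c \<subseteq> coeff_supp R (coeffs g)" by (auto simp: coeff_supp_def)
  then have "finite (coeff_supp R ?c)" "coeff_supp R ?c \<subseteq> V"
    using coeffs_props(2,3)[OF g] finite_subset by blast+
  then show ?thesis using coeffs_props(1)[OF g] K_props(2) by (auto simp: coeff_funs_def)
qed

lemma coeffs_hcomp: "g \<in> carrier R \<Longrightarrow> coeffs (hcomp d g) = (\<lambda>\<alpha>. if tdeg \<alpha> = d then coeffs g \<alpha> else \<zero>)"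
  unfolding hcomp_def by (rule coeffs_poly_val[OF hcomp_coeff_funs])

lemma hcomp_carrier: "g \<in> carrier R \<Longrightarrow> hcomp d g \<in> carrier R"
  unfolding hcomp_def by (rule poly_val_closed[OF hcomp_coeff_funs])

lemma hcomp_add: "g \<in> carrier R \<Longrightarrow> h \<in> carrier R \<Longrightarrow> hcomp d (g \<oplus> h) = hcomp d g \<oplus> hcomp d h"
  by (rule coeffs_inj) (auto simp: hcomp_carrier coeffs_hcomp coeffs_add)

lemma hcomp_zero: "hcomp d \<zero> = \<zero>"
  by (rule coeffs_inj) (auto simp: hcomp_carrier coeffs_hcomp coeffs_zero)

lemma hcomp_hcomp: "g \<in> carrier R \<Longrightarrow> hcomp d (hcomp d' g) = (if d = d' then hcomp d g else \<zero>)"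
  by (rule coeffs_inj) (auto simp: hcomp_carrier coeffs_hcomp coeffs_zero fun_eq_iff)

lemma hcomp_mon:
  assumes "k \<in> K" "\<alpha> \<in> V"
  shows "hcomp d (k \<otimes> xpow \<alpha>) = (if tdeg \<alpha> = d then k \<otimes> xpow \<alpha> else \<zero>)"
proof (rule coeffs_inj)
  have c: "k \<otimes> xpow \<alpha> \<in> carrier R" using assms K_props(6) mon_closed by simp
  then show "hcomp d (k \<otimes> xpow \<alpha>) \<in> carrier R" "(if tdeg \<alpha> = d then k \<otimes> xpow \<alpha> else \<zero>) \<in> carrier R"
    using hcomp_carrier by auto
  show "coeffs (hcomp d (k \<otimes> xpow \<alpha>)) = coeffs (if tdeg \<alpha> = d then k \<otimes> xpow \<alpha> else \<zero>)"
    unfolding coeffs_hcomp[OF c] using coeffs_mon[OF assms] coeffs_zero by auto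
qed

lemma hcomp_finsum:
  assumes "finite A" "f \<in> A \<rightarrow> carrier R"
  shows "hcomp d (finsum R f A) = finsum R (\<lambda>i. hcomp d (f i)) A"
  using assms
proof (induction A)
  case empty then show ?case by (simp add: hcomp_zero)
next
  case (insert y A)
  have "hcomp d (finsum R f (insert y A)) = hcomp d (f y \<oplus> finsum R f A)" using insert by (subst finsum_insert) auto
  also have "\<dots> = hcomp d (f y) \<oplus> finsum R (\<lambda>i. hcomp d (f i)) A" using insert by (subst hcomp_add) auto
  also have "\<dots> = finsum R (\<lambda>i. hcomp d (f i)) (insert y A)"
    using insert hcomp_carrier by (subst finsum_insert) (auto simp: Pi_iff)
  finally show ?case .
qed

lemma graded_piece_iff: "g \<in> graded_piece R K N x d \<longleftrightarrow> g \<in> carrier R \<and> hcomp d g = g"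
proof
  assume "g \<in> graded_piece R K N x d"
  then obtain c where c: "c \<in> coeff_funs R K N" "\<forall>\<alpha>\<in>coeff_supp R c. tdeg \<alpha> = d" "g = poly_val R N x c"
    unfolding graded_piece_def tdeg_def by blast
  have g: "g \<in> carrier R" using c poly_val_closed by blast
  have "c \<alpha> = \<zero>" if "tdeg \<alpha> \<noteq> d" for \<alpha> using c(2) that by (auto simp: coeff_supp_def)
  then have "coeffs (hcomp d g) = coeffs g"
    unfolding coeffs_hcomp[OF g] unfolding c(3) coeffs_poly_val[OF c(1)] by (simp add: fun_eq_iff)
  then show "g \<in> carrier R \<and> hcomp d g = g" using g coeffs_inj hcomp_carrier by blast
next
  assume g: "g \<in> carrier R \<and> hcomp d g = g"
  then have "coeffs g = (\<lambda>\<alpha>. if tdeg \<alpha> = d then coeffs g \<alpha> else \<zero>)" using coeffs_hcomp by metis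
  then have "\<forall>\<alpha>\<in>coeff_supp R (coeffs g). tdeg \<alpha> = d" by (auto simp: coeff_supp_def) metis
  then show "g \<in> graded_piece R K N x d"
    unfolding graded_piece_def tdeg_def[symmetric] using g coeffs_closed poly_val_coeffs by force
qed

lemma hcomp_bound: "g \<in> carrier R \<Longrightarrow> \<exists>D. \<forall>d\<ge>D. hcomp d g = \<zero>"
proof (induction rule: poly_induct)
  case zero then show ?case by (simp add: hcomp_zero)
next
  case (mon k \<alpha>) then show ?case by (intro exI[of _ "Suc (tdeg \<alpha>)"]) (auto simp: hcomp_mon)
next
  case (add g h)
  then obtain D D' where "\<forall>d\<ge>D. hcomp d g = \<zero>" "\<forall>d\<ge>D'. hcomp d h = \<zero>" by blast
  then show ?case using add.hyps by (intro exI[of _ "max D D'"]) (simp add: hcomp_add)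
qed

lemma hcomp_sum:
  assumes "g \<in> carrier R"
  shows "\<exists>D. g = (\<Oplus>d\<in>{..<D}. hcomp d g)"
proof -
  have "\<exists>D0. \<forall>D\<ge>D0. g = (\<Oplus>d\<in>{..<D}. hcomp d g)"
    using assms
  proof (induction rule: poly_induct)
    case zero then show ?case by (simp add: hcomp_zero)
  next
    case (mon k \<alpha>)
    have c: "k \<otimes> xpow \<alpha> \<in> carrier R" using mon K_props(6) mon_closed by simp
    have "(\<Oplus>d\<in>{..<D}. hcomp d (k \<otimes> xpow \<alpha>)) = k \<otimes> xpow \<alpha>" if "Suc (tdeg \<alpha>) \<le> D" for D
    proof -
      have "(\<Oplus>d\<in>{..<D}. hcomp d (k \<otimes> xpow \<alpha>)) = (\<Oplus>d\<in>{..<D}. if tdeg \<alpha> = d then k \<otimes> xpow \<alpha> else \<zero>)"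
        using c by (intro finsum_cong') (auto simp: hcomp_mon[OF mon])
      also have "\<dots> = k \<otimes> xpow \<alpha>" using that c by (intro finsum_singleton) auto
      finally show ?thesis .
    qed
    then show ?case by (intro exI[of _ "Suc (tdeg \<alpha>)"]) simp
  next
    case (add g h)
    then obtain D D' where D: "\<forall>E\<ge>D. g = (\<Oplus>d\<in>{..<E}. hcomp d g)" "\<forall>E\<ge>D'. h = (\<Oplus>d\<in>{..<E}. hcomp d h)" by blast
    have "g \<oplus> h = (\<Oplus>d\<in>{..<E}. hcomp d (g \<oplus> h))" if E: "max D D' \<le> E" for E
    proof -
      have "(\<Oplus>d\<in>{..<E}. hcomp d (g \<oplus> h)) = (\<Oplus>d\<in>{..<E}. hcomp d g) \<oplus> (\<Oplus>d\<in>{..<E}. hcomp d h)"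
        using add.hyps hcomp_carrier by (simp add: hcomp_add finsum_addf Pi_iff)
      moreover have "(\<Oplus>d\<in>{..<E}. hcomp d g) = g" "(\<Oplus>d\<in>{..<E}. hcomp d h) = h"
        using D E by (simp_all flip: )
      ultimately show ?thesis by (simp only:)
    qed
    then show ?case by blast
  qed
  then show ?thesis by blast
qed

lemma hcomp_mult_hom:
  assumes h: "h \<in> carrier R" and g: "g \<in> carrier R"
  shows "hcomp d (hcomp e h \<otimes> g) = (if e \<le> d then hcomp e h \<otimes> hcomp (d - e) g else \<zero>)"
  using h
proof (induction rule: poly_induct)
  case zero then show ?case using g hcomp_carrier by (simp add: hcomp_zero)
next
  case (mon k \<alpha>)
  have c: "k \<in> carrier R" "k \<otimes> xpow \<alpha> \<in> carrier R" using mon K_props(6) mon_closed by auto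
  have "hcomp d ((k \<otimes> xpow \<alpha>) \<otimes> g) = (if tdeg \<alpha> \<le> d then (k \<otimes> xpow \<alpha>) \<otimes> hcomp (d - tdeg \<alpha>) g else \<zero>)"
    using g
  proof (induction rule: poly_induct)
    case zero then show ?case using c by (simp add: hcomp_zero)
  next
    case (mon l \<beta>)
    have lincomb: "l \<in> carrier R" using mon K_props(6) by blast
    have pr: "(k \<otimes> xpow \<alpha>) \<otimes> (l \<otimes> xpow \<beta>) = (k \<otimes> l) \<otimes> xpow (exp_add \<alpha> \<beta>)" by (rule mon_mult[OF c(1) lincomb])
    have "hcomp d ((k \<otimes> l) \<otimes> xpow (exp_add \<alpha> \<beta>)) = (if tdeg \<alpha> + tdeg \<beta> = d then (k \<otimes> l) \<otimes> xpow (exp_add \<alpha> \<beta>) else \<zero>)"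
      using hcomp_mon[OF K_props(5)[OF \<open>k \<in> K\<close> mon(1)] exp_add_V] by (simp add: tdeg_exp_add)
    then show ?case unfolding pr hcomp_mon[OF mon] using c pr by auto
  next
    case (add g g') then show ?case using c hcomp_carrier by (simp add: r_distr hcomp_add)
  qed
  then show ?case unfolding hcomp_mon[OF mon] using g by (auto simp: hcomp_zero hcomp_carrier)
next
  case (add h h') then show ?case using g hcomp_carrier by (simp add: hcomp_add l_distr)
qed

lemma hcomp_mult_mem:
  assumes C: "ideal C R" and g: "g \<in> carrier R" and h: "h \<in> carrier R"
    and m: "\<And>i. i \<le> d \<Longrightarrow> hcomp i g \<otimes> hcomp (d - i) h \<in> C"
  shows "hcomp d (g \<otimes> h) \<in> C"
proof -
  obtain D where D: "g = (\<Oplus>i\<in>{..<D}. hcomp i g)" using hcomp_sum[OF g] by blast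
  have "g \<otimes> h = (\<Oplus>i\<in>{..<D}. hcomp i g) \<otimes> h" using D by (rule arg_cong)
  also have "\<dots> = (\<Oplus>i\<in>{..<D}. hcomp i g \<otimes> h)" using g h hcomp_carrier by (intro finsum_ldistr) auto
  finally have "hcomp d (g \<otimes> h) = (\<Oplus>i\<in>{..<D}. hcomp d (hcomp i g \<otimes> h))"
    using hcomp_finsum[of "{..<D}" "\<lambda>i. hcomp i g \<otimes> h" d] g h hcomp_carrier by simp
  moreover have "hcomp d (hcomp i g \<otimes> h) \<in> C" for i
    unfolding hcomp_mult_hom[OF g h] using m additive_subgroup.zero_closed[OF ideal.axioms(1)[OF C]] by simp
  ultimately show ?thesis using ideal_finsum[OF C, of "{..<D}"] by simp
qed

text \<open>Homogeneity in the form that passes to powers, Frobenius powers and colon ideals without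
  naming homogeneous generators.\<close>

definition hcomp_closed :: "'a set \<Rightarrow> bool" where
  "hcomp_closed A \<longleftrightarrow> (\<forall>g\<in>A. \<forall>d. hcomp d g \<in> A)"

lemma hcomp_closed_frob_span:
  assumes A: "A \<subseteq> carrier R" and m: "\<And>a d. a \<in> A \<Longrightarrow> hcomp d a \<in> frob_span R 1 A"
  shows "hcomp_closed (frob_span R 1 A)"
proof -
  have id: "ideal (frob_span R 1 A) R" using E1.frob_span_frob_submodule[OF A] frob_submodule_1_iff by blast
  have "hcomp d v \<in> frob_span R 1 A" if "v \<in> frob_span R 1 A" for v d
    using that
  proof induction
    case zero then show ?case by (simp add: hcomp_zero frob_span_zero)
  next
    case (step v c a)
    have cc: "v \<in> carrier R" "a \<in> carrier R" using step.hyps E1.frob_span_closed[OF A] A by auto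
    have "hcomp d (c \<otimes> a) \<in> frob_span R 1 A"
      using ideal.I_l_closed[OF id m[OF step.hyps(3)]] hcomp_carrier step.hyps(2) cc
      by (intro hcomp_mult_mem[OF id]) auto
    then show ?case using step.IH E1.frob_span_plus[OF A] cc step.hyps(2) by (simp add: hcomp_add)
  qed
  then show ?thesis unfolding hcomp_closed_def by blast
qed

lemma hcomp_closed_homogeneous_ideal:
  assumes "homogeneous_ideal R K N x A"
  shows "hcomp_closed A"
proof -
  let ?X = "A \<inter> (\<Union>d. graded_piece R K N x d)"
  have A: "ideal A R" "A = Idl ?X" using assms by (auto simp: homogeneous_ideal_def)
  have c: "?X \<subseteq> carrier R" using ideal.Icarr[OF A(1)] by blast
  have "A = frob_span R 1 ?X" using A(2) frob_span_1_eq_genideal[OF c] by simp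
  moreover have "hcomp_closed (frob_span R 1 ?X)"
  proof (rule hcomp_closed_frob_span[OF c])
    fix a d assume a: "a \<in> ?X"
    then obtain d' where "hcomp d' a = a" "a \<in> carrier R" using graded_piece_iff by blast
    then have "hcomp d a = (if d = d' then a else \<zero>)" using hcomp_hcomp[of a d d'] by metis
    then show "hcomp d a \<in> frob_span R 1 ?X" using E1.frob_span_base[OF c a] frob_span_zero by auto
  qed
  ultimately show ?thesis by simp
qed

lemma hcomp_closed_ideal_power:
  assumes A: "ideal A R" "hcomp_closed A"
  shows "hcomp_closed (ideal_power A k)"
proof (induction k)
  case 0 then show ?case using hcomp_carrier by (auto simp: hcomp_closed_def ideal_power_simps)
next
  case (Suc k)
  have id: "ideal (ideal_prod R (ideal_power A k) A) R" using ideal_prod_is_ideal ideal_power_ideal A by blast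
  have "v \<in> carrier R \<and> (\<forall>d. hcomp d v \<in> ideal_prod R (ideal_power A k) A)" if "v \<in> ideal_prod R (ideal_power A k) A" for v
    using that
  proof induction
    case (prod i j)
    have c: "i \<in> carrier R" "j \<in> carrier R" using prod ideal.Icarr[OF A(1)] ideal.Icarr[OF ideal_power_ideal[OF A(1)]] by auto
    have "hcomp a i \<in> ideal_power A k" "hcomp a j \<in> A" for a using prod Suc A(2) unfolding hcomp_closed_def by blast+
    then have "hcomp d (i \<otimes> j) \<in> ideal_prod R (ideal_power A k) A" for d
      using c by (intro hcomp_mult_mem[OF id]) (auto intro: ideal_prod.prod)
    then show ?case using c by simp
  next
    case (sum s1 s2)
    then show ?case using hcomp_add ideal_prod.sum[of _ R "ideal_power A k" A] by auto
  qed
  then show ?case unfolding hcomp_closed_def ideal_power_simps by blast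
qed

lemma hcomp_pow_p:
  assumes "g \<in> carrier R"
  shows "hcomp d (g [^] p) = (if p dvd d then hcomp (d div p) g [^] p else \<zero>)"
  using assms
proof (induction rule: poly_induct)
  case zero then show ?case by (simp add: hcomp_zero Ep.pow_zero)
next
  case (mon k \<alpha>)
  have c: "k \<in> carrier R" using mon K_props(6) by blast
  have "(k \<otimes> xpow \<alpha>) [^] p = k [^] p \<otimes> xpow (exp_scale p \<alpha>)" using c mon_closed by (simp add: Ep.pow_mult mon_pow)
  then have "hcomp d ((k \<otimes> xpow \<alpha>) [^] p) = (if p * tdeg \<alpha> = d then (k \<otimes> xpow \<alpha>) [^] p else \<zero>)"
    using hcomp_mon[OF K_pow[OF mon(1)] exp_scale_V] by (simp add: tdeg_exp_scale)
  moreover have "p * tdeg \<alpha> = d \<longleftrightarrow> p dvd d \<and> tdeg \<alpha> = d div p" using Ep.e_pos by auto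
  ultimately show ?case using hcomp_mon[OF mon] by (simp add: Ep.pow_zero)
next
  case (add g h) then show ?case using hcomp_carrier by (auto simp: Ep.pow_add hcomp_add)
qed

lemma hcomp_pow_pk:
  assumes g: "g \<in> carrier R"
  shows "hcomp d (g [^] (p ^ k)) = (if p ^ k dvd d then hcomp (d div p ^ k) g [^] (p ^ k) else \<zero>)"
proof (induction k arbitrary: d)
  case 0 then show ?case using g hcomp_carrier by (simp add: nat_pow_eone)
next
  case (Suc k)
  have eq: "y [^] (p ^ Suc k) = (y [^] (p ^ k)) [^] p" if "y \<in> carrier R" for y
    using that by (simp add: nat_pow_pow mult.commute)
  have dv: "p ^ Suc k dvd d \<longleftrightarrow> p dvd d \<and> p ^ k dvd d div p"
    using Ep.e_pos by (auto simp: dvd_def div_mult2_eq mult.assoc)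
  have dd: "d div p div p ^ k = d div p ^ Suc k" by (simp add: div_mult2_eq)
  have "hcomp d (g [^] (p ^ Suc k)) = hcomp d ((g [^] (p ^ k)) [^] p)" using eq[OF g] by simp
  also have "\<dots> = (if p dvd d then hcomp (d div p) (g [^] (p ^ k)) [^] p else \<zero>)" using g by (intro hcomp_pow_p) simp
  also have "\<dots> = (if p ^ Suc k dvd d then (hcomp (d div p ^ Suc k) g [^] (p ^ k)) [^] p else \<zero>)"
    unfolding Suc.IH dv dd by (auto simp: Ep.pow_zero)
  finally show ?case using eq[OF hcomp_carrier[OF g]] by simp
qed

lemma hcomp_closed_frob_power:
  assumes A: "A \<subseteq> carrier R" "hcomp_closed A"
  shows "hcomp_closed (frob_power R p A)"
  unfolding frob_power_frob_span[OF A(1)]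
proof (rule hcomp_closed_frob_span[OF pow_subset[OF A(1)]])
  fix a d assume "a \<in> (\<lambda>x. x [^] p) ` A"
  then obtain g where g: "g \<in> A" "a = g [^] p" by blast
  then have "hcomp (d div p) g \<in> A" using A(2) unfolding hcomp_closed_def by blast
  then have "hcomp (d div p) g [^] p \<in> frob_span R 1 ((\<lambda>x. x [^] p) ` A)"
    using E1.frob_span_base[OF pow_subset[OF A(1)]] by blast
  then show "hcomp d a \<in> frob_span R 1 ((\<lambda>x. x [^] p) ` A)"
    using hcomp_pow_p[of g d] g A(1) frob_span_zero by (auto simp: subset_iff)
qed

text \<open>For a component \<open>hcomp j a\<close> of an element of \<open>B\<close>, its product
  with \<open>hcomp d f\<close> is the component of degree j + d of its product with
  \<open>f\<close>, so it lies in \<open>A\<close>. Summing over the components of \<open>a\<close>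
  gives the claim.\<close>

lemma hcomp_closed_colon:
  assumes A: "ideal A R" "hcomp_closed A" and B: "B \<subseteq> carrier R" "hcomp_closed B" and f: "f \<in> colon_ideal R A B"
  shows "hcomp d f \<in> colon_ideal R A B"
proof -
  have fc: "f \<in> carrier R" using f by (simp add: colon_ideal_def)
  have "hcomp d f \<otimes> a \<in> A" if a: "a \<in> B" for a
  proof -
    have ac: "a \<in> carrier R" using a B by blast
    obtain D where D: "a = (\<Oplus>j\<in>{..<D}. hcomp j a)" using hcomp_sum[OF ac] by blast
    have "hcomp d f \<otimes> hcomp j a \<in> A" for j
    proof -
      have "hcomp j a \<in> B" using a B(2) unfolding hcomp_closed_def by blast
      then have "f \<otimes> hcomp j a \<in> A" using f by (simp add: colon_ideal_def)
      then have "hcomp (j + d) (hcomp j a \<otimes> f) \<in> A"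
        using A(2) fc ac hcomp_carrier m_comm unfolding hcomp_closed_def by metis
      then show ?thesis using hcomp_mult_hom[OF ac fc, of "j + d" j] hcomp_carrier fc ac by (simp add: m_comm)
    qed
    then have "(\<Oplus>j\<in>{..<D}. hcomp d f \<otimes> hcomp j a) \<in> A" using ideal_finsum[OF A(1), of "{..<D}"] by simp
    moreover have "(\<Oplus>j\<in>{..<D}. hcomp d f \<otimes> hcomp j a) = hcomp d f \<otimes> (\<Oplus>j\<in>{..<D}. hcomp j a)"
      using hcomp_carrier fc ac by (intro finsum_rdistr[symmetric]) auto
    ultimately have "hcomp d f \<otimes> (\<Oplus>j\<in>{..<D}. hcomp j a) \<in> A" by (simp only:)
    then show ?thesis using D[symmetric] by (simp only:)
  qed
  then show ?thesis using hcomp_carrier fc by (simp add: colon_ideal_def)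
qed

text \<open>If all components of \<open>r\<close> of degree above n are in \<open>A\<close>, the
  component of degree t + n of (s + s') r shows that \<open>s \<otimes> hcomp n r\<close> is in
  \<open>A\<close>. Passing from \<open>A\<close> to the colon ideal A : s puts
  \<open>hcomp n r\<close> into the ideal, and repeating this down to degree 0 uses finitely many
  factors \<open>s\<close>.\<close>

lemma top_component_kills:
  assumes A: "ideal A R" "hcomp_closed A" and s: "s \<in> carrier R" "hcomp t s = s"
    and s': "s' \<in> carrier R" "\<And>j. t \<le> j \<Longrightarrow> hcomp j s' = \<zero>" and r: "r \<in> carrier R" and m: "(s \<oplus> s') \<otimes> r \<in> A"
  shows "\<exists>M::nat. \<forall>i. s [^] M \<otimes> hcomp i r \<in> A"
proof -
  obtain n where n: "\<forall>d\<ge>n. hcomp d r = \<zero>" using hcomp_bound[OF r] by blast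
  have "\<exists>M::nat. \<forall>i. s [^] M \<otimes> hcomp i r \<in> A"
    if "ideal A R" "hcomp_closed A" "(s \<oplus> s') \<otimes> r \<in> A" "\<forall>i\<ge>n. hcomp i r \<in> A" for A n
    using that
  proof (induction n arbitrary: A)
    case 0
    then show ?case using hcomp_carrier r by (intro exI[of _ 0]) auto
  next
    case (Suc n)
    note id = Suc.prems(1)
    have zA: "\<zero> \<in> A" using additive_subgroup.zero_closed[OF ideal.axioms(1)[OF id]] .
    have 1: "hcomp (t + n) (s \<otimes> r) = s \<otimes> hcomp n r"
      using hcomp_mult_hom[OF s(1) r, of "t + n" t] s(2) by simp
    have 2: "hcomp (t + n) (s' \<otimes> r) \<in> A"
    proof (rule hcomp_mult_mem[OF id s'(1) r])
      fix i assume i: "i \<le> t + n"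
      show "hcomp i s' \<otimes> hcomp (t + n - i) r \<in> A"
      proof (cases "t \<le> i")
        case True then show ?thesis using s'(2) hcomp_carrier r zA by simp
      next
        case False
        then have "Suc n \<le> t + n - i" by simp
        then have "hcomp (t + n - i) r \<in> A" using Suc.prems(4) by blast
        then show ?thesis using ideal.I_l_closed[OF id] hcomp_carrier s'(1) by blast
      qed
    qed
    have "hcomp (t + n) ((s \<oplus> s') \<otimes> r) \<in> A" using Suc.prems(2,3) unfolding hcomp_closed_def by blast
    moreover have "hcomp (t + n) ((s \<oplus> s') \<otimes> r) = hcomp (t + n) (s' \<otimes> r) \<oplus> s \<otimes> hcomp n r"
      using s s' r 1 hcomp_carrier by (simp add: l_distr hcomp_add a_comm)
    ultimately have sn: "s \<otimes> hcomp n r \<in> A"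
      using E1.frob_submodule_cancel[OF id[folded frob_submodule_1_iff] 2] s r hcomp_carrier by simp
    let ?A = "{c \<in> carrier R. c [^] (1::nat) \<otimes> s \<in> A}"
    have mem: "c \<in> ?A \<longleftrightarrow> c \<in> carrier R \<and> s \<otimes> c \<in> A" for c using s by (auto simp: m_comm)
    have idA: "ideal ?A R" using E1.frob_submodule_colon[OF id[folded frob_submodule_1_iff] s(1)] frob_submodule_1_iff by blast
    have sub: "A \<subseteq> ?A" using ideal.I_l_closed[OF id _ s(1)] ideal.Icarr[OF id] mem by blast
    have hA: "hcomp_closed ?A"
      unfolding hcomp_closed_def
    proof (intro ballI allI)
      fix c d assume c: "c \<in> ?A"
      then have cc: "c \<in> carrier R" "s \<otimes> c \<in> A" using mem by auto
      have "hcomp (t + d) (s \<otimes> c) = s \<otimes> hcomp d c" using hcomp_mult_hom[OF s(1) cc(1), of "t + d" t] s(2) by simp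
      moreover have "hcomp (t + d) (s \<otimes> c) \<in> A" using cc(2) Suc.prems(2) unfolding hcomp_closed_def by blast
      ultimately show "hcomp d c \<in> ?A" using mem hcomp_carrier cc(1) by simp
    qed
    have "hcomp i r \<in> ?A" if "n \<le> i" for i
    proof (cases "i = n")
      case True then show ?thesis using sn mem hcomp_carrier r by simp
    next
      case False
      then have "hcomp i r \<in> A" using that Suc.prems(4) by auto
      then show ?thesis using sub by blast
    qed
    then obtain M :: nat where M: "\<forall>i. s [^] M \<otimes> hcomp i r \<in> ?A"
      using Suc.IH[OF idA hA] sub Suc.prems(3) by blast
    have "s [^] Suc M \<otimes> hcomp i r \<in> A" for i
    proof -
      have "s \<otimes> (s [^] M \<otimes> hcomp i r) \<in> A" using M mem by blast
      then show ?thesis using s hcomp_carrier[OF r] by (simp add: m_ac)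
    qed
    then show ?case by blast
  qed
  then show ?thesis using A m n additive_subgroup.zero_closed[OF ideal.axioms(1)[OF A(1)]] by metis
qed

text \<open>In characteristic \<open>p\<close> the top component \<open>s\<^sub>t\<close> of \<open>s\<close> can be split off from \<open>s\<close> by raising to a power
  \<open>q = p\<^sup>k\<close>: if \<open>s\<^sub>t\<^sup>q\<close> kills the components of \<open>r\<close> modulo \<open>A\<close>, then \<open>(s - s\<^sub>t)\<^sup>q r \<in> A\<close>.\<close>

lemma components_kill:
  assumes A: "ideal A R" "hcomp_closed A" and r: "r \<in> carrier R" and "s \<in> carrier R" "s \<otimes> r \<in> A"
  shows "\<exists>M::nat. \<forall>i. hcomp j s [^] M \<otimes> hcomp i r \<in> A"
  using assms(4,5)
proof (induction "card {j. hcomp j s \<noteq> \<zero>}" arbitrary: s j rule: less_induct)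
  case less
  let ?supp = "\<lambda>s. {j. hcomp j s \<noteq> \<zero>}"
  note s = less.prems(1)
  have zA: "\<zero> \<in> A" using additive_subgroup.zero_closed[OF ideal.axioms(1)[OF A(1)]] .
  have fin: "finite (?supp s)" if sc: "s \<in> carrier R" for s
  proof -
    obtain D where "\<forall>d\<ge>D. hcomp d s = \<zero>" using hcomp_bound[OF sc] by blast
    then have "?supp s \<subseteq> {..<D}" using not_le by auto
    then show ?thesis using finite_subset by blast
  qed
  show ?case
  proof (cases "hcomp j s = \<zero>")
    case True
    then show ?thesis using zA hcomp_carrier r by (intro exI[of _ 1]) simp
  next
    case nz: False
    define t where "t = Max (?supp s)"
    have t: "t \<in> ?supp s" "\<And>j. hcomp j s \<noteq> \<zero> \<Longrightarrow> j \<le> t"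
      using Max_in[OF fin[OF s]] Max_ge[OF fin[OF s]] nz unfolding t_def by blast+
    define s0 s' where "s0 = hcomp t s" and "s' = s \<ominus> s0"
    have c: "s0 \<in> carrier R" "s' \<in> carrier R" using s hcomp_carrier unfolding s0_def s'_def by auto
    have dec: "s0 \<oplus> s' = s" using c s unfolding s'_def by algebra
    have s0t: "hcomp j s0 = (if j = t then s0 else \<zero>)" for j
      unfolding s0_def using hcomp_hcomp[OF s] by simp
    have cs: "hcomp j s = hcomp j s0 \<oplus> hcomp j s'" for j using hcomp_add[OF c] dec by simp
    have "s0 \<oplus> hcomp t s' = s0" using cs[of t] s0t[of t] unfolding s0_def by simp
    then have s't: "hcomp t s' = \<zero>" using c hcomp_carrier by (simp add: add.l_cancel_one)
    have s'j: "hcomp j s' = hcomp j s" if "j \<noteq> t" for j using cs[of j] s0t[of j] that c hcomp_carrier by simp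
    have s'0: "hcomp j s' = \<zero>" if "t \<le> j" for j
      using that s't s'j[of j] t(2)[of j] by (cases "j = t") auto
    have s0t0: "hcomp t s0 = s0" using s0t[of t] by simp
    have "(s0 \<oplus> s') \<otimes> r \<in> A" using dec less.prems(2) by simp
    then obtain M0 :: nat where M0: "\<forall>i. s0 [^] M0 \<otimes> hcomp i r \<in> A"
      using top_component_kills[OF A c(1) s0t0 c(2) s'0 r] by blast
    \<comment> \<open>A power of \<open>p\<close> above \<open>M0\<close>: then s0^q still kills the
      components of \<open>r\<close>, while taking q-th powers is additive.\<close>
    define q where "q = p ^ M0"
    interpret Q: frob_exponent R q unfolding q_def by (rule frob_exponent_pk)
    have "M0 < q" unfolding q_def using prime_ge_2_nat[OF p_prime] by (intro power_gt_expt) simp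
    then obtain a where a: "q = M0 + a" using less_imp_add_positive by blast
    have "s0 [^] q \<otimes> hcomp i r \<in> A" for i
    proof -
      have "s0 [^] q \<otimes> hcomp i r = s0 [^] a \<otimes> (s0 [^] M0 \<otimes> hcomp i r)"
        unfolding a using c hcomp_carrier r by (simp add: nat_pow_mult[symmetric] m_ac)
      then show ?thesis using ideal.I_l_closed[OF A(1)] M0 c by simp
    qed
    moreover obtain D where D: "r = (\<Oplus>i\<in>{..<D}. hcomp i r)" using hcomp_sum[OF r] by blast
    ultimately have "(\<Oplus>i\<in>{..<D}. s0 [^] q \<otimes> hcomp i r) \<in> A" using ideal_finsum[OF A(1), of "{..<D}"] by simp
    moreover have "(\<Oplus>i\<in>{..<D}. s0 [^] q \<otimes> hcomp i r) = s0 [^] q \<otimes> (\<Oplus>i\<in>{..<D}. hcomp i r)"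
      using hcomp_carrier r c by (intro finsum_rdistr[symmetric]) auto
    ultimately have "s0 [^] q \<otimes> (\<Oplus>i\<in>{..<D}. hcomp i r) \<in> A" by (simp only:)
    then have 1: "s0 [^] q \<otimes> r \<in> A" using D[symmetric] by (simp only:)
    obtain b where b: "q = Suc b" using Q.e_pos by (cases q) auto
    have "s [^] q \<otimes> r = s [^] b \<otimes> (s \<otimes> r)" unfolding b using s r by (simp add: m_assoc)
    then have "s [^] q \<otimes> r \<in> A" using ideal.I_l_closed[OF A(1) less.prems(2)] s by simp
    moreover have "s [^] q \<otimes> r = s0 [^] q \<otimes> r \<oplus> s' [^] q \<otimes> r"
      unfolding dec[symmetric] using c r by (simp add: Q.pow_add l_distr)
    ultimately have s'q: "s' [^] q \<otimes> r \<in> A"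
      using E1.frob_submodule_cancel[OF A(1)[folded frob_submodule_1_iff] 1] c r by simp
    \<comment> \<open>The support of s'^q is contained in \<open>q\<close> times that of
      \<open>s'\<close>, which lacks the top degree \<open>t\<close>. So s'^q has fewer components
      than \<open>s\<close>, and the induction hypothesis applies to it.\<close>
    have cq: "hcomp d (s' [^] q) = (if q dvd d then hcomp (d div q) s' [^] q else \<zero>)" for d
      unfolding q_def by (rule hcomp_pow_pk[OF c(2)])
    have "?supp (s' [^] q) \<subseteq> (\<lambda>j. q * j) ` ?supp s'"
    proof
      fix d assume "d \<in> ?supp (s' [^] q)"
      then have "q dvd d" "hcomp (d div q) s' \<noteq> \<zero>" using cq[of d] Q.pow_zero by (auto split: if_splits)
      then show "d \<in> (\<lambda>j. q * j) ` ?supp s'" by (intro image_eqI[of _ _ "d div q"]) auto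
    qed
    then have "card (?supp (s' [^] q)) \<le> card (?supp s')"
      using fin[OF c(2)] by (meson card_image_le card_mono finite_imageI le_trans)
    moreover have "?supp s' \<subset> ?supp s"
    proof
      show "?supp s' \<subseteq> ?supp s"
      proof
        fix i assume i: "i \<in> ?supp s'"
        then have "i \<noteq> t" using s't by blast
        then show "i \<in> ?supp s" using i s'j by simp
      qed
      show "?supp s' \<noteq> ?supp s" using s't t(1) by blast
    qed
    then have "card (?supp s') < card (?supp s)" by (rule psubset_card_mono[OF fin[OF s]])
    ultimately have less_card: "card (?supp (s' [^] q)) < card (?supp s)" by linarith
    show ?thesis
    proof (cases "j = t")
      case True then show ?thesis using M0 unfolding s0_def by blast
    next
      case False
      \<comment> \<open>For j \<noteq> t the component of degree q j of s'^q is the q-th power of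
        the component of degree j of \<open>s\<close>, so a power of the latter kills as
        well.\<close>
      obtain M :: nat where "\<forall>i. hcomp (q * j) (s' [^] q) [^] M \<otimes> hcomp i r \<in> A"
        using less.hyps[OF less_card _ s'q] c by blast
      moreover have "hcomp (q * j) (s' [^] q) [^] M = hcomp j s [^] (q * M)"
        using cq[of "q * j"] s'j[OF False] Q.e_pos s hcomp_carrier by (simp add: nat_pow_pow)
      ultimately show ?thesis by auto
    qed
  qed
qed

section \<open>The homogeneous maximal ideal\<close>

lemma hcomp_0_const_coeff: "g \<in> carrier R \<Longrightarrow> hcomp 0 g = const_coeff g"
proof (induction rule: poly_induct)
  case zero then show ?case by (simp add: hcomp_zero const_coeff_zero)
next
  case (mon k \<alpha>)
  have "tdeg \<alpha> = 0 \<longleftrightarrow> \<alpha> = (\<lambda>i\<in>{..<N}. 0)"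
    using V_eqI[OF mon(2) V_I[of "\<lambda>_. 0"]] by (auto simp: tdeg_def)
  then show ?case unfolding hcomp_mon[OF mon] const_coeff_mon[OF mon] using mon_zero mon K_props(6) by auto
next
  case (add g h) then show ?case by (simp add: hcomp_add const_coeff_add)
qed

lemma vars_closed: "x ` {..<N} \<subseteq> carrier R"
  using x_closed by auto

lemma one_notin_vars: "\<one> \<notin> Idl (x ` {..<N})"
proof
  assume "\<one> \<in> Idl (x ` {..<N})"
  then have "\<one> \<in> frob_span R 1 (x ` {..<N})" using frob_span_1_eq_genideal[OF vars_closed] by simp
  moreover have "const_coeff v = \<zero>" if "v \<in> frob_span R 1 (x ` {..<N})" for v
    using that
  proof induction
    case zero then show ?case by (rule const_coeff_zero)
  next
    case (step v c y)
    obtain i where i: "i < N" "y = x i" using step.hyps by auto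
    let ?a = "\<lambda>j\<in>{..<N}. if j = i then 1 else (0::nat)"
    have "xpow ?a = (\<Otimes>j\<in>{..<N}. if i = j then x i else \<one>)"
      unfolding var_monom_def using x_closed by (intro finprod_cong') (auto simp: nat_pow_eone)
    also have "\<dots> = x i" using i x_closed by (intro finprod_singleton) auto
    finally have "y = \<one> \<otimes> xpow ?a" using i x_closed by simp
    moreover have ne: "?a \<noteq> (\<lambda>i\<in>{..<N}. 0)"
    proof
      assume "?a = (\<lambda>i\<in>{..<N}. 0)"
      from fun_cong[OF this, of i] show False using i by simp
    qed
    ultimately have "const_coeff y = \<zero>" using const_coeff_mon[OF K_props(3) V_I, of "\<lambda>j. if j = i then 1 else 0"] by (simp only: if_False)
    moreover have "v \<in> carrier R" "y \<in> carrier R" using step.hyps E1.frob_span_closed[OF vars_closed] i x_closed by auto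
    ultimately show ?case using step const_coeff_closed K_props(6) by (simp add: const_coeff_add const_coeff_mult)
  qed
  ultimately have "const_coeff \<one> = \<zero>" by blast
  then show False using const_coeff_K[OF K_props(3)] subfieldE(6)[OF K_subfield] by simp
qed

lemma vars_mem:
  assumes "g \<in> carrier R" "const_coeff g = \<zero>"
  shows "g \<in> Idl (x ` {..<N})"
proof -
  note id = genideal_ideal[OF vars_closed]
  have "g \<ominus> const_coeff g \<in> Idl (x ` {..<N})"
    using assms(1)
  proof (induction rule: poly_induct)
    case zero
    show ?case using additive_subgroup.zero_closed[OF ideal.axioms(1)[OF id]] by (simp add: const_coeff_zero a_minus_def)
  next
    case (mon k \<alpha>)
    have kc: "k \<in> carrier R" using mon K_props(6) by blast
    show ?case
    proof (cases "\<alpha> = (\<lambda>i\<in>{..<N}. 0)")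
      case True
      then have "k \<otimes> xpow \<alpha> \<ominus> const_coeff (k \<otimes> xpow \<alpha>) = \<zero>" using const_coeff_mon[OF mon] mon_zero kc by (simp add: a_minus_def r_neg)
      then show ?thesis using additive_subgroup.zero_closed[OF ideal.axioms(1)[OF id]] by simp
    next
      case False
      then obtain i where i: "i < N" "\<alpha> i \<noteq> 0" using V_eqI[OF mon(2) V_I[of "\<lambda>_. 0"]] by auto
      have "xpow \<alpha> = (\<Otimes>j\<in>insert i ({..<N} - {i}). x j [^] \<alpha> j)"
        unfolding var_monom_def using i by (intro arg_cong[of _ _ "finprod R _"]) auto
      also have "\<dots> = x i [^] \<alpha> i \<otimes> (\<Otimes>j\<in>{..<N} - {i}. x j [^] \<alpha> j)"
        using i x_closed by (intro finprod_insert) auto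
      finally have e: "xpow \<alpha> = x i [^] \<alpha> i \<otimes> (\<Otimes>j\<in>{..<N} - {i}. x j [^] \<alpha> j)" .
      obtain a where a: "\<alpha> i = Suc a" using i(2) not0_implies_Suc by blast
      have "x i \<in> Idl (x ` {..<N})" using genideal_self[OF vars_closed] i by blast
      then have "x i [^] \<alpha> i \<in> Idl (x ` {..<N})" unfolding a using ideal.I_l_closed[OF id] x_closed[OF i(1)] by simp
      moreover have "(\<Otimes>j\<in>{..<N} - {i}. x j [^] \<alpha> j) \<in> carrier R" using x_closed by (intro finprod_closed) auto
      ultimately have "xpow \<alpha> \<in> Idl (x ` {..<N})" unfolding e using ideal.I_r_closed[OF id] by blast
      then have "k \<otimes> xpow \<alpha> \<in> Idl (x ` {..<N})" using ideal.I_l_closed[OF id] kc by blast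
      moreover have "const_coeff (k \<otimes> xpow \<alpha>) = \<zero>" using const_coeff_mon[OF mon] False by simp
      ultimately show ?thesis using kc mon_closed by (simp add: a_minus_def)
    qed
  next
    case (add g h)
    have c: "const_coeff g \<in> carrier R" "const_coeff h \<in> carrier R" using add.hyps const_coeff_closed K_props(6) by auto
    have "(g \<oplus> h) \<ominus> const_coeff (g \<oplus> h) = (g \<ominus> const_coeff g) \<oplus> (h \<ominus> const_coeff h)"
      unfolding const_coeff_add[OF add.hyps(1,2)] using add.hyps(1,2) c by algebra
    then show ?case using add.IH additive_subgroup.a_closed[OF ideal.axioms(1)[OF id]] by simp
  qed
  then show ?thesis using assms by (simp add: a_minus_def)
qed

end

section \<open>Homogeneous splittings\<close>

locale graded_symbolic = poly_dual R p K N x \<Lambda> l e b + symbolic R p I H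
  for R (structure) and p K N x \<Lambda> l e b I H +
  assumes hom: "homogeneous_ideal R K N x I"
begin

text \<open>A denominator \<open>s\<close> of \<open>r\<close> need not have its components in
  \<open>S\<close>. At each minimal prime \<open>P\<close>, however, some component of
  \<open>s\<close> is outside \<open>P\<close>, and a power of it multiplies every component of
  \<open>r\<close> into the power of \<open>I\<close>, which is homogeneous. Prime avoidance then
  assembles a denominator in \<open>S\<close> for each component of \<open>r\<close>.\<close>

lemma hcomp_closed_symb: "hcomp_closed (symbolic_power R I n)"
  unfolding hcomp_closed_def
proof (intro ballI allI)
  fix r i assume "r \<in> symbolic_power R I n"
  then obtain s where s: "r \<in> carrier R" "s \<in> S" "s \<otimes> r \<in> ideal_power I n" using mem_symb by blast
  have sc: "s \<in> carrier R" using s(2) MS.S_carr by blast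
  note id = ideal_power_ideal[OF I_ideal, of n]
  let ?B = "{u \<in> carrier R. u [^] (1::nat) \<otimes> hcomp i r \<in> ideal_power I n}"
  have B: "ideal ?B R" using E1.frob_submodule_colon[OF id[folded frob_submodule_1_iff] hcomp_carrier[OF s(1)]] frob_submodule_1_iff by blast
  have "\<exists>u\<in>?B. u \<notin> P" if P: "P \<in> minimal_primes R I" for P
  proof -
    have sP: "s \<in> carrier R - P" by (rule S_notin[OF s(2) P])
    have "\<exists>j. hcomp j s \<notin> P"
    proof (rule ccontr)
      assume "\<not> (\<exists>j. hcomp j s \<notin> P)"
      then have sum: "(\<Oplus>d\<in>{..<D}. hcomp d s) \<in> P" for D
        using ideal_finsum[OF primeideal.axioms(1)[OF minp(1)[OF P]], of "{..<D}"] by simp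
      obtain D where D: "s = (\<Oplus>d\<in>{..<D}. hcomp d s)" using hcomp_sum[OF sc] by blast
      have "s \<in> P" using sum[of D] D[symmetric] by (simp only:)
      then show False using sP by blast
    qed
    then obtain j where "hcomp j s \<notin> P" by blast
    then have j: "hcomp j s \<in> carrier R - P" using hcomp_carrier[OF sc] by blast
    obtain M :: nat where "\<forall>i. hcomp j s [^] M \<otimes> hcomp i r \<in> ideal_power I n"
      using components_kill[OF id hcomp_closed_ideal_power[OF I_ideal hcomp_closed_homogeneous_ideal[OF hom]] s(1) sc s(3)] by blast
    moreover have "hcomp j s [^] M \<in> carrier R - P" by (rule prime_pow_notin[OF minp(1)[OF P] j])
    ultimately show ?thesis by (intro bexI[of _ "hcomp j s [^] M"]) auto
  qed
  then obtain u where "u \<in> ?B" "u \<in> S" using meets_S[OF B] by blast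
  then show "hcomp i r \<in> symbolic_power R I n" using mem_symb hcomp_carrier[OF s(1)] by auto
qed

lemma tdeg_exp_top: "tdeg exp_top = N * (p - 1)"
  by (simp add: tdeg_def exp_top_def)

text \<open>The trace reads the exponents p \<gamma> + (p - 1), whose total degree is p times the
  degree of \<gamma> plus N (p - 1).\<close>

lemma hcomp_trace:
  assumes "g \<in> carrier R"
  shows "hcomp d (trace g) = trace (hcomp (p * d + N * (p - 1)) g)"
  using assms
proof (induction rule: poly_induct)
  case zero then show ?case by (simp add: hcomp_zero trace_zero)
next
  case (mon k \<alpha>)
  show ?case
  proof (cases "\<exists>\<gamma>\<in>V. \<alpha> = exp_frob \<gamma>")
    case True
    then obtain \<gamma> where ga: "\<gamma> \<in> V" "\<alpha> = exp_frob \<gamma>" by blast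
    have "tdeg \<alpha> = p * tdeg \<gamma> + N * (p - 1)" unfolding ga(2) exp_frob_def by (simp add: tdeg_exp_add tdeg_exp_scale tdeg_exp_top)
    then have "tdeg \<alpha> = p * d + N * (p - 1) \<longleftrightarrow> tdeg \<gamma> = d" using Ep.e_pos by simp
    then show ?thesis
      using hcomp_mon[OF mon] trace_mon_exp_frob[OF mon(1) ga(1)] hcomp_mon[OF Lam_closed[OF mon(1)] ga(1)] ga(2) trace_zero
      by simp
  next
    case False
    then have "trace (k \<otimes> xpow \<alpha>) = \<zero>" using trace_mon_not_exp_frob[OF mon] by blast
    then show ?thesis using hcomp_mon[OF mon] trace_zero hcomp_zero by simp
  qed
next
  case (add g h) then show ?case by (simp add: hcomp_add trace_add trace_closed hcomp_carrier)
qed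

lemma colon_homogeneous: "f \<in> colon_n n \<Longrightarrow> hcomp d f \<in> colon_n n"
  by (rule hcomp_closed_colon[OF frob_power_ideal[OF symb_sub] hcomp_closed_frob_power[OF symb_sub hcomp_closed_symb] symb_sub hcomp_closed_symb])

text \<open>The product h g has degree N (p - 1) + d, so its trace has degree d/p; if
  \<open>p\<close> does not divide \<open>d\<close>, every component of the trace vanishes.\<close>

lemma trace_homogeneous_degree:
  assumes h: "h \<in> carrier R" "hcomp (N * (p - 1)) h = h" and g: "g \<in> carrier R" "hcomp d g = g"
  shows "trace (h \<otimes> g) \<in> (if p dvd d then graded_piece R K N x (d div p) else {\<zero>})"
proof -
  have hg: "hcomp j (h \<otimes> g) = (if j = N * (p - 1) + d then h \<otimes> g else \<zero>)" for j
  proof -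
    have "hcomp j (h \<otimes> g) = (if N * (p - 1) \<le> j then h \<otimes> hcomp (j - N * (p - 1)) g else \<zero>)"
      using hcomp_mult_hom[OF h(1) g(1), of j "N * (p - 1)"] h(2) by simp
    moreover have "hcomp i g = (if i = d then g else \<zero>)" for i using hcomp_hcomp[OF g(1), of i d] g(2) by auto
    ultimately show ?thesis using h(1) by auto
  qed
  have c: "h \<otimes> g \<in> carrier R" using h g by simp
  have t: "hcomp j (trace (h \<otimes> g)) = (if p * j = d then trace (h \<otimes> g) else \<zero>)" for j
    unfolding hcomp_trace[OF c] hg by (simp add: trace_zero)
  show ?thesis
  proof (cases "p dvd d")
    case True then show ?thesis using t[of "d div p"] graded_piece_iff trace_closed[OF c] by simp
  next
    case False
    obtain D where D: "trace (h \<otimes> g) = (\<Oplus>j\<in>{..<D}. hcomp j (trace (h \<otimes> g)))" using hcomp_sum[OF trace_closed[OF c]] by blast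
    have "p * j \<noteq> d" for j using False by auto
    then have "hcomp j (trace (h \<otimes> g)) = \<zero>" for j using t by simp
    then have "(\<Oplus>j\<in>{..<D}. hcomp j (trace (h \<otimes> g))) = \<zero>" by simp
    then show ?thesis using D[symmetric] False by simp
  qed
qed

lemma graded_equivalence:
  assumes \<delta>: "\<delta> = (if p \<le> H then 1 else (0::nat))"
  shows "graded_symbolic_F_split R K N x p I \<longleftrightarrow>
    \<not> (\<Inter>n\<in>{0..nat (max 0 (int H - 1 - int \<delta>))}. colon_n n) \<subseteq> frob_power R p (Idl (x ` {..<N}))"
proof
  assume "graded_symbolic_F_split R K N x p I"
  then obtain \<phi> where "symbolic_F_splitting R p I \<phi>" unfolding graded_symbolic_F_split_def by blast
  then have s: "F_splitting R p \<phi>" "\<And>n. (\<lambda>g. \<phi> (Proot g)) ` symbolic_power R I (n * p + 1) \<subseteq> symbolic_power R I (n + 1)"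
    using symbolic_splitting_iff by auto
  show "\<not> (\<Inter>n\<in>{0..nat (max 0 (int H - 1 - int \<delta>))}. colon_n n) \<subseteq> frob_power R p (Idl (x ` {..<N}))"
    by (rule split_imp_colon[OF trace_dual F_splitting_linear[OF s(1)] s(2) genideal_ideal[OF vars_closed] one_notin_vars])
next
  assume "\<not> (\<Inter>n\<in>{0..nat (max 0 (int H - 1 - int \<delta>))}. colon_n n) \<subseteq> frob_power R p (Idl (x ` {..<N}))"
  then obtain f where f: "f \<in> (\<Inter>n\<in>{0..nat (max 0 (int H - 1 - int \<delta>))}. colon_n n)"
    "f \<notin> frob_power R p (Idl (x ` {..<N}))" by blast
  have fn: "f \<in> colon_n n" for n by (rule colon_all[OF trace_dual \<delta> f(1)])
  then have fc: "f \<in> carrier R" by (auto simp: colon_ideal_def)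
  obtain r where r: "r \<in> carrier R" "trace (r \<otimes> f) \<notin> Idl (x ` {..<N})"
    using mem_frob_power_iff[OF trace_dual genideal_ideal[OF vars_closed] fc] f(2) by blast
  \<comment> \<open>From this degree the trace lands in degree 0, so the trace of \<open>h\<close>
    is the constant coefficient of the trace of r f; it is nonzero because that trace is not in the
    ideal of the variables.\<close>
  define h where "h = hcomp (N * (p - 1)) (r \<otimes> f)"
  have rfc: "r \<otimes> f \<in> carrier R" using r fc by simp
  have hc: "h \<in> carrier R" unfolding h_def by (rule hcomp_carrier[OF rfc])
  have hh: "hcomp (N * (p - 1)) h = h" unfolding h_def using hcomp_hcomp[OF rfc] by simp
  have hn: "h \<in> colon_n n" for n
  proof -
    have "r \<otimes> f \<otimes> a \<in> frob_power R p (symbolic_power R I (n + 1))" if a: "a \<in> symbolic_power R I (n * p + 1)" for a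
    proof -
      have "f \<otimes> a \<in> frob_power R p (symbolic_power R I (n + 1))" using fn[of n] a by (auto simp: colon_ideal_def)
      then have "r \<otimes> (f \<otimes> a) \<in> frob_power R p (symbolic_power R I (n + 1))"
        using ideal.I_l_closed[OF frob_power_ideal[OF symb_sub]] r(1) by blast
      moreover have "a \<in> carrier R" using a symb_sub by blast
      ultimately show ?thesis using r(1) fc by (simp add: m_assoc)
    qed
    then have "r \<otimes> f \<in> colon_n n" using rfc by (simp add: colon_ideal_def)
    then show ?thesis unfolding h_def by (rule colon_homogeneous)
  qed
  have trh: "trace h = const_coeff (trace (r \<otimes> f))"
    using hcomp_trace[OF rfc, of 0] hcomp_0_const_coeff[OF trace_closed[OF rfc]] by (simp add: h_def)
  have k: "trace h \<in> K" "trace h \<noteq> \<zero>"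
    using trh const_coeff_closed[OF trace_closed[OF rfc]] vars_mem[OF trace_closed[OF rfc]] r(2) by auto
  then have "trace h \<in> K - {\<zero>}" by blast
  note inv = subfield_m_inv[OF K_subfield this]
  define k where "k = inv (trace h)"
  have kK: "k \<in> K" "k \<in> carrier R" "k \<otimes> trace h = \<one>" using inv K_props(6) unfolding k_def by auto
  \<comment> \<open>The constant \<open>k\<close> normalizes the value at 1; being of degree 0, it
    does not disturb the grading.\<close>
  define h' where "h' = k [^] p \<otimes> h"
  have h'c: "h' \<in> carrier R" using kK hc by (simp add: h'_def)
  let ?psi = "\<lambda>g. trace (h' \<otimes> g)"
  have psi: "frob_linear R p ?psi" by (rule frob_linear_mult[OF trace_frob_linear h'c])
  have tr_h': "?psi g = k \<otimes> trace (h \<otimes> g)" if g: "g \<in> carrier R" for g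
    using frob_linearD(3)[OF trace_frob_linear kK(2), of "h \<otimes> g"] kK hc g by (simp add: h'_def m_assoc)
  have "?psi \<one> = \<one>" using tr_h'[OF one_closed] hc kK by simp
  then have sp: "F_splitting R p (\<lambda>t. ?psi (proot_arg t))" using linear_F_splitting[OF psi] by blast
  have "?psi a \<in> symbolic_power R I (n + 1)" if a: "a \<in> symbolic_power R I (n * p + 1)" for a n
  proof -
    have "a \<in> carrier R" using a symb_sub by blast
    then have "h' \<otimes> a = k [^] p \<otimes> (h \<otimes> a)" using kK hc by (simp add: h'_def m_assoc)
    then show ?thesis using colon_maps[OF trace_dual hn a, of "k [^] p"] kK by simp
  qed
  then have s: "symbolic_F_splitting R p I (\<lambda>t. ?psi (proot_arg t))"
    using sp symbolic_splitting_iff by auto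
  have kp: "hcomp 0 k = k" using hcomp_0_const_coeff[OF kK(2)] const_coeff_K[OF kK(1)] by simp
  have "degree_preserving R K N x p (\<lambda>t. ?psi (proot_arg t))"
    unfolding degree_preserving_def
  proof (intro allI ballI)
    fix d g assume "g \<in> graded_piece R K N x d"
    then have g: "g \<in> carrier R" "hcomp d g = g" using graded_piece_iff by auto
    have t: "trace (h \<otimes> g) \<in> (if p dvd d then graded_piece R K N x (d div p) else {\<zero>})"
      by (rule trace_homogeneous_degree[OF hc hh g])
    have tc: "trace (h \<otimes> g) \<in> carrier R" using hc g trace_closed by simp
    have "hcomp i (k \<otimes> trace (h \<otimes> g)) = k \<otimes> hcomp i (trace (h \<otimes> g))" for i
      using hcomp_mult_hom[OF kK(2) tc, of i 0] kp by simp
    then have "k \<otimes> trace (h \<otimes> g) \<in> (if p dvd d then graded_piece R K N x (d div p) else {\<zero>})"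
      using t graded_piece_iff kK tc by (auto split: if_splits)
    then show "?psi (proot_arg (Proot g)) \<in> (if p dvd d then graded_piece R K N x (d div p) else {\<zero>})"
      using tr_h'[OF g(1)] by simp
  qed
  then show "graded_symbolic_F_split R K N x p I"
    unfolding graded_symbolic_F_split_def using s by blast
qed

end

section \<open>Units of local rings and the conclusion\<close>

lemma (in noetherian_cring) ex_maximalideal:
  assumes "ideal J R" "J \<noteq> carrier R"
  shows "\<exists>M. maximalideal M R \<and> J \<subseteq> M"
  using assms
proof (induction rule: noetherian_induct)
  case (step J)
  show ?case
  proof (cases "maximalideal J R")
    case False
    then obtain J' where "ideal J' R" "J \<subset> J'" "J' \<noteq> carrier R"
      using maximalidealI[OF step.hyps step.prems[symmetric]] ideal.Icarr by (metis psubsetI subsetI)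
    then show ?thesis using step.IH by blast
  qed auto
qed

lemma (in noetherian_cring) local_ring_units:
  assumes loc: "local_ring R m" and x: "x \<in> carrier R - m"
  shows "\<exists>y\<in>carrier R. y \<otimes> x = \<one>"
proof (rule ccontr)
  assume n: "\<not> ?thesis"
  have xc: "x \<in> carrier R" using x by blast
  have "\<one> \<notin> PIdl x" using n unfolding cgenideal_def by auto
  then have "PIdl x \<noteq> carrier R" using one_closed by blast
  then obtain M where "maximalideal M R" "PIdl x \<subseteq> M" using ex_maximalideal[OF cgenideal_ideal[OF xc]] by blast
  then have "x \<in> m" using loc cgenideal_self[OF xc] unfolding local_ring_def by blast
  then show False using x by blast
qed

theorem theorem5p8:
  fixes R :: "('a, 'b) ring_scheme" and \<mm> I :: "'a set" and p H \<delta> :: nat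
  assumes "Factorial_Ring.prime p" and "has_char R p"
    and "regular_ring R" and "F_finite R p"
    and "radical_ideal R I" and "I \<noteq> carrier R"
    and "big_height R I = enat H"
    and "\<delta> = (if p \<le> H then 1 else 0)"
  shows
    "(local_ring R \<mm> \<longrightarrow>
       (symbolic_F_split R p I \<longleftrightarrow>
        \<not> (\<Inter>n\<in>{0..nat (max 0 (int H - 1 - int \<delta>))}.
             colon_ideal R (frob_power R p (symbolic_power R I (n + 1)))
               (symbolic_power R I (n * p + 1)))
          \<subseteq> frob_power R p \<mm>)) \<and>
     (\<forall>K N x. polynomial_ring_over R K N x \<and> \<mm> = Idl\<^bsub>R\<^esub> (x ` {..<N}) \<and>
         homogeneous_ideal R K N x I \<longrightarrow>
       (graded_symbolic_F_split R K N x p I \<longleftrightarrow>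
        \<not> (\<Inter>n\<in>{0..nat (max 0 (int H - 1 - int \<delta>))}.
             colon_ideal R (frob_power R p (symbolic_power R I (n + 1)))
               (symbolic_power R I (n * p + 1)))
          \<subseteq> frob_power R p \<mm>))"
proof (intro conjI impI allI)
  interpret cring R using assms(3) by (simp add: regular_ring_def)
  interpret noetherian_ring R using assms(3) by (simp add: regular_ring_def)
  interpret noetherian_cring R by unfold_locales
  interpret Fp: frob_exponent R p
    using assms(1) frobenius_add[OF assms(1,2)] by unfold_locales (auto simp: prime_gt_0_nat)
  interpret FF: F_finite_ring R p
    by unfold_locales (use assms(1,2) Fp.F_finite_ex_gens[OF assms(4)] in auto)
  have sym: "symbolic R p I H"
    by (intro symbolic.intro FF.F_finite_ring_axioms symbolic_axioms.intro assms)
  {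
    assume loc: "local_ring R \<mm>"
    have pm: "primeideal \<mm> R" using loc maximalideal_prime by (auto simp: local_ring_def)
    interpret M: primeideal \<mm> R by (rule pm)
    obtain ys c where ys: "set ys \<subseteq> \<mm>" "\<forall>y\<in>\<mm>. \<exists>s\<in>carrier R - \<mm>. s \<otimes>\<^bsub>R\<^esub> y \<in> frob_span R 1 (set ys)"
      "prime_chain R c (length ys)" using regular_prime[OF assms(3) pm] by blast
    have ysc: "set ys \<subseteq> carrier R" using ys(1) M.Icarr by blast
    have id: "ideal (frob_span R 1 (set ys)) R" using E1.frob_span_frob_submodule[OF ysc] frob_submodule_1_iff by blast
    \<comment> \<open>The denominators left by \<open>regular_prime\<close> are outside
      \<open>\<mm>\<close>, hence units, so the local generators generate \<open>\<mm>\<close>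
      itself.\<close>
    have "\<mm> = frob_span R 1 (set ys)"
    proof
      show "frob_span R 1 (set ys) \<subseteq> \<mm>" using E1.frob_span_least[OF _ ys(1)] M.ideal_axioms frob_submodule_1_iff by blast
      show "\<mm> \<subseteq> frob_span R 1 (set ys)"
      proof
        fix y assume y: "y \<in> \<mm>"
        then obtain s where s: "s \<in> carrier R - \<mm>" "s \<otimes>\<^bsub>R\<^esub> y \<in> frob_span R 1 (set ys)" using ys(2) by blast
        obtain u where u: "u \<in> carrier R" "u \<otimes>\<^bsub>R\<^esub> s = \<one>\<^bsub>R\<^esub>" using local_ring_units[OF loc s(1)] by blast
        have yc: "y \<in> carrier R" using y M.Icarr by blast
        have "u \<otimes>\<^bsub>R\<^esub> (s \<otimes>\<^bsub>R\<^esub> y) \<in> frob_span R 1 (set ys)" using ideal.I_l_closed[OF id s(2) u(1)] .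
        moreover have "u \<otimes>\<^bsub>R\<^esub> (s \<otimes>\<^bsub>R\<^esub> y) = y" using u s yc by (simp add: m_assoc[symmetric])
        ultimately show "y \<in> frob_span R 1 (set ys)" by simp
      qed
    qed
    then interpret L: local_frob R p \<mm> ys c
      by (intro local_frob.intro FF.F_finite_ring_axioms local_frob_axioms.intro pm ysc ys(3) local_ring_units[OF loc])
    obtain \<Phi> and n :: nat and e b where D: "frob_dual R p \<Phi> {..<n} e b" using L.ex_frob_dual by blast
    have one: "\<one>\<^bsub>R\<^esub> \<notin> \<mm>" using E1.one_notin_prime[OF pm] by blast
    show "symbolic_F_split R p I \<longleftrightarrow>
        \<not> (\<Inter>n\<in>{0..nat (max 0 (int H - 1 - int \<delta>))}.
             colon_ideal R (frob_power R p (symbolic_power R I (n + 1)))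
               (symbolic_power R I (n * p + 1)))
          \<subseteq> frob_power R p \<mm>"
      by (rule symbolic.local_equivalence[OF sym D assms(8) M.ideal_axioms one
            local_ring_units[OF loc]])
  }
  fix K N x
  assume "polynomial_ring_over R K N x \<and> \<mm> = Idl\<^bsub>R\<^esub> (x ` {..<N}) \<and> homogeneous_ideal R K N x I"
  then have P: "polynomial_ring_over R K N x" "\<mm> = Idl\<^bsub>R\<^esub> (x ` {..<N})" "homogeneous_ideal R K N x I" by auto
  interpret P: poly_ring R p K N x
    by (intro poly_ring.intro FF.F_finite_ring_axioms poly_ring_axioms.intro P(1))
  \<comment> \<open>F-finiteness of \<open>R\<close> passes to \<open>K\<close>, where the duality
    for fields supplies the map \<open>\<Lambda>\<close> on coefficients.\<close>
  obtain ks where ks: "set ks \<subseteq> K" "frob_span (R \<lparr> carrier := K \<rparr>) p (set ks) = K" using P.K_frob_span by blast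
  obtain \<Lambda> and n :: nat and e b where D: "\<Lambda> \<in> K \<rightarrow> K" "\<forall>x\<in>K. \<forall>y\<in>K. \<Lambda> (x \<oplus>\<^bsub>R\<^esub> y) = \<Lambda> x \<oplus>\<^bsub>R\<^esub> \<Lambda> y"
    "\<forall>c\<in>K. \<forall>x\<in>K. \<Lambda> (c [^]\<^bsub>R\<^esub> p \<otimes>\<^bsub>R\<^esub> x) = c \<otimes>\<^bsub>R\<^esub> \<Lambda> x" "e \<in> {..<n} \<rightarrow> K" "b \<in> {..<n} \<rightarrow> K"
    "\<forall>g\<in>K. g = (\<Oplus>\<^bsub>R\<^esub>i\<in>{..<n}. \<Lambda> (e i \<otimes>\<^bsub>R\<^esub> g) [^]\<^bsub>R\<^esub> p \<otimes>\<^bsub>R\<^esub> b i)"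
    using field_frob_dual[OF P.K_subfield assms(1,2) ks] by blast
  have "poly_dual R p K N x \<Lambda> n e b"
    by (intro poly_dual.intro P.poly_ring_axioms poly_dual_axioms.intro D(1,4,5,6)) (use D(2,3) in blast)+
  then have "graded_symbolic R p K N x \<Lambda> n e b I H"
    by (intro graded_symbolic.intro sym graded_symbolic_axioms.intro P(3))
  then show "graded_symbolic_F_split R K N x p I \<longleftrightarrow>
        \<not> (\<Inter>n\<in>{0..nat (max 0 (int H - 1 - int \<delta>))}.
             colon_ideal R (frob_power R p (symbolic_power R I (n + 1)))
               (symbolic_power R I (n * p + 1)))
          \<subseteq> frob_power R p \<mm>"
    unfolding P(2) by (rule graded_symbolic.graded_equivalence[OF _ assms(8)])
qed

end
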